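(* Let $\Lambda\subseteq\mathbb{R}^{2d}$ be a lattice, let $1\le p<\infty$, let $\varphi\in\mathcal{S}(\mathbb{R}^d)$ be non-zero, and let $m:\mathbb{R}^{2d}\to(0,\infty)$ be a weight function for which there are constants $C,N\ge 0$ with $m(z_1+z_2)\le C(1+|z_1|)^N m(z_2)$ for all $z_1,z_2\in\mathbb{R}^{2d}$. Let $s\ge N$, and let $\sigma$ be a non-negative measurable function on $\mathbb{R}^{2d}$ with $\int_{\mathbb{R}^{2d}}\sigma(z)(1+|z|)^s\,dz<\infty$ such that, for some constants $A,B>0$, $A\le\sum_{\lambda\in\Lambda}\sigma(z-\lambda)\le B$ for almost every $z\in\mathbb{R}^{2d}$. Then a tempered distribution $f\in\mathcal{S}'(\mathbb{R}^d)$ with $\sup_{z\in\mathbb{R}^{2d}}|\mathcal{V}_\varphi f(z)|(1+|z|)^{-s}<\infty$ satisfies $$\Big(\int_{\mathbb{R}^{2d}}|\mathcal{V}_\varphi f(z)|^p m(z)^p\,dz\Big)^{1/p}<\infty$$ if and only if $$\Big(\sum_{\lambda\in\Lambda}\|H_{T_\lambda\sigma}f\|_2^p\,m(\lambda)^p\Big)^{1/p}<\infty .$$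
   Context: A lattice is $\Lambda=A_0\mathbb{Z}^{2d}$ with $A_0$ an invertible real $2d\times 2d$ matrix. Weight functions are positive and measurable. $T_\lambda\sigma(z)=\sigma(z-\lambda)$. For $z=(x,\omega)\in\mathbb{R}^{2d}$, $\pi(z)f(t)=e^{2\pi i\omega\cdot t}f(t-x)$. The short-time Fourier transform is $\mathcal{V}_\varphi f(z)=\langle f,\pi(z)\varphi\rangle$ (bracket conjugate-linear in the second argument), i.e. $\mathcal{V}_\varphi f(x,\omega)=\int f(t)\overline{\varphi(t-x)}e^{-2\pi i\omega\cdot t}\,dt$ for functions $f$. For a symbol $\tau$ on $\mathbb{R}^{2d}$ the time-frequency localization operator (with window $\varphi$) is $H_\tau f=\int_{\mathbb{R}^{2d}}\tau(z)\mathcal{V}_\varphi f(z)\,\pi(z)\varphi\,dz$, understood weakly: $\langle H_\tau f,h\rangle=\int\tau(z)\mathcal{V}_\varphi f(z)\overline{\mathcal{V}_\varphi h(z)}\,dz$. $\|\cdot\|_2$ is the norm of $L^2(\mathbb{R}^d)$. *)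

theory Defs
  imports "HOL-Analysis.Analysis"
begin

section \<open>Schwartz functions and tempered distributions\<close>

definition partial_deriv :: "'n::finite \<Rightarrow> (real^'n \<Rightarrow> complex) \<Rightarrow> real^'n \<Rightarrow> complex" where
  "partial_deriv i g x = frechet_derivative g (at x) (axis i 1)"

definition iter_partial_deriv :: "'n::finite list \<Rightarrow> (real^'n \<Rightarrow> complex) \<Rightarrow> real^'n \<Rightarrow> complex" where
  "iter_partial_deriv is g = foldr partial_deriv is g"

text \<open>Since \<^const>\<open>frechet_derivative\<close> is unspecified at points of non-differentiability, smoothness
  is required separately: every iterated partial derivative is (totally) differentiable everywhere.\<close>

definition schwartz :: "(real^'n::finite \<Rightarrow> complex) \<Rightarrow> bool" where
  "schwartz g \<longleftrightarrow>
     (\<forall>is. \<forall>x. iter_partial_deriv is g differentiable (at x)) \<and>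
     (\<forall>is. \<forall>k::nat. \<exists>K. \<forall>x. (1 + norm x) ^ k * cmod (iter_partial_deriv is g x) \<le> K)"

definition schwartz_seminorm :: "nat \<Rightarrow> (real^'n::finite \<Rightarrow> complex) \<Rightarrow> real" where
  "schwartz_seminorm k g =
     (SUP (is, x) \<in> {is. length is \<le> k} \<times> UNIV. (1 + norm x) ^ k * cmod (iter_partial_deriv is g x))"

text \<open>Distributions are represented by functionals on all functions; only their values on Schwartz
  functions are meaningful.\<close>

definition tempered_distribution :: "((real^'n::finite \<Rightarrow> complex) \<Rightarrow> complex) \<Rightarrow> bool" where
  "tempered_distribution u \<longleftrightarrow>
     (\<forall>g h. schwartz g \<longrightarrow> schwartz h \<longrightarrow> u (\<lambda>t. g t + h t) = u g + u h) \<and>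
     (\<forall>c g. schwartz g \<longrightarrow> u (\<lambda>t. c * g t) = c * u g) \<and>
     (\<exists>K k. \<forall>g. schwartz g \<longrightarrow> cmod (u g) \<le> K * schwartz_seminorm k g)"

definition dist_of_fun :: "(real^'n::finite \<Rightarrow> complex) \<Rightarrow> (real^'n \<Rightarrow> complex) \<Rightarrow> complex" where
  "dist_of_fun g = (\<lambda>h. \<integral>t. g t * h t \<partial>lebesgue)"

text \<open>Distributions are linear functionals; the sesquilinear bracket conjugates the test function.\<close>

definition bracket :: "((real^'n::finite \<Rightarrow> complex) \<Rightarrow> complex) \<Rightarrow> (real^'n \<Rightarrow> complex) \<Rightarrow> complex" where
  "bracket u h = u (\<lambda>t. cnj (h t))"

section \<open>The $L^2$ norm of a distribution\<close>

definition L2_fun :: "(real^'n::finite \<Rightarrow> complex) \<Rightarrow> bool" where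
  "L2_fun g \<longleftrightarrow> g \<in> borel_measurable lebesgue \<and> integrable lebesgue (\<lambda>t. (cmod (g t))\<^sup>2)"

text \<open>The norm is \<open>\<infinity>\<close> (the infimum of the empty set) if the distribution is not given by an
  \<open>L\<^sup>2\<close> function; otherwise that function is unique up to null sets.\<close>

definition dist_L2_norm :: "((real^'n::finite \<Rightarrow> complex) \<Rightarrow> complex) \<Rightarrow> ennreal" where
  "dist_L2_norm u =
     (INF g \<in> {g. L2_fun g \<and> (\<forall>h. schwartz h \<longrightarrow> u h = dist_of_fun g h)}.
        ennreal (sqrt (\<integral>t. (cmod (g t))\<^sup>2 \<partial>lebesgue)))"

section \<open>Time-frequency analysis\<close>

definition tf_shift :: "(real^'n::finite) \<times> (real^'n) \<Rightarrow> (real^'n \<Rightarrow> complex) \<Rightarrow> real^'n \<Rightarrow> complex" where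
  "tf_shift z g t = (case z of (x, w) \<Rightarrow> cis (2 * pi * (w \<bullet> t)) * g (t - x))"

definition stft :: "(real^'n::finite \<Rightarrow> complex) \<Rightarrow> ((real^'n \<Rightarrow> complex) \<Rightarrow> complex)
    \<Rightarrow> (real^'n) \<times> (real^'n) \<Rightarrow> complex" where
  "stft \<phi> f z = bracket f (tf_shift z \<phi>)"

text \<open>The weakly defined localization operator, as the linear functional whose bracket against
  a test function is given in \<open>bracket_loc_op\<close> below.\<close>

definition loc_op :: "(real^'n::finite \<Rightarrow> complex) \<Rightarrow> ((real^'n) \<times> (real^'n) \<Rightarrow> real)
    \<Rightarrow> ((real^'n \<Rightarrow> complex) \<Rightarrow> complex) \<Rightarrow> (real^'n \<Rightarrow> complex) \<Rightarrow> complex" where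
  "loc_op \<phi> \<tau> f = (\<lambda>h. \<integral>z. complex_of_real (\<tau> z) * stft \<phi> f z
      * cnj (stft \<phi> (dist_of_fun (\<lambda>t. cnj (h t))) z) \<partial>lebesgue)"

lemma bracket_loc_op:
  "bracket (loc_op \<phi> \<tau> f) h =
     (\<integral>z. complex_of_real (\<tau> z) * stft \<phi> f z * cnj (stft \<phi> (dist_of_fun h) z) \<partial>lebesgue)"
  by (simp add: bracket_def loc_op_def)

lemma stft_dist_of_fun:
  "stft \<phi> (dist_of_fun h) (x, w) =
     (\<integral>t. h t * cnj (\<phi> (t - x)) * exp (- 2 * pi * \<i> * (w \<bullet> t)) \<partial>lebesgue)"
  by (simp add: stft_def bracket_def dist_of_fun_def tf_shift_def cis_conv_exp exp_cnj mult_ac)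

definition translate :: "'a::ab_group_add \<Rightarrow> ('a \<Rightarrow> 'b) \<Rightarrow> 'a \<Rightarrow> 'b" where
  "translate l \<tau> z = \<tau> (z - l)"

section \<open>Lattices in phase space\<close>

text \<open>The identification of \<open>\<real>\<^sup>2\<^sup>d\<close>, with coordinates indexed by \<open>'n + 'n\<close>, with phase space.\<close>

definition phase_point :: "real^('n::finite + 'n) \<Rightarrow> (real^'n) \<times> (real^'n)" where
  "phase_point v = (\<chi> i. v $ Inl i, \<chi> i. v $ Inr i)"

definition phase_lattice :: "((real^'n::finite) \<times> (real^'n)) set \<Rightarrow> bool" where
  "phase_lattice \<Lambda> \<longleftrightarrow> (\<exists>A :: real^('n + 'n)^('n + 'n). invertible A \<and>
     \<Lambda> = {phase_point (A *v k) | k. \<forall>i. k $ i \<in> \<int>})"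

section \<open>Powers of extended non-negative reals\<close>

text \<open>Only meant for positive exponents.\<close>

definition ennpowr :: "ennreal \<Rightarrow> real \<Rightarrow> ennreal" where
  "ennpowr x p = (if x = \<infinity> then \<infinity> else ennreal (enn2real x powr p))"

end

theory Submission
  imports Defs "HOL-Probability.Probability"
begin

text \<open>
  Write \<open>F = V\<^sub>\<phi> f\<close>. Fourier inversion gives the reproducing formula \<open>F = P F\<close>, where \<open>P\<close> is the integral
  operator whose kernel is, up to the factor \<open>\<parallel>\<phi>\<parallel>\<^sup>-\<^sup>2\<close>, the inner product of two time-frequency shifts of
  \<open>\<phi>\<close>; this kernel is hermitian, idempotent, and decays faster than any power of the distance to the
  diagonal. Hence \<open>P\<close> is a contraction on \<open>L\<^sup>2\<close>. If \<open>S = \<Sum>\<^sub>\<lambda> T\<^sub>\<lambda> \<sigma>\<close> and \<open>c = 2 / (A + B)\<close>, then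
  \<open>F = P ((1 - c S) F) + c P S F\<close> with \<open>\<bar>1 - c S\<bar> \<le> (B - A) / (B + A) < 1\<close>. In \<open>L\<^sup>2\<close> with the slowly varying
  weight \<open>(1 + \<epsilon> \<bar>z - l\<bar>)\<^sup>-\<^sup>M\<close> this remains a contraction for small \<open>\<epsilon>\<close>, and the polynomial growth of \<open>F\<close>
  makes its weighted norm finite, so the first term can be absorbed. In the second term \<open>P (T\<^sub>\<lambda> \<sigma> F)\<close>
  is, up to normalization, \<open>V\<^sub>\<phi> (H\<^sub>\<lambda> f)\<close>, which is bounded by \<open>\<parallel>\<phi>\<parallel> \<parallel>H\<^sub>\<lambda> f\<parallel>\<close>; truncating \<open>\<lambda>\<close> to the points
  near \<open>z\<close> costs another small term that is absorbed as well. The outcome is the pointwise bound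
  \<open>\<bar>F z\<bar> \<le> C \<Sum>\<^sub>\<lambda> \<parallel>H\<^sub>\<lambda> f\<parallel> (1 + \<bar>z - \<lambda>\<bar>)\<^sup>-\<^sup>k\<close>, and Young's inequality gives one implication. For the converse,
  \<open>\<parallel>H\<^sub>\<lambda> f\<parallel>\<close> is bounded by a multiple of \<open>\<integral> \<bar>F z\<bar> \<sigma> (z - \<lambda>) dz\<close>; the local boundedness of \<open>F\<close> by convolutions of \<open>\<bar>F\<bar>\<close>
  and Jensen's inequality conclude.
\<close>

subsection \<open>Polynomial kernels\<close>

text \<open>The contraction argument is tied to L^2, where the projection has norm one and the
  factor \<gamma> survives; in other L^p spaces or with the weight m its norm may be larger. As F
  need not lie in L^2, the estimate is localised at a point \<open>a\<close> by a polynomial weight,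
  whose commutator with the projection vanishes as \<epsilon> tends to 0. The resulting bound at
  \<open>a\<close> is uniform in \<open>a\<close> and mentions neither p nor m, so it serves all of
  them. Absorbing a term requires the weighted norm to be finite beforehand; this is where
  polynomial growth of F enters. The truncation is forced: the available bound for the projection of
  a single piece of S F is constant in z and cannot be summed over the whole lattice. The lattice
  points left out produce tails of the periodization, which are bounded but small only on average,
  since \<sigma> is merely integrable. They are therefore smeared by the reproducing formula before
  they are estimated.\<close>

definition kap :: "nat \<Rightarrow> 'a::real_normed_vector \<Rightarrow> real" where
  "kap k x = 1 / (1 + norm x) ^ k"

lemma norm1_pos [simp]: "0 < 1 + norm x" "0 \<le> 1 + norm x" "1 + norm x \<noteq> 0"
  by (smt (verit) norm_ge_zero)+

lemma kap_pos [simp]: "0 < kap k x"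
  and kap_nonneg [simp]: "0 \<le> kap k x"
  by (auto simp: kap_def)

lemma kap_le_1 [simp]: "kap k x \<le> 1"
  by (simp add: kap_def one_le_power)

lemma kap_mono: "j \<le> k \<Longrightarrow> kap k x \<le> kap j x"
  by (simp add: kap_def frac_le power_increasing)

lemma kap_add: "kap (j + k) x = kap j x * kap k x"
  by (simp add: kap_def power_add)

lemma kap_minus_commute: "kap k (x - y) = kap k (y - x)"
  by (simp add: kap_def norm_minus_commute)

lemma kap_anti: "norm x \<le> norm y \<Longrightarrow> kap k y \<le> kap k x"
  by (simp add: kap_def frac_le power_mono)

lemma kap_mult_pow [simp]: "kap k x * (1 + norm x) ^ k = 1" "(1 + norm x) ^ k * kap k x = 1"
  by (auto simp: kap_def)

lemma norm1_triangle: "1 + norm (x + y) \<le> (1 + norm x) * (1 + norm y)"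
proof -
  have "norm (x + y) \<le> norm x + norm y" by (rule norm_triangle_ineq)
  moreover have "0 \<le> norm x * norm y" by simp
  ultimately have "norm (x + y) \<le> norm x + norm y + norm x * norm y" by linarith
  then show ?thesis by (simp add: algebra_simps)
qed

lemma norm1_triangle_pow: "(1 + norm (x + y)) ^ k \<le> (1 + norm x) ^ k * (1 + norm y) ^ k"
  using power_mono[OF norm1_triangle[of x y], of k] by (simp add: power_mult_distrib)

text \<open>Peetre's inequality. It is used throughout to change the base point of a polynomial
  weight at the price of a power of the displacement.\<close>

lemma kap_triangle: "kap k x * kap k y \<le> kap k (x + y)"
proof -
  have "kap k (x + y) \<ge> 1 / ((1 + norm x) ^ k * (1 + norm y) ^ k)"
    unfolding kap_def
    by (rule frac_le) (use norm1_triangle_pow[of x y k] in auto)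
  then show ?thesis by (simp add: kap_def)
qed

lemma kap_measurable [measurable]: "kap k \<in> borel_measurable borel"
  unfolding kap_def by measurable

lemma measurable_cnj [measurable (raw)]:
  "f \<in> borel_measurable M \<Longrightarrow> (\<lambda>x. cnj (f x)) \<in> borel_measurable M"
  by (rule measurable_compose[OF _ borel_measurable_continuous_onI]) (auto intro: continuous_intros)

lemma ball_measurable [measurable]: "ball x r \<in> sets borel"
  by simp

text \<open>The function is dominated by a sum of multiples of indicators of the balls of radius j +
  1: with j the integer part of the norm, \<open>kap k x\<close> is at most (j + 1)^(-k). These
  balls have volume proportional to the DIM-th power of the radius, so two extra powers leave a
  convergent sum of inverse squares.\<close>

lemma nn_integral_kap_finite:
  assumes "k \<ge> DIM('a) + 2"
  shows "(\<integral>\<^sup>+x. ennreal (kap k (x::'a::euclidean_space)) \<partial>lborel) < \<infinity>"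
proof -
  define V where "V = measure lborel (ball (0::'a) 1)"
  have "ennreal (kap k x) \<le> (\<Sum>j. ennreal (1 / real (Suc j) ^ k) * indicator (ball (0::'a) (real (Suc j))) x)" for x :: 'a
  proof -
    define j where "j = nat \<lfloor>norm x\<rfloor>"
    have j: "real j \<le> norm x" "norm x < real (Suc j)" by (simp add: j_def, unfold j_def, simp, linarith)
    have "kap k x \<le> 1 / real (Suc j) ^ k"
      unfolding kap_def by (rule frac_le) (use j in \<open>auto intro!: power_mono\<close>)
    then have "ennreal (kap k x) \<le> ennreal (1 / real (Suc j) ^ k) * indicator (ball (0::'a) (real (Suc j))) x"
      using j by (simp add: indicator_def ennreal_leI)
    also have "\<dots> \<le> (\<Sum>j. ennreal (1 / real (Suc j) ^ k) * indicator (ball (0::'a) (real (Suc j))) x)"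
    proof -
      have "f j \<le> (\<Sum>i. f i)" for f :: "nat \<Rightarrow> ennreal"
        using sum_le_suminf[of f "{j}"] by simp
      then show ?thesis .
    qed
    finally show ?thesis .
  qed
  then have "(\<integral>\<^sup>+x. ennreal (kap k (x::'a)) \<partial>lborel)
     \<le> (\<integral>\<^sup>+x. (\<Sum>j. ennreal (1 / real (Suc j) ^ k) * indicator (ball (0::'a) (real (Suc j))) x) \<partial>lborel)"
    by (intro nn_integral_mono)
  also have "\<dots> = (\<Sum>j. ennreal (1 / real (Suc j) ^ k) * emeasure lborel (ball (0::'a) (real (Suc j))))"
  proof (subst nn_integral_suminf)
    fix j show "(\<lambda>x. ennreal (1 / real (Suc j) ^ k) * indicator (ball (0::'a) (real (Suc j))) x) \<in> borel_measurable lborel"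
      by measurable
  next
    have "(\<integral>\<^sup>+x. ennreal (1 / real (Suc j) ^ k) * indicator (ball (0::'a) (real (Suc j))) x \<partial>lborel)
      = ennreal (1 / real (Suc j) ^ k) * emeasure lborel (ball (0::'a) (real (Suc j)))" for j
      by (rule nn_integral_cmult_indicator) auto
    then show "(\<Sum>j. \<integral>\<^sup>+x. ennreal (1 / real (Suc j) ^ k) * indicator (ball (0::'a) (real (Suc j))) x \<partial>lborel)
      = (\<Sum>j. ennreal (1 / real (Suc j) ^ k) * emeasure lborel (ball (0::'a) (real (Suc j))))"
      by (rule arg_cong[where f=suminf, OF ext])
  qed
  also have "\<dots> \<le> (\<Sum>j. ennreal (V * inverse (real (Suc j) ^ 2)))"
  proof (intro suminf_le allI)
    fix j
    have "measure lborel (ball (0::'a) (real (Suc j))) = real (Suc j) ^ DIM('a) * V"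
      using content_ball_conv_unit_ball[of "real (Suc j)" "0::'a"] by (simp add: V_def)
    then have "emeasure lborel (ball (0::'a) (real (Suc j))) = ennreal (real (Suc j) ^ DIM('a) * V)"
      using emeasure_eq_ennreal_measure[of lborel "ball (0::'a) (real (Suc j))"]
        emeasure_lborel_ball_finite[of "0::'a" "real (Suc j)"]
      by (simp add: less_top)
    then have "ennreal (1 / real (Suc j) ^ k) * emeasure lborel (ball (0::'a) (real (Suc j)))
       = ennreal (1 / real (Suc j) ^ k * (real (Suc j) ^ DIM('a) * V))"
      by (subst ennreal_mult'') (auto simp: V_def)
    also have "\<dots> \<le> ennreal (V * inverse (real (Suc j) ^ 2))"
    proof (rule ennreal_leI)
      have "real (Suc j) ^ DIM('a) * real (Suc j) ^ 2 \<le> real (Suc j) ^ k"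
        using assms by (simp only: power_add[symmetric]) (rule power_increasing, auto)
      then have "real (Suc j) ^ DIM('a) / real (Suc j) ^ k \<le> inverse (real (Suc j) ^ 2)"
        by (simp add: divide_simps del: of_nat_Suc)
      then have "V * (real (Suc j) ^ DIM('a) / real (Suc j) ^ k) \<le> V * inverse (real (Suc j) ^ 2)"
        by (intro mult_left_mono) (auto simp: V_def)
      then show "1 / real (Suc j) ^ k * (real (Suc j) ^ DIM('a) * V) \<le> V * inverse (real (Suc j) ^ 2)"
        by (simp add: mult.commute)
    qed
    finally show "ennreal (1 / real (Suc j) ^ k) * emeasure lborel (ball (0::'a) (real (Suc j)))
       \<le> ennreal (V * inverse (real (Suc j) ^ 2))" .
  qed auto
  also have "\<dots> < \<infinity>"
  proof -
    have "summable (\<lambda>j. inverse (real (Suc j) ^ 2))"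
      using inverse_power_summable[of 2, where ?'a=real] by (subst summable_Suc_iff) auto
    then have "summable (\<lambda>j. V * inverse (real (Suc j) ^ 2))" by (rule summable_mult)
    then show ?thesis
      by (subst suminf_ennreal2) (auto simp: V_def)
  qed
  finally show ?thesis .
qed

lemma integrable_kap:
  assumes "k \<ge> DIM('a) + 2"
  shows "integrable lborel (kap k :: 'a::euclidean_space \<Rightarrow> real)"
  using nn_integral_kap_finite[OF assms] by (intro integrableI_nonneg) auto

section \<open>Reflections and translations of Lebesgue measure\<close>

lemma lborel_distr_minus:
  fixes a :: "'a::euclidean_space"
  shows "distr lborel borel (\<lambda>x. a - x) = lborel"
  by (subst (2) lborel_affine[of "-1" a]) (auto simp: density_1)

lemma lborel_distr_diff:
  fixes a :: "'a::euclidean_space"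
  shows "distr lborel borel (\<lambda>x. x - a) = lborel"
  by (subst (2) lborel_affine[of 1 "- a"]) (auto simp: density_1)

lemma nn_integral_lborel_minus:
  fixes a :: "'a::euclidean_space"
  assumes [measurable]: "f \<in> borel_measurable borel"
  shows "(\<integral>\<^sup>+x. f (a - x) \<partial>lborel) = (\<integral>\<^sup>+x. f x \<partial>lborel)"
  by (subst lborel_distr_minus[symmetric, of a], subst nn_integral_distr) auto

lemma nn_integral_lborel_diff:
  fixes a :: "'a::euclidean_space"
  assumes [measurable]: "f \<in> borel_measurable borel"
  shows "(\<integral>\<^sup>+x. f (x - a) \<partial>lborel) = (\<integral>\<^sup>+x. f x \<partial>lborel)"
  by (subst lborel_distr_diff[symmetric, of a], subst nn_integral_distr) auto

lemma integral_lborel_diff: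
  fixes a :: "'a::euclidean_space" and f :: "'a \<Rightarrow> 'b::{banach, second_countable_topology}"
  assumes [measurable]: "f \<in> borel_measurable borel"
  shows "(\<integral>x. f (x - a) \<partial>lborel) = (\<integral>x. f x \<partial>lborel)"
  by (subst (2) lborel_distr_diff[symmetric, of a], subst integral_distr) auto

lemma integral_lborel_minus:
  fixes a :: "'a::euclidean_space" and f :: "'a \<Rightarrow> 'b::{banach, second_countable_topology}"
  assumes [measurable]: "f \<in> borel_measurable borel"
  shows "(\<integral>x. f (a - x) \<partial>lborel) = (\<integral>x. f x \<partial>lborel)"
  by (subst (2) lborel_distr_minus[symmetric, of a], subst integral_distr) auto

lemma integrable_lborel_diff:
  fixes a :: "'a::euclidean_space" and f :: "'a \<Rightarrow> 'b::{banach, second_countable_topology}"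
  assumes "integrable lborel f"
  shows "integrable lborel (\<lambda>x. f (x - a))"
proof -
  have "integrable (distr lborel borel (\<lambda>x. x - a)) f"
    using assms by (simp add: lborel_distr_diff)
  then show ?thesis by (rule integrable_distr[rotated]) auto
qed

lemma integrable_lborel_minus:
  fixes a :: "'a::euclidean_space" and f :: "'a \<Rightarrow> 'b::{banach, second_countable_topology}"
  assumes "integrable lborel f"
  shows "integrable lborel (\<lambda>x. f (a - x))"
proof -
  have "integrable (distr lborel borel (\<lambda>x. a - x)) f"
    using assms by (simp add: lborel_distr_minus)
  then show ?thesis by (rule integrable_distr[rotated]) auto
qed

subsection \<open>Sums over separated sets\<close>

text \<open>Countability is recorded because sums over the set are written as integrals over
  \<open>count_space\<close> and are interchanged with Lebesgue integrals.\<close>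

definition separated :: "real \<Rightarrow> 'a::metric_space set \<Rightarrow> bool" where
  "separated \<delta> L \<longleftrightarrow> 0 < \<delta> \<and> countable L \<and> (\<forall>x\<in>L. \<forall>y\<in>L. x \<noteq> y \<longrightarrow> \<delta> \<le> dist x y)"

text \<open>Packing argument: the balls of radius \<delta>/2 about the points are disjoint and the
  kernel is comparable to a constant on each of them, so the sum times the volume of one ball is at
  most a multiple of the integral of the kernel.\<close>

lemma separated_kap_sum:
  fixes L :: "'a::euclidean_space set"
  assumes "separated \<delta> L" and k: "k \<ge> DIM('a) + 2"
  obtains K where "K > 0" "\<And>x. (\<integral>\<^sup>+l. ennreal (kap k (x - l)) \<partial>count_space L) \<le> ennreal K"
proof -
  have \<delta>: "\<delta> > 0" and cL: "countable L" and sep: "\<And>x y. x \<in> L \<Longrightarrow> y \<in> L \<Longrightarrow> x \<noteq> y \<Longrightarrow> \<delta> \<le> dist x y"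
    using assms by (auto simp: separated_def)
  define V where "V = measure lborel (ball (0::'a) (\<delta>/2))"
  have V: "V > 0" unfolding V_def using content_ball_pos[of "\<delta>/2" "0::'a"] \<delta> by simp
  have emV: "emeasure lborel (ball l (\<delta>/2)) = ennreal V" for l :: 'a
  proof -
    have "measure lborel (ball l (\<delta>/2)) = V"
      unfolding V_def using content_ball_conv_unit_ball[of "\<delta>/2" l] content_ball_conv_unit_ball[of "\<delta>/2" "0::'a"] \<delta> by simp
    then show ?thesis
      using emeasure_eq_ennreal_measure[of lborel "ball l (\<delta>/2)"] emeasure_lborel_ball_finite[of l "\<delta>/2"]
      by (simp add: less_top)
  qed
  define J where "J = (\<integral>x. kap k (x::'a) \<partial>lborel)"
  define c where "c = (1 + \<delta>/2) ^ k"
  have c: "c > 0" using \<delta> by (simp add: c_def)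
  have J: "(\<integral>\<^sup>+v. ennreal (kap k (x - v)) \<partial>lborel) = ennreal J" for x :: 'a
    unfolding J_def
    by (subst nn_integral_lborel_minus[of "\<lambda>v. ennreal (kap k v)"])
       (auto intro!: nn_integral_eq_integral integrable_kap k)
  have J0: "J \<ge> 0" unfolding J_def by (rule integral_nonneg_AE) simp
  have main: "(\<integral>\<^sup>+l. ennreal (kap k (x - l)) \<partial>count_space L) * ennreal V \<le> ennreal (c * J)" for x
  proof -
    \<comment> \<open>Moving from the centre \<open>l\<close> to a point \<open>v\<close> of its
      ball enlarges 1 + norm by at most the factor 1 + \<delta>/2, whose \<open>k\<close>-th power
      is \<open>c\<close>.\<close>
    have pt: "kap k (x - l) \<le> c * kap k (x - v)" if "v \<in> ball l (\<delta>/2)" for l v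
    proof -
      have "norm (x - v) \<le> norm (x - l) + \<delta>/2"
        using that norm_triangle_ineq[of "x - l" "l - v"] by (simp add: dist_norm)
      then have "1 + norm (x - v) \<le> (1 + \<delta>/2) * (1 + norm (x - l))"
        using mult_nonneg_nonneg[OF less_imp_le[OF \<delta>] norm_ge_zero[of "x - l"]]
        unfolding distrib_left distrib_right by linarith
      then have "(1 + norm (x - v))^k \<le> c * (1 + norm (x - l))^k"
        unfolding c_def using power_mono[of _ _ k] by (metis norm1_pos(2) power_mult_distrib)
      then show ?thesis by (simp add: kap_def divide_simps)
    qed
    have "(\<integral>\<^sup>+l. ennreal (kap k (x - l)) \<partial>count_space L) * ennreal V
        = (\<integral>\<^sup>+l. ennreal (kap k (x - l)) * ennreal V \<partial>count_space L)"
      by (simp add: nn_integral_multc)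
    also have "\<dots> = (\<integral>\<^sup>+l. (\<integral>\<^sup>+v. ennreal (kap k (x - l)) * indicator (ball l (\<delta>/2)) v \<partial>lborel) \<partial>count_space L)"
      by (simp add: nn_integral_cmult_indicator emV)
    also have "\<dots> \<le> (\<integral>\<^sup>+l. (\<integral>\<^sup>+v. ennreal (c * kap k (x - v)) * indicator (ball l (\<delta>/2)) v \<partial>lborel) \<partial>count_space L)"
      using pt by (intro nn_integral_mono) (auto simp: indicator_def intro!: ennreal_leI)
    also have "\<dots> = (\<integral>\<^sup>+v. (\<integral>\<^sup>+l. ennreal (c * kap k (x - v)) * indicator (ball l (\<delta>/2)) v \<partial>count_space L) \<partial>lborel)"
      by (rule nn_integral_count_space_nn_integral[symmetric, OF cL]) measurable
    also have "\<dots> \<le> (\<integral>\<^sup>+v. ennreal (c * kap k (x - v)) \<partial>lborel)"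
    proof (intro nn_integral_mono)
      fix v :: 'a
      have "(\<integral>\<^sup>+l. indicator (ball l (\<delta>/2)) v \<partial>count_space L) = (\<integral>\<^sup>+l. indicator {l\<in>L. v \<in> ball l (\<delta>/2)} l \<partial>count_space L)"
        by (intro nn_integral_cong) (auto simp: indicator_def)
      also have "\<dots> = emeasure (count_space L) {l\<in>L. v \<in> ball l (\<delta>/2)}"
        by (rule nn_integral_indicator) auto
      \<comment> \<open>Two centres whose balls share \<open>v\<close> would be closer than
        \<delta>, so at most one ball contains \<open>v\<close>.\<close>
      also have "\<dots> \<le> 1"
      proof (cases "{l\<in>L. v \<in> ball l (\<delta>/2)} = {}")
        case False
        then obtain l0 where l0: "l0 \<in> L" "v \<in> ball l0 (\<delta>/2)" by auto
        have "l = l0" if "l \<in> L" "v \<in> ball l (\<delta>/2)" for l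
        proof (rule ccontr)
          assume "l \<noteq> l0"
          then have "\<delta> \<le> dist l l0" using sep that l0 by auto
          moreover have "dist l l0 < \<delta>" using that l0 dist_triangle_half_l[of l v \<delta> l0]
            by (auto simp: dist_commute)
          ultimately show False by simp
        qed
        then have "{l\<in>L. v \<in> ball l (\<delta>/2)} = {l0}" using l0 by blast
        then show ?thesis using l0 by simp
      next
        case True
        show ?thesis unfolding True by simp
      qed
      finally have *: "(\<integral>\<^sup>+l. indicator (ball l (\<delta>/2)) v \<partial>count_space L) \<le> (1::ennreal)" .
      have "(\<integral>\<^sup>+l. ennreal (c * kap k (x - v)) * indicator (ball l (\<delta>/2)) v \<partial>count_space L)
         = ennreal (c * kap k (x - v)) * (\<integral>\<^sup>+l. indicator (ball l (\<delta>/2)) v \<partial>count_space L)"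
        by (rule nn_integral_cmult) simp
      also have "\<dots> \<le> ennreal (c * kap k (x - v)) * 1"
        by (rule mult_left_mono[OF *]) simp
      finally show "(\<integral>\<^sup>+l. ennreal (c * kap k (x - v)) * indicator (ball l (\<delta>/2)) v \<partial>count_space L) \<le> ennreal (c * kap k (x - v))"
        by simp
    qed
    also have "\<dots> = ennreal (c * J)"
      using c J0 by (simp add: ennreal_mult nn_integral_cmult J)
    finally show ?thesis .
  qed
  have "(\<integral>\<^sup>+l. ennreal (kap k (x - l)) \<partial>count_space L) \<le> ennreal (c * J / V + 1)" for x
  proof -
    have "(\<integral>\<^sup>+l. ennreal (kap k (x - l)) \<partial>count_space L) = (\<integral>\<^sup>+l. ennreal (kap k (x - l)) \<partial>count_space L) * ennreal V / ennreal V"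
      using V by (simp add: ennreal_mult_divide_eq)
    also have "\<dots> \<le> ennreal (c * J) / ennreal V"
      by (rule divide_right_mono_ennreal[OF main])
    also have "\<dots> \<le> ennreal (c * J / V + 1)"
      using V c J0 by (simp add: divide_ennreal ennreal_leI)
    finally show ?thesis .
  qed
  \<comment> \<open>The summand 1 makes the constant visibly positive; \<open>J\<close> is only
    known to be nonnegative here.\<close>
  moreover have "c * J / V + 1 > 0" using c J0 V by (intro add_nonneg_pos) auto
  ultimately show thesis using that by blast
qed

subsection \<open>Integral inequalities\<close>

text \<open>Jensen's inequality up to the factor \<open>2\<^sup>p\<close>, from the pointwise bound
  \<open>g \<le> a + a\<^bsup>1-p\<^esup> g\<^sup>p\<close> with the best \<open>a\<close>.\<close>

lemma ennpowr_nn_integral_le: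
  fixes w g :: "'a \<Rightarrow> real"
  assumes p: "1 \<le> p" and [measurable]: "w \<in> borel_measurable M" "g \<in> borel_measurable M"
    and w0: "\<And>x. 0 \<le> w x" and g0: "\<And>x. 0 \<le> g x"
    and W: "(\<integral>\<^sup>+x. ennreal (w x) \<partial>M) \<le> ennreal W" "W > 0"
  shows "ennpowr (\<integral>\<^sup>+x. ennreal (w x * g x) \<partial>M) p
     \<le> ennreal (2 powr p * W powr (p - 1)) * (\<integral>\<^sup>+x. ennreal (w x * g x powr p) \<partial>M)"
proof -
  define X where "X = (\<integral>\<^sup>+x. ennreal (w x * g x) \<partial>M)"
  define Y where "Y = (\<integral>\<^sup>+x. ennreal (w x * g x powr p) \<partial>M)"
  define cc where "cc = 2 powr p * W powr (p - 1)"
  have cc: "cc > 0" using W by (simp add: cc_def)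
  have pt: "X \<le> ennreal (a * W) + ennreal (a powr (1 - p)) * Y" if a: "a > 0" for a
  proof -
    \<comment> \<open>If \<open>g x \<le> a\<close> the first term suffices; otherwise g^(1-p) is at
      most a^(1-p), because the exponent is not positive.\<close>
    have le: "g x \<le> a + a powr (1 - p) * g x powr p" for x
    proof (cases "g x \<le> a")
      case True then show ?thesis using a by (simp add: add_increasing2)
    next
      case False
      then have gx: "g x > 0" using a by simp
      have "g x powr (1 - p) \<le> a powr (1 - p)"
        using False a p by (intro powr_mono2') auto
      then have "g x powr (1 - p) * g x powr p \<le> a powr (1 - p) * g x powr p"
        by (rule mult_right_mono) simp
      moreover have "g x powr (1 - p) * g x powr p = g x" using gx by (simp add: powr_add[symmetric])
      ultimately show ?thesis using a by linarith
    qed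
    have "X \<le> (\<integral>\<^sup>+x. ennreal a * ennreal (w x) + ennreal (a powr (1 - p)) * ennreal (w x * g x powr p) \<partial>M)"
      unfolding X_def
    proof (rule nn_integral_mono)
      fix x
      have "w x * g x \<le> w x * (a + a powr (1 - p) * g x powr p)"
        by (rule mult_left_mono[OF le w0])
      also have "\<dots> = a * w x + a powr (1 - p) * (w x * g x powr p)"
        by (simp add: algebra_simps)
      finally show "ennreal (w x * g x) \<le> ennreal a * ennreal (w x) + ennreal (a powr (1 - p)) * ennreal (w x * g x powr p)"
        using a w0[of x] g0[of x] by (simp add: ennreal_mult'[symmetric] ennreal_plus[symmetric] ennreal_leI del: ennreal_plus)
    qed
    also have "\<dots> = ennreal a * (\<integral>\<^sup>+x. ennreal (w x) \<partial>M) + ennreal (a powr (1 - p)) * Y"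
      unfolding Y_def by (subst nn_integral_add) (auto simp: nn_integral_cmult)
    also have "\<dots> \<le> ennreal a * ennreal W + ennreal (a powr (1 - p)) * Y"
      by (intro add_right_mono mult_left_mono W) simp
    finally show ?thesis using a by (simp add: ennreal_mult')
  qed
  show ?thesis
  proof (cases Y)
    case top
    then show ?thesis using cc unfolding Y_def[symmetric] cc_def[symmetric] by (simp add: ennreal_mult_top)
  next
    case (real y)
    show ?thesis
    \<comment> \<open>The optimal \<open>a\<close> would be 0 in this case, but then
      \<open>w x * g x\<close> vanishes almost everywhere, having the same zeros as the integrand of
      \<open>Y\<close>.\<close>
    proof (cases "y = 0")
      case True
      then have "AE x in M. ennreal (w x * g x powr p) = 0"
        using real unfolding Y_def by (subst nn_integral_0_iff_AE[symmetric]) auto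
      then have "AE x in M. ennreal (w x * g x) = 0"
        by eventually_elim (use w0 g0 in \<open>auto simp: ennreal_eq_0_iff mult_le_0_iff not_le order.antisym\<close>)
      then have "X = 0" unfolding X_def by (subst nn_integral_0_iff_AE) auto
      then show ?thesis unfolding X_def[symmetric] using p by (simp add: ennpowr_def)
    next
      case False
      with real have y: "y > 0" by simp
      \<comment> \<open>This value makes the two terms of the bound equal; their sum
        \<open>2 * a * W\<close> is the source of the factor 2^p.\<close>
      define a where "a = (y / W) powr (1/p)"
      have a: "a > 0" using y W by (simp add: a_def)
      have ap: "a powr p = y / W" using p y W by (simp add: a_def powr_powr)
      have "a powr (1 - p) * y = a * W"
      proof -
        have "a powr (1 - p) * a powr p = a" using a by (simp add: powr_add[symmetric])
        then show ?thesis unfolding ap using W by (simp add: field_simps)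
      qed
      then have "X \<le> ennreal (2 * a * W)"
        using pt[OF a] real y a W
        by (simp add: ennreal_mult'[symmetric] ennreal_plus[symmetric] mult_ac del: ennreal_plus)
      moreover obtain x where x: "X = ennreal x" "x \<ge> 0"
        using \<open>X \<le> ennreal (2 * a * W)\<close> by (cases X) (auto simp: top_unique)
      ultimately have "x \<le> 2 * a * W" using a W by (simp add: ennreal_le_iff)
      then have "x powr p \<le> (2 * a * W) powr p" using x p by (intro powr_mono2) auto
      also have "\<dots> = 2 powr p * a powr p * W powr p" using a W by (simp add: powr_mult)
      also have "\<dots> = 2 powr p * y * (W powr p / W)" by (simp add: ap)
      also have "W powr p / W = W powr (p - 1)" using W by (simp add: powr_diff)
      finally have "x powr p \<le> cc * y" by (simp add: cc_def mult_ac)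
      then show ?thesis
        unfolding X_def[symmetric] Y_def[symmetric] cc_def[symmetric] x(1)
        using x cc y real by (simp add: ennpowr_def ennreal_mult'[symmetric] ennreal_leI)
    qed
  qed
qed

lemma ennpowr_2: "ennpowr x 2 = x\<^sup>2"
  by (cases x) (auto simp: ennpowr_def powr_numeral ennreal_power top_power_ennreal)

lemma nn_integral_square_le:
  fixes w g :: "'a \<Rightarrow> real"
  assumes [measurable]: "w \<in> borel_measurable M" "g \<in> borel_measurable M"
    and w0: "\<And>x. 0 \<le> w x" and g0: "\<And>x. 0 \<le> g x"
    and W: "(\<integral>\<^sup>+x. ennreal (w x) \<partial>M) \<le> ennreal W" "W \<ge> 0"
  shows "(\<integral>\<^sup>+x. ennreal (w x * g x) \<partial>M)\<^sup>2 \<le> ennreal (4 * W) * (\<integral>\<^sup>+x. ennreal (w x * (g x)\<^sup>2) \<partial>M)"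
proof (cases "W = 0")
  case True
  then have "AE x in M. ennreal (w x) = 0"
    using W by (subst nn_integral_0_iff_AE[symmetric]) auto
  then have "AE x in M. ennreal (w x * g x) = 0"
    by eventually_elim (use w0 in \<open>auto simp: ennreal_eq_0_iff mult_le_0_iff order.antisym\<close>)
  then have "(\<integral>\<^sup>+x. ennreal (w x * g x) \<partial>M) = 0" by (subst nn_integral_0_iff_AE) auto
  then show ?thesis by simp
next
  case False
  then show ?thesis
    using ennpowr_nn_integral_le[of 2 w M g W] assms by (simp add: ennpowr_2 powr_numeral)
qed

text \<open>Schur test, or Young's inequality for the convolution of an L^1 and an L^2 function: the
  square is moved under the inner integral, then Tonelli applies. The factor 4 stems from
  \<open>nn_integral_square_le\<close>; what matters is that the bound vanishes with
  \<open>W\<close>.\<close>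

lemma schur_square:
  fixes \<kappa> g :: "'a::euclidean_space \<Rightarrow> real"
  assumes [measurable]: "\<kappa> \<in> borel_measurable borel" "g \<in> borel_measurable borel"
    and \<kappa>0: "\<And>x. 0 \<le> \<kappa> x" and g0: "\<And>x. 0 \<le> g x"
    and W: "(\<integral>\<^sup>+x. ennreal (\<kappa> x) \<partial>lborel) \<le> ennreal W" "W \<ge> 0"
  shows "(\<integral>\<^sup>+z. (\<integral>\<^sup>+v. ennreal (\<kappa> (z - v) * g v) \<partial>lborel)\<^sup>2 \<partial>lborel)
     \<le> ennreal (4 * W\<^sup>2) * (\<integral>\<^sup>+v. ennreal ((g v)\<^sup>2) \<partial>lborel)"
proof -
  have "(\<integral>\<^sup>+v. ennreal (\<kappa> (z - v) * g v) \<partial>lborel)\<^sup>2 \<le> ennreal (4 * W) * (\<integral>\<^sup>+v. ennreal (\<kappa> (z - v) * (g v)\<^sup>2) \<partial>lborel)" for z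
    using W \<kappa>0 g0 nn_integral_lborel_minus[of "\<lambda>x. ennreal (\<kappa> x)" z]
    by (intro nn_integral_square_le) auto
  then have "(\<integral>\<^sup>+z. (\<integral>\<^sup>+v. ennreal (\<kappa> (z - v) * g v) \<partial>lborel)\<^sup>2 \<partial>lborel)
     \<le> (\<integral>\<^sup>+z. ennreal (4 * W) * (\<integral>\<^sup>+v. ennreal (\<kappa> (z - v) * (g v)\<^sup>2) \<partial>lborel) \<partial>lborel)"
    by (intro nn_integral_mono) auto
  also have "\<dots> = ennreal (4 * W) * (\<integral>\<^sup>+z. (\<integral>\<^sup>+v. ennreal (\<kappa> (z - v) * (g v)\<^sup>2) \<partial>lborel) \<partial>lborel)"
    by (rule nn_integral_cmult) measurable
  also have "(\<integral>\<^sup>+z. (\<integral>\<^sup>+v. ennreal (\<kappa> (z - v) * (g v)\<^sup>2) \<partial>lborel) \<partial>lborel)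
     = (\<integral>\<^sup>+v. (\<integral>\<^sup>+z. ennreal (\<kappa> (z - v) * (g v)\<^sup>2) \<partial>lborel) \<partial>lborel)"
    by (rule lborel_pair.Fubini') measurable
  also have "\<dots> = (\<integral>\<^sup>+v. (\<integral>\<^sup>+z. ennreal (\<kappa> z) \<partial>lborel) * ennreal ((g v)\<^sup>2) \<partial>lborel)"
    using \<kappa>0 nn_integral_lborel_diff[of "\<lambda>x. ennreal (\<kappa> x)"]
    by (intro nn_integral_cong) (simp add: ennreal_mult nn_integral_multc)
  also have "\<dots> = (\<integral>\<^sup>+z. ennreal (\<kappa> z) \<partial>lborel) * (\<integral>\<^sup>+v. ennreal ((g v)\<^sup>2) \<partial>lborel)"
    by (rule nn_integral_cmult) measurable
  also have "ennreal (4 * W) * \<dots> \<le> ennreal (4 * W) * (ennreal W * (\<integral>\<^sup>+v. ennreal ((g v)\<^sup>2) \<partial>lborel))"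
    by (intro mult_left_mono mult_right_mono W) auto
  also have "\<dots> = ennreal (4 * W\<^sup>2) * (\<integral>\<^sup>+v. ennreal ((g v)\<^sup>2) \<partial>lborel)"
    using W by (simp add: ennreal_mult power2_eq_square mult.assoc)
  finally show ?thesis .
qed

subsection \<open>Reproducing kernels\<close>

text \<open>Integrability is dispensed with by the convention that a non-integrable function has
  Bochner integral 0.\<close>

lemma norm_integral_le_nn_integral:
  fixes f :: "'a \<Rightarrow> 'b::{banach, second_countable_topology}"
  shows "ennreal (norm (integral\<^sup>L M f)) \<le> (\<integral>\<^sup>+x. ennreal (norm (f x)) \<partial>M)"
  by (cases "integrable M f") (auto simp: integral_norm_bound_ennreal not_integrable_integral_eq)

lemma borel_measurable_nn_integral_count_space:
  fixes f :: "'i \<Rightarrow> 'a \<Rightarrow> ennreal"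
  assumes "countable I" and [measurable]: "\<And>i. i \<in> I \<Longrightarrow> f i \<in> borel_measurable M"
  shows "(\<lambda>x. \<integral>\<^sup>+i. f i x \<partial>count_space I) \<in> borel_measurable M"
proof (cases "finite I")
  case True
  then show ?thesis by (simp add: nn_integral_count_space_finite)
next
  case False
  then have [measurable]: "from_nat_into I n \<in> I" for n
    using from_nat_into[of I n] by fastforce
  have "(\<integral>\<^sup>+i. f i x \<partial>count_space I) = (\<Sum>n. f (from_nat_into I n) x)" for x
    using nn_integral_bij_count_space[OF bij_betw_from_nat_into[OF \<open>countable I\<close> False], of "\<lambda>i. f i x"]
    by (simp add: nn_integral_count_space_nat)
  then show ?thesis by simp
qed

lemma nn_integral_count_space_lborel_measurable [measurable (raw)]:
  fixes f :: "'b \<Rightarrow> 'i \<Rightarrow> ennreal"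
  assumes "countable I" "\<And>i. i \<in> I \<Longrightarrow> (\<lambda>x. f x i) \<in> borel_measurable M"
  shows "(\<lambda>x. \<integral>\<^sup>+i. f x i \<partial>count_space I) \<in> borel_measurable M"
  using borel_measurable_nn_integral_count_space[of I "\<lambda>i x. f x i"] assms by simp

lemma integrable_kap_conv:
  assumes g: "integrable lborel (g :: 'a::euclidean_space \<Rightarrow> real)" and k: "k \<ge> DIM('a) + 2"
  shows "integrable (lborel \<Otimes>\<^sub>M lborel) (\<lambda>(z, w). kap k (z - w) * g w)"
proof (rule integrableI_bounded)
  have [measurable]: "g \<in> borel_measurable borel" using g by auto
  show "(\<lambda>(z, w). kap k (z - w) * g w) \<in> borel_measurable (lborel \<Otimes>\<^sub>M lborel)" by measurable
  have "(\<integral>\<^sup>+x. ennreal (norm (case x of (z, w) \<Rightarrow> kap k (z - w) * g w)) \<partial>(lborel \<Otimes>\<^sub>M lborel))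
     = (\<integral>\<^sup>+w. \<integral>\<^sup>+z. ennreal (kap k (z - w)) * ennreal \<bar>g w\<bar> \<partial>lborel \<partial>lborel)"
    by (subst lborel_pair.nn_integral_snd[symmetric]) (simp_all add: abs_mult ennreal_mult)
  also have "\<dots> = (\<integral>\<^sup>+w. (\<integral>\<^sup>+z. ennreal (kap k (z::'a)) \<partial>lborel) * ennreal \<bar>g w\<bar> \<partial>lborel)"
    using nn_integral_lborel_diff[of "\<lambda>x. ennreal (kap k (x::'a))"] by (simp add: nn_integral_multc)
  also have "\<dots> = (\<integral>\<^sup>+z. ennreal (kap k (z::'a)) \<partial>lborel) * (\<integral>\<^sup>+w. ennreal \<bar>g w\<bar> \<partial>lborel)"
    by (simp add: nn_integral_cmult)
  also have "\<dots> < \<infinity>"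
    using nn_integral_kap_finite[OF k] g
    by (simp add: integrable_iff_bounded ennreal_mult_less_top)
  finally show "(\<integral>\<^sup>+x. ennreal (norm (case x of (z, w) \<Rightarrow> kap k (z - w) * g w)) \<partial>(lborel \<Otimes>\<^sub>M lborel)) < \<infinity>" .
qed

lemma integral_tail_tendsto_0:
  fixes f :: "'a::euclidean_space \<Rightarrow> real"
  assumes f: "integrable lborel f"
  shows "(\<lambda>n. \<integral>x. f x * indicator {x. real n < norm x} x \<partial>lborel) \<longlonglongrightarrow> 0"
proof -
  have [measurable]: "f \<in> borel_measurable borel" using f by auto
  have "(\<lambda>n. \<integral>x. f x * indicator {x. real n < norm x} x \<partial>lborel) \<longlonglongrightarrow> (\<integral>x. 0 \<partial>(lborel::'a measure))"
  proof (rule integral_dominated_convergence[where w="\<lambda>x. norm (f x)"])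
    show "AE x in lborel. (\<lambda>n. f x * indicator {x. real n < norm x} x) \<longlonglongrightarrow> 0"
    proof (rule AE_I2, rule tendsto_eventually)
      fix x :: 'a
      show "eventually (\<lambda>n. f x * indicator {x. real n < norm x} x = 0) sequentially"
        using eventually_ge_at_top[of "nat \<lceil>norm x\<rceil>"] by eventually_elim (auto simp: indicator_def)
    qed
    show "AE x in lborel. norm (f x * indicator {x. real n < norm x} x) \<le> norm (f x)" for n
      by (auto simp: indicator_def)
  qed (use f in auto)
  then show ?thesis by simp
qed

text \<open>Expands the square of \<open>t * x - y\<close>. With \<open>t\<close> small the
  coefficient of the first square stays close to 1, so that a contraction remains one after a
  perturbation has been added.\<close>

lemma ennreal_square_add_le:
  assumes t: "t > 0"
  shows "(a + b)\<^sup>2 \<le> ennreal (1 + t) * a\<^sup>2 + ennreal (1 + 1/t) * (b::ennreal)\<^sup>2"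
proof (cases "a = \<infinity> \<or> b = \<infinity>")
  case True
  then show ?thesis using t by (auto simp: ennreal_mult_top top_power_ennreal)
next
  case False
  then obtain x y where xy: "a = ennreal x" "b = ennreal y" "x \<ge> 0" "y \<ge> 0"
    by (cases a; cases b) auto
  have "0 \<le> (t * x - y)\<^sup>2 / t" using t by simp
  also have "\<dots> = t * x\<^sup>2 - 2 * x * y + y\<^sup>2 / t"
    using t by (simp add: power2_eq_square field_simps)
  finally have "(x + y)\<^sup>2 \<le> (1 + t) * x\<^sup>2 + (1 + 1/t) * y\<^sup>2"
    by (simp add: power2_eq_square algebra_simps)
  then show ?thesis using t xy
    by (simp add: ennreal_plus[symmetric] ennreal_power ennreal_mult'[symmetric] ennreal_leI del: ennreal_plus)
qed

lemma ennreal_square_add_le2: "(a + b)\<^sup>2 \<le> 2 * a\<^sup>2 + 2 * (b::ennreal)\<^sup>2"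
  using ennreal_square_add_le[of 1 a b] by simp

lemma ennreal_square_le_imp:
  assumes "x\<^sup>2 \<le> ennreal c * y\<^sup>2" "c \<ge> 0"
  shows "x \<le> ennreal (sqrt c) * (y::ennreal)"
proof (cases x)
  case (real a)
  show ?thesis
  proof (cases y)
    case y: (real b)
    have "a\<^sup>2 \<le> c * b\<^sup>2"
      using assms real y by (simp add: ennreal_power ennreal_mult'[symmetric] ennreal_le_iff)
    then have "a \<le> sqrt (c * b\<^sup>2)" by (rule real_le_rsqrt)
    then show ?thesis
      using real y assms by (simp add: real_sqrt_mult ennreal_mult'[symmetric] ennreal_leI)
  next
    case top
    then show ?thesis using assms real
      by (cases "c = 0") (auto simp: ennreal_mult_top ennreal_power)
  qed
next
  case top
  then have "ennreal c * y\<^sup>2 = \<top>" using assms by (simp add: top_power_ennreal top_unique)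
  then show ?thesis using assms
    by (cases y) (auto simp: ennreal_mult_eq_top_iff ennreal_power ennreal_mult_top)
qed

text \<open>Each term is at most the whole sum: the l^1 norm dominates the l^2 norm.\<close>

lemma nn_integral_count_space_square_le:
  fixes f :: "'i \<Rightarrow> ennreal"
  shows "(\<integral>\<^sup>+i. (f i)\<^sup>2 \<partial>count_space I) \<le> (\<integral>\<^sup>+i. f i \<partial>count_space I)\<^sup>2"
proof -
  have "(\<integral>\<^sup>+i. (f i)\<^sup>2 \<partial>count_space I) \<le> (\<integral>\<^sup>+i. f i * (\<integral>\<^sup>+i. f i \<partial>count_space I) \<partial>count_space I)"
    unfolding power2_eq_square
    by (intro nn_integral_mono mult_left_mono nn_integral_ge_point) auto
  then show ?thesis by (simp add: nn_integral_multc power2_eq_square)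
qed

text \<open>The kernel of an orthogonal projection with rapid off-diagonal decay, abstracted from
  the projection onto the range of the short-time Fourier transform; the concrete instance is
  \<open>rep_kernel_gab\<close>.\<close>

locale rep_kernel =
  fixes k :: "'a::euclidean_space \<Rightarrow> 'a \<Rightarrow> complex"
  assumes k_measurable_pair: "case_prod k \<in> borel_measurable (borel \<Otimes>\<^sub>M borel)"
    and k_decay: "\<And>j. \<exists>C. \<forall>z w. cmod (k z w) \<le> C * kap j (z - w)"
    and k_herm: "\<And>z w. cnj (k z w) = k w z"
    and k_idem: "\<And>w v. (\<integral>z. k w z * k z v \<partial>lborel) = k w v"
begin

lemma k_measurable [measurable (raw)]:
  assumes "f \<in> M \<rightarrow>\<^sub>M borel" "g \<in> M \<rightarrow>\<^sub>M borel"
  shows "(\<lambda>x. k (f x) (g x)) \<in> borel_measurable M"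
  using measurable_compose[OF measurable_Pair[OF assms] k_measurable_pair] by simp

lemma k_decayE:
  obtains C where "C > 0" "\<And>z w. cmod (k z w) \<le> C * kap j (z - w)"
proof -
  obtain C where C: "\<And>z w. cmod (k z w) \<le> C * kap j (z - w)" using k_decay by blast
  show thesis
  proof (rule that[of "max C 1"])
    show "cmod (k z w) \<le> max C 1 * kap j (z - w)" for z w
      using C[of z w] by (rule order_trans) (auto intro!: mult_right_mono)
  qed simp
qed

text \<open>The projection with kernel \<open>k\<close> is a contraction: \<open>\<parallel>P G\<parallel>\<^sup>2 = \<langle>P G, G\<rangle>\<close> since \<open>k\<close> is hermitian and idempotent.\<close>

lemma projection_contraction:
  fixes G :: "'a \<Rightarrow> complex"
  assumes [measurable]: "G \<in> borel_measurable borel"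
    and G: "\<And>z. cmod (G z) \<le> c * kap (DIM('a) + 2) z"
  shows "(\<integral>\<^sup>+z. (ennreal (cmod (\<integral>w. k z w * G w \<partial>lborel)))\<^sup>2 \<partial>lborel) \<le> (\<integral>\<^sup>+z. (ennreal (cmod (G z)))\<^sup>2 \<partial>lborel)"
proof -
  define d where "d = DIM('a) + 2"
  obtain C where C: "C > 0" "\<And>z w. cmod (k z w) \<le> C * kap d (z - w)" using k_decayE by blast
  have G: "cmod (G z) \<le> c * kap d z" for z using assms(2) by (simp add: d_def)
  have c0: "c \<ge> 0" using order_trans[OF norm_ge_zero G[of 0]] by (simp add: kap_def)
  have ik: "integrable lborel (kap d :: 'a \<Rightarrow> real)" unfolding d_def by (rule integrable_kap) simp
  have iconv: "integrable (lborel \<Otimes>\<^sub>M lborel) (\<lambda>(z::'a, w). kap d (z - w) * kap d w)"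
    using integrable_kap_conv[OF ik, of d] by (simp add: d_def)
  define P where "P = (\<lambda>z. \<integral>w. k z w * G w \<partial>lborel)"
  have Pm [measurable]: "P \<in> borel_measurable borel" unfolding P_def by measurable
  have ikG: "integrable (lborel \<Otimes>\<^sub>M lborel) (\<lambda>(z, w). k z w * G w)"
  proof (rule Bochner_Integration.integrable_bound)
    show "integrable (lborel \<Otimes>\<^sub>M lborel) (\<lambda>x. (C * c) * (case x of (z::'a, w) \<Rightarrow> kap d (z - w) * kap d w))"
      using iconv by (rule integrable_mult_right)
    show "AE x in lborel \<Otimes>\<^sub>M lborel. norm (case x of (z, w) \<Rightarrow> k z w * G w) \<le> norm (C * c * (case x of (z, w) \<Rightarrow> kap d (z - w) * kap d w))"
    proof (intro AE_I2, clarify)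
      fix z w
      have "cmod (k z w) * cmod (G w) \<le> (C * kap d (z - w)) * (c * kap d w)"
        using C G c0 by (intro mult_mono) auto
      then show "norm (k z w * G w) \<le> norm (C * c * (kap d (z - w) * kap d w))"
        using C c0 by (simp add: norm_mult abs_mult mult_ac)
    qed
  qed measurable
  have iP: "integrable lborel P" unfolding P_def by (rule lborel_pair.integrable_fst[OF ikG])
  have Gbd: "cmod (G w) \<le> c * 1" for w
    using G[of w] mult_left_mono[OF kap_le_1[of d w] c0] by linarith
  define B where "B = C * c * (\<integral>x. kap d (x::'a) \<partial>lborel)"
  have B0: "B \<ge> 0" unfolding B_def using C c0 by (intro mult_nonneg_nonneg integral_nonneg_AE) auto
  have Pbd: "cmod (P z) \<le> B" for z
  proof -
    have "cmod (P z) \<le> (\<integral>w. C * kap d (z - w) * c \<partial>lborel)"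
      unfolding P_def
    proof (rule order_trans[OF integral_norm_bound integral_mono'])
      show "integrable lborel (\<lambda>w. C * kap d (z - w) * c)"
        using integrable_lborel_minus[OF ik, of z] by simp
      show "norm (k z w * G w) \<le> C * kap d (z - w) * c" for w
        unfolding norm_mult using C Gbd by (intro mult_mono) auto
      show "0 \<le> C * kap d (z - w) * c" for w using C c0 by simp
    qed
    also have "\<dots> = B" unfolding B_def using integral_lborel_minus[of "kap d" z] by simp
    finally show ?thesis .
  qed
  \<comment> \<open>Idempotence of the kernel after exchanging the integrals; as
    \<open>k w z\<close> is bounded, the integrability of \<open>k z v * G v\<close> on the product
    space carries over.\<close>
  have PP: "(\<integral>z. k w z * P z \<partial>lborel) = P w" for w
  proof -
    have "(\<integral>z. k w z * P z \<partial>lborel) = (\<integral>z. (\<integral>v. k w z * k z v * G v \<partial>lborel) \<partial>lborel)"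
      unfolding P_def by (simp add: mult.assoc)
    also have "\<dots> = (\<integral>v. (\<integral>z. k w z * k z v * G v \<partial>lborel) \<partial>lborel)"
    proof (rule lborel_pair.Fubini_integral[symmetric])
      show "integrable (lborel \<Otimes>\<^sub>M lborel) (\<lambda>(z, v). k w z * k z v * G v)"
      proof (rule Bochner_Integration.integrable_bound)
        show "integrable (lborel \<Otimes>\<^sub>M lborel) (\<lambda>x. C * norm (case x of (z, v) \<Rightarrow> k z v * G v))"
          using ikG by (intro integrable_mult_right integrable_norm)
        show "AE x in lborel \<Otimes>\<^sub>M lborel. norm (case x of (z, v) \<Rightarrow> k w z * k z v * G v) \<le> norm (C * norm (case x of (z, v) \<Rightarrow> k z v * G v))"
        proof (intro AE_I2, clarify)
          fix z v
          have "cmod (k w z) \<le> C * 1"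
            using C(2)[of w z] mult_left_mono[OF kap_le_1[of d "w - z"], of C] C(1) by linarith
          then have "cmod (k w z) * (cmod (k z v) * cmod (G v)) \<le> C * (cmod (k z v) * cmod (G v))"
            by (intro mult_right_mono) auto
          then show "norm (k w z * k z v * G v) \<le> norm (C * norm (k z v * G v))"
            using C by (simp add: norm_mult abs_mult mult.assoc)
        qed
      qed measurable
    qed
    also have "\<dots> = (\<integral>v. k w v * G v \<partial>lborel)" by (simp add: k_idem)
    finally show ?thesis by (simp add: P_def)
  qed
  have iGP: "integrable (lborel \<Otimes>\<^sub>M lborel) (\<lambda>(w, z). cnj (G w) * (k w z * P z))"
  proof (rule Bochner_Integration.integrable_bound)
    show "integrable (lborel \<Otimes>\<^sub>M lborel) (\<lambda>x. (B * C * c) * (case x of (w::'a, z) \<Rightarrow> kap d (z - w) * kap d w))"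
      using lborel_pair.integrable_product_swap[OF iconv] by (auto simp: split_def intro!: integrable_mult_right)
    show "AE x in lborel \<Otimes>\<^sub>M lborel. norm (case x of (w, z) \<Rightarrow> cnj (G w) * (k w z * P z)) \<le> norm (B * C * c * (case x of (w, z) \<Rightarrow> kap d (z - w) * kap d w))"
    proof (intro AE_I2, clarify)
      fix w z
      have "cmod (G w) * (cmod (k w z) * cmod (P z)) \<le> (c * kap d w) * ((C * kap d (z - w)) * B)"
        using C(1) C(2)[of w z] G Pbd c0 by (intro mult_mono) (auto simp: kap_minus_commute)
      then show "norm (cnj (G w) * (k w z * P z)) \<le> norm (B * C * c * (kap d (z - w) * kap d w))"
        using C c0 B0 by (simp add: norm_mult abs_mult mult_ac)
    qed
  qed measurable
  have iP2: "integrable lborel (\<lambda>z. (cmod (P z))\<^sup>2)"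
  proof (rule Bochner_Integration.integrable_bound)
    show "integrable lborel (\<lambda>z. B * cmod (P z))" using iP by simp
    show "AE z in lborel. norm ((cmod (P z))\<^sup>2) \<le> norm (B * cmod (P z))"
      using Pbd B0 by (auto simp: power2_eq_square abs_mult intro!: mult_right_mono)
  qed measurable
  have iG2: "integrable lborel (\<lambda>z. (cmod (G z))\<^sup>2)"
  proof (rule Bochner_Integration.integrable_bound)
    show "integrable lborel (\<lambda>z. c * (c * kap d (z::'a)))" using ik by simp
    have "cmod (G z) * cmod (G z) \<le> c * (c * kap d z)" for z
      using G[of z] Gbd[of z] c0 by (intro mult_mono) auto
    then show "AE z in lborel. norm ((cmod (G z))\<^sup>2) \<le> norm (c * (c * kap d z))"
      using c0 by (auto simp: power2_eq_square abs_mult)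
  qed measurable
  have "complex_of_real (\<integral>z. (cmod (P z))\<^sup>2 \<partial>lborel) = (\<integral>z. cnj (P z) * P z \<partial>lborel)"
    by (subst integral_complex_of_real[symmetric]) (simp add: complex_norm_square mult.commute del: of_real_power)
  also have "\<dots> = (\<integral>z. (\<integral>w. cnj (G w) * (k w z * P z) \<partial>lborel) \<partial>lborel)"
  proof (rule Bochner_Integration.integral_cong[OF refl])
    fix z
    have "cnj (P z) = (\<integral>w. cnj (k z w * G w) \<partial>lborel)" unfolding P_def by (simp del: complex_cnj_mult)
    also have "\<dots> = (\<integral>w. cnj (G w) * k w z \<partial>lborel)" by (simp add: k_herm mult.commute)
    finally show "cnj (P z) * P z = (\<integral>w. cnj (G w) * (k w z * P z) \<partial>lborel)"
      by (simp add: mult.assoc[symmetric])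
  qed
  also have "\<dots> = (\<integral>w. (\<integral>z. cnj (G w) * (k w z * P z) \<partial>lborel) \<partial>lborel)"
    by (rule lborel_pair.Fubini_integral[OF iGP])
  also have "\<dots> = (\<integral>w. cnj (G w) * P w \<partial>lborel)" by (simp add: PP)
  finally have eq: "complex_of_real (\<integral>z. (cmod (P z))\<^sup>2 \<partial>lborel) = (\<integral>w. cnj (G w) * P w \<partial>lborel)" .
  have "(\<integral>z. (cmod (P z))\<^sup>2 \<partial>lborel) \<le> cmod (complex_of_real (\<integral>z. (cmod (P z))\<^sup>2 \<partial>lborel))" by simp
  also have "\<dots> = cmod (\<integral>w. cnj (G w) * P w \<partial>lborel)" by (simp only: eq)
  \<comment> \<open>The arithmetic-geometric mean inequality stands in for Cauchy-Schwarz. Half of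
    the squared norm of \<open>P\<close> then moves to the left side, which is legitimate since
    \<open>iP2\<close> makes it finite.\<close>
  also have "\<dots> \<le> (\<integral>w. ((cmod (G w))\<^sup>2 + (cmod (P w))\<^sup>2) / 2 \<partial>lborel)"
  proof (rule order_trans[OF integral_norm_bound integral_mono'])
    show "integrable lborel (\<lambda>w. ((cmod (G w))\<^sup>2 + (cmod (P w))\<^sup>2) / 2)" using iG2 iP2 by simp
    show "norm (cnj (G w) * P w) \<le> ((cmod (G w))\<^sup>2 + (cmod (P w))\<^sup>2) / 2" for w
      using sum_squares_bound[of "cmod (G w)" "cmod (P w)"] by (simp add: norm_mult)
  qed simp
  also have "\<dots> = ((\<integral>z. (cmod (G z))\<^sup>2 \<partial>lborel) + (\<integral>z. (cmod (P z))\<^sup>2 \<partial>lborel)) / 2"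
    using iG2 iP2 by simp
  finally have le: "(\<integral>z. (cmod (P z))\<^sup>2 \<partial>lborel) \<le> (\<integral>z. (cmod (G z))\<^sup>2 \<partial>lborel)" by simp
  have "(\<integral>\<^sup>+z. (ennreal (cmod (P z)))\<^sup>2 \<partial>lborel) = ennreal (\<integral>z. (cmod (P z))\<^sup>2 \<partial>lborel)"
    using nn_integral_eq_integral[OF iP2] by (simp add: ennreal_power)
  also have "\<dots> \<le> ennreal (\<integral>z. (cmod (G z))\<^sup>2 \<partial>lborel)" by (rule ennreal_leI[OF le])
  also have "\<dots> = (\<integral>\<^sup>+z. (ennreal (cmod (G z)))\<^sup>2 \<partial>lborel)"
    using nn_integral_eq_integral[OF iG2] by (simp add: ennreal_power)
  finally show ?thesis by (simp add: P_def)
qed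

end

subsection \<open>The local estimate\<close>

text \<open>\<open>n\<close> is the growth order of \<open>F\<close>, \<open>M\<close> the order of
  the localising weight, and \<open>d\<close> is enough decay for integrability and for summation
  over \<open>L\<close>. With \<open>M \<ge> n + d\<close> the weighted \<open>F\<close> is square
  integrable, and decay of order \<open>M + d\<close> leaves \<open>kap d\<close> once the weight
  has been moved across the kernel. The lattice is present only through countability,
  \<open>L_sum\<close> and the bounds for the periodization.\<close>

locale core_estimate = rep_kernel k for k :: "'a::euclidean_space \<Rightarrow> 'a \<Rightarrow> complex" +
  fixes F :: "'a \<Rightarrow> complex" and \<sigma> :: "'a \<Rightarrow> real" and L :: "'a set"
    and A B C0 Ck Kl :: real and n M d :: nat
  assumes d_def: "d = DIM('a) + 2"
    and F_measurable [measurable]: "F \<in> borel_measurable borel"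
    and F_growth: "\<And>z. cmod (F z) \<le> C0 * (1 + norm z) ^ n"
    and F_rep: "\<And>z. (\<integral>w. k z w * F w \<partial>lborel) = F z"
    and \<sigma>_measurable [measurable]: "\<sigma> \<in> borel_measurable borel"
    and \<sigma>_nonneg: "\<And>z. 0 \<le> \<sigma> z"
    and \<sigma>_int: "(\<integral>\<^sup>+z. ennreal (\<sigma> z) \<partial>lborel) < \<infinity>"
    and L_countable: "countable L"
    and Kl_pos: "Kl > 0"
    and L_sum: "\<And>x. (\<integral>\<^sup>+l. ennreal (kap d (x - l)) \<partial>count_space L) \<le> ennreal Kl"
    and A_pos: "0 < A" and A_le_B: "A \<le> B"
    and S_bounds: "AE z in lborel. ennreal A \<le> (\<integral>\<^sup>+l. ennreal (\<sigma> (z - l)) \<partial>count_space L)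
        \<and> (\<integral>\<^sup>+l. ennreal (\<sigma> (z - l)) \<partial>count_space L) \<le> ennreal B"
    and M_ge: "M \<ge> n + d"
    and Ck_pos: "Ck > 0"
    and k_bound: "\<And>z w. cmod (k z w) \<le> Ck * kap (M + d) (z - w)"
begin

definition S :: "'a \<Rightarrow> ennreal" where
  "S v = (\<integral>\<^sup>+l. ennreal (\<sigma> (v - l)) \<partial>count_space L)"

text \<open>The complement is a null set. \<open>Sb\<close> and \<open>T\<close> are set to 0 there
  so that their bounds hold at every point.\<close>

definition good :: "'a \<Rightarrow> bool" where
  "good v \<longleftrightarrow> ennreal A \<le> S v \<and> S v \<le> ennreal B"

text \<open>For this constant the two extreme deviations \<open>1 - c * A\<close> and
  \<open>c * B - 1\<close> coincide; both are \<gamma>.\<close>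

definition c :: real where "c = 2 / (A + B)"

definition Sb :: "'a \<Rightarrow> real" where
  "Sb v = (if good v then enn2real (S v) else 0)"

definition T :: "'a \<Rightarrow> real" where
  "T v = (if good v then 1 - c * Sb v else 0)"

definition \<gamma> :: real where "\<gamma> = (B - A) / (A + B)"

text \<open>The tail of the periodization. It is bounded by \<open>B\<close> almost everywhere, but
  becomes uniformly small only after averaging, see \<open>R_conv\<close>.\<close>

definition R :: "real \<Rightarrow> 'a \<Rightarrow> ennreal" where
  "R r v = (\<integral>\<^sup>+l. ennreal (\<sigma> (v - l) * indicator {y. r < norm y} (v - l)) \<partial>count_space L)"

text \<open>A real-valued version that agrees with \<open>R\<close> at good points and, thanks to
  the default 0, stays below \<open>R\<close> everywhere.\<close>

definition Rb :: "real \<Rightarrow> 'a \<Rightarrow> real" where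
  "Rb r v = (if R r v \<le> ennreal B then enn2real (R r v) else 0)"

text \<open>Localises at \<open>a\<close>, where it equals 1, on the length scale
  1/\<epsilon>.\<close>

definition u :: "real \<Rightarrow> 'a \<Rightarrow> 'a \<Rightarrow> real" where
  "u \<epsilon> a z = kap M (\<epsilon> *\<^sub>R (z - a))"

definition H :: "real \<Rightarrow> 'a \<Rightarrow> 'a \<Rightarrow> real" where
  "H \<epsilon> a z = cmod (F z) * u \<epsilon> a z"

text \<open>The projection of the part of \<open>S F\<close> carried by the translate of \<sigma> to
  \<open>l\<close>. For the concrete kernel it is the localization operator tested against an atom,
  divided by the squared norm of the window.\<close>

definition g :: "'a \<Rightarrow> 'a \<Rightarrow> complex" where
  "g l w = (\<integral>v. complex_of_real (\<sigma> (v - l)) * F v * k w v \<partial>lborel)"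

text \<open>The ball moves with \<open>z\<close>, so this is not the projection of one truncated
  symbol: the projection formula is evaluated at \<open>z\<close> for a symbol that itself depends
  on \<open>z\<close>.\<close>

definition X :: "real \<Rightarrow> 'a \<Rightarrow> complex" where
  "X r z = (\<Sum>l\<in>L \<inter> cball z (2 * r). g l z)"

definition J :: real where "J = (\<integral>x. kap d (x::'a) \<partial>lborel)"

lemma S_measurable [measurable]: "S \<in> borel_measurable borel"
  unfolding S_def by (rule nn_integral_count_space_lborel_measurable[OF L_countable]) measurable

lemma R_measurable [measurable]: "R r \<in> borel_measurable borel"
  unfolding R_def by (rule nn_integral_count_space_lborel_measurable[OF L_countable]) measurable

lemma good_measurable [measurable]: "Measurable.pred borel good"
  unfolding good_def by measurable

lemma Sb_measurable [measurable]: "Sb \<in> borel_measurable borel"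
  unfolding Sb_def by measurable

lemma T_measurable [measurable]: "T \<in> borel_measurable borel"
  unfolding T_def by measurable

lemma Rb_measurable [measurable]: "Rb r \<in> borel_measurable borel"
  unfolding Rb_def by measurable

lemma u_measurable [measurable]: "u \<epsilon> a \<in> borel_measurable borel"
  unfolding u_def by measurable

lemma H_measurable [measurable]: "H \<epsilon> a \<in> borel_measurable borel"
  unfolding H_def by measurable

lemma B_pos: "0 < B" using A_pos A_le_B by simp

lemma c_pos: "0 < c" using A_pos B_pos by (simp add: c_def)

lemma \<gamma>_range: "0 \<le> \<gamma>" "\<gamma> < 1" "\<gamma> \<le> 1"
  using A_pos A_le_B by (auto simp: \<gamma>_def divide_simps)

lemma J_nonneg: "0 \<le> J" unfolding J_def by (rule integral_nonneg_AE) simp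

lemma C0_nonneg: "0 \<le> C0"
  using order_trans[OF norm_ge_zero F_growth[of 0]] by simp

lemma good_AE: "AE v in lborel. good v"
  using S_bounds by (simp add: good_def S_def)

lemma Sb_eq: "good v \<Longrightarrow> ennreal (Sb v) = S v"
  unfolding Sb_def good_def by (auto simp: ennreal_enn2real_if top_unique)

lemma Sb_bounds: "0 \<le> Sb v" "Sb v \<le> B"
proof -
  show "0 \<le> Sb v" by (simp add: Sb_def)
  show "Sb v \<le> B"
  proof (cases "good v")
    case True
    then have "ennreal (Sb v) \<le> ennreal B" by (simp add: Sb_eq) (simp add: good_def)
    then show ?thesis using B_pos by simp
  next
    case False then show ?thesis using B_pos by (simp add: Sb_def)
  qed
qed

lemma T_abs: "\<bar>T v\<bar> \<le> \<gamma>"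
proof (cases "good v")
  case True
  then have "ennreal A \<le> ennreal (Sb v)" by (simp add: Sb_eq) (simp add: good_def)
  then have s: "A \<le> Sb v" "Sb v \<le> B" using Sb_bounds A_pos by (auto simp: ennreal_le_iff)
  have "c * A \<le> c * Sb v" "c * Sb v \<le> c * B" using s c_pos by (auto intro: mult_left_mono)
  moreover have "1 - c * A = \<gamma>" "c * B - 1 = \<gamma>"
    using A_pos B_pos by (auto simp: c_def \<gamma>_def field_simps)
  ultimately show ?thesis using True by (simp add: T_def abs_le_iff)
next
  case False then show ?thesis using \<gamma>_range by (simp add: T_def)
qed

lemma R_le_S: "R r v \<le> S v"
  unfolding R_def S_def by (intro nn_integral_mono ennreal_leI) (auto simp: indicator_def \<sigma>_nonneg)

lemma Rb_bounds: "0 \<le> Rb r v" "Rb r v \<le> B" "ennreal (Rb r v) \<le> R r v"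
proof -
  show "0 \<le> Rb r v" by (simp add: Rb_def)
  show "ennreal (Rb r v) \<le> R r v"
    by (auto simp: Rb_def ennreal_enn2real_if)
  show "Rb r v \<le> B"
  proof (cases "R r v \<le> ennreal B")
    case True
    then have "ennreal (Rb r v) \<le> ennreal B" by (auto simp: Rb_def ennreal_enn2real_if)
    then show ?thesis using B_pos by simp
  next
    case False then show ?thesis using B_pos by (simp add: Rb_def)
  qed
qed

lemma Rb_eq: "good v \<Longrightarrow> ennreal (Rb r v) = R r v"
  using R_le_S[of r v] unfolding good_def Rb_def
  by (auto simp: ennreal_enn2real_if top_unique dest: order_trans)

text \<open>On the ball the kernel is at least (1 + |\<rho>|)^(-d), so \<open>L_sum\<close> bounds
  the number of points.\<close>

lemma finite_ball: "finite (L \<inter> cball z \<rho>)"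
proof -
  have "emeasure (count_space L) (L \<inter> cball z \<rho>) = (\<integral>\<^sup>+l. indicator (L \<inter> cball z \<rho>) l \<partial>count_space L)"
    by (rule nn_integral_indicator[symmetric]) auto
  also have "\<dots> \<le> (\<integral>\<^sup>+l. ennreal ((1 + \<bar>\<rho>\<bar>) ^ d) * ennreal (kap d (z - l)) \<partial>count_space L)"
  proof (intro nn_integral_mono)
    fix l assume "l \<in> space (count_space L)"
    show "indicator (L \<inter> cball z \<rho>) l \<le> ennreal ((1 + \<bar>\<rho>\<bar>) ^ d) * ennreal (kap d (z - l))"
    proof (cases "l \<in> cball z \<rho>")
      case True
      then have "(1 + norm (z - l)) ^ d \<le> (1 + \<bar>\<rho>\<bar>) ^ d"
        by (intro power_mono) (auto simp: dist_norm)
      then have "1 \<le> (1 + \<bar>\<rho>\<bar>) ^ d * kap d (z - l)" by (simp add: kap_def)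
      then have "1 \<le> ennreal ((1 + \<bar>\<rho>\<bar>) ^ d * kap d (z - l))" by simp
      then show ?thesis by (auto simp: indicator_def ennreal_mult)
    qed (auto simp: indicator_def)
  qed
  also have "\<dots> = ennreal ((1 + \<bar>\<rho>\<bar>) ^ d) * (\<integral>\<^sup>+l. ennreal (kap d (z - l)) \<partial>count_space L)"
    by (rule nn_integral_cmult) simp
  also have "\<dots> \<le> ennreal ((1 + \<bar>\<rho>\<bar>) ^ d) * ennreal Kl"
    by (rule mult_left_mono[OF L_sum]) simp
  also have "\<dots> < \<infinity>" by (simp add: ennreal_mult_less_top)
  finally show ?thesis by (subst (asm) emeasure_count_space) (auto split: if_splits)
qed

text \<open>Peetre's inequality turns the growth of \<open>F\<close> at \<open>v\<close> into growth
  at \<open>z\<close> times a power of the displacement; \<open>n\<close> of the available powers of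
  kernel decay absorb the latter.\<close>

lemma kF_bound: "cmod (k z v * F v) \<le> (Ck * C0 * (1 + norm z) ^ n) * kap d (z - v)"
proof -
  have "(1 + norm v) ^ n \<le> (1 + norm z) ^ n * (1 + norm (z - v)) ^ n"
    using norm1_triangle_pow[of z "v - z" n] by (simp add: norm_minus_commute)
  then have F: "cmod (F v) \<le> C0 * ((1 + norm z) ^ n * (1 + norm (z - v)) ^ n)"
    using F_growth[of v] C0_nonneg mult_left_mono order_trans by blast
  have "kap (M + d) (z - v) * (1 + norm (z - v)) ^ n \<le> kap (n + d) (z - v) * (1 + norm (z - v)) ^ n"
    using M_ge by (intro mult_right_mono kap_mono) auto
  also have "\<dots> = kap d (z - v)" by (simp add: kap_add)
  finally have k1: "kap (M + d) (z - v) * (1 + norm (z - v)) ^ n \<le> kap d (z - v)" .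
  have "cmod (k z v * F v) \<le> (Ck * kap (M + d) (z - v)) * (C0 * ((1 + norm z) ^ n * (1 + norm (z - v)) ^ n))"
    unfolding norm_mult using Ck_pos by (intro mult_mono k_bound F) auto
  also have "\<dots> = (Ck * C0 * (1 + norm z) ^ n) * (kap (M + d) (z - v) * (1 + norm (z - v)) ^ n)"
    by (simp add: mult_ac)
  also have "\<dots> \<le> (Ck * C0 * (1 + norm z) ^ n) * kap d (z - v)"
    using k1 Ck_pos C0_nonneg by (intro mult_left_mono) auto
  finally show ?thesis .
qed

lemma integrable_kF:
  assumes [measurable]: "h \<in> borel_measurable borel" and h: "AE v in lborel. \<bar>h v\<bar> \<le> b"
  shows "integrable lborel (\<lambda>v. k z v * F v * complex_of_real (h v))"
proof (rule Bochner_Integration.integrable_bound)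
  have "integrable lborel (\<lambda>v. kap d (z - v))"
    using integrable_lborel_minus[of "kap d" z] integrable_kap[where 'a='a, of d] by (simp add: d_def)
  then show "integrable lborel (\<lambda>v. (Ck * C0 * (1 + norm z) ^ n) * kap d (z - v) * b)"
    by (intro integrable_mult_left integrable_mult_right)
  show "AE v in lborel. norm (k z v * F v * complex_of_real (h v)) \<le> norm ((Ck * C0 * (1 + norm z) ^ n) * kap d (z - v) * b)"
    using h
  proof eventually_elim
    case (elim v)
    then have "b \<ge> 0" by linarith
    have "cmod (k z v * F v) * \<bar>h v\<bar> \<le> (Ck * C0 * (1 + norm z) ^ n) * kap d (z - v) * b"
      using elim kF_bound Ck_pos C0_nonneg by (intro mult_mono) auto
    also have "\<dots> \<le> norm \<dots>" by simp
    finally show ?case by (simp add: norm_mult)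
  qed
qed measurable

text \<open>Almost everywhere 1 = T + c S. In the second summand \<open>S\<close> is replaced by the
  finite sum \<open>q\<close> over the lattice points within \<open>2 * r\<close> of
  \<open>z\<close>, whose projection at \<open>z\<close> is \<open>X r z\<close>. The error
  \<open>S - q\<close> is at most \<open>B\<close> in any case, and at most the tail
  \<open>R r v\<close> when \<open>v\<close> lies within \<open>r\<close> of \<open>z\<close>; the
  middle term of the bound records both cases.\<close>

lemma F_decomp:
  assumes r: "r \<ge> 0"
  shows "ennreal (cmod (F z)) \<le> ennreal (cmod (\<integral>v. k z v * (T v * F v) \<partial>lborel))
     + (ennreal c * (\<integral>\<^sup>+v. ennreal (cmod (k z v) * cmod (F v) * (B * indicator {y. r < norm y} (z - v) + Rb r v)) \<partial>lborel)
     + ennreal c * ennreal (cmod (X r z)))"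
proof -
  define q where "q = (\<lambda>v. \<Sum>l\<in>L \<inter> cball z (2 * r). \<sigma> (v - l))"
  have [measurable]: "q \<in> borel_measurable borel" unfolding q_def by measurable
  define tl where "tl = (\<lambda>v. \<integral>\<^sup>+l. ennreal (\<sigma> (v - l)) * indicator (- cball z (2 * r)) l \<partial>count_space L)"
  have q0: "q v \<ge> 0" for v unfolding q_def by (intro sum_nonneg) (simp add: \<sigma>_nonneg)
  have split: "S v = ennreal (q v) + tl v" for v
  proof -
    have "S v = (\<integral>\<^sup>+l. ennreal (\<sigma> (v - l)) * indicator (cball z (2 * r)) l + ennreal (\<sigma> (v - l)) * indicator (- cball z (2 * r)) l \<partial>count_space L)"
      unfolding S_def by (intro nn_integral_cong) (auto simp: indicator_def)
    also have "\<dots> = (\<integral>\<^sup>+l. ennreal (\<sigma> (v - l)) * indicator (cball z (2 * r)) l \<partial>count_space L) + tl v"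
      unfolding tl_def by (rule nn_integral_add) auto
    also have "(\<integral>\<^sup>+l. ennreal (\<sigma> (v - l)) * indicator (cball z (2 * r)) l \<partial>count_space L)
        = (\<Sum>l\<in>L \<inter> cball z (2 * r). ennreal (\<sigma> (v - l)) * indicator (cball z (2 * r)) l)"
      by (rule nn_integral_count_space') (use finite_ball in \<open>auto simp: indicator_def\<close>)
    also have "\<dots> = ennreal (q v)"
      unfolding q_def by (subst sum_ennreal[symmetric]) (auto simp: \<sigma>_nonneg intro!: sum.cong)
    finally show ?thesis .
  qed
  \<comment> \<open>If \<open>v\<close> is within \<open>r\<close> of \<open>z\<close> and
    \<open>l\<close> is not within \<open>2 * r\<close> of \<open>z\<close>, then \<open>l\<close>
    is further than \<open>r\<close> from \<open>v\<close>. This is why the ball in \<open>X\<close>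
    has twice the radius.\<close>
  have tl_R: "tl v \<le> R r v" if "norm (z - v) \<le> r" for v
    unfolding tl_def R_def
  proof (intro nn_integral_mono)
    fix l
    have "r < norm (v - l)" if "l \<notin> cball z (2 * r)"
      using that norm_triangle_ineq[of "z - v" "v - l"] \<open>norm (z - v) \<le> r\<close> by (simp add: dist_norm)
    then show "ennreal (\<sigma> (v - l)) * indicator (- cball z (2 * r)) l \<le> ennreal (\<sigma> (v - l) * indicator {y. r < norm y} (v - l))"
      by (auto simp: indicator_def)
  qed
  have dist: "\<bar>Sb v - q v\<bar> \<le> B * indicator {y. r < norm y} (z - v) + Rb r v" if "good v" for v
  proof -
    have le: "ennreal (q v) \<le> ennreal (Sb v)" using Sb_eq[OF that] split by simp
    then have qS: "q v \<le> Sb v" using Sb_bounds by (simp add: ennreal_le_iff)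
    show ?thesis
    proof (cases "norm (z - v) \<le> r")
      case True
      have "ennreal (Sb v) \<le> ennreal (q v) + ennreal (Rb r v)"
        unfolding Sb_eq[OF that] Rb_eq[OF that] split[of v] by (intro add_left_mono tl_R True)
      then have "Sb v \<le> q v + Rb r v"
        using q0[of v] Rb_bounds[of r v] by (simp add: ennreal_plus[symmetric] ennreal_le_iff del: ennreal_plus)
      then show ?thesis using qS True by (simp add: indicator_def)
    next
      case False
      then show ?thesis using qS Sb_bounds[of v] q0[of v] Rb_bounds(1)[of r v] by (simp add: indicator_def)
    qed
  qed
  have q_AE: "AE v in lborel. \<bar>q v\<bar> \<le> B"
    using good_AE
  proof eventually_elim
    case (elim v)
    have "ennreal (q v) \<le> ennreal B" using elim split[of v] unfolding good_def
      by (metis add.commute le_iff_add order_trans zero_le add_increasing2 order_refl)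
    then show ?case using q0[of v] B_pos by simp
  qed
  have g_int: "integrable lborel (\<lambda>v. k z v * F v * complex_of_real (\<sigma> (v - l)))" if "l \<in> L \<inter> cball z (2 * r)" for l
  proof (rule integrable_kF)
    show "AE v in lborel. \<bar>\<sigma> (v - l)\<bar> \<le> B"
      using q_AE
    proof eventually_elim
      case (elim v)
      have "\<sigma> (v - l) \<le> q v" unfolding q_def
        by (rule member_le_sum) (use that finite_ball \<sigma>_nonneg in auto)
      then show ?case using elim \<sigma>_nonneg[of "v - l"] by simp
    qed
  qed measurable
  have Xeq: "X r z = (\<integral>v. k z v * F v * complex_of_real (q v) \<partial>lborel)"
  proof -
    have "X r z = (\<Sum>l\<in>L \<inter> cball z (2 * r). \<integral>v. k z v * F v * complex_of_real (\<sigma> (v - l)) \<partial>lborel)"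
      unfolding X_def g_def by (simp add: mult_ac)
    also have "\<dots> = (\<integral>v. (\<Sum>l\<in>L \<inter> cball z (2 * r). k z v * F v * complex_of_real (\<sigma> (v - l))) \<partial>lborel)"
      using g_int by (subst Bochner_Integration.integral_sum) auto
    finally show ?thesis by (simp add: q_def sum_distrib_left)
  qed
  define Y where "Y = (\<integral>v. k z v * F v * complex_of_real (Sb v) \<partial>lborel)"
  have iT: "integrable lborel (\<lambda>v. k z v * F v * complex_of_real (T v))"
    by (rule integrable_kF[where b=\<gamma>]) (use T_abs in auto)
  have iS: "integrable lborel (\<lambda>v. k z v * F v * complex_of_real (Sb v))"
    by (rule integrable_kF[where b=B]) (use Sb_bounds in auto)
  have iq: "integrable lborel (\<lambda>v. k z v * F v * complex_of_real (q v))"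
    by (rule integrable_kF[OF _ q_AE]) auto
  have "F z = (\<integral>v. k z v * F v * complex_of_real (T v) + c * (k z v * F v * complex_of_real (Sb v)) \<partial>lborel)"
  proof (subst F_rep[symmetric], rule integral_cong_AE)
    show "AE v in lborel. k z v * F v = k z v * F v * complex_of_real (T v) + c * (k z v * F v * complex_of_real (Sb v))"
      using good_AE by eventually_elim (simp add: T_def algebra_simps)
  qed measurable
  also have "\<dots> = (\<integral>v. k z v * F v * complex_of_real (T v) \<partial>lborel) + c * Y"
    using iT iS by (simp add: Y_def)
  finally have Fz: "F z = (\<integral>v. k z v * F v * complex_of_real (T v) \<partial>lborel) + (c * (Y - X r z) + c * X r z)"
    by (simp add: algebra_simps)
  have YX: "ennreal (cmod (Y - X r z)) \<le> (\<integral>\<^sup>+v. ennreal (cmod (k z v) * cmod (F v) * (B * indicator {y. r < norm y} (z - v) + Rb r v)) \<partial>lborel)"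
  proof -
    have YX_eq: "Y - X r z = (\<integral>v. k z v * F v * complex_of_real (Sb v) - k z v * F v * complex_of_real (q v) \<partial>lborel)"
      using iS iq by (simp add: Y_def Xeq)
    have "ennreal (cmod (Y - X r z)) \<le> (\<integral>\<^sup>+v. ennreal (cmod (k z v * F v * complex_of_real (Sb v) - k z v * F v * complex_of_real (q v))) \<partial>lborel)"
      unfolding YX_eq by (rule norm_integral_le_nn_integral)
    also have "\<dots> \<le> (\<integral>\<^sup>+v. ennreal (cmod (k z v) * cmod (F v) * (B * indicator {y. r < norm y} (z - v) + Rb r v)) \<partial>lborel)"
    proof (rule nn_integral_mono_AE, use good_AE in eventually_elim)
      case (elim v)
      have "cmod (k z v * F v * complex_of_real (Sb v) - k z v * F v * complex_of_real (q v)) = cmod (k z v) * cmod (F v) * \<bar>Sb v - q v\<bar>"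
        by (simp only: right_diff_distrib[symmetric] of_real_diff[symmetric] norm_mult norm_of_real mult.assoc)
      also have "\<dots> \<le> cmod (k z v) * cmod (F v) * (B * indicator {y. r < norm y} (z - v) + Rb r v)"
        using dist[OF elim] by (intro mult_left_mono) auto
      finally show ?case by (rule ennreal_leI)
    qed
    finally show ?thesis .
  qed
  have "cmod (F z) \<le> cmod (\<integral>v. k z v * F v * complex_of_real (T v) \<partial>lborel) + (c * cmod (Y - X r z) + c * cmod (X r z))"
    apply (subst Fz)
    apply (rule order_trans[OF norm_triangle_ineq] add_left_mono)+
    using c_pos by (simp add: norm_mult)
  then have "ennreal (cmod (F z)) \<le> ennreal (cmod (\<integral>v. k z v * F v * complex_of_real (T v) \<partial>lborel)) + (ennreal c * ennreal (cmod (Y - X r z)) + ennreal c * ennreal (cmod (X r z)))"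
    using c_pos by (simp add: ennreal_mult'[symmetric] ennreal_plus[symmetric] ennreal_leI del: ennreal_plus)
  also have "\<dots> \<le> ennreal (cmod (\<integral>v. k z v * F v * complex_of_real (T v) \<partial>lborel)) + (ennreal c * (\<integral>\<^sup>+v. ennreal (cmod (k z v) * cmod (F v) * (B * indicator {y. r < norm y} (z - v) + Rb r v)) \<partial>lborel) + ennreal c * ennreal (cmod (X r z)))"
    by (intro add_left_mono add_right_mono mult_left_mono YX) simp
  finally show ?thesis by (simp add: mult_ac)
qed

end

lemma kap_mult_le_imp:
  assumes "kap k x * kap k y \<le> c"
  shows "kap k x \<le> c * (1 + norm y) ^ k"
proof -
  have "kap k x = kap k x * kap k y * (1 + norm y) ^ k" by (simp add: mult.assoc)
  also have "\<dots> \<le> c * (1 + norm y) ^ k" by (rule mult_right_mono[OF assms]) simp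
  finally show ?thesis .
qed

section \<open>Weights and the terms of the decomposition\<close>

context core_estimate
begin

lemma u_bounds: "0 < u \<epsilon> a z" "0 \<le> u \<epsilon> a z" "u \<epsilon> a z \<le> 1"
  by (simp_all add: u_def)

lemma H_nonneg [simp]: "0 \<le> H \<epsilon> a z"
  by (simp add: H_def u_def)

text \<open>\<open>kap_triangle\<close> after scaling. Keeping \<epsilon> in the factor matters: for
  a fixed displacement it tends to 1 as \<epsilon> tends to 0, which \<open>u_diff\<close>
  exploits.\<close>

lemma u_ratio:
  "u \<epsilon> a z \<le> u \<epsilon> a v * (1 + \<bar>\<epsilon>\<bar> * norm (z - v)) ^ M"
proof -
  have "kap M (\<epsilon> *\<^sub>R (z - a)) * kap M (\<epsilon> *\<^sub>R (v - z)) \<le> kap M (\<epsilon> *\<^sub>R (z - a) + \<epsilon> *\<^sub>R (v - z))"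
    by (rule kap_triangle)
  also have "\<epsilon> *\<^sub>R (z - a) + \<epsilon> *\<^sub>R (v - z) = \<epsilon> *\<^sub>R (v - a)" by (simp add: scaleR_right_diff_distrib)
  finally have "kap M (\<epsilon> *\<^sub>R (z - a)) \<le> kap M (\<epsilon> *\<^sub>R (v - a)) * (1 + norm (\<epsilon> *\<^sub>R (v - z))) ^ M"
    by (rule kap_mult_le_imp)
  then show ?thesis by (simp add: u_def norm_minus_commute)
qed

lemma u_ratio1:
  assumes "\<bar>\<epsilon>\<bar> \<le> 1"
  shows "u \<epsilon> a z \<le> u \<epsilon> a v * (1 + norm (z - v)) ^ M"
proof -
  have "(1 + \<bar>\<epsilon>\<bar> * norm (z - v)) ^ M \<le> (1 + norm (z - v)) ^ M"
    using mult_right_mono[OF assms norm_ge_zero[of "z - v"]] by (intro power_mono) auto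
  then have "u \<epsilon> a v * (1 + \<bar>\<epsilon>\<bar> * norm (z - v)) ^ M \<le> u \<epsilon> a v * (1 + norm (z - v)) ^ M"
    by (rule mult_left_mono) (rule u_bounds)
  then show ?thesis using u_ratio[of \<epsilon> a z v] by linarith
qed

text \<open>The ratio bound is used in both directions. The right side is relative to the weight at
  \<open>v\<close> and vanishes with \<epsilon>, so it controls the commutator of the weight with
  the projection.\<close>

lemma u_diff:
  "\<bar>u \<epsilon> a z - u \<epsilon> a v\<bar> \<le> u \<epsilon> a v * ((1 + \<bar>\<epsilon>\<bar> * norm (z - v)) ^ M - 1)"
proof -
  define q where "q = (1 + \<bar>\<epsilon>\<bar> * norm (z - v)) ^ M"
  have q: "q \<ge> 1" unfolding q_def by (rule one_le_power) simp
  have 1: "u \<epsilon> a z \<le> u \<epsilon> a v * q" unfolding q_def by (rule u_ratio)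
  have 2: "u \<epsilon> a v \<le> u \<epsilon> a z * q" unfolding q_def using u_ratio[of \<epsilon> a v z] by (simp add: norm_minus_commute)
  have "u \<epsilon> a v - u \<epsilon> a z \<le> u \<epsilon> a v * (q - 1)"
  proof (cases "u \<epsilon> a v \<le> u \<epsilon> a z")
    case True
    then have "u \<epsilon> a v - u \<epsilon> a z \<le> 0" by simp
    also have "0 \<le> u \<epsilon> a v * (q - 1)" using q u_bounds by simp
    finally show ?thesis .
  next
    case False
    have "u \<epsilon> a z * (q - 1) \<le> u \<epsilon> a v * (q - 1)" using False q by (intro mult_right_mono) auto
    then show ?thesis using 2 by (simp add: algebra_simps)
  qed
  then show ?thesis using 1 unfolding q_def[symmetric] by (simp add: abs_le_iff algebra_simps)
qed

text \<open>Majorant for the kernel of the commutator between the weight \<open>u\<close> and the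
  projection.\<close>

definition \<kappa>1 :: "real \<Rightarrow> 'a \<Rightarrow> real" where
  "\<kappa>1 \<epsilon> y = Ck * kap (M + d) y * ((1 + \<bar>\<epsilon>\<bar> * norm y) ^ M - 1)"

text \<open>Majorant for the weighted kernel beyond distance \<open>r\<close>, multiplied by the
  bound \<open>B\<close> of the periodization.\<close>

definition \<kappa>2 :: "real \<Rightarrow> 'a \<Rightarrow> real" where
  "\<kappa>2 r y = B * (Ck * kap d y * indicator {y. r < norm y} y)"

text \<open>Majorant for the kernel after the weight has been moved from \<open>z\<close> to
  \<open>v\<close>, which spends \<open>M\<close> of its \<open>M + d\<close> powers of
  decay.\<close>

definition \<kappa>3 :: "'a \<Rightarrow> real" where
  "\<kappa>3 y = Ck * kap d y"

lemma \<kappa>_measurable [measurable]: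
  "\<kappa>1 \<epsilon> \<in> borel_measurable borel" "\<kappa>2 r \<in> borel_measurable borel" "\<kappa>3 \<in> borel_measurable borel"
  unfolding \<kappa>1_def[abs_def] \<kappa>2_def[abs_def] \<kappa>3_def[abs_def] by measurable

lemma \<kappa>_nonneg [simp]: "0 \<le> \<kappa>1 \<epsilon> y" "0 \<le> \<kappa>2 r y" "0 \<le> \<kappa>3 y"
  using Ck_pos B_pos by (auto simp: \<kappa>1_def \<kappa>2_def \<kappa>3_def)

lemma integrable_kapd: "integrable lborel (kap d :: 'a \<Rightarrow> real)"
  by (rule integrable_kap) (simp add: d_def)

lemma \<kappa>1_le: "\<bar>\<epsilon>\<bar> \<le> 1 \<Longrightarrow> \<kappa>1 \<epsilon> y \<le> \<kappa>3 y"
proof -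
  assume e: "\<bar>\<epsilon>\<bar> \<le> 1"
  have "(1 + \<bar>\<epsilon>\<bar> * norm y) ^ M \<le> (1 + norm y) ^ M"
    using mult_right_mono[OF e norm_ge_zero[of y]] by (intro power_mono) auto
  then have "kap (M + d) y * ((1 + \<bar>\<epsilon>\<bar> * norm y) ^ M - 1) \<le> kap (M + d) y * (1 + norm y) ^ M"
    by (intro mult_left_mono) auto
  also have "\<dots> = kap d y" by (simp add: kap_add mult.commute)
  finally show ?thesis using Ck_pos unfolding \<kappa>1_def \<kappa>3_def by (simp add: mult.assoc)
qed

lemma integrable_\<kappa>3: "integrable lborel \<kappa>3"
  unfolding \<kappa>3_def[abs_def] using integrable_kapd by simp

lemma integrable_\<kappa>2: "integrable lborel (\<kappa>2 r)"
  by (rule Bochner_Integration.integrable_bound[OF integrable_mult_right[OF integrable_\<kappa>3, of B]])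
     (use B_pos Ck_pos in \<open>auto simp: \<kappa>2_def \<kappa>3_def indicator_def\<close>)

lemma integrable_\<kappa>1: "\<bar>\<epsilon>\<bar> \<le> 1 \<Longrightarrow> integrable lborel (\<kappa>1 \<epsilon>)"
  by (rule Bochner_Integration.integrable_bound[OF integrable_\<kappa>3]) (use \<kappa>1_le in auto)

lemma k_le_\<kappa>3:
  assumes "\<bar>\<epsilon>\<bar> \<le> 1"
  shows "u \<epsilon> a z * cmod (k z v) \<le> \<kappa>3 (z - v) * u \<epsilon> a v"
proof -
  have "u \<epsilon> a z * cmod (k z v) \<le> (u \<epsilon> a v * (1 + norm (z - v)) ^ M) * (Ck * kap (M + d) (z - v))"
    using u_bounds by (intro mult_mono k_bound u_ratio1 assms) (auto intro: mult_nonneg_nonneg less_imp_le)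
  also have "\<dots> = \<kappa>3 (z - v) * u \<epsilon> a v" by (simp add: \<kappa>3_def kap_add)
  finally show ?thesis .
qed

definition G :: "real \<Rightarrow> 'a \<Rightarrow> 'a \<Rightarrow> complex" where
  "G \<epsilon> a v = complex_of_real (u \<epsilon> a v * T v) * F v"

lemma G_measurable [measurable]: "G \<epsilon> a \<in> borel_measurable borel"
  unfolding G_def by measurable

lemma G_le_H: "cmod (G \<epsilon> a v) \<le> \<gamma> * H \<epsilon> a v"
proof -
  have "\<bar>T v\<bar> * (u \<epsilon> a v * cmod (F v)) \<le> \<gamma> * (u \<epsilon> a v * cmod (F v))"
    using u_bounds by (intro mult_right_mono T_abs) auto
  then show ?thesis using u_bounds[of \<epsilon> a v] by (simp add: G_def H_def norm_mult abs_mult mult_ac)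
qed

text \<open>The constant depends on \<epsilon> and \<open>a\<close> and is not uniform; it only
  serves to show that weighted norms are finite and that \<open>projection_contraction\<close>
  applies. Of the \<open>M\<close> powers of decay of the weight, \<open>n\<close> cancel the growth
  of \<open>F\<close> and at least \<open>d\<close> remain.\<close>

lemma H_decay:
  assumes "\<epsilon> \<noteq> 0"
  obtains K where "K \<ge> 0" "\<And>z. H \<epsilon> a z \<le> K * kap d z"
proof
  define m where "m = min 1 \<bar>\<epsilon>\<bar>"
  have m: "0 < m" "m \<le> 1" "m \<le> \<bar>\<epsilon>\<bar>" using assms by (auto simp: m_def)
  have u: "u \<epsilon> a z \<le> (1 + norm a) ^ M / m ^ M * kap M z" for z
  proof -
    have "m * (1 + norm (z - a)) \<le> 1 + norm (\<epsilon> *\<^sub>R (z - a))"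
      using m mult_right_mono[OF m(3) norm_ge_zero[of "z - a"]] by (simp add: distrib_left)
    then have "(m * (1 + norm (z - a))) ^ M \<le> (1 + norm (\<epsilon> *\<^sub>R (z - a))) ^ M"
      using m by (intro power_mono) auto
    then have 1: "u \<epsilon> a z \<le> kap M (z - a) / m ^ M"
      using m by (simp add: u_def kap_def power_mult_distrib frac_le divide_divide_eq_left mult.commute)
    have "kap M (z - a) * kap M a \<le> kap M z" using kap_triangle[of M "z - a" a] by simp
    then have "kap M (z - a) \<le> (1 + norm a) ^ M * kap M z" using kap_mult_le_imp by (subst mult.commute) blast
    then have "kap M (z - a) / m ^ M \<le> (1 + norm a) ^ M * kap M z / m ^ M"
      using m by (intro divide_right_mono) auto
    then show ?thesis using 1 by simp
  qed
  define K where "K = C0 * ((1 + norm a) ^ M / m ^ M)"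
  show "K \<ge> 0" using C0_nonneg m by (simp add: K_def)
  show "H \<epsilon> a z \<le> K * kap d z" for z
  proof -
    have "H \<epsilon> a z \<le> (C0 * (1 + norm z) ^ n) * ((1 + norm a) ^ M / m ^ M * kap M z)"
      unfolding H_def using C0_nonneg u_bounds by (intro mult_mono u F_growth) auto
    also have "\<dots> = K * (kap M z * (1 + norm z) ^ n)" by (simp add: K_def)
    also have "\<dots> \<le> K * (kap (n + d) z * (1 + norm z) ^ n)"
      using \<open>K \<ge> 0\<close> M_ge by (intro mult_left_mono mult_right_mono kap_mono) auto
    also have "\<dots> = K * kap d z" by (simp add: kap_add)
    finally show ?thesis .
  qed
qed

lemma nn_integral_conv_le:
  assumes [measurable]: "\<kappa> \<in> borel_measurable borel" and i: "integrable lborel \<kappa>"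
    and nn: "\<And>y. 0 \<le> \<kappa> (y::'a)"
  shows "(\<integral>\<^sup>+z. (\<integral>\<^sup>+v. ennreal (\<kappa> (z - v) * H \<epsilon> a v) \<partial>lborel)\<^sup>2 \<partial>lborel)
     \<le> ennreal (4 * (\<integral>y. \<kappa> y \<partial>lborel)\<^sup>2) * (\<integral>\<^sup>+v. ennreal ((H \<epsilon> a v)\<^sup>2) \<partial>lborel)"
  using nn_integral_eq_integral[OF i] nn by (intro schur_square) (auto intro!: integral_nonneg_AE)

text \<open>Multiplication by \<open>u\<close> and the projection are exchanged. The commutator has
  the kernel \<open>k z v\<close> times the difference of the weights at \<open>z\<close> and
  \<open>v\<close>, which \<open>u_diff\<close> bounds by \<open>\<kappa>1\<close>.\<close>

lemma P_weighted:
  "ennreal (u \<epsilon> a z) * ennreal (cmod (\<integral>v. k z v * (T v * F v) \<partial>lborel))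
   \<le> ennreal (cmod (\<integral>v. k z v * G \<epsilon> a v \<partial>lborel)) + (\<integral>\<^sup>+v. ennreal (\<kappa>1 \<epsilon> (z - v) * H \<epsilon> a v) \<partial>lborel)"
proof -
  define P1 where "P1 = (\<integral>v. k z v * G \<epsilon> a v \<partial>lborel)"
  have iT: "integrable lborel (\<lambda>v. k z v * F v * complex_of_real (T v))"
    by (rule integrable_kF[where b=\<gamma>]) (use T_abs in auto)
  have "\<bar>u \<epsilon> a v * T v\<bar> \<le> \<gamma>" for v
    unfolding abs_mult using mult_mono[OF u_bounds(3)[of \<epsilon> a v] T_abs[of v]] u_bounds(2)[of \<epsilon> a v] by simp
  then have iG: "integrable lborel (\<lambda>v. k z v * F v * complex_of_real (u \<epsilon> a v * T v))"
    by (intro integrable_kF[where b=\<gamma>]) auto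
  have eq: "complex_of_real (u \<epsilon> a z) * (\<integral>v. k z v * (T v * F v) \<partial>lborel) - P1
     = (\<integral>v. complex_of_real (u \<epsilon> a z) * (k z v * F v * complex_of_real (T v)) - k z v * F v * complex_of_real (u \<epsilon> a v * T v) \<partial>lborel)"
    by (subst Bochner_Integration.integral_diff[OF integrable_mult_right[OF iT] iG], subst integral_mult_right_zero)
       (simp add: P1_def G_def mult_ac)
  have "ennreal (cmod (complex_of_real (u \<epsilon> a z) * (\<integral>v. k z v * (T v * F v) \<partial>lborel) - P1))
     \<le> (\<integral>\<^sup>+v. ennreal (cmod (complex_of_real (u \<epsilon> a z) * (k z v * F v * complex_of_real (T v)) - k z v * F v * complex_of_real (u \<epsilon> a v * T v))) \<partial>lborel)"
    unfolding eq by (rule norm_integral_le_nn_integral)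
  also have "\<dots> \<le> (\<integral>\<^sup>+v. ennreal (\<kappa>1 \<epsilon> (z - v) * H \<epsilon> a v) \<partial>lborel)"
  proof (intro nn_integral_mono ennreal_leI)
    fix v
    have "complex_of_real (u \<epsilon> a z) * (k z v * F v * complex_of_real (T v)) - k z v * F v * complex_of_real (u \<epsilon> a v * T v)
      = k z v * F v * complex_of_real (T v) * complex_of_real (u \<epsilon> a z - u \<epsilon> a v)" by (simp add: algebra_simps)
    then have "cmod (complex_of_real (u \<epsilon> a z) * (k z v * F v * complex_of_real (T v)) - k z v * F v * complex_of_real (u \<epsilon> a v * T v))
      = cmod (F v) * (\<bar>T v\<bar> * (cmod (k z v) * \<bar>u \<epsilon> a z - u \<epsilon> a v\<bar>))" by (simp only: norm_mult norm_of_real mult_ac)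
    also have "\<dots> \<le> cmod (F v) * (1 * ((Ck * kap (M + d) (z - v)) * (u \<epsilon> a v * ((1 + \<bar>\<epsilon>\<bar> * norm (z - v)) ^ M - 1))))"
      using T_abs[of v] \<gamma>_range Ck_pos by (intro mult_left_mono mult_mono k_bound u_diff) (auto intro: mult_nonneg_nonneg)
    also have "\<dots> = \<kappa>1 \<epsilon> (z - v) * H \<epsilon> a v" by (simp add: \<kappa>1_def H_def mult_ac)
    finally show "cmod (complex_of_real (u \<epsilon> a z) * (k z v * F v * complex_of_real (T v)) - k z v * F v * complex_of_real (u \<epsilon> a v * T v)) \<le> \<kappa>1 \<epsilon> (z - v) * H \<epsilon> a v" .
  qed
  finally have *: "ennreal (cmod (complex_of_real (u \<epsilon> a z) * (\<integral>v. k z v * (T v * F v) \<partial>lborel) - P1))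
    \<le> (\<integral>\<^sup>+v. ennreal (\<kappa>1 \<epsilon> (z - v) * H \<epsilon> a v) \<partial>lborel)" .
  have "u \<epsilon> a z * cmod (\<integral>v. k z v * (T v * F v) \<partial>lborel) \<le> cmod P1 + cmod (complex_of_real (u \<epsilon> a z) * (\<integral>v. k z v * (T v * F v) \<partial>lborel) - P1)"
    using norm_triangle_sub[of "complex_of_real (u \<epsilon> a z) * (\<integral>v. k z v * (T v * F v) \<partial>lborel)" P1] u_bounds[of \<epsilon> a z]
    by (simp add: norm_mult)
  then have "ennreal (u \<epsilon> a z) * ennreal (cmod (\<integral>v. k z v * (T v * F v) \<partial>lborel))
    \<le> ennreal (cmod P1) + ennreal (cmod (complex_of_real (u \<epsilon> a z) * (\<integral>v. k z v * (T v * F v) \<partial>lborel) - P1))"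
    using u_bounds[of \<epsilon> a z] by (simp add: ennreal_mult'[symmetric] ennreal_plus[symmetric] ennreal_leI del: ennreal_plus)
  also have "\<dots> \<le> ennreal (cmod P1) + (\<integral>\<^sup>+v. ennreal (\<kappa>1 \<epsilon> (z - v) * H \<epsilon> a v) \<partial>lborel)"
    by (rule add_left_mono[OF *])
  finally show ?thesis by (simp add: P1_def)
qed

lemma tail_weighted:
  assumes "\<bar>\<epsilon>\<bar> \<le> 1"
  shows "ennreal (u \<epsilon> a z) * (\<integral>\<^sup>+v. ennreal (cmod (k z v) * cmod (F v) * (B * indicator {y. r < norm y} (z - v) + Rb r v)) \<partial>lborel)
   \<le> (\<integral>\<^sup>+v. ennreal (\<kappa>2 r (z - v) * H \<epsilon> a v) \<partial>lborel) + (\<integral>\<^sup>+v. ennreal (\<kappa>3 (z - v) * (Rb r v * H \<epsilon> a v)) \<partial>lborel)"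
proof -
  have "ennreal (u \<epsilon> a z) * (\<integral>\<^sup>+v. ennreal (cmod (k z v) * cmod (F v) * (B * indicator {y. r < norm y} (z - v) + Rb r v)) \<partial>lborel)
     = (\<integral>\<^sup>+v. ennreal (u \<epsilon> a z) * ennreal (cmod (k z v) * cmod (F v) * (B * indicator {y. r < norm y} (z - v) + Rb r v)) \<partial>lborel)"
    by (rule nn_integral_cmult[symmetric]) measurable
  also have "\<dots> \<le> (\<integral>\<^sup>+v. ennreal (\<kappa>2 r (z - v) * H \<epsilon> a v) + ennreal (\<kappa>3 (z - v) * (Rb r v * H \<epsilon> a v)) \<partial>lborel)"
  proof (intro nn_integral_mono)
    fix v
    have nn: "0 \<le> cmod (F v) * (B * indicator {y. r < norm y} (z - v) + Rb r v)"
      using B_pos Rb_bounds by (auto intro!: mult_nonneg_nonneg add_nonneg_nonneg)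
    have "u \<epsilon> a z * (cmod (k z v) * cmod (F v) * (B * indicator {y. r < norm y} (z - v) + Rb r v))
       \<le> (\<kappa>3 (z - v) * u \<epsilon> a v) * (cmod (F v) * (B * indicator {y. r < norm y} (z - v) + Rb r v))"
      using mult_right_mono[OF k_le_\<kappa>3[OF assms, of a z v] nn] by (simp add: mult_ac)
    also have "\<dots> = \<kappa>2 r (z - v) * H \<epsilon> a v + \<kappa>3 (z - v) * (Rb r v * H \<epsilon> a v)"
      by (simp add: \<kappa>2_def \<kappa>3_def H_def algebra_simps)
    finally show "ennreal (u \<epsilon> a z) * ennreal (cmod (k z v) * cmod (F v) * (B * indicator {y. r < norm y} (z - v) + Rb r v))
       \<le> ennreal (\<kappa>2 r (z - v) * H \<epsilon> a v) + ennreal (\<kappa>3 (z - v) * (Rb r v * H \<epsilon> a v))"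
      using u_bounds[of \<epsilon> a z] Rb_bounds(1)[of r v]
      by (simp add: ennreal_mult'[symmetric] ennreal_plus[symmetric] ennreal_leI del: ennreal_plus)
  qed
  also have "\<dots> = (\<integral>\<^sup>+v. ennreal (\<kappa>2 r (z - v) * H \<epsilon> a v) \<partial>lborel) + (\<integral>\<^sup>+v. ennreal (\<kappa>3 (z - v) * (Rb r v * H \<epsilon> a v)) \<partial>lborel)"
    by (rule nn_integral_add) measurable
  finally show ?thesis .
qed

lemma F_le_conv:
  assumes "\<bar>\<epsilon>\<bar> \<le> 1"
  shows "ennreal (H \<epsilon> a z) \<le> (\<integral>\<^sup>+v. ennreal (\<kappa>3 (z - v) * H \<epsilon> a v) \<partial>lborel)"
proof -
  have "ennreal (cmod (F z)) \<le> (\<integral>\<^sup>+v. ennreal (cmod (k z v * F v)) \<partial>lborel)"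
    by (subst F_rep[symmetric]) (rule norm_integral_le_nn_integral)
  then have "ennreal (u \<epsilon> a z) * ennreal (cmod (F z)) \<le> ennreal (u \<epsilon> a z) * (\<integral>\<^sup>+v. ennreal (cmod (k z v * F v)) \<partial>lborel)"
    by (rule mult_left_mono) simp
  also have "\<dots> = (\<integral>\<^sup>+v. ennreal (u \<epsilon> a z) * ennreal (cmod (k z v * F v)) \<partial>lborel)"
    by (rule nn_integral_cmult[symmetric]) measurable
  also have "\<dots> \<le> (\<integral>\<^sup>+v. ennreal (\<kappa>3 (z - v) * H \<epsilon> a v) \<partial>lborel)"
  proof (intro nn_integral_mono)
    fix v
    have "u \<epsilon> a z * cmod (k z v * F v) \<le> \<kappa>3 (z - v) * H \<epsilon> a v"
      using mult_right_mono[OF k_le_\<kappa>3[OF assms, of a z v], of "cmod (F v)"]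
      by (simp add: H_def norm_mult mult_ac)
    then show "ennreal (u \<epsilon> a z) * ennreal (cmod (k z v * F v)) \<le> ennreal (\<kappa>3 (z - v) * H \<epsilon> a v)"
      using u_bounds[of \<epsilon> a z] by (simp add: ennreal_mult'[symmetric] ennreal_leI)
  qed
  finally show ?thesis using u_bounds[of \<epsilon> a z] by (simp add: H_def ennreal_mult'[symmetric] mult.commute)
qed

text \<open>The reproducing formula acts like a mean value property: the square at a point is
  bounded by a local average of squares. This smears the tail \<open>R\<close>, and later turns the
  weighted L^2 bound into a bound at a point.\<close>

lemma F_sq_le_conv:
  assumes "\<bar>\<epsilon>\<bar> \<le> 1"
  shows "ennreal ((H \<epsilon> a z)\<^sup>2) \<le> ennreal (4 * (Ck * J)) * (\<integral>\<^sup>+v. ennreal (\<kappa>3 (z - v) * (H \<epsilon> a v)\<^sup>2) \<partial>lborel)"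
proof -
  have "ennreal ((H \<epsilon> a z)\<^sup>2) = (ennreal (H \<epsilon> a z))\<^sup>2" by (simp add: ennreal_power)
  also have "\<dots> \<le> (\<integral>\<^sup>+v. ennreal (\<kappa>3 (z - v) * H \<epsilon> a v) \<partial>lborel)\<^sup>2"
    by (intro power_mono F_le_conv assms) simp
  also have "\<dots> \<le> ennreal (4 * (Ck * J)) * (\<integral>\<^sup>+v. ennreal (\<kappa>3 (z - v) * (H \<epsilon> a v)\<^sup>2) \<partial>lborel)"
  proof (rule nn_integral_square_le)
    have "(\<integral>\<^sup>+v. ennreal (\<kappa>3 (z - v)) \<partial>lborel) = (\<integral>\<^sup>+v. ennreal (\<kappa>3 v) \<partial>lborel)"
      by (rule nn_integral_lborel_minus[of "\<lambda>v. ennreal (\<kappa>3 v)"]) measurable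
    also have "\<dots> = ennreal (\<integral>v. \<kappa>3 v \<partial>lborel)"
      by (rule nn_integral_eq_integral[OF integrable_\<kappa>3]) simp
    also have "(\<integral>v. \<kappa>3 v \<partial>lborel) = Ck * J" by (simp add: \<kappa>3_def J_def)
    finally show "(\<integral>\<^sup>+v. ennreal (\<kappa>3 (z - v)) \<partial>lborel) \<le> ennreal (Ck * J)" by simp
    show "0 \<le> Ck * J" using Ck_pos J_nonneg by simp
  qed auto
  finally show ?thesis .
qed

text \<open>Tonelli transfers the sum over \<open>L\<close> from \<sigma> to the kernel: after the
  substitution v = y + l the lattice sum of \<open>kap d\<close> is at most \<open>Kl\<close>, and
  only the tail integral of \<sigma> remains.\<close>

lemma R_conv:
  "(\<integral>\<^sup>+v. R r v * ennreal (kap d (v - w)) \<partial>lborel) \<le> ennreal Kl * (\<integral>\<^sup>+y. ennreal (\<sigma> y * indicator {y. r < norm y} y) \<partial>lborel)"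
proof -
  have "(\<integral>\<^sup>+v. R r v * ennreal (kap d (v - w)) \<partial>lborel)
    = (\<integral>\<^sup>+v. (\<integral>\<^sup>+l. ennreal (\<sigma> (v - l) * indicator {y. r < norm y} (v - l)) * ennreal (kap d (v - w)) \<partial>count_space L) \<partial>lborel)"
    unfolding R_def by (simp add: nn_integral_multc)
  also have "\<dots> = (\<integral>\<^sup>+l. (\<integral>\<^sup>+v. ennreal (\<sigma> (v - l) * indicator {y. r < norm y} (v - l)) * ennreal (kap d (v - w)) \<partial>lborel) \<partial>count_space L)"
    by (rule nn_integral_count_space_nn_integral[OF L_countable]) measurable
  also have "\<dots> = (\<integral>\<^sup>+l. (\<integral>\<^sup>+y. ennreal (\<sigma> y * indicator {y. r < norm y} y) * ennreal (kap d ((w - y) - l)) \<partial>lborel) \<partial>count_space L)"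
  proof (rule nn_integral_cong)
    fix l
    show "(\<integral>\<^sup>+v. ennreal (\<sigma> (v - l) * indicator {y. r < norm y} (v - l)) * ennreal (kap d (v - w)) \<partial>lborel)
       = (\<integral>\<^sup>+y. ennreal (\<sigma> y * indicator {y. r < norm y} y) * ennreal (kap d ((w - y) - l)) \<partial>lborel)"
      by (subst nn_integral_lborel_diff[symmetric, of _ l], measurable)
         (simp add: algebra_simps kap_minus_commute)
  qed
  also have "\<dots> = (\<integral>\<^sup>+y. (\<integral>\<^sup>+l. ennreal (\<sigma> y * indicator {y. r < norm y} y) * ennreal (kap d ((w - y) - l)) \<partial>count_space L) \<partial>lborel)"
    by (rule nn_integral_count_space_nn_integral[OF L_countable, symmetric]) measurable
  also have "\<dots> \<le> (\<integral>\<^sup>+y. ennreal (\<sigma> y * indicator {y. r < norm y} y) * ennreal Kl \<partial>lborel)"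
    by (intro nn_integral_mono) (simp add: nn_integral_cmult mult_left_mono L_sum)
  also have "\<dots> = ennreal Kl * (\<integral>\<^sup>+y. ennreal (\<sigma> y * indicator {y. r < norm y} y) \<partial>lborel)"
    by (subst nn_integral_multc) (auto simp: mult.commute)
  finally show ?thesis .
qed

definition W3 :: "real \<Rightarrow> real" where
  "W3 r = (\<integral>y. \<sigma> y * indicator {y. r < norm y} y \<partial>lborel)"

lemma integrable_\<sigma>: "integrable lborel \<sigma>"
  using \<sigma>_int \<sigma>_nonneg by (intro integrableI_nonneg) auto

lemma W3_eq: "(\<integral>\<^sup>+y. ennreal (\<sigma> y * indicator {y. r < norm y} y) \<partial>lborel) = ennreal (W3 r)"
proof -
  have "integrable lborel (\<lambda>y. \<sigma> y * indicator {y. r < norm y} y)"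
    by (rule Bochner_Integration.integrable_bound[OF integrable_\<sigma>]) (auto simp: indicator_def)
  then show ?thesis unfolding W3_def
    by (rule nn_integral_eq_integral) (auto simp: \<sigma>_nonneg)
qed

lemma W3_nonneg: "0 \<le> W3 r" unfolding W3_def by (rule integral_nonneg_AE) (simp add: \<sigma>_nonneg)

text \<open>One factor \<open>Rb\<close> is bounded by \<open>B\<close>, the other by
  \<open>R\<close>. Replacing the square of \<open>H\<close> by its local average lets
  \<open>R\<close> meet a kernel after Tonelli, so that \<open>R_conv\<close> applies; the result is
  linear in the tail integral \<open>W3 r\<close>.\<close>

lemma RbH_sq:
  assumes "\<bar>\<epsilon>\<bar> \<le> 1"
  shows "(\<integral>\<^sup>+v. ennreal ((Rb r v * H \<epsilon> a v)\<^sup>2) \<partial>lborel)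
    \<le> ennreal (4 * B * (Ck * J) * Ck * Kl * W3 r) * (\<integral>\<^sup>+v. ennreal ((H \<epsilon> a v)\<^sup>2) \<partial>lborel)"
proof -
  have pt: "ennreal ((Rb r v * H \<epsilon> a v)\<^sup>2) \<le> ennreal (4 * B * (Ck * J)) * (\<integral>\<^sup>+w. R r v * ennreal (\<kappa>3 (v - w) * (H \<epsilon> a w)\<^sup>2) \<partial>lborel)" for v
  proof -
    have "Rb r v * Rb r v * (H \<epsilon> a v)\<^sup>2 \<le> B * Rb r v * (H \<epsilon> a v)\<^sup>2"
      using Rb_bounds by (intro mult_right_mono) auto
    then have "ennreal ((Rb r v * H \<epsilon> a v)\<^sup>2) \<le> ennreal (B * Rb r v * (H \<epsilon> a v)\<^sup>2)"
      by (intro ennreal_leI) (simp add: power2_eq_square mult_ac)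
    also have "\<dots> = ennreal B * ennreal (Rb r v) * ennreal ((H \<epsilon> a v)\<^sup>2)"
      using B_pos Rb_bounds(1)[of r v] by (simp add: ennreal_mult)
    also have "\<dots> \<le> ennreal B * R r v * (ennreal (4 * (Ck * J)) * (\<integral>\<^sup>+w. ennreal (\<kappa>3 (v - w) * (H \<epsilon> a w)\<^sup>2) \<partial>lborel))"
      by (intro mult_mono F_sq_le_conv assms Rb_bounds mult_left_mono) auto
    also have "\<dots> = ennreal (4 * B * (Ck * J)) * (R r v * (\<integral>\<^sup>+w. ennreal (\<kappa>3 (v - w) * (H \<epsilon> a w)\<^sup>2) \<partial>lborel))"
      using B_pos Ck_pos J_nonneg by (simp add: ennreal_mult mult_ac)
    finally show ?thesis by (simp add: nn_integral_cmult)
  qed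
  have "(\<integral>\<^sup>+v. ennreal ((Rb r v * H \<epsilon> a v)\<^sup>2) \<partial>lborel)
     \<le> (\<integral>\<^sup>+v. ennreal (4 * B * (Ck * J)) * (\<integral>\<^sup>+w. R r v * ennreal (\<kappa>3 (v - w) * (H \<epsilon> a w)\<^sup>2) \<partial>lborel) \<partial>lborel)"
    by (intro nn_integral_mono pt)
  also have "\<dots> = ennreal (4 * B * (Ck * J)) * (\<integral>\<^sup>+v. (\<integral>\<^sup>+w. R r v * ennreal (\<kappa>3 (v - w) * (H \<epsilon> a w)\<^sup>2) \<partial>lborel) \<partial>lborel)"
    by (rule nn_integral_cmult) measurable
  finally have outer: "(\<integral>\<^sup>+v. ennreal ((Rb r v * H \<epsilon> a v)\<^sup>2) \<partial>lborel)
     \<le> ennreal (4 * B * (Ck * J)) * (\<integral>\<^sup>+v. (\<integral>\<^sup>+w. R r v * ennreal (\<kappa>3 (v - w) * (H \<epsilon> a w)\<^sup>2) \<partial>lborel) \<partial>lborel)" .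
  have "(\<integral>\<^sup>+v. (\<integral>\<^sup>+w. R r v * ennreal (\<kappa>3 (v - w) * (H \<epsilon> a w)\<^sup>2) \<partial>lborel) \<partial>lborel)
     = (\<integral>\<^sup>+w. (\<integral>\<^sup>+v. R r v * ennreal (\<kappa>3 (v - w) * (H \<epsilon> a w)\<^sup>2) \<partial>lborel) \<partial>lborel)"
    by (rule lborel_pair.Fubini') measurable
  also have "\<dots> = (\<integral>\<^sup>+w. ennreal (Ck * (H \<epsilon> a w)\<^sup>2) * (\<integral>\<^sup>+v. R r v * ennreal (kap d (v - w)) \<partial>lborel) \<partial>lborel)"
  proof (intro nn_integral_cong)
    fix w
    have "R r v * ennreal (\<kappa>3 (v - w) * (H \<epsilon> a w)\<^sup>2) = ennreal (Ck * (H \<epsilon> a w)\<^sup>2) * (R r v * ennreal (kap d (v - w)))" for v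
    proof -
      have *: "\<kappa>3 (v - w) * (H \<epsilon> a w)\<^sup>2 = (Ck * (H \<epsilon> a w)\<^sup>2) * kap d (v - w)" by (simp add: \<kappa>3_def)
      show ?thesis unfolding * using Ck_pos by (simp add: ennreal_mult mult_ac)
    qed
    then show "(\<integral>\<^sup>+v. R r v * ennreal (\<kappa>3 (v - w) * (H \<epsilon> a w)\<^sup>2) \<partial>lborel) = ennreal (Ck * (H \<epsilon> a w)\<^sup>2) * (\<integral>\<^sup>+v. R r v * ennreal (kap d (v - w)) \<partial>lborel)"
      by (simp add: nn_integral_cmult)
  qed
  also have "\<dots> \<le> (\<integral>\<^sup>+w. ennreal (Ck * (H \<epsilon> a w)\<^sup>2) * (ennreal Kl * ennreal (W3 r)) \<partial>lborel)"
    using R_conv[of r] by (intro nn_integral_mono mult_left_mono) (auto simp: W3_eq)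
  also have "\<dots> = (\<integral>\<^sup>+w. ennreal (Ck * Kl * W3 r) * ennreal ((H \<epsilon> a w)\<^sup>2) \<partial>lborel)"
    using Ck_pos Kl_pos W3_nonneg by (intro nn_integral_cong) (simp add: ennreal_mult mult_ac)
  also have "\<dots> = ennreal (Ck * Kl * W3 r) * (\<integral>\<^sup>+w. ennreal ((H \<epsilon> a w)\<^sup>2) \<partial>lborel)"
    by (rule nn_integral_cmult) measurable
  finally have inner: "(\<integral>\<^sup>+v. (\<integral>\<^sup>+w. R r v * ennreal (\<kappa>3 (v - w) * (H \<epsilon> a w)\<^sup>2) \<partial>lborel) \<partial>lborel)
     \<le> ennreal (Ck * Kl * W3 r) * (\<integral>\<^sup>+w. ennreal ((H \<epsilon> a w)\<^sup>2) \<partial>lborel)" .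
  have eq: "ennreal (4 * B * (Ck * J)) * (ennreal (Ck * Kl * W3 r) * q) = ennreal (4 * B * (Ck * J) * Ck * Kl * W3 r) * q" for q
  proof -
    have *: "4 * B * (Ck * J) * Ck * Kl * W3 r = (4 * B * (Ck * J)) * (Ck * Kl * W3 r)" by (simp only: mult_ac)
    show ?thesis
      unfolding * using B_pos Ck_pos J_nonneg Kl_pos W3_nonneg[of r]
      by (subst ennreal_mult[of "4 * B * (Ck * J)"]) (simp_all add: mult.assoc)
  qed
  show ?thesis
    using order_trans[OF outer mult_left_mono[OF inner]] by (simp add: eq)
qed

end

section \<open>Absorption and the pointwise bound\<close>

context core_estimate
begin

definition XB :: "('a \<Rightarrow> real) \<Rightarrow> real \<Rightarrow> 'a \<Rightarrow> ennreal" where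
  "XB b r z = (\<integral>\<^sup>+l. ennreal (b l * indicator (cball 0 (2 * r)) (z - l)) \<partial>count_space L)"

lemma cball_measurable [measurable]: "cball (x::'a) r \<in> sets borel"
  by simp

lemma XB_measurable [measurable]: "XB b r \<in> borel_measurable borel"
  unfolding XB_def by (rule nn_integral_count_space_lborel_measurable[OF L_countable]) measurable

lemma X_le_XB:
  assumes "\<And>l. 0 \<le> b l" "\<And>l w. l \<in> L \<Longrightarrow> cmod (g l w) \<le> b l"
  shows "ennreal (cmod (X r z)) \<le> XB b r z"
proof -
  have "cmod (X r z) \<le> (\<Sum>l\<in>L \<inter> cball z (2 * r). b l)"
    unfolding X_def by (rule order_trans[OF norm_sum sum_mono]) (use assms in auto)
  then have "ennreal (cmod (X r z)) \<le> ennreal (\<Sum>l\<in>L \<inter> cball z (2 * r). b l)" by (rule ennreal_leI)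
  also have "\<dots> = (\<Sum>l\<in>L \<inter> cball z (2 * r). ennreal (b l * indicator (cball 0 (2 * r)) (z - l)))"
    using assms(1) by (subst sum_ennreal) (auto simp: dist_norm indicator_def norm_minus_commute intro!: arg_cong[where f=ennreal] sum.cong)
  also have "\<dots> = XB b r z"
    unfolding XB_def
    by (rule nn_integral_count_space'[symmetric]) (use finite_ball in \<open>auto simp: indicator_def dist_norm norm_minus_commute\<close>)
  finally show ?thesis .
qed

lemma indicator_sum_le:
  assumes "0 \<le> \<rho>"
  shows "(\<integral>\<^sup>+l. ennreal (indicator (cball 0 \<rho>) (z - l)) \<partial>count_space L) \<le> ennreal ((1 + \<rho>) ^ d * Kl)"
proof -
  have "(\<integral>\<^sup>+l. ennreal (indicator (cball 0 \<rho>) (z - l)) \<partial>count_space L)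
     \<le> (\<integral>\<^sup>+l. ennreal ((1 + \<rho>) ^ d) * ennreal (kap d (z - l)) \<partial>count_space L)"
  proof (intro nn_integral_mono)
    fix l
    show "ennreal (indicator (cball 0 \<rho>) (z - l)) \<le> ennreal ((1 + \<rho>) ^ d) * ennreal (kap d (z - l))"
    proof (cases "norm (z - l) \<le> \<rho>")
      case True
      then have "(1 + norm (z - l)) ^ d \<le> (1 + \<rho>) ^ d" by (intro power_mono) auto
      then have "1 \<le> (1 + \<rho>) ^ d * kap d (z - l)" by (simp add: kap_def)
      then have "1 \<le> ennreal ((1 + \<rho>) ^ d * kap d (z - l))" by simp
      then show ?thesis using assms by (auto simp: indicator_def ennreal_mult)
    qed (auto simp: indicator_def)
  qed
  also have "\<dots> = ennreal ((1 + \<rho>) ^ d) * (\<integral>\<^sup>+l. ennreal (kap d (z - l)) \<partial>count_space L)"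
    by (rule nn_integral_cmult) simp
  also have "\<dots> \<le> ennreal ((1 + \<rho>) ^ d) * ennreal Kl"
    by (rule mult_left_mono[OF L_sum]) simp
  finally show ?thesis using assms Kl_pos by (simp add: ennreal_mult)
qed

text \<open>Only lattice points within \<open>2 * r\<close> of \<open>z\<close> contribute, and
  there the weight at \<open>z\<close> is comparable to the weight at \<open>l\<close>, which is at
  most \<epsilon>^(-M) \<open>kap M (a - l)\<close>. Counting the points in a ball, integrating in
  \<open>z\<close> and passing from l^2 to l^1 gives the bound. The constant may be large, but it is
  independent of \<open>a\<close> and \<open>b\<close>.\<close>

lemma uXB_sq:
  assumes e: "0 < \<epsilon>" "\<epsilon> \<le> 1" and r: "0 \<le> r"
  obtains K where "K \<ge> 0" "\<And>b a. (\<And>l. 0 \<le> b l) \<Longrightarrow> (\<integral>\<^sup>+z. (ennreal (u \<epsilon> a z) * XB b r z)\<^sup>2 \<partial>lborel)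
     \<le> ennreal K * (\<integral>\<^sup>+l. ennreal (b l * kap M (a - l)) \<partial>count_space L)\<^sup>2"
proof -
  define K1 where "K1 = (1 + 2 * r) ^ M / \<epsilon> ^ M"
  define nr where "nr = (1 + 2 * r) ^ d * Kl"
  define V where "V = measure lborel (cball (0::'a) (2 * r))"
  have K1: "K1 \<ge> 0" and nr: "nr \<ge> 0" and V: "V \<ge> 0" using r e Kl_pos by (auto simp: K1_def nr_def V_def)
  have emV: "(\<integral>\<^sup>+z. ennreal (indicator (cball 0 (2 * r)) (z - l)) \<partial>lborel) = ennreal V" for l :: 'a
  proof -
    have "(\<integral>\<^sup>+z. ennreal (indicator (cball 0 (2 * r)) (z - l)) \<partial>lborel) = (\<integral>\<^sup>+z. ennreal (indicator (cball 0 (2 * r)) (z::'a)) \<partial>lborel)"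
      by (rule nn_integral_lborel_diff[of "\<lambda>z. ennreal (indicator (cball 0 (2 * r)) z)"]) measurable
    also have "\<dots> = emeasure lborel (cball (0::'a) (2 * r))"
      by (simp add: ennreal_indicator)
    also have "\<dots> = ennreal V"
      unfolding V_def using emeasure_eq_ennreal_measure[of lborel "cball (0::'a) (2 * r)"] emeasure_lborel_cball_finite[of "0::'a" "2 * r"]
      by (simp add: less_top)
    finally show ?thesis .
  qed
  have "(\<integral>\<^sup>+z. (ennreal (u \<epsilon> a z) * XB b r z)\<^sup>2 \<partial>lborel)
     \<le> ennreal (K1\<^sup>2 * (4 * nr) * V) * (\<integral>\<^sup>+l. ennreal (b l * kap M (a - l)) \<partial>count_space L)\<^sup>2"
    if b: "\<And>l. 0 \<le> b l" for a b
  proof -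
    define h where "h = (\<lambda>l. b l * kap M (a - l))"
    have h0: "0 \<le> h l" for l using b by (simp add: h_def)
    have pt: "ennreal (u \<epsilon> a z) * XB b r z \<le> ennreal K1 * (\<integral>\<^sup>+l. ennreal (indicator (cball 0 (2 * r)) (z - l) * h l) \<partial>count_space L)" for z
    proof -
      have "ennreal (u \<epsilon> a z) * XB b r z = (\<integral>\<^sup>+l. ennreal (u \<epsilon> a z) * ennreal (b l * indicator (cball 0 (2 * r)) (z - l)) \<partial>count_space L)"
        unfolding XB_def by (simp add: nn_integral_cmult)
      also have "\<dots> \<le> (\<integral>\<^sup>+l. ennreal K1 * ennreal (indicator (cball 0 (2 * r)) (z - l) * h l) \<partial>count_space L)"
      proof (intro nn_integral_mono)
        fix l
        show "ennreal (u \<epsilon> a z) * ennreal (b l * indicator (cball 0 (2 * r)) (z - l)) \<le> ennreal K1 * ennreal (indicator (cball 0 (2 * r)) (z - l) * h l)"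
        proof (cases "norm (z - l) \<le> 2 * r")
          case True
          have "u \<epsilon> a z \<le> u \<epsilon> a l * (1 + norm (z - l)) ^ M"
            using e by (intro u_ratio1) simp
          also have "\<dots> \<le> u \<epsilon> a l * (1 + 2 * r) ^ M"
            using True u_bounds by (intro mult_left_mono power_mono) auto
          also have "u \<epsilon> a l \<le> kap M (a - l) / \<epsilon> ^ M"
          proof -
            have "\<epsilon> * (1 + norm (l - a)) \<le> 1 + norm (\<epsilon> *\<^sub>R (l - a))"
              using e by (simp add: distrib_left)
            then have "(\<epsilon> * (1 + norm (l - a))) ^ M \<le> (1 + norm (\<epsilon> *\<^sub>R (l - a))) ^ M"
              using e by (intro power_mono) auto
            then show ?thesis
              using e by (simp add: u_def kap_def power_mult_distrib frac_le divide_divide_eq_left mult.commute norm_minus_commute)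
          qed
          finally have "u \<epsilon> a z \<le> K1 * kap M (a - l)"
            using r by (simp add: K1_def mult_right_mono mult.commute)
          then have "u \<epsilon> a z * b l \<le> K1 * h l"
            using b[of l] mult_right_mono[of "u \<epsilon> a z" "K1 * kap M (a - l)" "b l"] by (simp add: h_def mult_ac)
          then show ?thesis using True u_bounds[of \<epsilon> a z] K1
            by (simp add: ennreal_mult'[symmetric] ennreal_leI)
        qed simp
      qed
      also have "\<dots> = ennreal K1 * (\<integral>\<^sup>+l. ennreal (indicator (cball 0 (2 * r)) (z - l) * h l) \<partial>count_space L)"
        by (rule nn_integral_cmult) simp
      finally show ?thesis .
    qed
    have "(\<integral>\<^sup>+z. (ennreal (u \<epsilon> a z) * XB b r z)\<^sup>2 \<partial>lborel)
       \<le> (\<integral>\<^sup>+z. ennreal (K1\<^sup>2 * (4 * nr)) * (\<integral>\<^sup>+l. ennreal (indicator (cball 0 (2 * r)) (z - l) * (h l)\<^sup>2) \<partial>count_space L) \<partial>lborel)"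
    proof (rule nn_integral_mono)
      fix z
      have "(ennreal (u \<epsilon> a z) * XB b r z)\<^sup>2 \<le> (ennreal K1 * (\<integral>\<^sup>+l. ennreal (indicator (cball 0 (2 * r)) (z - l) * h l) \<partial>count_space L))\<^sup>2"
        by (rule power_mono[OF pt]) simp
      also have "\<dots> = ennreal (K1\<^sup>2) * (\<integral>\<^sup>+l. ennreal (indicator (cball 0 (2 * r)) (z - l) * h l) \<partial>count_space L)\<^sup>2"
        using K1 by (simp add: power_mult_distrib ennreal_power)
      also have "\<dots> \<le> ennreal (K1\<^sup>2) * (ennreal (4 * nr) * (\<integral>\<^sup>+l. ennreal (indicator (cball 0 (2 * r)) (z - l) * (h l)\<^sup>2) \<partial>count_space L))"
        using indicator_sum_le[of "2 * r" z] r h0 nr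
        by (intro mult_left_mono nn_integral_square_le) (auto simp: nr_def)
      also have "\<dots> = ennreal (K1\<^sup>2 * (4 * nr)) * (\<integral>\<^sup>+l. ennreal (indicator (cball 0 (2 * r)) (z - l) * (h l)\<^sup>2) \<partial>count_space L)"
        using K1 nr by (simp add: ennreal_mult mult.assoc)
      finally show "(ennreal (u \<epsilon> a z) * XB b r z)\<^sup>2 \<le> \<dots>" .
    qed
    also have "\<dots> = ennreal (K1\<^sup>2 * (4 * nr)) * (\<integral>\<^sup>+z. (\<integral>\<^sup>+l. ennreal (indicator (cball 0 (2 * r)) (z - l) * (h l)\<^sup>2) \<partial>count_space L) \<partial>lborel)"
      by (rule nn_integral_cmult, rule nn_integral_count_space_lborel_measurable[OF L_countable]) measurable
    also have "(\<integral>\<^sup>+z. (\<integral>\<^sup>+l. ennreal (indicator (cball 0 (2 * r)) (z - l) * (h l)\<^sup>2) \<partial>count_space L) \<partial>lborel)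
      = (\<integral>\<^sup>+l. (\<integral>\<^sup>+z. ennreal (indicator (cball 0 (2 * r)) (z - l) * (h l)\<^sup>2) \<partial>lborel) \<partial>count_space L)"
      by (rule nn_integral_count_space_nn_integral[OF L_countable]) measurable
    also have "\<dots> = (\<integral>\<^sup>+l. ennreal V * (ennreal (h l))\<^sup>2 \<partial>count_space L)"
    proof (rule nn_integral_cong)
      fix l
      have "(\<integral>\<^sup>+z. ennreal (indicator (cball 0 (2 * r)) (z - l)) * ennreal ((h l)\<^sup>2) \<partial>lborel) = ennreal V * ennreal ((h l)\<^sup>2)"
        by (subst nn_integral_multc) (auto simp: emV)
      then show "(\<integral>\<^sup>+z. ennreal (indicator (cball 0 (2 * r)) (z - l) * (h l)\<^sup>2) \<partial>lborel) = ennreal V * (ennreal (h l))\<^sup>2"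
        using h0[of l] by (simp add: ennreal_mult ennreal_power)
    qed
    also have "\<dots> = ennreal V * (\<integral>\<^sup>+l. (ennreal (h l))\<^sup>2 \<partial>count_space L)"
      by (rule nn_integral_cmult) simp
    finally have 1: "(\<integral>\<^sup>+z. (ennreal (u \<epsilon> a z) * XB b r z)\<^sup>2 \<partial>lborel)
       \<le> ennreal (K1\<^sup>2 * (4 * nr)) * (ennreal V * (\<integral>\<^sup>+l. (ennreal (h l))\<^sup>2 \<partial>count_space L))" .
    have "ennreal (K1\<^sup>2 * (4 * nr)) * (ennreal V * (\<integral>\<^sup>+l. (ennreal (h l))\<^sup>2 \<partial>count_space L))
       \<le> ennreal (K1\<^sup>2 * (4 * nr)) * (ennreal V * (\<integral>\<^sup>+l. ennreal (h l) \<partial>count_space L)\<^sup>2)"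
      by (intro mult_left_mono nn_integral_count_space_square_le) auto
    also have "\<dots> = ennreal (K1\<^sup>2 * (4 * nr) * V) * (\<integral>\<^sup>+l. ennreal (h l) \<partial>count_space L)\<^sup>2"
      using K1 nr V by (simp add: ennreal_mult mult.assoc)
    finally show ?thesis using 1 by (simp add: h_def)
  qed
  moreover have "K1\<^sup>2 * (4 * nr) * V \<ge> 0" using nr V by simp
  ultimately show thesis using that by blast
qed

definition W1 :: "real \<Rightarrow> real" where "W1 \<epsilon> = (\<integral>y. \<kappa>1 \<epsilon> y \<partial>lborel)"
definition W2 :: "real \<Rightarrow> real" where "W2 r = (\<integral>y. \<kappa>2 r y \<partial>lborel)"

text \<open>For each displacement the weight ratio tends to 1, and \<open>\<kappa>3\<close> is an
  integrable majorant independent of \<epsilon>.\<close>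

lemma W1_tendsto: "(\<lambda>m. W1 (1 / real (Suc m))) \<longlonglongrightarrow> 0"
proof -
  have "(\<lambda>m. W1 (1 / real (Suc m))) \<longlonglongrightarrow> (\<integral>y. 0 \<partial>(lborel::'a measure))"
    unfolding W1_def
  proof (rule integral_dominated_convergence[where w=\<kappa>3])
    show "integrable lborel \<kappa>3" by (rule integrable_\<kappa>3)
    show "AE y in lborel. norm (\<kappa>1 (1 / real (Suc m)) y) \<le> \<kappa>3 y" for m
      by (rule AE_I2) (use \<kappa>1_le[of "1 / real (Suc m)"] in simp)
    show "AE y in lborel. (\<lambda>m. \<kappa>1 (1 / real (Suc m)) y) \<longlonglongrightarrow> 0"
    proof (rule AE_I2)
      fix y :: 'a
      have "(\<lambda>m. 1 / real (Suc m)) \<longlonglongrightarrow> 0" using LIMSEQ_inverse_real_of_nat by (simp add: inverse_eq_divide)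
      then have "(\<lambda>m. Ck * kap (M + d) y * ((1 + \<bar>1 / real (Suc m)\<bar> * norm y) ^ M - 1)) \<longlonglongrightarrow> Ck * kap (M + d) y * ((1 + \<bar>0\<bar> * norm y) ^ M - 1)"
        by (intro tendsto_intros)
      then show "(\<lambda>m. \<kappa>1 (1 / real (Suc m)) y) \<longlonglongrightarrow> 0" by (simp add: \<kappa>1_def)
    qed
  qed auto
  then show ?thesis by simp
qed

lemma W2_tendsto: "(\<lambda>m. W2 (real m)) \<longlonglongrightarrow> 0"
proof -
  have "integrable lborel (\<lambda>y::'a. B * (Ck * kap d y))" using integrable_kapd by simp
  from integral_tail_tendsto_0[OF this] show ?thesis
    unfolding W2_def \<kappa>2_def by (simp add: mult.assoc)
qed

lemma W3_tendsto: "(\<lambda>m. W3 (real m)) \<longlonglongrightarrow> 0"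
  unfolding W3_def by (rule integral_tail_tendsto_0[OF integrable_\<sigma>])

lemma H_le:
  assumes e: "\<bar>\<epsilon>\<bar> \<le> 1" and r: "0 \<le> r"
    and b: "\<And>l. 0 \<le> b l" "\<And>l w. l \<in> L \<Longrightarrow> cmod (g l w) \<le> b l"
  shows "ennreal (H \<epsilon> a z) \<le> ennreal (cmod (\<integral>v. k z v * G \<epsilon> a v \<partial>lborel))
     + ((\<integral>\<^sup>+v. ennreal (\<kappa>1 \<epsilon> (z - v) * H \<epsilon> a v) \<partial>lborel)
     + (ennreal c * ((\<integral>\<^sup>+v. ennreal (\<kappa>2 r (z - v) * H \<epsilon> a v) \<partial>lborel) + (\<integral>\<^sup>+v. ennreal (\<kappa>3 (z - v) * (Rb r v * H \<epsilon> a v)) \<partial>lborel))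
     + ennreal c * (ennreal (u \<epsilon> a z) * XB b r z)))"
proof -
  have "ennreal (H \<epsilon> a z) = ennreal (u \<epsilon> a z) * ennreal (cmod (F z))"
    using u_bounds[of \<epsilon> a z] by (simp add: H_def ennreal_mult'[symmetric] mult.commute)
  also have "\<dots> \<le> ennreal (u \<epsilon> a z) * (ennreal (cmod (\<integral>v. k z v * (T v * F v) \<partial>lborel))
     + (ennreal c * (\<integral>\<^sup>+v. ennreal (cmod (k z v) * cmod (F v) * (B * indicator {y. r < norm y} (z - v) + Rb r v)) \<partial>lborel)
     + ennreal c * ennreal (cmod (X r z))))"
    by (intro mult_left_mono F_decomp r) simp
  also have "\<dots> = ennreal (u \<epsilon> a z) * ennreal (cmod (\<integral>v. k z v * (T v * F v) \<partial>lborel))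
     + (ennreal c * (ennreal (u \<epsilon> a z) * (\<integral>\<^sup>+v. ennreal (cmod (k z v) * cmod (F v) * (B * indicator {y. r < norm y} (z - v) + Rb r v)) \<partial>lborel))
     + ennreal c * (ennreal (u \<epsilon> a z) * ennreal (cmod (X r z))))"
    by (simp add: distrib_left mult_ac)
  also have "\<dots> \<le> (ennreal (cmod (\<integral>v. k z v * G \<epsilon> a v \<partial>lborel)) + (\<integral>\<^sup>+v. ennreal (\<kappa>1 \<epsilon> (z - v) * H \<epsilon> a v) \<partial>lborel))
     + (ennreal c * ((\<integral>\<^sup>+v. ennreal (\<kappa>2 r (z - v) * H \<epsilon> a v) \<partial>lborel) + (\<integral>\<^sup>+v. ennreal (\<kappa>3 (z - v) * (Rb r v * H \<epsilon> a v)) \<partial>lborel))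
     + ennreal c * (ennreal (u \<epsilon> a z) * XB b r z))"
    by (intro add_mono P_weighted mult_left_mono tail_weighted e X_le_XB b) auto
  finally show ?thesis by (simp add: add.assoc)
qed

lemma Q_finite:
  assumes "\<epsilon> \<noteq> 0"
  shows "(\<integral>\<^sup>+z. ennreal ((H \<epsilon> a z)\<^sup>2) \<partial>lborel) < \<infinity>"
proof -
  obtain K where K: "K \<ge> 0" "\<And>z. H \<epsilon> a z \<le> K * kap d z" using H_decay[OF assms] by blast
  have "(H \<epsilon> a z)\<^sup>2 \<le> K * (K * kap d z)" for z
  proof -
    have "H \<epsilon> a z \<le> K * 1" using K mult_left_mono[OF kap_le_1[of d z] K(1)] order_trans by blast
    then show ?thesis unfolding power2_eq_square using K by (intro mult_mono) auto
  qed
  then have "(\<integral>\<^sup>+z. ennreal ((H \<epsilon> a z)\<^sup>2) \<partial>lborel) \<le> (\<integral>\<^sup>+z. ennreal (K * (K * kap d (z::'a))) \<partial>lborel)"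
    by (intro nn_integral_mono ennreal_leI)
  also have "\<dots> < \<infinity>"
    using nn_integral_eq_integral[of lborel "\<lambda>z::'a. K * (K * kap d z)"] integrable_kapd K(1) by simp
  finally show ?thesis .
qed

text \<open>The factor arises before projecting, from the bound \<gamma> for \<open>T\<close>; the
  projection itself contributes norm one.\<close>

lemma PG_sq:
  assumes "\<epsilon> \<noteq> 0"
  shows "(\<integral>\<^sup>+z. (ennreal (cmod (\<integral>v. k z v * G \<epsilon> a v \<partial>lborel)))\<^sup>2 \<partial>lborel) \<le> ennreal (\<gamma>\<^sup>2) * (\<integral>\<^sup>+z. ennreal ((H \<epsilon> a z)\<^sup>2) \<partial>lborel)"
proof -
  obtain K where K: "K \<ge> 0" "\<And>z. H \<epsilon> a z \<le> K * kap d z" using H_decay[OF assms] by blast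
  have "cmod (G \<epsilon> a z) \<le> K * kap (DIM('a) + 2) z" for z
  proof -
    have "cmod (G \<epsilon> a z) \<le> 1 * H \<epsilon> a z"
      by (rule order_trans[OF G_le_H mult_right_mono]) (use \<gamma>_range in auto)
    then show ?thesis using K(2)[of z] by (simp add: d_def)
  qed
  then have "(\<integral>\<^sup>+z. (ennreal (cmod (\<integral>v. k z v * G \<epsilon> a v \<partial>lborel)))\<^sup>2 \<partial>lborel) \<le> (\<integral>\<^sup>+z. (ennreal (cmod (G \<epsilon> a z)))\<^sup>2 \<partial>lborel)"
    by (intro projection_contraction) auto
  also have "\<dots> \<le> (\<integral>\<^sup>+z. ennreal (\<gamma>\<^sup>2) * ennreal ((H \<epsilon> a z)\<^sup>2) \<partial>lborel)"
  proof (rule nn_integral_mono)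
    fix z
    have "(cmod (G \<epsilon> a z))\<^sup>2 \<le> (\<gamma> * H \<epsilon> a z)\<^sup>2" by (rule power_mono[OF G_le_H]) simp
    then have "ennreal ((cmod (G \<epsilon> a z))\<^sup>2) \<le> ennreal (\<gamma>\<^sup>2 * (H \<epsilon> a z)\<^sup>2)"
      by (intro ennreal_leI) (simp add: power_mult_distrib)
    then show "(ennreal (cmod (G \<epsilon> a z)))\<^sup>2 \<le> ennreal (\<gamma>\<^sup>2) * ennreal ((H \<epsilon> a z)\<^sup>2)"
      by (simp add: ennreal_power ennreal_mult)
  qed
  also have "\<dots> = ennreal (\<gamma>\<^sup>2) * (\<integral>\<^sup>+z. ennreal ((H \<epsilon> a z)\<^sup>2) \<partial>lborel)"
    by (rule nn_integral_cmult) measurable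
  finally show ?thesis .
qed

text \<open>The three terms belong to the commutator, to the kernel beyond distance \<open>r\<close>
  and to the lattice tail. The numerical factors collect the 2 from each splitting of a square and
  the 4 from the Schur test.\<close>

definition \<Theta> :: "real \<Rightarrow> real \<Rightarrow> real" where
  "\<Theta> \<epsilon> r = 8 * (W1 \<epsilon>)\<^sup>2 + 32 * c\<^sup>2 * (W2 r)\<^sup>2 + 32 * c\<^sup>2 * (Ck * J)\<^sup>2 * (4 * B * (Ck * J) * Ck * Kl * W3 r)"

lemma \<Theta>_nonneg: "0 \<le> \<Theta> \<epsilon> r"
  unfolding \<Theta>_def using B_pos Ck_pos J_nonneg Kl_pos W3_nonneg by (intro add_nonneg_nonneg mult_nonneg_nonneg) auto

lemma perturbation_sq:
  assumes e: "\<bar>\<epsilon>\<bar> \<le> 1"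
  shows "(\<integral>\<^sup>+z. (((\<integral>\<^sup>+v. ennreal (\<kappa>1 \<epsilon> (z - v) * H \<epsilon> a v) \<partial>lborel)
     + (ennreal c * ((\<integral>\<^sup>+v. ennreal (\<kappa>2 r (z - v) * H \<epsilon> a v) \<partial>lborel) + (\<integral>\<^sup>+v. ennreal (\<kappa>3 (z - v) * (Rb r v * H \<epsilon> a v)) \<partial>lborel))
     + ennreal c * (ennreal (u \<epsilon> a z) * XB b r z))))\<^sup>2 \<partial>lborel)
    \<le> ennreal (\<Theta> \<epsilon> r) * (\<integral>\<^sup>+z. ennreal ((H \<epsilon> a z)\<^sup>2) \<partial>lborel)
      + ennreal (4 * c\<^sup>2) * (\<integral>\<^sup>+z. (ennreal (u \<epsilon> a z) * XB b r z)\<^sup>2 \<partial>lborel)"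
proof -
  define Q where "Q = (\<integral>\<^sup>+z. ennreal ((H \<epsilon> a z)\<^sup>2) \<partial>lborel)"
  define b1 where "b1 = (\<lambda>z. \<integral>\<^sup>+v. ennreal (\<kappa>1 \<epsilon> (z - v) * H \<epsilon> a v) \<partial>lborel)"
  define b2 where "b2 = (\<lambda>z. \<integral>\<^sup>+v. ennreal (\<kappa>2 r (z - v) * H \<epsilon> a v) \<partial>lborel)"
  define b3 where "b3 = (\<lambda>z. \<integral>\<^sup>+v. ennreal (\<kappa>3 (z - v) * (Rb r v * H \<epsilon> a v)) \<partial>lborel)"
  define w where "w = (\<lambda>z. ennreal (u \<epsilon> a z) * XB b r z)"
  have [measurable]: "b1 \<in> borel_measurable borel" "b2 \<in> borel_measurable borel" "b3 \<in> borel_measurable borel" "w \<in> borel_measurable borel"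
    unfolding b1_def b2_def b3_def w_def by measurable
  have pt: "(b1 z + (ennreal c * (b2 z + b3 z) + ennreal c * w z))\<^sup>2
     \<le> 2 * (b1 z)\<^sup>2 + (ennreal (8 * c\<^sup>2) * (b2 z)\<^sup>2 + (ennreal (8 * c\<^sup>2) * (b3 z)\<^sup>2 + ennreal (4 * c\<^sup>2) * (w z)\<^sup>2))" for z
  proof -
    have "(b1 z + (ennreal c * (b2 z + b3 z) + ennreal c * w z))\<^sup>2 \<le> 2 * (b1 z)\<^sup>2 + 2 * (ennreal c * (b2 z + b3 z) + ennreal c * w z)\<^sup>2"
      by (rule ennreal_square_add_le2)
    also have "\<dots> \<le> 2 * (b1 z)\<^sup>2 + 2 * (2 * (ennreal c * (b2 z + b3 z))\<^sup>2 + 2 * (ennreal c * w z)\<^sup>2)"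
      by (intro add_left_mono mult_left_mono ennreal_square_add_le2) simp
    also have "(ennreal c * (b2 z + b3 z))\<^sup>2 = ennreal (c\<^sup>2) * (b2 z + b3 z)\<^sup>2"
      using c_pos by (simp add: power_mult_distrib ennreal_power)
    also have "(ennreal c * w z)\<^sup>2 = ennreal (c\<^sup>2) * (w z)\<^sup>2"
      using c_pos by (simp add: power_mult_distrib ennreal_power)
    also have "2 * (b1 z)\<^sup>2 + 2 * (2 * (ennreal (c\<^sup>2) * (b2 z + b3 z)\<^sup>2) + 2 * (ennreal (c\<^sup>2) * (w z)\<^sup>2))
       \<le> 2 * (b1 z)\<^sup>2 + 2 * (2 * (ennreal (c\<^sup>2) * (2 * (b2 z)\<^sup>2 + 2 * (b3 z)\<^sup>2)) + 2 * (ennreal (c\<^sup>2) * (w z)\<^sup>2))"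
      by (intro add_mono mult_left_mono ennreal_square_add_le2) auto
    also have "\<dots> = 2 * (b1 z)\<^sup>2 + (ennreal (8 * c\<^sup>2) * (b2 z)\<^sup>2 + (ennreal (8 * c\<^sup>2) * (b3 z)\<^sup>2 + ennreal (4 * c\<^sup>2) * (w z)\<^sup>2))"
    proof -
      have "ennreal (8 * c\<^sup>2) = 8 * ennreal (c\<^sup>2)" "ennreal (4 * c\<^sup>2) = 4 * ennreal (c\<^sup>2)"
        by (simp_all add: ennreal_mult)
      moreover have "2 * (2 * (x * (2 * y))) = 8 * x * y" "2 * (2 * (x * y)) = 4 * x * y" for x y :: ennreal
        by (simp_all add: mult_ac)
      ultimately show ?thesis by (simp only: distrib_left add.assoc)
    qed
    finally show ?thesis .
  qed
  have I1: "(\<integral>\<^sup>+z. (b1 z)\<^sup>2 \<partial>lborel) \<le> ennreal (4 * (W1 \<epsilon>)\<^sup>2) * Q"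
    unfolding b1_def Q_def W1_def by (intro nn_integral_conv_le integrable_\<kappa>1 e) auto
  have I2: "(\<integral>\<^sup>+z. (b2 z)\<^sup>2 \<partial>lborel) \<le> ennreal (4 * (W2 r)\<^sup>2) * Q"
    unfolding b2_def Q_def W2_def by (intro nn_integral_conv_le integrable_\<kappa>2) auto
  have J3: "(\<integral>y. \<kappa>3 y \<partial>lborel) = Ck * J" by (simp add: \<kappa>3_def J_def)
  have I3: "(\<integral>\<^sup>+z. (b3 z)\<^sup>2 \<partial>lborel) \<le> ennreal (4 * (Ck * J)\<^sup>2 * (4 * B * (Ck * J) * Ck * Kl * W3 r)) * Q"
  proof -
    have "(\<integral>\<^sup>+z. (b3 z)\<^sup>2 \<partial>lborel) \<le> ennreal (4 * (Ck * J)\<^sup>2) * (\<integral>\<^sup>+v. ennreal ((Rb r v * H \<epsilon> a v)\<^sup>2) \<partial>lborel)"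
      unfolding b3_def
      using nn_integral_eq_integral[OF integrable_\<kappa>3] Rb_bounds Ck_pos J_nonneg
      by (intro schur_square) (auto simp: J3)
    also have "\<dots> \<le> ennreal (4 * (Ck * J)\<^sup>2) * (ennreal (4 * B * (Ck * J) * Ck * Kl * W3 r) * Q)"
      unfolding Q_def by (intro mult_left_mono RbH_sq e) simp
    also have "\<dots> = ennreal (4 * (Ck * J)\<^sup>2 * (4 * B * (Ck * J) * Ck * Kl * W3 r)) * Q"
      using B_pos Ck_pos J_nonneg Kl_pos W3_nonneg[of r]
      by (subst ennreal_mult[of "4 * (Ck * J)\<^sup>2"]) (simp_all add: mult.assoc)
    finally show ?thesis .
  qed
  have "(\<integral>\<^sup>+z. (b1 z + (ennreal c * (b2 z + b3 z) + ennreal c * w z))\<^sup>2 \<partial>lborel)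
    \<le> (\<integral>\<^sup>+z. 2 * (b1 z)\<^sup>2 + (ennreal (8 * c\<^sup>2) * (b2 z)\<^sup>2 + (ennreal (8 * c\<^sup>2) * (b3 z)\<^sup>2 + ennreal (4 * c\<^sup>2) * (w z)\<^sup>2)) \<partial>lborel)"
    by (rule nn_integral_mono[OF pt])
  also have "\<dots> = 2 * (\<integral>\<^sup>+z. (b1 z)\<^sup>2 \<partial>lborel) + (ennreal (8 * c\<^sup>2) * (\<integral>\<^sup>+z. (b2 z)\<^sup>2 \<partial>lborel) + (ennreal (8 * c\<^sup>2) * (\<integral>\<^sup>+z. (b3 z)\<^sup>2 \<partial>lborel) + ennreal (4 * c\<^sup>2) * (\<integral>\<^sup>+z. (w z)\<^sup>2 \<partial>lborel)))"
    by (simp add: nn_integral_add nn_integral_cmult)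
  also have "\<dots> \<le> 2 * (ennreal (4 * (W1 \<epsilon>)\<^sup>2) * Q) + (ennreal (8 * c\<^sup>2) * (ennreal (4 * (W2 r)\<^sup>2) * Q) + (ennreal (8 * c\<^sup>2) * (ennreal (4 * (Ck * J)\<^sup>2 * (4 * B * (Ck * J) * Ck * Kl * W3 r)) * Q) + ennreal (4 * c\<^sup>2) * (\<integral>\<^sup>+z. (w z)\<^sup>2 \<partial>lborel)))"
    by (intro add_mono mult_left_mono I1 I2 I3) auto
  also have "\<dots> = ennreal (\<Theta> \<epsilon> r) * Q + ennreal (4 * c\<^sup>2) * (\<integral>\<^sup>+z. (w z)\<^sup>2 \<partial>lborel)"
  proof -
    have nn: "0 \<le> 4 * (Ck * J)\<^sup>2 * (4 * B * (Ck * J) * Ck * Kl * W3 r)"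
      using B_pos Ck_pos J_nonneg Kl_pos W3_nonneg[of r] by (intro mult_nonneg_nonneg) auto
    have split: "ennreal (2 * x + (p * y + p * q)) = 2 * ennreal x + (ennreal p * ennreal y + ennreal p * ennreal q)"
      if "0 \<le> x" "0 \<le> y" "0 \<le> q" "0 \<le> p" for x y p q
      using that by (simp add: ennreal_mult)
    have th: "\<Theta> \<epsilon> r = 2 * (4 * (W1 \<epsilon>)\<^sup>2) + (8 * c\<^sup>2 * (4 * (W2 r)\<^sup>2) + 8 * c\<^sup>2 * (4 * (Ck * J)\<^sup>2 * (4 * B * (Ck * J) * Ck * Kl * W3 r)))"
      by (simp add: \<Theta>_def)
    have "ennreal (\<Theta> \<epsilon> r) = 2 * ennreal (4 * (W1 \<epsilon>)\<^sup>2) + (ennreal (8 * c\<^sup>2) * ennreal (4 * (W2 r)\<^sup>2) + ennreal (8 * c\<^sup>2) * ennreal (4 * (Ck * J)\<^sup>2 * (4 * B * (Ck * J) * Ck * Kl * W3 r)))"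
      unfolding th using nn by (intro split) auto
    then show ?thesis by (simp only: distrib_right mult.assoc add.assoc)
  qed
  finally show ?thesis by (simp only: b1_def b2_def b3_def w_def Q_def)
qed

text \<open>Along \<epsilon> = 1/(m + 1) and r = m all three terms of \<open>\<Theta>\<close> tend
  to 0, so one index controls both parameters.\<close>

lemma small_parameters:
  assumes "0 < \<eta>"
  obtains \<epsilon> r where "0 < \<epsilon>" "\<epsilon> \<le> 1" "0 \<le> r" "\<Theta> \<epsilon> r \<le> \<eta>"
proof -
  have "(\<lambda>m. \<Theta> (1 / real (Suc m)) (real m)) \<longlonglongrightarrow> 8 * 0\<^sup>2 + 32 * c\<^sup>2 * 0\<^sup>2 + 32 * c\<^sup>2 * (Ck * J)\<^sup>2 * (4 * B * (Ck * J) * Ck * Kl * 0)"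
    unfolding \<Theta>_def by (intro tendsto_intros W1_tendsto W2_tendsto W3_tendsto)
  then have "eventually (\<lambda>m. \<Theta> (1 / real (Suc m)) (real m) < \<eta>) sequentially"
    by (rule order_tendstoD) (use assms in simp)
  then obtain m where "\<Theta> (1 / real (Suc m)) (real m) < \<eta>"
    by (auto simp: eventually_sequentially)
  then show thesis by (intro that[of "1 / real (Suc m)" "real m"]) auto
qed

text \<open>The weighted norm \<open>Q\<close> is at most \<theta> \<open>Q\<close> plus the lattice
  term, with \<theta> < 1. As \<open>u\<close> equals 1 at its centre, evaluating at
  \<open>a\<close> removes the weight. \<open>K\<close> is fixed before \<open>b\<close> and
  \<open>a\<close>, which makes the bound uniform in the point.\<close>

theorem core_bound:
  obtains K where "K \<ge> 0"
    "\<And>b a. (\<And>l. 0 \<le> b l) \<Longrightarrow> (\<And>l w. l \<in> L \<Longrightarrow> cmod (g l w) \<le> b l) \<Longrightarrow>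
       ennreal (cmod (F a)) \<le> ennreal K * (\<integral>\<^sup>+l. ennreal (b l * kap M (a - l)) \<partial>count_space L)"
proof -
  have g2: "\<gamma>\<^sup>2 < 1" using \<gamma>_range by (simp add: power_less_one_iff abs_square_less_1)
  \<comment> \<open>Of the gap 1 - \<gamma>^2 one half is spent on the factor 1 + t, as t \<gamma>^2
    is at most t, and one quarter on the perturbation through \<eta>; the remaining quarter keeps
    \<theta> below 1.\<close>
  define t where "t = (1 - \<gamma>\<^sup>2) / 2"
  have t: "t > 0" using g2 by (simp add: t_def)
  define \<eta> where "\<eta> = ((1 - \<gamma>\<^sup>2) / 4) / (1 + 1 / t)"
  have t1: "1 + 1 / t > 0" using t by (intro add_pos_pos) auto
  then have "\<eta> > 0" using g2 by (auto simp: \<eta>_def intro!: divide_pos_pos)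
  then obtain \<epsilon> r where er: "0 < \<epsilon>" "\<epsilon> \<le> 1" "0 \<le> r" "\<Theta> \<epsilon> r \<le> \<eta>" using small_parameters by blast
  define \<theta> where "\<theta> = (1 + t) * \<gamma>\<^sup>2 + (1 + 1 / t) * \<Theta> \<epsilon> r"
  have "(1 + 1 / t) * \<Theta> \<epsilon> r \<le> (1 + 1 / t) * \<eta>" using t1 er by (intro mult_left_mono) auto
  also have "\<dots> = (1 - \<gamma>\<^sup>2) / 4" using less_imp_neq[OF t1] unfolding \<eta>_def by (metis nonzero_mult_div_cancel_left times_divide_eq_right)
  finally have th1: "(1 + 1 / t) * \<Theta> \<epsilon> r \<le> (1 - \<gamma>\<^sup>2) / 4" .
  have "t * \<gamma>\<^sup>2 \<le> t * 1" using g2 t by (intro mult_left_mono) auto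
  then have tg: "t * \<gamma>\<^sup>2 \<le> t" by simp
  have t2: "t = (1 - \<gamma>\<^sup>2) / 2" by (simp add: t_def)
  have "\<theta> = \<gamma>\<^sup>2 + t * \<gamma>\<^sup>2 + (1 + 1 / t) * \<Theta> \<epsilon> r" by (simp only: \<theta>_def distrib_right mult_1_left)
  also have "\<dots> \<le> \<gamma>\<^sup>2 + (1 - \<gamma>\<^sup>2) / 2 + (1 - \<gamma>\<^sup>2) / 4"
    using th1 tg by (intro add_mono order_refl) (simp_all only: t2[symmetric])
  also have "\<dots> < 1" using g2 by (simp add: field_simps)
  finally have \<theta>: "\<theta> < 1" .
  have \<theta>0: "0 \<le> \<theta>" unfolding \<theta>_def using t t1 \<Theta>_nonneg by (intro add_nonneg_nonneg mult_nonneg_nonneg) auto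
  obtain K2 where K2: "K2 \<ge> 0" "\<And>b a. (\<And>l. 0 \<le> b l) \<Longrightarrow> (\<integral>\<^sup>+z. (ennreal (u \<epsilon> a z) * XB b r z)\<^sup>2 \<partial>lborel)
     \<le> ennreal K2 * (\<integral>\<^sup>+l. ennreal (b l * kap M (a - l)) \<partial>count_space L)\<^sup>2"
    using uXB_sq[OF er(1-3)] by blast
  define K3 where "K3 = ((1 + 1 / t) * (4 * c\<^sup>2) * K2) / (1 - \<theta>)"
  define K4 where "K4 = 4 * (Ck * J) * Ck * K3"
  have K3: "K3 \<ge> 0" unfolding K3_def using t1 K2 \<theta> by (intro divide_nonneg_nonneg mult_nonneg_nonneg) auto
  have K4: "K4 \<ge> 0" unfolding K4_def using K3 Ck_pos J_nonneg by simp
  have "ennreal (cmod (F a)) \<le> ennreal (sqrt K4) * (\<integral>\<^sup>+l. ennreal (b l * kap M (a - l)) \<partial>count_space L)"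
    if b: "\<And>l. 0 \<le> b l" "\<And>l w. l \<in> L \<Longrightarrow> cmod (g l w) \<le> b l" for b a
  proof (rule ennreal_square_le_imp[OF _ K4])
    define Y where "Y = (\<integral>\<^sup>+l. ennreal (b l * kap M (a - l)) \<partial>count_space L)"
    define Q where "Q = (\<integral>\<^sup>+z. ennreal ((H \<epsilon> a z)\<^sup>2) \<partial>lborel)"
    define p1 where "p1 = (\<lambda>z. ennreal (cmod (\<integral>v. k z v * G \<epsilon> a v \<partial>lborel)))"
    define p2 where "p2 = (\<lambda>z. (\<integral>\<^sup>+v. ennreal (\<kappa>1 \<epsilon> (z - v) * H \<epsilon> a v) \<partial>lborel)
     + (ennreal c * ((\<integral>\<^sup>+v. ennreal (\<kappa>2 r (z - v) * H \<epsilon> a v) \<partial>lborel) + (\<integral>\<^sup>+v. ennreal (\<kappa>3 (z - v) * (Rb r v * H \<epsilon> a v)) \<partial>lborel))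
     + ennreal c * (ennreal (u \<epsilon> a z) * XB b r z)))"
    have [measurable]: "p1 \<in> borel_measurable borel" "p2 \<in> borel_measurable borel"
      unfolding p1_def p2_def by measurable
    have e: "\<bar>\<epsilon>\<bar> \<le> 1" "\<epsilon> \<noteq> 0" using er by auto
    have "Q \<le> (\<integral>\<^sup>+z. ennreal (1 + t) * (p1 z)\<^sup>2 + ennreal (1 + 1 / t) * (p2 z)\<^sup>2 \<partial>lborel)"
      unfolding Q_def
    proof (rule nn_integral_mono)
      fix z
      have "ennreal ((H \<epsilon> a z)\<^sup>2) = (ennreal (H \<epsilon> a z))\<^sup>2" by (simp add: ennreal_power)
      also have "\<dots> \<le> (p1 z + p2 z)\<^sup>2"
        unfolding p1_def p2_def by (intro power_mono H_le e er b) auto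
      also have "\<dots> \<le> ennreal (1 + t) * (p1 z)\<^sup>2 + ennreal (1 + 1 / t) * (p2 z)\<^sup>2"
        by (rule ennreal_square_add_le[OF t])
      finally show "ennreal ((H \<epsilon> a z)\<^sup>2) \<le> ennreal (1 + t) * (p1 z)\<^sup>2 + ennreal (1 + 1 / t) * (p2 z)\<^sup>2" .
    qed
    also have "\<dots> = ennreal (1 + t) * (\<integral>\<^sup>+z. (p1 z)\<^sup>2 \<partial>lborel) + ennreal (1 + 1 / t) * (\<integral>\<^sup>+z. (p2 z)\<^sup>2 \<partial>lborel)"
      by (subst nn_integral_add) (auto simp: nn_integral_cmult)
    also have "\<dots> \<le> ennreal (1 + t) * (ennreal (\<gamma>\<^sup>2) * Q)
        + ennreal (1 + 1 / t) * (ennreal (\<Theta> \<epsilon> r) * Q + ennreal (4 * c\<^sup>2) * (\<integral>\<^sup>+z. (ennreal (u \<epsilon> a z) * XB b r z)\<^sup>2 \<partial>lborel))"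
      unfolding p1_def p2_def Q_def by (intro add_mono mult_left_mono PG_sq perturbation_sq e) auto
    also have "\<dots> \<le> ennreal (1 + t) * (ennreal (\<gamma>\<^sup>2) * Q)
        + ennreal (1 + 1 / t) * (ennreal (\<Theta> \<epsilon> r) * Q + ennreal (4 * c\<^sup>2) * (ennreal K2 * Y\<^sup>2))"
      unfolding Y_def by (intro add_left_mono mult_left_mono K2 b) auto
    also have "\<dots> = ennreal \<theta> * Q + ennreal ((1 + 1 / t) * (4 * c\<^sup>2) * K2) * Y\<^sup>2"
    proof -
      have "ennreal \<theta> = ennreal (1 + t) * ennreal (\<gamma>\<^sup>2) + ennreal (1 + 1 / t) * ennreal (\<Theta> \<epsilon> r)"
        unfolding \<theta>_def using t t1 \<Theta>_nonneg[of \<epsilon> r] \<gamma>_range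
        by (subst ennreal_plus) (auto simp: ennreal_mult intro!: mult_nonneg_nonneg)
      moreover have "ennreal ((1 + 1 / t) * (4 * c\<^sup>2) * K2) = ennreal (1 + 1 / t) * ennreal (4 * c\<^sup>2) * ennreal K2"
        using t1 K2 by (simp add: ennreal_mult)
      ultimately show ?thesis by (simp only: distrib_right distrib_left mult.assoc add.assoc)
    qed
    finally have QY: "Q \<le> ennreal \<theta> * Q + ennreal ((1 + 1 / t) * (4 * c\<^sup>2) * K2) * Y\<^sup>2" .
    \<comment> \<open>Without finiteness the inequality \<open>QY\<close> could not be solved for
      \<open>Q\<close>.\<close>
    have "Q < \<infinity>" unfolding Q_def by (rule Q_finite[OF e(2)])
    then obtain q where q: "Q = ennreal q" "q \<ge> 0" by (cases Q) auto
    have QK3: "Q \<le> ennreal K3 * Y\<^sup>2"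
    proof (cases Y)
      case (real y)
      have real_le: "q \<le> \<theta> * q + e * y\<^sup>2" if "0 \<le> e" "ennreal q \<le> ennreal \<theta> * ennreal q + ennreal e * (ennreal y)\<^sup>2" for e
        using that q(2) real(1) \<theta>0
        by (simp add: ennreal_mult''[symmetric] ennreal_power ennreal_plus[symmetric] del: ennreal_plus)
      have "q \<le> \<theta> * q + ((1 + 1 / t) * (4 * c\<^sup>2) * K2) * y\<^sup>2"
        using QY K2(1) t1 unfolding q(1) real(2) by (intro real_le mult_nonneg_nonneg) auto
      then have "(1 - \<theta>) * q \<le> ((1 + 1 / t) * (4 * c\<^sup>2) * K2) * y\<^sup>2" by (simp add: algebra_simps)
      then have "q \<le> K3 * y\<^sup>2"
        unfolding K3_def using \<theta> by (simp add: pos_le_divide_eq mult.commute)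
      then show ?thesis unfolding q(1) real(2) using real(1) K3 by (simp add: ennreal_power ennreal_mult'[symmetric] ennreal_leI)
    next
      case top
      show ?thesis
      \<comment> \<open>With \<open>K3 = 0\<close> the right side is 0 by the convention 0 *
        \<infinity> = 0, so \<open>Q = 0\<close> has to be derived from Q \<le> \<theta> Q.\<close>
      proof (cases "K3 = 0")
        case False
        then show ?thesis using top K3 by (simp add: top_power_ennreal ennreal_mult_top)
      next
        case True
        then have K2_0: "(1 + 1 / t) * (4 * c\<^sup>2) * K2 = 0" using \<theta> by (simp add: K3_def)
        have "Q \<le> ennreal (\<theta> * q)" using QY unfolding K2_0 using q \<theta>0 by (simp add: ennreal_mult'[symmetric])
        then have "q \<le> \<theta> * q" using q \<theta>0 by simp
        then have "q = 0" using \<theta> q(2) by (metis less_eq_real_def mult_le_cancel_right1 not_le)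
        then show ?thesis using q by simp
      qed
    qed
    have "ennreal (cmod (F a)) = ennreal (H \<epsilon> a a)" by (simp add: H_def u_def kap_def)
    then have "(ennreal (cmod (F a)))\<^sup>2 = ennreal ((H \<epsilon> a a)\<^sup>2)" by (simp add: ennreal_power)
    also have "\<dots> \<le> ennreal (4 * (Ck * J)) * (\<integral>\<^sup>+v. ennreal (\<kappa>3 (a - v) * (H \<epsilon> a v)\<^sup>2) \<partial>lborel)"
      by (rule F_sq_le_conv[OF e(1)])
    also have "\<dots> \<le> ennreal (4 * (Ck * J)) * (\<integral>\<^sup>+v. ennreal Ck * ennreal ((H \<epsilon> a v)\<^sup>2) \<partial>lborel)"
    proof (intro mult_left_mono nn_integral_mono)
      fix v
      have "\<kappa>3 (a - v) \<le> Ck * 1" unfolding \<kappa>3_def using Ck_pos by (intro mult_left_mono) auto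
      then have "\<kappa>3 (a - v) * (H \<epsilon> a v)\<^sup>2 \<le> Ck * (H \<epsilon> a v)\<^sup>2" by (intro mult_right_mono) auto
      then show "ennreal (\<kappa>3 (a - v) * (H \<epsilon> a v)\<^sup>2) \<le> ennreal Ck * ennreal ((H \<epsilon> a v)\<^sup>2)"
        using Ck_pos by (simp add: ennreal_mult'[symmetric] ennreal_leI)
    qed simp
    also have "\<dots> = ennreal (4 * (Ck * J)) * (ennreal Ck * Q)"
      unfolding Q_def by (subst nn_integral_cmult) auto
    also have "\<dots> \<le> ennreal (4 * (Ck * J)) * (ennreal Ck * (ennreal K3 * Y\<^sup>2))"
      by (intro mult_left_mono QK3) auto
    also have "\<dots> = ennreal K4 * Y\<^sup>2"
      unfolding K4_def using Ck_pos J_nonneg K3 by (subst (2) mult.assoc[symmetric])+ (simp add: ennreal_mult mult_ac)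
    finally show "(ennreal (cmod (F a)))\<^sup>2 \<le> ennreal K4 * (\<integral>\<^sup>+l. ennreal (b l * kap M (a - l)) \<partial>count_space L)\<^sup>2"
      by (simp add: Y_def)
  qed
  then show thesis using that[of "sqrt K4"] K4 by auto
qed

end

subsection \<open>Partial derivatives\<close>

lemma partial_deriv_eqI:
  "(g has_derivative g') (at x) \<Longrightarrow> partial_deriv i g x = g' (axis i 1)"
  unfolding partial_deriv_def using frechet_derivative_at by metis

lemma has_derivative_frechet:
  "g differentiable (at x) \<Longrightarrow> (g has_derivative frechet_derivative g (at x)) (at x)"
  by (simp add: frechet_derivative_works)

lemma frechet_derivative_eq_sum:
  fixes g :: "real^'n::finite \<Rightarrow> complex"
  assumes "g differentiable (at x)"
  shows "frechet_derivative g (at x) h = (\<Sum>i\<in>UNIV. (h $ i) *\<^sub>R partial_deriv i g x)"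
proof -
  have lin: "linear (frechet_derivative g (at x))"
    using has_derivative_frechet[OF assms] has_derivative_linear by blast
  have "frechet_derivative g (at x) h = frechet_derivative g (at x) (\<Sum>i\<in>UNIV. (h $ i) *\<^sub>R axis i 1)"
    by (simp add: basis_expansion scalar_mult_eq_scaleR[symmetric])
  also have "\<dots> = (\<Sum>i\<in>UNIV. (h $ i) *\<^sub>R partial_deriv i g x)"
    by (simp add: linear_sum[OF lin] linear_scale[OF lin] partial_deriv_def)
  finally show ?thesis .
qed

lemma has_vector_derivative_line:
  fixes g :: "real^'n::finite \<Rightarrow> complex"
  assumes "g differentiable (at (t + s *\<^sub>R axis i 1))"
  shows "((\<lambda>s. g (t + s *\<^sub>R axis i 1)) has_vector_derivative partial_deriv i g (t + s *\<^sub>R axis i 1)) (at s within S)"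
proof -
  have "((\<lambda>s. t + s *\<^sub>R axis i 1) has_derivative (\<lambda>h. h *\<^sub>R axis i (1::real))) (at s within S)"
    by (auto intro!: derivative_eq_intros)
  from has_derivative_compose[OF this has_derivative_frechet[OF assms]]
  have "((\<lambda>s. g (t + s *\<^sub>R axis i 1)) has_derivative (\<lambda>h. frechet_derivative g (at (t + s *\<^sub>R axis i 1)) (h *\<^sub>R axis i 1))) (at s within S)" .
  moreover have "linear (frechet_derivative g (at (t + s *\<^sub>R axis i 1)))"
    using has_derivative_frechet[OF assms] has_derivative_linear by blast
  ultimately show ?thesis
    by (simp add: has_vector_derivative_def linear_scale partial_deriv_def)
qed

text \<open>Taken along a sequence, as dominated convergence requires: derivatives under an integral
  are always reached through these quotients.\<close>

lemma difference_quotient_tendsto: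
  fixes g :: "real^'n::finite \<Rightarrow> complex"
  assumes "g differentiable (at t)"
  shows "(\<lambda>m. (g (t + (1 / real (Suc m)) *\<^sub>R axis i 1) - g t) * of_nat (Suc m)) \<longlonglongrightarrow> partial_deriv i g t"
proof -
  have "((\<lambda>s. g (t + s *\<^sub>R axis i 1)) has_vector_derivative partial_deriv i g t) (at 0)"
    using has_vector_derivative_line[of g t 0 i UNIV] assms by simp
  then have lim: "((\<lambda>h. norm (g (t + h *\<^sub>R axis i 1) - g t - h *\<^sub>R partial_deriv i g t) / norm h) \<longlongrightarrow> 0) (at 0)"
    by (simp add: has_vector_derivative_def has_derivative_at)
  have "filterlim (\<lambda>m. 1 / real (Suc m)) (at 0) sequentially"
    using LIMSEQ_inverse_real_of_nat by (intro filterlim_atI) (auto simp: inverse_eq_divide)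
  from filterlim_compose[OF lim this]
  have "(\<lambda>m. norm ((g (t + (1 / real (Suc m)) *\<^sub>R axis i 1) - g t) * of_nat (Suc m) - partial_deriv i g t)) \<longlonglongrightarrow> 0"
  proof (rule Lim_transform_eventually, intro always_eventually allI)
    fix m
    have "norm ((g (t + (1 / real (Suc m)) *\<^sub>R axis i 1) - g t) * of_nat (Suc m) - partial_deriv i g t)
      = norm (of_nat (Suc m) * (g (t + (1 / real (Suc m)) *\<^sub>R axis i 1) - g t - (1 / real (Suc m)) *\<^sub>R partial_deriv i g t))"
      by (rule arg_cong[where f=norm]) (simp add: scaleR_conv_of_real field_simps del: of_nat_Suc)
    also have "\<dots> = real (Suc m) * norm (g (t + (1 / real (Suc m)) *\<^sub>R axis i 1) - g t - (1 / real (Suc m)) *\<^sub>R partial_deriv i g t)"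
      by (simp only: norm_mult norm_of_nat)
    also have "\<dots> = norm (g (t + (1 / real (Suc m)) *\<^sub>R axis i 1) - g t - (1 / real (Suc m)) *\<^sub>R partial_deriv i g t) / norm (1 / real (Suc m))"
      by (simp del: of_nat_Suc)
    finally show "norm (g (t + (1 / real (Suc m)) *\<^sub>R axis i 1) - g t - (1 / real (Suc m)) *\<^sub>R partial_deriv i g t) / norm (1 / real (Suc m))
      = norm ((g (t + (1 / real (Suc m)) *\<^sub>R axis i 1) - g t) * of_nat (Suc m) - partial_deriv i g t)" by simp
  qed
  then show ?thesis by (simp only: tendsto_norm_zero_iff LIM_zero_iff)
qed

lemma difference_bound:
  fixes g :: "real^'n::finite \<Rightarrow> complex"
  assumes "\<And>x. g differentiable (at x)" "0 \<le> \<tau>"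
    and "\<And>s. 0 \<le> s \<Longrightarrow> s \<le> \<tau> \<Longrightarrow> cmod (partial_deriv i g (t + s *\<^sub>R axis i 1)) \<le> B"
  shows "cmod (g (t + \<tau> *\<^sub>R axis i 1) - g t) \<le> B * \<tau>"
proof -
  have "norm (g (t + \<tau> *\<^sub>R axis i 1) - g (t + 0 *\<^sub>R axis i 1)) \<le> B * norm (\<tau> - 0)"
  proof (rule differentiable_bound[where S="{0..\<tau>}" and f="\<lambda>s. g (t + s *\<^sub>R axis i 1)"
        and f'="\<lambda>s h. h *\<^sub>R partial_deriv i g (t + s *\<^sub>R axis i 1)"])
    show "((\<lambda>s. g (t + s *\<^sub>R axis i 1)) has_derivative (\<lambda>h. h *\<^sub>R partial_deriv i g (t + s *\<^sub>R axis i 1))) (at s within {0..\<tau>})" for s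
      using has_vector_derivative_line[OF assms(1)] by (simp add: has_vector_derivative_def)
    show "onorm (\<lambda>h. h *\<^sub>R partial_deriv i g (t + s *\<^sub>R axis i 1)) \<le> B" if "s \<in> {0..\<tau>}" for s
    proof (rule onorm_le)
      fix h
      show "norm (h *\<^sub>R partial_deriv i g (t + s *\<^sub>R axis i 1)) \<le> B * norm h"
        using mult_right_mono[OF assms(3)[of s] abs_ge_zero[of h]] that by (simp add: mult.commute)
    qed
  qed (use assms(2) in auto)
  then show ?thesis using assms(2) by simp
qed

section \<open>Iterated derivatives, smooth functions and Schwartz functions\<close>

lemma iter_Nil [simp]: "iter_partial_deriv [] g = g"
  and iter_Cons: "iter_partial_deriv (i # is) g = partial_deriv i (iter_partial_deriv is g)"
  and iter_snoc: "iter_partial_deriv (is @ [i]) g = iter_partial_deriv is (partial_deriv i g)"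
  by (simp_all add: iter_partial_deriv_def)

text \<open>Graded by order so that closure properties can be proved by induction: the derivative of
  an atom involves the atom itself, and only the order decreases.\<close>

definition smooth_upto :: "nat \<Rightarrow> (real^'n::finite \<Rightarrow> complex) \<Rightarrow> bool" where
  "smooth_upto m g \<longleftrightarrow> (\<forall>is. length is \<le> m \<longrightarrow> (\<forall>x. iter_partial_deriv is g differentiable (at x)))"

lemma smooth_upto_0: "smooth_upto 0 g \<longleftrightarrow> (\<forall>x. g differentiable (at x))"
  by (simp add: smooth_upto_def)

text \<open>The last list entry is the derivative taken first, so the recursion peels lists from the
  right.\<close>

lemma smooth_upto_Suc:
  fixes g :: "real^'n::finite \<Rightarrow> complex"
  shows "smooth_upto (Suc m) g \<longleftrightarrow> (\<forall>x. g differentiable (at x)) \<and> (\<forall>i. smooth_upto m (partial_deriv i g))"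
proof (intro iffI conjI allI)
  assume *: "smooth_upto (Suc m) g"
  show "g differentiable (at x)" for x
    using * unfolding smooth_upto_def by (metis iter_Nil le0 list.size(3))
  show "smooth_upto m (partial_deriv i g)" for i
    unfolding smooth_upto_def
  proof (intro allI impI)
    fix "is" :: "'n list" and x assume "length is \<le> m"
    then have "length (is @ [i]) \<le> Suc m" by simp
    then show "iter_partial_deriv is (partial_deriv i g) differentiable (at x)"
      using * unfolding smooth_upto_def by (metis iter_snoc)
  qed
next
  assume *: "(\<forall>x. g differentiable (at x)) \<and> (\<forall>i. smooth_upto m (partial_deriv i g))"
  show "smooth_upto (Suc m) g"
    unfolding smooth_upto_def
  proof (intro allI impI)
    fix "is" :: "'n list" and x assume "length is \<le> Suc m"
    then show "iter_partial_deriv is g differentiable (at x)"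
      using * by (cases "is" rule: rev_cases) (auto simp: iter_snoc smooth_upto_def)
  qed
qed

lemma partial_deriv_add_cmult:
  assumes "g differentiable (at x)" "h differentiable (at x)"
  shows "partial_deriv i (\<lambda>t. g t + c * h t) x = partial_deriv i g x + c * partial_deriv i h x"
proof -
  have "((\<lambda>t. g t + c * h t) has_derivative (\<lambda>v. frechet_derivative g (at x) v + c * frechet_derivative h (at x) v)) (at x)"
    using assms by (auto intro!: derivative_eq_intros has_derivative_frechet)
  then show ?thesis by (subst partial_deriv_eqI) (auto simp: partial_deriv_def)
qed

lemma smooth_upto_add_cmult:
  assumes "smooth_upto m g" "smooth_upto m h"
  shows "smooth_upto m (\<lambda>t. g t + c * h t)"
  using assms
proof (induction m arbitrary: g h)
  case 0
  then show ?case by (auto simp: smooth_upto_0)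
next
  case (Suc m)
  then have d: "\<And>x. g differentiable (at x)" "\<And>x. h differentiable (at x)"
    and s: "\<And>i. smooth_upto m (partial_deriv i g)" "\<And>i. smooth_upto m (partial_deriv i h)"
    by (auto simp: smooth_upto_Suc)
  have "partial_deriv i (\<lambda>t. g t + c * h t) = (\<lambda>t. partial_deriv i g t + c * partial_deriv i h t)" for i
    by (rule ext) (rule partial_deriv_add_cmult[OF d])
  then show ?case
    using d Suc.IH[OF s] by (auto simp: smooth_upto_Suc)
qed

definition smooth :: "(real^'n::finite \<Rightarrow> complex) \<Rightarrow> bool" where
  "smooth g \<longleftrightarrow> (\<forall>m. smooth_upto m g)"

lemma smooth_iter: "smooth g \<Longrightarrow> iter_partial_deriv is g differentiable (at x)"
  unfolding smooth_def smooth_upto_def by blast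

lemma smooth_differentiable: "smooth g \<Longrightarrow> g differentiable (at x)"
  using smooth_iter[of g "[]"] by simp

lemma smooth_partial_deriv: "smooth g \<Longrightarrow> smooth (partial_deriv i g)"
  unfolding smooth_def by (metis smooth_upto_Suc)

lemma smooth_add_cmult: "smooth g \<Longrightarrow> smooth h \<Longrightarrow> smooth (\<lambda>t. g t + c * h t)"
  by (simp add: smooth_def smooth_upto_add_cmult)

lemma iter_add_cmult:
  assumes "smooth g" "smooth h"
  shows "iter_partial_deriv is (\<lambda>t. g t + c * h t) = (\<lambda>t. iter_partial_deriv is g t + c * iter_partial_deriv is h t)"
  by (induction "is") (auto simp: iter_Cons partial_deriv_add_cmult smooth_iter[OF assms(1)] smooth_iter[OF assms(2)])

lemma schwartz_alt:
  "schwartz g \<longleftrightarrow> smooth g \<and> (\<forall>is. \<forall>k::nat. \<exists>K. \<forall>x. (1 + norm x) ^ k * cmod (iter_partial_deriv is g x) \<le> K)"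
  by (auto simp: schwartz_def smooth_def smooth_upto_def)

lemma schwartz_smooth: "schwartz g \<Longrightarrow> smooth g"
  by (simp add: schwartz_alt)

lemma schwartz_bound:
  assumes "schwartz g"
  obtains K where "K > 0" "\<And>x. (1 + norm x) ^ k * cmod (iter_partial_deriv is g x) \<le> K"
proof -
  obtain K where K: "\<And>x. (1 + norm x) ^ k * cmod (iter_partial_deriv is g x) \<le> K"
    using assms unfolding schwartz_alt by blast
  show thesis using K by (intro that[of "max K 1"]) (auto simp: le_max_iff_disj)
qed

lemma schwartz_kap:
  assumes "schwartz g"
  obtains K where "K > 0" "\<And>x. cmod (g x) \<le> K * kap k x"
proof -
  obtain K where K: "K > 0" "\<And>x. (1 + norm x) ^ k * cmod (iter_partial_deriv [] g x) \<le> K"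
    using schwartz_bound[OF assms, of k "[]"] by blast
  show thesis using K(1) K(2) by (intro that[of K]) (auto simp: kap_def field_simps)
qed

lemma schwartz_partial_deriv: "schwartz g \<Longrightarrow> schwartz (partial_deriv i g)"
  unfolding schwartz_alt by (metis iter_snoc smooth_partial_deriv)

lemma schwartz_add_cmult:
  assumes g: "schwartz g" and h: "schwartz h"
  shows "schwartz (\<lambda>t. g t + c * h t)"
  unfolding schwartz_alt
proof (intro conjI allI)
  show "smooth (\<lambda>t. g t + c * h t)" using assms by (intro smooth_add_cmult schwartz_smooth)
  fix "is" and k :: nat
  obtain K1 where K1: "\<And>x. (1 + norm x) ^ k * cmod (iter_partial_deriv is g x) \<le> K1"
    using schwartz_bound[OF g] by metis
  obtain K2 where K2: "\<And>x. (1 + norm x) ^ k * cmod (iter_partial_deriv is h x) \<le> K2"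
    using schwartz_bound[OF h] by metis
  have "(1 + norm x) ^ k * cmod (iter_partial_deriv is (\<lambda>t. g t + c * h t) x) \<le> K1 + cmod c * K2" for x
  proof -
    have "(1 + norm x) ^ k * cmod (iter_partial_deriv is g x + c * iter_partial_deriv is h x)
       \<le> (1 + norm x) ^ k * (cmod (iter_partial_deriv is g x) + cmod c * cmod (iter_partial_deriv is h x))"
      by (intro mult_left_mono order_trans[OF norm_triangle_ineq]) (auto simp: norm_mult)
    also have "\<dots> = (1 + norm x) ^ k * cmod (iter_partial_deriv is g x) + cmod c * ((1 + norm x) ^ k * cmod (iter_partial_deriv is h x))"
      by (simp add: algebra_simps)
    also have "\<dots> \<le> K1 + cmod c * K2"
      by (intro add_mono mult_left_mono K1 K2) simp
    finally show ?thesis using assms by (simp add: iter_add_cmult schwartz_smooth)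
  qed
  then show "\<exists>K. \<forall>x. (1 + norm x) ^ k * cmod (iter_partial_deriv is (\<lambda>t. g t + c * h t) x) \<le> K" by blast
qed

lemma schwartz_cmult: "schwartz g \<Longrightarrow> schwartz (\<lambda>t. c * g t)"
  using schwartz_add_cmult[of g g "c - 1"] by (simp add: algebra_simps)

lemma schwartz_zero:
  fixes g :: "real^'n::finite \<Rightarrow> complex"
  assumes "schwartz g"
  shows "schwartz (\<lambda>t::real^'n. 0)"
  using schwartz_cmult[OF assms, where c=0] by simp

lemma schwartz_sum:
  fixes g :: "real^'n::finite \<Rightarrow> complex" and G :: "'b \<Rightarrow> real^'n \<Rightarrow> complex"
  assumes "finite D" "schwartz g" "\<And>x. x \<in> D \<Longrightarrow> schwartz (G x)"
  shows "schwartz (\<lambda>t. \<Sum>x\<in>D. c x * G x t)"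
  using assms
proof (induction D)
  case empty
  then show ?case using schwartz_zero[of g] by simp
next
  case (insert x D)
  then have "schwartz (\<lambda>t. (\<Sum>x\<in>D. c x * G x t) + c x * G x t)"
    by (intro schwartz_add_cmult) auto
  then show ?case using insert by (simp add: add.commute)
qed

text \<open>The identity reaches order \<open>Suc m\<close>, one above the order of smoothness,
  since the last derivative is taken of a function known to be differentiable.\<close>

lemma smooth_upto_cnj:
  assumes "smooth_upto m g"
  shows "smooth_upto m (\<lambda>t. cnj (g t))" "\<And>is x. length is \<le> Suc m \<Longrightarrow> iter_partial_deriv is (\<lambda>t. cnj (g t)) x = cnj (iter_partial_deriv is g x)"
proof -
  have pd: "(\<lambda>t. cnj (h t)) differentiable (at x) \<and> partial_deriv i (\<lambda>t. cnj (h t)) x = cnj (partial_deriv i h x)"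
    if "h differentiable (at x)" for h :: "real^'a \<Rightarrow> complex" and i x
  proof -
    have "((\<lambda>t. cnj (h t)) has_derivative (\<lambda>v. cnj (frechet_derivative h (at x) v))) (at x)"
      using has_derivative_frechet[OF that] by (rule has_derivative_cnj)
    then show ?thesis using partial_deriv_eqI[of "\<lambda>t. cnj (h t)"] by (auto simp: partial_deriv_def differentiable_def)
  qed
  have it: "iter_partial_deriv is (\<lambda>t. cnj (g t)) = (\<lambda>x. cnj (iter_partial_deriv is g x))" if "length is \<le> Suc m" for "is"
    using that
  proof (induction "is")
    case (Cons i "is")
    then show ?case using assms by (auto simp: iter_Cons smooth_upto_def intro!: ext pd[THEN conjunct2])
  qed simp
  then show "\<And>is x. length is \<le> Suc m \<Longrightarrow> iter_partial_deriv is (\<lambda>t. cnj (g t)) x = cnj (iter_partial_deriv is g x)" by simp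
  show "smooth_upto m (\<lambda>t. cnj (g t))"
    using assms by (auto simp: smooth_upto_def it intro!: pd[THEN conjunct1])
qed

lemma schwartz_cnj:
  assumes "schwartz g" shows "schwartz (\<lambda>t. cnj (g t))"
proof -
  have s: "smooth_upto m g" for m using schwartz_smooth[OF assms] by (simp add: smooth_def)
  have "iter_partial_deriv is (\<lambda>t. cnj (g t)) x = cnj (iter_partial_deriv is g x)" for "is" x
    by (rule smooth_upto_cnj(2)[OF s, of "is" "length is"]) simp
  then show ?thesis using assms smooth_upto_cnj(1)[OF s] by (simp add: schwartz_alt smooth_def)
qed

lemma smooth_continuous: "smooth g \<Longrightarrow> continuous_on S g"
  using smooth_differentiable differentiable_imp_continuous_within
  by (metis continuous_at_imp_continuous_on)

lemma schwartz_measurable: "schwartz g \<Longrightarrow> g \<in> borel_measurable borel"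
  by (intro borel_measurable_continuous_onI smooth_continuous schwartz_smooth)

subsection \<open>Time-frequency atoms\<close>

text \<open>The conjugate of a time-frequency shift of the conjugate of \<open>g\<close>. With it
  the short-time Fourier transform becomes a linear pairing of \<open>f\<close> with an atom, see
  \<open>stft_eq_atom\<close>.\<close>

definition atom :: "(real^'n::finite) \<times> (real^'n) \<Rightarrow> (real^'n \<Rightarrow> complex) \<Rightarrow> real^'n \<Rightarrow> complex" where
  "atom w g t = cis (- 2 * pi * (snd w \<bullet> t)) * g (t - fst w)"

lemma cnj_tf_shift: "cnj (tf_shift w g t) = atom w (\<lambda>t. cnj (g t)) t"
  by (simp add: tf_shift_def atom_def cis_cnj split: prod.split)

lemma atom_has_derivative:
  assumes "\<And>x. g differentiable (at x)"
  shows "(atom w g has_derivative (\<lambda>h. cis (- 2 * pi * (snd w \<bullet> t)) * frechet_derivative g (at (t - fst w)) h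
     + (- 2 * pi * \<i> * (snd w \<bullet> h)) * atom w g t)) (at t)"
proof -
  have g: "((\<lambda>t. g (t - fst w)) has_derivative (\<lambda>h. frechet_derivative g (at (t - fst w)) h)) (at t)"
    by (rule has_derivative_compose[OF _ has_derivative_frechet[OF assms]]) (auto intro!: derivative_eq_intros)
  have "((\<lambda>t. exp (complex_of_real (- 2 * pi * (snd w \<bullet> t)) * \<i>)) has_derivative
     (\<lambda>h. exp (complex_of_real (- 2 * pi * (snd w \<bullet> t)) * \<i>) * (complex_of_real (- 2 * pi * (snd w \<bullet> h)) * \<i>))) (at t)"
  proof (rule has_derivative_compose[OF _ DERIV_exp[unfolded has_field_derivative_def]])
    show "((\<lambda>t. complex_of_real (- 2 * pi * (snd w \<bullet> t)) * \<i>) has_derivative (\<lambda>h. complex_of_real (- 2 * pi * (snd w \<bullet> h)) * \<i>)) (at t)"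
      by (intro has_derivative_mult_left has_derivative_of_real has_derivative_mult_right has_derivative_inner_right has_derivative_ident)
  qed
  then have c: "((\<lambda>t. cis (- 2 * pi * (snd w \<bullet> t))) has_derivative
     (\<lambda>h. cis (- 2 * pi * (snd w \<bullet> t)) * (complex_of_real (- 2 * pi * (snd w \<bullet> h)) * \<i>))) (at t)"
    by (simp add: cis_conv_exp mult.commute)
  show ?thesis
    unfolding atom_def[abs_def]
    by (rule has_derivative_eq_rhs[OF has_derivative_mult[OF c g]]) (auto simp: algebra_simps)
qed

lemma atom_differentiable: "(\<And>x. g differentiable (at x)) \<Longrightarrow> atom w g differentiable (at t)"
  using atom_has_derivative differentiable_def by blast

lemma partial_deriv_atom:
  assumes "\<And>x. g differentiable (at x)"
  shows "partial_deriv i (atom w g) = (\<lambda>t. atom w (partial_deriv i g) t + (- 2 * pi * \<i> * (snd w $ i)) * atom w g t)"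
  by (rule ext, subst partial_deriv_eqI[OF atom_has_derivative[OF assms]])
     (simp add: atom_def partial_deriv_def inner_axis)

lemma smooth_upto_atom: "smooth_upto m g \<Longrightarrow> smooth_upto m (atom w g)"
proof (induction m arbitrary: g)
  case 0
  then show ?case by (auto simp: smooth_upto_0 intro: atom_differentiable)
next
  case (Suc m)
  then have d: "\<And>x. g differentiable (at x)" and s: "\<And>i. smooth_upto m (partial_deriv i g)"
    by (auto simp: smooth_upto_Suc)
  have "smooth_upto m g" using Suc.prems by (auto simp: smooth_upto_def)
  then show ?case
    unfolding smooth_upto_Suc partial_deriv_atom[OF d]
    by (intro conjI allI smooth_upto_add_cmult atom_differentiable d Suc.IH s)
qed

lemma smooth_atom: "smooth g \<Longrightarrow> smooth (atom w g)"
  by (simp add: smooth_def smooth_upto_atom)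

lemma iter_atom_snoc:
  assumes "smooth g"
  shows "iter_partial_deriv (is @ [i]) (atom w g) t
    = iter_partial_deriv is (atom w (partial_deriv i g)) t + (- 2 * pi * \<i> * (snd w $ i)) * iter_partial_deriv is (atom w g) t"
  unfolding iter_snoc partial_deriv_atom[OF smooth_differentiable[OF assms]]
  by (simp only: iter_add_cmult smooth_atom smooth_partial_deriv assms)

lemma norm_fst_le': "norm (fst w) \<le> norm w" and norm_snd_le': "norm (snd w) \<le> norm w"
  by (metis norm_fst_le prod.collapse, metis norm_snd_le prod.collapse)

lemma component_snd_le: "\<bar>snd w $ i\<bar> \<le> norm (w :: 'a::real_normed_vector \<times> (real^'n::finite))"
  using component_le_norm_cart[of "snd w" i] norm_snd_le'[of w] by linarith

text \<open>Each derivative either falls on \<open>g\<close> or produces a frequency component,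
  which costs one more power of \<open>1 + norm w\<close>; the shift in position costs
  \<open>k\<close> powers. The induction removes the derivative taken first and therefore ranges
  over all Schwartz functions \<open>g\<close>.\<close>

lemma atom_bound:
  assumes "schwartz g"
  obtains C M where "C > 0" "\<And>w t. (1 + norm t) ^ k * cmod (iter_partial_deriv is (atom w g) t) \<le> C * (1 + norm w) ^ M"
  using assms
proof (induction "is" arbitrary: g thesis rule: rev_induct)
  case Nil
  obtain K where K: "K > 0" "\<And>x. (1 + norm x) ^ k * cmod (iter_partial_deriv [] g x) \<le> K"
    using schwartz_bound[OF Nil(2)] by blast
  show ?case
  proof (rule Nil(1)[OF K(1), of k])
    fix w :: "(real^'a) \<times> (real^'a)" and t
    have "(1 + norm t) ^ k \<le> (1 + norm (t - fst w)) ^ k * (1 + norm (fst w)) ^ k"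
      using norm1_triangle_pow[of "t - fst w" "fst w" k] by simp
    also have "\<dots> \<le> (1 + norm (t - fst w)) ^ k * (1 + norm w) ^ k"
      by (intro mult_left_mono power_mono) (auto simp: norm_fst_le')
    finally have "(1 + norm t) ^ k * cmod (g (t - fst w)) \<le> ((1 + norm (t - fst w)) ^ k * (1 + norm w) ^ k) * cmod (g (t - fst w))"
      by (rule mult_right_mono) simp
    also have "\<dots> \<le> K * (1 + norm w) ^ k"
      using mult_right_mono[OF K(2)[of "t - fst w"], of "(1 + norm w) ^ k"] by (simp add: mult_ac)
    finally show "(1 + norm t) ^ k * cmod (iter_partial_deriv [] (atom w g) t) \<le> K * (1 + norm w) ^ k"
      by (simp add: atom_def norm_mult)
  qed
next
  case (snoc i "is")
  obtain C1 M1 where 1: "C1 > 0" "\<And>w t. (1 + norm t) ^ k * cmod (iter_partial_deriv is (atom w (partial_deriv i g)) t) \<le> C1 * (1 + norm w) ^ M1"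
    using snoc(1)[OF _ schwartz_partial_deriv[OF snoc(3)]] by blast
  obtain C2 M2 where 2: "C2 > 0" "\<And>w t. (1 + norm t) ^ k * cmod (iter_partial_deriv is (atom w g) t) \<le> C2 * (1 + norm w) ^ M2"
    using snoc(1)[OF _ snoc(3)] by blast
  define M where "M = max M1 (Suc M2)"
  show ?case
  proof (rule snoc(2)[of "C1 + 2 * pi * C2" M])
    show "C1 + 2 * pi * C2 > 0" using 1(1) 2(1) by (intro add_pos_pos) auto
    fix w :: "(real^'a) \<times> (real^'a)" and t
    have "(1 + norm t) ^ k * cmod (iter_partial_deriv (is @ [i]) (atom w g) t)
      \<le> (1 + norm t) ^ k * (cmod (iter_partial_deriv is (atom w (partial_deriv i g)) t) + 2 * pi * \<bar>snd w $ i\<bar> * cmod (iter_partial_deriv is (atom w g) t))"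
      unfolding iter_atom_snoc[OF schwartz_smooth[OF snoc(3)]]
      by (intro mult_left_mono order_trans[OF norm_triangle_ineq]) (auto simp: norm_mult)
    also have "\<dots> = (1 + norm t) ^ k * cmod (iter_partial_deriv is (atom w (partial_deriv i g)) t)
       + 2 * pi * \<bar>snd w $ i\<bar> * ((1 + norm t) ^ k * cmod (iter_partial_deriv is (atom w g) t))"
      by (simp add: algebra_simps)
    also have "\<dots> \<le> C1 * (1 + norm w) ^ M1 + 2 * pi * (1 + norm w) * (C2 * (1 + norm w) ^ M2)"
    proof (intro add_mono 1)
      have "2 * pi * \<bar>snd w $ i\<bar> \<le> 2 * pi * (1 + norm w)" using component_snd_le[of w i] by simp
      then show "2 * pi * \<bar>snd w $ i\<bar> * ((1 + norm t) ^ k * cmod (iter_partial_deriv is (atom w g) t))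
         \<le> 2 * pi * (1 + norm w) * (C2 * (1 + norm w) ^ M2)"
        by (rule mult_mono[OF _ 2(2)]) auto
    qed
    also have "\<dots> = C1 * (1 + norm w) ^ M1 + (2 * pi * C2) * (1 + norm w) ^ Suc M2" by (simp add: mult_ac)
    also have "\<dots> \<le> C1 * (1 + norm w) ^ M + (2 * pi * C2) * (1 + norm w) ^ M"
      using 1(1) 2(1) by (intro add_mono mult_left_mono power_increasing) (auto simp: M_def)
    finally show "(1 + norm t) ^ k * cmod (iter_partial_deriv (is @ [i]) (atom w g) t) \<le> (C1 + 2 * pi * C2) * (1 + norm w) ^ M"
      by (simp add: distrib_right)
  qed
qed

lemma schwartz_atom:
  assumes "schwartz g" shows "schwartz (atom w g)"
  unfolding schwartz_alt
proof (intro conjI allI)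
  show "smooth (atom w g)" using assms by (intro smooth_atom schwartz_smooth)
  fix "is" and k :: nat
  obtain C M where "\<And>w t. (1 + norm t) ^ k * cmod (iter_partial_deriv is (atom w g) t) \<le> C * (1 + norm w) ^ M"
    using atom_bound[OF assms] by metis
  then show "\<exists>K. \<forall>x. (1 + norm x) ^ k * cmod (iter_partial_deriv is (atom w g) x) \<le> K" by blast
qed

lemma schwartz_tf_shift:
  assumes "schwartz g" shows "schwartz (tf_shift w g)"
proof -
  have "tf_shift w g = (\<lambda>t. cnj (atom w (\<lambda>t. cnj (g t)) t))"
    using cnj_tf_shift[of w g] by (metis complex_cnj_cnj)
  then show ?thesis using assms by (simp add: schwartz_cnj schwartz_atom)
qed

lemma cmod_cis_diff_le: "cmod (cis a - cis b) \<le> \<bar>a - b\<bar>"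
proof -
  have "cmod (cis (a - b) - 1) \<le> \<bar>a - b\<bar>"
    using iexp_approx1[of "a - b" 0] by (simp add: cis_conv_exp)
  moreover have "cis a - cis b = cis b * (cis (a - b) - 1)"
    by (simp add: right_diff_distrib cis_mult)
  ultimately show ?thesis by (simp add: norm_mult)
qed

text \<open>Mean value inequality on the unit ball about \<open>y\<close>, where the polynomial
  weights differ by at most the factor \<open>2 ^ k\<close>.\<close>

lemma schwartz_lipschitz:
  assumes g: "schwartz g"
  obtains C where "C > 0" "\<And>y y'. norm (y - y') \<le> 1 \<Longrightarrow> (1 + norm y) ^ k * cmod (g y - g y') \<le> C * norm (y - y')"
proof -
  have "\<exists>K. K > 0 \<and> (\<forall>x. (1 + norm x) ^ k * cmod (partial_deriv i g x) \<le> K)" for i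
  proof -
    obtain K where "K > 0" "\<And>x. (1 + norm x) ^ k * cmod (iter_partial_deriv [] (partial_deriv i g) x) \<le> K"
      using schwartz_bound[OF schwartz_partial_deriv[OF g]] by metis
    then show ?thesis by auto
  qed
  then obtain K where K: "\<And>i. K i > 0" "\<And>i x. (1 + norm x) ^ k * cmod (partial_deriv i g x) \<le> K i" by metis
  define S where "S = (\<Sum>i\<in>UNIV. K i)"
  have S: "S > 0" unfolding S_def using K by (intro sum_pos) auto
  show thesis
  proof (rule that[of "2 ^ k * S"])
    show "2 ^ k * S > 0" using S by simp
    fix y y' :: "real^'a" assume yy: "norm (y - y') \<le> 1"
    have "cmod (g y' - g y) \<le> (2 ^ k * S * kap k y) * norm (y' - y)"
    proof (rule differentiable_bound[where S="cball y 1" and f'="\<lambda>x. frechet_derivative g (at x)"])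
      show "(g has_derivative frechet_derivative g (at x)) (at x within cball y 1)" for x
        using has_derivative_frechet[OF smooth_differentiable[OF schwartz_smooth[OF g]]] has_derivative_at_withinI by blast
      fix x assume x: "x \<in> cball y 1"
      have "(1 + norm y) ^ k \<le> (1 + norm x) ^ k * (1 + norm (y - x)) ^ k"
        using norm1_triangle_pow[of x "y - x" k] by simp
      also have "\<dots> \<le> (1 + norm x) ^ k * 2 ^ k"
        using x by (intro mult_left_mono power_mono) (auto simp: dist_norm)
      finally have yx: "(1 + norm y) ^ k \<le> (1 + norm x) ^ k * 2 ^ k" .
      have pd: "cmod (partial_deriv i g x) \<le> 2 ^ k * K i * kap k y" for i
      proof -
        have "(1 + norm y) ^ k * cmod (partial_deriv i g x) \<le> ((1 + norm x) ^ k * 2 ^ k) * cmod (partial_deriv i g x)"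
          by (rule mult_right_mono[OF yx]) simp
        also have "\<dots> \<le> 2 ^ k * K i" using K(2)[of x i] by (simp add: mult_ac)
        finally show ?thesis by (simp add: kap_def pos_le_divide_eq mult.commute)
      qed
      show "onorm (frechet_derivative g (at x)) \<le> 2 ^ k * S * kap k y"
      proof (rule onorm_le)
        fix h
        have "norm (frechet_derivative g (at x) h) \<le> (\<Sum>i\<in>UNIV. norm ((h $ i) *\<^sub>R partial_deriv i g x))"
          unfolding frechet_derivative_eq_sum[OF smooth_differentiable[OF schwartz_smooth[OF g]]] by (rule norm_sum)
        also have "\<dots> \<le> (\<Sum>i\<in>UNIV. norm h * (2 ^ k * K i * kap k y))"
          using pd component_le_norm_cart[of h] by (intro sum_mono) (auto intro!: mult_mono)
        also have "\<dots> = 2 ^ k * S * kap k y * norm h"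
          by (simp add: S_def sum_distrib_left sum_distrib_right mult_ac)
        finally show "norm (frechet_derivative g (at x) h) \<le> 2 ^ k * S * kap k y * norm h" .
      qed
    qed (use yy in \<open>auto simp: dist_norm norm_minus_commute\<close>)
    then have "(1 + norm y) ^ k * cmod (g y - g y') \<le> (1 + norm y) ^ k * ((2 ^ k * S * kap k y) * norm (y' - y))"
      by (intro mult_left_mono) (auto simp: norm_minus_commute)
    also have "\<dots> = 2 ^ k * S * norm (y - y')" by (simp add: kap_def norm_minus_commute)
    finally show "(1 + norm y) ^ k * cmod (g y - g y') \<le> 2 ^ k * S * norm (y - y')" .
  qed
qed

subsection \<open>Fourier inversion\<close>

lemma integral_lborel_affine:
  fixes f :: "'a::euclidean_space \<Rightarrow> 'b::{banach, second_countable_topology}"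
  assumes [measurable]: "f \<in> borel_measurable borel" and "c \<noteq> 0"
  shows "(\<integral>x. f x \<partial>lborel) = \<bar>c\<bar> ^ DIM('a) *\<^sub>R (\<integral>x. f (a + c *\<^sub>R x) \<partial>lborel)"
  by (subst lborel_affine[OF assms(2), of a])
     (simp add: integral_density integral_distr)

text \<open>Built from one-dimensional normal densities, so that their known characteristic function
  gives the Fourier transform coordinate by coordinate.\<close>

definition gauss :: "'a::euclidean_space \<Rightarrow> real" where
  "gauss x = (\<Prod>b\<in>Basis. std_normal_density (x \<bullet> b))"

lemma gauss_measurable [measurable]: "gauss \<in> borel_measurable borel"
  unfolding gauss_def by measurable

lemma gauss_nonneg: "0 \<le> gauss x"
  unfolding gauss_def by (intro prod_nonneg) simp

lemma norm_sq_eq_sum_Basis: "(norm (x::'a::euclidean_space))\<^sup>2 = (\<Sum>b\<in>Basis. (x \<bullet> b)\<^sup>2)"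
  unfolding power2_norm_eq_inner by (subst euclidean_inner) (simp add: power2_eq_square)

lemma gauss_eq: "gauss (x::'a::euclidean_space) = (1 / sqrt (2 * pi)) ^ DIM('a) * exp (- (norm x)\<^sup>2 / 2)"
proof -
  have "exp (- (norm x)\<^sup>2 / 2) = (\<Prod>b\<in>Basis. exp (- (x \<bullet> b)\<^sup>2 / 2))"
    by (simp add: norm_sq_eq_sum_Basis exp_sum[symmetric] sum_negf sum_divide_distrib)
  then show ?thesis
    by (simp add: gauss_def std_normal_density_def prod_dividef power_one_over prod.distrib field_simps)
qed

lemma prod_integral_lborel:
  fixes f :: "'a::euclidean_space \<Rightarrow> real \<Rightarrow> complex"
  assumes f: "\<And>b. b \<in> Basis \<Longrightarrow> integrable lborel (f b)"
  shows "(\<integral>x. (\<Prod>b\<in>Basis. f b (x \<bullet> b)) \<partial>(lborel :: 'a measure)) = (\<Prod>b\<in>Basis. (\<integral>x. f b x \<partial>lborel))"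
proof -
  interpret product_sigma_finite "\<lambda>_::'a. lborel :: real measure" ..
  have [measurable]: "b \<in> Basis \<Longrightarrow> f b \<in> borel_measurable borel" for b using f[of b] by auto
  have "(\<integral>x. (\<Prod>b\<in>Basis. f b (x \<bullet> b)) \<partial>(lborel :: 'a measure))
     = (\<integral>x. (\<Prod>b\<in>Basis. f b ((\<Sum>b\<in>Basis. x b *\<^sub>R b) \<bullet> b)) \<partial>(\<Pi>\<^sub>M b\<in>(Basis::'a set). lborel))"
    by (subst lborel_eq, subst integral_distr) (auto intro!: borel_measurable_prod)
  also have "\<dots> = (\<integral>x. (\<Prod>b\<in>Basis. f b (x b)) \<partial>(\<Pi>\<^sub>M b\<in>(Basis::'a set). lborel))"
    by (intro Bochner_Integration.integral_cong prod.cong refl) simp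
  also have "\<dots> = (\<Prod>b\<in>Basis. (\<integral>x. f b x \<partial>lborel))"
    by (rule product_integral_prod) (use f in auto)
  finally show ?thesis .
qed

lemma gauss_fourier:
  fixes s :: "'a::euclidean_space"
  shows "(\<integral>x. cis (s \<bullet> x) * complex_of_real (gauss x) \<partial>lborel) = complex_of_real (exp (- (norm s)\<^sup>2 / 2))"
proof -
  have one: "(\<integral>x. cis (t * x) * complex_of_real (std_normal_density x) \<partial>lborel) = complex_of_real (exp (- t\<^sup>2 / 2))" for t
  proof -
    have "complex_of_real (exp (- t\<^sup>2 / 2)) = char std_normal_distribution t"
      by (simp add: char_std_normal_distribution)
    also have "\<dots> = (\<integral>x. std_normal_density x *\<^sub>R iexp (t * x) \<partial>lborel)"
      unfolding char_def by (subst integral_density) (auto simp: normal_density_nonneg)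
    finally show ?thesis by (simp add: cis_conv_exp scaleR_conv_of_real mult_ac)
  qed
  have int: "integrable lborel (\<lambda>x. cis (t * x) * complex_of_real (std_normal_density x))" for t
  proof (rule Bochner_Integration.integrable_bound)
    show "integrable lborel std_normal_density" by simp
    show "(\<lambda>x. cis (t * x) * complex_of_real (std_normal_density x)) \<in> borel_measurable lborel"
      unfolding cis_conv_exp by measurable
  qed (auto simp: norm_mult)
  have "cis (s \<bullet> x) = (\<Prod>b\<in>Basis. cis ((s \<bullet> b) * (x \<bullet> b)))" for x
    by (subst euclidean_inner) (simp add: cis_conv_exp exp_sum[symmetric] sum_distrib_left)
  then have "cis (s \<bullet> x) * complex_of_real (gauss x) = (\<Prod>b\<in>Basis. cis ((s \<bullet> b) * (x \<bullet> b)) * complex_of_real (std_normal_density (x \<bullet> b)))" for x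
    by (simp add: gauss_def prod.distrib)
  then have "(\<integral>x. cis (s \<bullet> x) * complex_of_real (gauss x) \<partial>lborel) = (\<Prod>b\<in>Basis. complex_of_real (exp (- (s \<bullet> b)\<^sup>2 / 2)))"
    using prod_integral_lborel[of "\<lambda>b x. cis ((s \<bullet> b) * x) * complex_of_real (std_normal_density x)"]
    by (simp add: int one)
  also have "\<dots> = complex_of_real (exp (\<Sum>b\<in>Basis. - (s \<bullet> b)\<^sup>2 / 2))"
    by (simp only: exp_sum[OF finite_Basis] of_real_prod)
  also have "(\<Sum>b\<in>Basis. - (s \<bullet> b)\<^sup>2 / 2) = - (norm s)\<^sup>2 / 2"
    by (simp add: norm_sq_eq_sum_Basis sum_negf sum_divide_distrib)
  finally show ?thesis .
qed

text \<open>A non-integrable function would have Bochner integral 0, whereas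
  \<open>gauss_fourier\<close> at the origin gives 1.\<close>

lemma integrable_gauss: "integrable lborel (gauss :: 'a::euclidean_space \<Rightarrow> real)"
proof (rule ccontr)
  assume "\<not> ?thesis"
  then have "\<not> integrable lborel (\<lambda>x::'a. complex_of_real (gauss x))"
    using integrable_Re[of lborel "\<lambda>x::'a. complex_of_real (gauss x)"] by auto
  then have "(\<integral>x. complex_of_real (gauss x) \<partial>(lborel :: 'a measure)) = 0" by (rule not_integrable_integral_eq)
  then show False using gauss_fourier[of "0::'a"] by simp
qed

lemma integral_gauss: "(\<integral>x. gauss x \<partial>(lborel :: 'a::euclidean_space measure)) = 1"
  using gauss_fourier[of "0::'a"] by (simp add: of_real_eq_1_iff)

lemma cis_measurable [measurable (raw)]:
  "f \<in> borel_measurable M \<Longrightarrow> (\<lambda>x. cis (f x)) \<in> borel_measurable M"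
  unfolding cis_conv_exp by measurable

lemma integrable_product_lborel:
  fixes f :: "'a::euclidean_space \<Rightarrow> real" and g :: "'b::euclidean_space \<Rightarrow> complex"
  assumes f: "integrable lborel f" and g: "integrable lborel g"
  shows "integrable (lborel \<Otimes>\<^sub>M lborel) (\<lambda>(x, y). f x *\<^sub>R g y)"
proof (rule lborel_pair.Fubini_integrable)
  have [measurable]: "f \<in> borel_measurable borel" "g \<in> borel_measurable borel" using f g by auto
  show "(\<lambda>(x, y). f x *\<^sub>R g y) \<in> borel_measurable (lborel \<Otimes>\<^sub>M lborel)" by measurable
  show "integrable lborel (\<lambda>x. \<integral>y. norm (case (x, y) of (x, y) \<Rightarrow> f x *\<^sub>R g y) \<partial>lborel)"
    using f by simp
  show "AE x in lborel. integrable lborel (\<lambda>y. case (x, y) of (x, y) \<Rightarrow> f x *\<^sub>R g y)"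
    using g by simp
qed

text \<open>Gaussian summation: the factor \<open>e\<close> at the argument \<epsilon> w makes the
  double integral absolutely convergent, and exchanging the integrals yields an average of
  \<open>h\<close> about \<open>t\<close> against a Gaussian of width proportional to \<epsilon>. As
  \<epsilon> tends to 0 the regularised integrals \<open>I\<close> converge to both sides.\<close>

lemma fourier_inversion:
  fixes h :: "'a::euclidean_space \<Rightarrow> complex"
  assumes cont: "continuous_on UNIV h" and bd: "\<And>x. cmod (h x) \<le> K"
    and int: "integrable lborel h"
    and int': "integrable lborel (\<lambda>w. \<integral>y. h y * cis (- 2 * pi * (w \<bullet> y)) \<partial>lborel)"
  shows "(\<integral>w. (\<integral>y. h y * cis (- 2 * pi * (w \<bullet> y)) \<partial>lborel) * cis (2 * pi * (w \<bullet> t)) \<partial>lborel) = h t"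
proof -
  have [measurable]: "h \<in> borel_measurable borel" using cont by (rule borel_measurable_continuous_onI)
  define H where "H = (\<lambda>w. \<integral>y. h y * cis (- 2 * pi * (w \<bullet> y)) \<partial>lborel)"
  have [measurable]: "H \<in> borel_measurable borel" unfolding H_def by measurable
  have iH: "integrable lborel H" using int' by (simp add: H_def)
  define e where "e = (\<lambda>x::'a. exp (- (norm x)\<^sup>2 / 2))"
  have [measurable]: "e \<in> borel_measurable borel" unfolding e_def by measurable
  define c0 where "c0 = (1 / sqrt (2 * pi)) ^ DIM('a)"
  have c0: "c0 > 0" by (simp add: c0_def)
  have eg: "e x = gauss x / c0" for x using c0 by (simp add: e_def gauss_eq c0_def)
  define \<epsilon> where "\<epsilon> = (\<lambda>m. 1 / real (Suc m))"
  have \<epsilon>: "\<epsilon> m > 0" for m by (simp add: \<epsilon>_def)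
  have \<epsilon>0: "\<epsilon> \<longlonglongrightarrow> 0" using LIMSEQ_inverse_real_of_nat by (simp add: \<epsilon>_def inverse_eq_divide)
  define I where "I = (\<lambda>m. \<integral>w. H w * cis (2 * pi * (w \<bullet> t)) * complex_of_real (e (\<epsilon> m *\<^sub>R w)) \<partial>lborel)"
  have lim1: "I \<longlonglongrightarrow> (\<integral>w. H w * cis (2 * pi * (w \<bullet> t)) \<partial>lborel)"
    unfolding I_def
  proof (rule integral_dominated_convergence[where w="\<lambda>w. cmod (H w)"])
    show "AE w in lborel. (\<lambda>m. H w * cis (2 * pi * (w \<bullet> t)) * complex_of_real (e (\<epsilon> m *\<^sub>R w))) \<longlonglongrightarrow> H w * cis (2 * pi * (w \<bullet> t))"
    proof (rule AE_I2)
      fix w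
      have "(\<lambda>m. H w * cis (2 * pi * (w \<bullet> t)) * complex_of_real (exp (- (norm (\<epsilon> m *\<^sub>R w))\<^sup>2 / 2)))
         \<longlonglongrightarrow> H w * cis (2 * pi * (w \<bullet> t)) * complex_of_real (exp (- (norm (0 *\<^sub>R w))\<^sup>2 / 2))"
        by (intro tendsto_intros \<epsilon>0) simp
      then show "(\<lambda>m. H w * cis (2 * pi * (w \<bullet> t)) * complex_of_real (e (\<epsilon> m *\<^sub>R w))) \<longlonglongrightarrow> H w * cis (2 * pi * (w \<bullet> t))"
        by (simp add: e_def)
    qed
    show "AE w in lborel. norm (H w * cis (2 * pi * (w \<bullet> t)) * complex_of_real (e (\<epsilon> m *\<^sub>R w))) \<le> cmod (H w)" for m
      by (auto simp: norm_mult e_def mult_left_le)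
  qed (use iH in \<open>auto\<close>)
  have I_eq: "I m = (\<integral>v. h (t + (- \<epsilon> m / (2 * pi)) *\<^sub>R v) * complex_of_real (gauss v) \<partial>lborel)" for m
  proof -
    have ie: "integrable lborel (\<lambda>w. e (\<epsilon> m *\<^sub>R w))"
    proof -
      have "integrable lborel (\<lambda>w::'a. e w)" using integrable_gauss[where 'a='a] by (simp add: eg)
      then have "integrable (density (distr lborel borel (\<lambda>x::'a. 0 + \<epsilon> m *\<^sub>R x)) (\<lambda>_. ennreal (\<bar>\<epsilon> m\<bar> ^ DIM('a)))) e"
        using lborel_affine[of "\<epsilon> m" "0::'a"] \<epsilon>[of m] by simp
      then show ?thesis using \<epsilon>[of m]
        by (simp add: integrable_density integrable_distr_eq)
    qed
    have "I m = (\<integral>w. (\<integral>y. h y * cis (- 2 * pi * (w \<bullet> y)) * (cis (2 * pi * (w \<bullet> t)) * complex_of_real (e (\<epsilon> m *\<^sub>R w))) \<partial>lborel) \<partial>lborel)"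
      unfolding I_def H_def by (simp only: mult.assoc integral_mult_left_zero[symmetric])
    also have "\<dots> = (\<integral>y. (\<integral>w. h y * cis (- 2 * pi * (w \<bullet> y)) * (cis (2 * pi * (w \<bullet> t)) * complex_of_real (e (\<epsilon> m *\<^sub>R w))) \<partial>lborel) \<partial>lborel)"
    proof (rule lborel_pair.Fubini_integral[symmetric])
      have "integrable (lborel \<Otimes>\<^sub>M lborel) (\<lambda>(w, y). e (\<epsilon> m *\<^sub>R w) *\<^sub>R h y)"
        by (rule integrable_product_lborel[OF ie int])
      then show "integrable (lborel \<Otimes>\<^sub>M lborel) (\<lambda>(w, y). h y * cis (- 2 * pi * (w \<bullet> y)) * (cis (2 * pi * (w \<bullet> t)) * complex_of_real (e (\<epsilon> m *\<^sub>R w))))"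
        by (rule Bochner_Integration.integrable_bound) (auto simp: norm_mult)
    qed
    also have "\<dots> = (\<integral>y. h y * complex_of_real ((1 / \<epsilon> m) ^ DIM('a) / c0 * e ((2 * pi / \<epsilon> m) *\<^sub>R (t - y))) \<partial>lborel)"
    proof (rule Bochner_Integration.integral_cong[OF refl])
      fix y
      have "(\<integral>w. h y * cis (- 2 * pi * (w \<bullet> y)) * (cis (2 * pi * (w \<bullet> t)) * complex_of_real (e (\<epsilon> m *\<^sub>R w))) \<partial>lborel)
         = h y * (\<integral>w. cis (((2 * pi) *\<^sub>R (t - y)) \<bullet> w) * complex_of_real (e (\<epsilon> m *\<^sub>R w)) \<partial>lborel)"
      proof (subst integral_mult_right_zero[symmetric], rule Bochner_Integration.integral_cong[OF refl])
        fix w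
        have "- 2 * pi * (w \<bullet> y) + 2 * pi * (w \<bullet> t) = ((2 * pi) *\<^sub>R (t - y)) \<bullet> w"
          by (simp add: inner_diff_left inner_commute[of w] right_diff_distrib)
        then have "cis (- 2 * pi * (w \<bullet> y)) * cis (2 * pi * (w \<bullet> t)) = cis (((2 * pi) *\<^sub>R (t - y)) \<bullet> w)"
          by (simp only: cis_mult)
        then show "h y * cis (- 2 * pi * (w \<bullet> y)) * (cis (2 * pi * (w \<bullet> t)) * complex_of_real (e (\<epsilon> m *\<^sub>R w)))
          = h y * (cis (((2 * pi) *\<^sub>R (t - y)) \<bullet> w) * complex_of_real (e (\<epsilon> m *\<^sub>R w)))"
          by (metis mult.assoc)
      qed
      also have "(\<integral>w. cis (((2 * pi) *\<^sub>R (t - y)) \<bullet> w) * complex_of_real (e (\<epsilon> m *\<^sub>R w)) \<partial>lborel)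
         = \<bar>1 / \<epsilon> m\<bar> ^ DIM('a) *\<^sub>R (\<integral>w. cis (((2 * pi) *\<^sub>R (t - y)) \<bullet> (0 + (1 / \<epsilon> m) *\<^sub>R w)) * complex_of_real (e (\<epsilon> m *\<^sub>R (0 + (1 / \<epsilon> m) *\<^sub>R w))) \<partial>lborel)"
        by (rule integral_lborel_affine) (use \<epsilon>[of m] in auto)
      also have "(\<integral>w. cis (((2 * pi) *\<^sub>R (t - y)) \<bullet> (0 + (1 / \<epsilon> m) *\<^sub>R w)) * complex_of_real (e (\<epsilon> m *\<^sub>R (0 + (1 / \<epsilon> m) *\<^sub>R w))) \<partial>lborel)
         = (\<integral>w. cis (((2 * pi / \<epsilon> m) *\<^sub>R (t - y)) \<bullet> w) * complex_of_real (gauss w) / c0 \<partial>lborel)"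
        using \<epsilon>[of m] by (simp add: eg)
      also have "\<dots> = complex_of_real (e ((2 * pi / \<epsilon> m) *\<^sub>R (t - y))) / c0"
        by (simp only: integral_divide_zero gauss_fourier e_def)
      finally show "(\<integral>w. h y * cis (- 2 * pi * (w \<bullet> y)) * (cis (2 * pi * (w \<bullet> t)) * complex_of_real (e (\<epsilon> m *\<^sub>R w))) \<partial>lborel)
         = h y * complex_of_real ((1 / \<epsilon> m) ^ DIM('a) / c0 * e ((2 * pi / \<epsilon> m) *\<^sub>R (t - y)))"
        using \<epsilon>[of m] by (simp add: scaleR_conv_of_real)
    qed
    \<comment> \<open>The substitution y = t - \<epsilon> v / (2 pi) turns the shrinking Gaussian
      into the fixed density \<open>gauss v\<close>.\<close>
    also have "\<dots> = \<bar>- \<epsilon> m / (2 * pi)\<bar> ^ DIM('a) *\<^sub>R (\<integral>v. h (t + (- \<epsilon> m / (2 * pi)) *\<^sub>R v) *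
        complex_of_real ((1 / \<epsilon> m) ^ DIM('a) / c0 * e ((2 * pi / \<epsilon> m) *\<^sub>R (t - (t + (- \<epsilon> m / (2 * pi)) *\<^sub>R v)))) \<partial>lborel)"
      by (rule integral_lborel_affine) (use \<epsilon>[of m] in auto)
    also have "\<dots> = (\<integral>v. h (t + (- \<epsilon> m / (2 * pi)) *\<^sub>R v) * complex_of_real (gauss v) \<partial>lborel)"
    proof -
      have "(2 * pi / \<epsilon> m) *\<^sub>R (t - (t + (- \<epsilon> m / (2 * pi)) *\<^sub>R v)) = v" for v
        using \<epsilon>[of m] by simp
      moreover have "\<bar>- \<epsilon> m / (2 * pi)\<bar> ^ DIM('a) * ((1 / \<epsilon> m) ^ DIM('a) / c0 * e v) = gauss v" for v
      proof -
        have "\<bar>- \<epsilon> m / (2 * pi)\<bar> ^ DIM('a) * (1 / \<epsilon> m) ^ DIM('a) = (1 / (2 * pi)) ^ DIM('a)"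
          using \<epsilon>[of m] by (simp add: power_mult_distrib[symmetric] abs_mult)
        \<comment> \<open>One factor \<open>c0\<close> undoes the normalisation of the transformed
          Gaussian, the other turns \<open>e\<close> into \<open>gauss\<close>.\<close>
        also have "\<dots> = c0 * c0"
          by (simp add: c0_def power_mult_distrib[symmetric] real_sqrt_mult_self)
        finally have xy: "\<bar>- \<epsilon> m / (2 * pi)\<bar> ^ DIM('a) * (1 / \<epsilon> m) ^ DIM('a) = c0 * c0" .
        have "x * (y / c0 * e v) = gauss v" if "x * y = c0 * c0" for x y
        proof -
          have "x * (y / c0 * e v) = (x * y) * gauss v / (c0 * c0)" by (simp add: eg)
          then show ?thesis using c0 that by simp
        qed
        then show ?thesis using xy by blast
      qed
      ultimately have "\<bar>- \<epsilon> m / (2 * pi)\<bar> ^ DIM('a) *\<^sub>R (h (t + (- \<epsilon> m / (2 * pi)) *\<^sub>R v) *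
        complex_of_real ((1 / \<epsilon> m) ^ DIM('a) / c0 * e ((2 * pi / \<epsilon> m) *\<^sub>R (t - (t + (- \<epsilon> m / (2 * pi)) *\<^sub>R v)))))
        = h (t + (- \<epsilon> m / (2 * pi)) *\<^sub>R v) * complex_of_real (gauss v)" for v
        by (metis mult_scaleR_right of_real_mult scaleR_conv_of_real)
      then show ?thesis by (simp only: integral_scaleR_right[symmetric])
    qed
    finally show ?thesis .
  qed
  have lim2: "I \<longlonglongrightarrow> (\<integral>v. h t * complex_of_real (gauss v) \<partial>(lborel :: 'a measure))"
    unfolding I_eq
  proof (rule integral_dominated_convergence[where w="\<lambda>v::'a. K * gauss v"])
    show "AE v in lborel. (\<lambda>m. h (t + (- \<epsilon> m / (2 * pi)) *\<^sub>R v) * complex_of_real (gauss v)) \<longlonglongrightarrow> h t * complex_of_real (gauss v)"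
    proof (rule AE_I2)
      fix v :: 'a
      have "(\<lambda>m. t + (- \<epsilon> m / (2 * pi)) *\<^sub>R v) \<longlonglongrightarrow> t + (- 0 / (2 * pi)) *\<^sub>R v"
        by (intro tendsto_intros \<epsilon>0) simp
      then have "(\<lambda>m. t + (- \<epsilon> m / (2 * pi)) *\<^sub>R v) \<longlonglongrightarrow> t" by simp
      moreover have "isCont h t" using cont by (simp add: continuous_on_eq_continuous_at)
      ultimately have "(\<lambda>m. h (t + (- \<epsilon> m / (2 * pi)) *\<^sub>R v)) \<longlonglongrightarrow> h t"
        by (rule isCont_tendsto_compose[rotated])
      then show "(\<lambda>m. h (t + (- \<epsilon> m / (2 * pi)) *\<^sub>R v) * complex_of_real (gauss v)) \<longlonglongrightarrow> h t * complex_of_real (gauss v)"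
        by (intro tendsto_intros)
    qed
    show "AE v in lborel. norm (h (t + (- \<epsilon> m / (2 * pi)) *\<^sub>R v) * complex_of_real (gauss v)) \<le> K * gauss v" for m
    proof (rule AE_I2)
      fix v :: 'a
      show "norm (h (t + (- \<epsilon> m / (2 * pi)) *\<^sub>R v) * complex_of_real (gauss v)) \<le> K * gauss v"
        unfolding norm_mult using mult_right_mono[OF bd gauss_nonneg[of v]] gauss_nonneg[of v] by simp
    qed
  qed (use integrable_gauss in auto)
  have "(\<integral>v. h t * complex_of_real (gauss v) \<partial>(lborel :: 'a measure)) = h t"
    using integral_gauss[where 'a='a] by simp
  then show ?thesis using LIMSEQ_unique[OF lim1 lim2] by (simp add: H_def)
qed

text \<open>The induction of \<open>atom_bound\<close>, applied to differences: it gives Lipschitz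
  dependence on the phase-space point in every seminorm. Continuity of the pairing with a
  distribution and uniform control of Riemann sums rest on it.\<close>

lemma atom_lipschitz:
  assumes "schwartz g"
  obtains C M where "C > 0" "\<And>w w' t. norm (w - w') \<le> 1 \<Longrightarrow>
    (1 + norm t) ^ k * cmod (iter_partial_deriv is (atom w g) t - iter_partial_deriv is (atom w' g) t) \<le> C * (1 + norm w) ^ M * norm (w - w')"
  using assms
proof (induction "is" arbitrary: g thesis rule: rev_induct)
  case Nil
  \<comment> \<open>The difference of two phases contributes a factor \<open>norm t\<close>, which
    the additional power in \<open>Suc k\<close> absorbs.\<close>
  obtain C1 M1 where 1: "C1 > 0" "\<And>w t. (1 + norm t) ^ Suc k * cmod (iter_partial_deriv [] (atom w g) t) \<le> C1 * (1 + norm w) ^ M1"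
    using atom_bound[OF Nil(2), of "Suc k" "[]"] by blast
  obtain C2 where 2: "C2 > 0" "\<And>y y'. norm (y - y') \<le> 1 \<Longrightarrow> (1 + norm y) ^ k * cmod (g y - g y') \<le> C2 * norm (y - y')"
    using schwartz_lipschitz[OF Nil(2), of k] by blast
  define M where "M = max M1 k"
  show ?case
  proof (rule Nil(1)[of "2 * pi * C1 + C2" M])
    show "2 * pi * C1 + C2 > 0" using 1(1) 2(1) by (intro add_pos_pos) auto
    fix w w' :: "(real^'a) \<times> (real^'a)" and t
    assume ww: "norm (w - w') \<le> 1"
    define a where "a = - 2 * pi * (snd w \<bullet> t)"
    define a' where "a' = - 2 * pi * (snd w' \<bullet> t)"
    have eq: "atom w g t - atom w' g t = (cis a - cis a') * g (t - fst w) + cis a' * (g (t - fst w) - g (t - fst w'))"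
      by (simp add: atom_def a_def a'_def algebra_simps)
    have aa: "\<bar>a - a'\<bar> \<le> 2 * pi * norm (w - w') * (1 + norm t)"
    proof -
      have "a - a' = - 2 * pi * (snd (w - w') \<bullet> t)" by (simp add: a_def a'_def inner_diff_left right_diff_distrib)
      then have "\<bar>a - a'\<bar> = 2 * pi * \<bar>snd (w - w') \<bullet> t\<bar>" by (simp add: abs_mult)
      also have "\<dots> \<le> 2 * pi * (norm (snd (w - w')) * norm t)" by (intro mult_left_mono Cauchy_Schwarz_ineq2) simp
      also have "\<dots> \<le> 2 * pi * (norm (w - w') * (1 + norm t))"
        using norm_snd_le'[of "w - w'"] by (intro mult_left_mono mult_mono) auto
      finally show ?thesis by (simp add: mult.assoc)
    qed
    have T1: "(1 + norm t) ^ k * cmod ((cis a - cis a') * g (t - fst w)) \<le> 2 * pi * norm (w - w') * (C1 * (1 + norm w) ^ M)"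
    proof -
      have "cmod (cis a - cis a') * cmod (g (t - fst w)) \<le> (2 * pi * norm (w - w') * (1 + norm t)) * cmod (g (t - fst w))"
        using cmod_cis_diff_le[of a a'] aa by (intro mult_right_mono) auto
      then have "(1 + norm t) ^ k * cmod ((cis a - cis a') * g (t - fst w)) \<le> (1 + norm t) ^ k * ((2 * pi * norm (w - w') * (1 + norm t)) * cmod (g (t - fst w)))"
        unfolding norm_mult by (rule mult_left_mono) simp
      also have "\<dots> = 2 * pi * norm (w - w') * ((1 + norm t) ^ Suc k * cmod (atom w g t))"
        by (simp add: atom_def norm_mult mult_ac)
      also have "\<dots> \<le> 2 * pi * norm (w - w') * (C1 * (1 + norm w) ^ M)"
      proof (rule mult_left_mono)
        have "(1 + norm t) ^ Suc k * cmod (atom w g t) \<le> C1 * (1 + norm w) ^ M1" using 1(2)[of t w] by simp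
        also have "\<dots> \<le> C1 * (1 + norm w) ^ M" using 1(1) by (intro mult_left_mono power_increasing) (auto simp: M_def)
        finally show "(1 + norm t) ^ Suc k * cmod (atom w g t) \<le> C1 * (1 + norm w) ^ M" .
      qed simp
      finally show ?thesis .
    qed
    have T2: "(1 + norm t) ^ k * cmod (cis a' * (g (t - fst w) - g (t - fst w'))) \<le> (1 + norm w) ^ M * (C2 * norm (w - w'))"
    proof -
      have fw: "norm ((t - fst w) - (t - fst w')) \<le> norm (w - w')"
        using norm_fst_le'[of "w - w'"] by (simp add: norm_minus_commute)
      have "(1 + norm t) ^ k \<le> (1 + norm (t - fst w)) ^ k * (1 + norm (fst w)) ^ k"
        using norm1_triangle_pow[of "t - fst w" "fst w" k] by simp
      also have "\<dots> \<le> (1 + norm (t - fst w)) ^ k * (1 + norm w) ^ M"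
      proof (rule mult_left_mono)
        have "(1 + norm (fst w)) ^ k \<le> (1 + norm w) ^ k" by (intro power_mono) (auto simp: norm_fst_le')
        also have "\<dots> \<le> (1 + norm w) ^ M" by (rule power_increasing) (auto simp: M_def)
        finally show "(1 + norm (fst w)) ^ k \<le> (1 + norm w) ^ M" .
      qed simp
      finally have "(1 + norm t) ^ k * cmod (g (t - fst w) - g (t - fst w'))
         \<le> ((1 + norm (t - fst w)) ^ k * (1 + norm w) ^ M) * cmod (g (t - fst w) - g (t - fst w'))"
        by (rule mult_right_mono) simp
      also have "\<dots> = (1 + norm w) ^ M * ((1 + norm (t - fst w)) ^ k * cmod (g (t - fst w) - g (t - fst w')))" by (simp add: mult_ac)
      also have "\<dots> \<le> (1 + norm w) ^ M * (C2 * norm ((t - fst w) - (t - fst w')))"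
        using fw ww by (intro mult_left_mono 2(2)) auto
      also have "\<dots> \<le> (1 + norm w) ^ M * (C2 * norm (w - w'))"
        using 2(1) fw by (intro mult_left_mono) auto
      finally show ?thesis by (simp add: norm_mult)
    qed
    have "(1 + norm t) ^ k * cmod (atom w g t - atom w' g t) \<le> (1 + norm t) ^ k * (cmod ((cis a - cis a') * g (t - fst w)) + cmod (cis a' * (g (t - fst w) - g (t - fst w'))))"
      unfolding eq by (intro mult_left_mono norm_triangle_ineq) simp
    also have "\<dots> \<le> 2 * pi * norm (w - w') * (C1 * (1 + norm w) ^ M) + (1 + norm w) ^ M * (C2 * norm (w - w'))"
      unfolding distrib_left by (rule add_mono[OF T1 T2])
    also have "\<dots> = (2 * pi * C1 + C2) * (1 + norm w) ^ M * norm (w - w')" by (simp add: algebra_simps)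
    finally show "(1 + norm t) ^ k * cmod (iter_partial_deriv [] (atom w g) t - iter_partial_deriv [] (atom w' g) t) \<le> (2 * pi * C1 + C2) * (1 + norm w) ^ M * norm (w - w')"
      by simp
  qed
next
  case (snoc i "is")
  obtain C1 M1 where 1: "C1 > 0" "\<And>w w' t. norm (w - w') \<le> 1 \<Longrightarrow>
    (1 + norm t) ^ k * cmod (iter_partial_deriv is (atom w (partial_deriv i g)) t - iter_partial_deriv is (atom w' (partial_deriv i g)) t) \<le> C1 * (1 + norm w) ^ M1 * norm (w - w')"
    using snoc(1)[OF _ schwartz_partial_deriv[OF snoc(3)]] by blast
  obtain C2 M2 where 2: "C2 > 0" "\<And>w w' t. norm (w - w') \<le> 1 \<Longrightarrow>
    (1 + norm t) ^ k * cmod (iter_partial_deriv is (atom w g) t - iter_partial_deriv is (atom w' g) t) \<le> C2 * (1 + norm w) ^ M2 * norm (w - w')"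
    using snoc(1)[OF _ snoc(3)] by blast
  obtain C3 M3 where 3: "C3 > 0" "\<And>w t. (1 + norm t) ^ k * cmod (iter_partial_deriv is (atom w g) t) \<le> C3 * (1 + norm w) ^ M3"
    using atom_bound[OF snoc(3)] by blast
  \<comment> \<open>\<open>Suc M2\<close> makes room for the frequency factor \<open>c'\<close>, and
    \<open>M3\<close> for the undifferenced derivative that is multiplied by
    \<open>c - c'\<close>.\<close>
  define M where "M = M1 + Suc M2 + M3"
  show ?case
  proof (rule snoc(2)[of "C1 + 2 * pi * C3 + 2 * pi * C2" M])
    show "C1 + 2 * pi * C3 + 2 * pi * C2 > 0" using 1(1) 2(1) 3(1) by (intro add_pos_pos) auto
    fix w w' :: "(real^'a) \<times> (real^'a)" and t
    assume ww: "norm (w - w') \<le> 1"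
    define p p' where "p = iter_partial_deriv is (atom w (partial_deriv i g)) t" and "p' = iter_partial_deriv is (atom w' (partial_deriv i g)) t"
    define q q' where "q = iter_partial_deriv is (atom w g) t" and "q' = iter_partial_deriv is (atom w' g) t"
    define c c' where "c = - 2 * pi * \<i> * (snd w $ i)" and "c' = - 2 * pi * \<i> * (snd w' $ i)"
    have eq: "iter_partial_deriv (is @ [i]) (atom w g) t - iter_partial_deriv (is @ [i]) (atom w' g) t = ((p - p') + (c - c') * q) + c' * (q - q')"
      unfolding iter_atom_snoc[OF schwartz_smooth[OF snoc(3)]] p_def p'_def q_def q'_def c_def c'_def by (simp add: algebra_simps)
    have cc: "cmod (c - c') \<le> 2 * pi * norm (w - w')"
    proof -
      have "c - c' = complex_of_real (- 2 * pi * (snd (w - w') $ i)) * \<i>" by (simp add: c_def c'_def algebra_simps)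
      then have "cmod (c - c') = \<bar>- 2 * pi * (snd (w - w') $ i)\<bar>" by (simp only: norm_mult norm_of_real norm_ii mult_1_right)
      also have "\<dots> = 2 * pi * \<bar>snd (w - w') $ i\<bar>" by (simp add: abs_mult)
      finally have "cmod (c - c') = 2 * pi * \<bar>snd (w - w') $ i\<bar>" .
      also have "\<dots> \<le> 2 * pi * norm (w - w')" by (intro mult_left_mono component_snd_le) simp
      finally show ?thesis .
    qed
    have c': "cmod c' \<le> 2 * pi * (1 + norm w)"
    proof -
      have "\<bar>snd w' $ i\<bar> \<le> norm w'" by (rule component_snd_le)
      also have "\<dots> \<le> 1 + norm w" using ww norm_triangle_ineq2[of w' w] by (simp add: norm_minus_commute)
      finally have "2 * pi * \<bar>snd w' $ i\<bar> \<le> 2 * pi * (1 + norm w)" by (intro mult_left_mono) auto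
      then show ?thesis by (simp add: c'_def norm_mult)
    qed
    have pw: "(1 + norm w) ^ j \<le> (1 + norm w) ^ M" if "j \<le> M" for j
      using that by (intro power_increasing) auto
    have P: "(1 + norm t) ^ k * cmod (p - p') \<le> C1 * ((1 + norm w) ^ M * norm (w - w'))"
    proof -
      have "(1 + norm t) ^ k * cmod (p - p') \<le> C1 * (1 + norm w) ^ M1 * norm (w - w')"
        unfolding p_def p'_def by (rule 1(2)[OF ww])
      also have "\<dots> \<le> C1 * (1 + norm w) ^ M * norm (w - w')"
        using 1(1) by (intro mult_right_mono mult_left_mono pw) (auto simp: M_def)
      finally show ?thesis by (simp add: mult.assoc)
    qed
    have Q: "(1 + norm t) ^ k * (cmod (c - c') * cmod q) \<le> 2 * pi * C3 * ((1 + norm w) ^ M * norm (w - w'))"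
    proof -
      have "(1 + norm t) ^ k * (cmod (c - c') * cmod q) = cmod (c - c') * ((1 + norm t) ^ k * cmod q)" by simp
      also have "\<dots> \<le> (2 * pi * norm (w - w')) * (C3 * (1 + norm w) ^ M3)"
        unfolding q_def by (rule mult_mono[OF cc 3(2)]) auto
      also have "\<dots> \<le> (2 * pi * norm (w - w')) * (C3 * (1 + norm w) ^ M)"
        using 3(1) by (intro mult_left_mono pw) (auto simp: M_def)
      finally show ?thesis by (simp add: mult_ac)
    qed
    have R: "(1 + norm t) ^ k * (cmod c' * cmod (q - q')) \<le> 2 * pi * C2 * ((1 + norm w) ^ M * norm (w - w'))"
    proof -
      have "(1 + norm t) ^ k * (cmod c' * cmod (q - q')) = cmod c' * ((1 + norm t) ^ k * cmod (q - q'))" by simp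
      also have "\<dots> \<le> (2 * pi * (1 + norm w)) * (C2 * (1 + norm w) ^ M2 * norm (w - w'))"
        unfolding q_def q'_def by (rule mult_mono[OF c' 2(2)[OF ww]]) auto
      also have "\<dots> = 2 * pi * C2 * ((1 + norm w) ^ Suc M2 * norm (w - w'))" by (simp add: mult_ac)
      also have "\<dots> \<le> 2 * pi * C2 * ((1 + norm w) ^ M * norm (w - w'))"
        using 2(1) by (intro mult_left_mono mult_right_mono pw) (auto simp: M_def)
      finally show ?thesis .
    qed
    have "cmod (((p - p') + (c - c') * q) + c' * (q - q')) \<le> cmod (p - p') + cmod (c - c') * cmod q + cmod c' * cmod (q - q')"
      by (metis (no_types, opaque_lifting) norm_mult norm_triangle_le norm_triangle_ineq add_right_mono)
    then have "(1 + norm t) ^ k * cmod (((p - p') + (c - c') * q) + c' * (q - q'))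
      \<le> (1 + norm t) ^ k * (cmod (p - p') + cmod (c - c') * cmod q + cmod c' * cmod (q - q'))"
      by (rule mult_left_mono) simp
    also have "\<dots> \<le> C1 * ((1 + norm w) ^ M * norm (w - w')) + 2 * pi * C3 * ((1 + norm w) ^ M * norm (w - w')) + 2 * pi * C2 * ((1 + norm w) ^ M * norm (w - w'))"
      unfolding distrib_left by (intro add_mono P Q R)
    also have "\<dots> = (C1 + 2 * pi * C3 + 2 * pi * C2) * (1 + norm w) ^ M * norm (w - w')" by (simp add: algebra_simps)
    finally show "(1 + norm t) ^ k * cmod (iter_partial_deriv (is @ [i]) (atom w g) t - iter_partial_deriv (is @ [i]) (atom w' g) t)
      \<le> (C1 + 2 * pi * C3 + 2 * pi * C2) * (1 + norm w) ^ M * norm (w - w')"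
      unfolding eq .
  qed
qed

subsection \<open>Ambiguity functions\<close>

text \<open>The cross-ambiguity function in bilinear form; with \<open>h\<close> the conjugate
  window it is the short-time Fourier transform of \<open>g\<close>.\<close>

definition amb :: "(real^'n::finite \<Rightarrow> complex) \<Rightarrow> (real^'n \<Rightarrow> complex) \<Rightarrow> (real^'n) \<times> (real^'n) \<Rightarrow> complex" where
  "amb g h w = (\<integral>t. g t * atom w h t \<partial>lborel)"

text \<open>Every difference quotient integrates to 0 by translation invariance, and the decay of
  the derivative supplies an integrable majorant for the passage to the limit.\<close>

lemma integral_partial_deriv_zero:
  fixes H :: "real^'n::finite \<Rightarrow> complex"
  assumes diff: "\<And>x. H differentiable (at x)"
    and H: "\<And>x. cmod (H x) \<le> C * kap (DIM(real^'n) + 2) x"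
    and DH: "\<And>x. cmod (partial_deriv i H x) \<le> C * kap (DIM(real^'n) + 2) x"
  shows "(\<integral>x. partial_deriv i H x \<partial>lborel) = 0"
proof -
  define d where "d = DIM(real^'n) + 2"
  have C0: "C \<ge> 0" using order_trans[OF norm_ge_zero H[of 0]] by (simp add: kap_def)
  have cont: "continuous_on UNIV H"
    by (metis diff continuous_at_imp_continuous_on differentiable_imp_continuous_within)
  then have [measurable]: "H \<in> borel_measurable borel" by (rule borel_measurable_continuous_onI)
  have ik: "integrable lborel (kap d :: real^'n \<Rightarrow> real)" by (rule integrable_kap) (simp add: d_def)
  have iH: "integrable lborel H"
    by (rule Bochner_Integration.integrable_bound[of _ "\<lambda>x. C * kap d x"]) (use ik H C0 in \<open>auto simp: d_def\<close>)
  define Q where "Q = (\<lambda>m x. (H (x + (1 / real (Suc m)) *\<^sub>R axis i 1) - H x) * of_nat (Suc m))"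
  have Q0: "(\<integral>x. Q m x \<partial>lborel) = 0" for m
  proof -
    have "integrable lborel (\<lambda>x. H (x - (- (1 / real (Suc m)) *\<^sub>R axis i 1)))" by (rule integrable_lborel_diff[OF iH])
    then have 1: "integrable lborel (\<lambda>x. H (x + (1 / real (Suc m)) *\<^sub>R axis i 1))" by simp
    have "(\<integral>x. H (x - (- (1 / real (Suc m)) *\<^sub>R axis i 1)) \<partial>lborel) = (\<integral>x. H x \<partial>lborel)"
      by (rule integral_lborel_diff) simp
    then have "(\<integral>x. H (x + (1 / real (Suc m)) *\<^sub>R axis i 1) \<partial>lborel) = (\<integral>x. H x \<partial>lborel)" by simp
    then show ?thesis using 1 iH by (simp add: Q_def)
  qed
  have "(\<lambda>m. \<integral>x. Q m x \<partial>lborel) \<longlonglongrightarrow> (\<integral>x. partial_deriv i H x \<partial>lborel)"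
  proof (rule integral_dominated_convergence[where w="\<lambda>x. (2 ^ d * C) * kap d x"])
    show lim: "AE x in lborel. (\<lambda>m. Q m x) \<longlonglongrightarrow> partial_deriv i H x"
      unfolding Q_def by (intro AE_I2 difference_quotient_tendsto diff)
    show "partial_deriv i H \<in> borel_measurable lborel"
      by (rule borel_measurable_LIMSEQ_metric[of Q]) (auto simp: Q_def intro!: difference_quotient_tendsto diff simp del: of_nat_Suc)
    show "AE x in lborel. norm (Q m x) \<le> (2 ^ d * C) * kap d x" for m
    proof (rule AE_I2)
      fix x :: "real^'n"
      have "cmod (H (x + (1 / real (Suc m)) *\<^sub>R axis i 1) - H x) \<le> (2 ^ d * C * kap d x) * (1 / real (Suc m))"
      proof (rule difference_bound[OF diff])
        fix s :: real assume s: "0 \<le> s" "s \<le> 1 / real (Suc m)"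
        define y :: "real^'n" where "y = x + s *\<^sub>R axis i 1"
        have "s \<le> 1" by (rule order_trans[OF s(2)]) simp
        then have "norm (x - y) \<le> 1" using s by (simp add: y_def)
        have "(1 + norm x) ^ d \<le> (1 + norm y) ^ d * (1 + norm (x - y)) ^ d"
          using norm1_triangle_pow[of y "x - y" d] by simp
        also have "\<dots> \<le> (1 + norm y) ^ d * 2 ^ d"
          using \<open>norm (x - y) \<le> 1\<close> by (intro mult_left_mono power_mono) auto
        finally have "kap d y \<le> 2 ^ d * kap d x" by (simp add: kap_def field_simps)
        then have "C * kap d y \<le> C * (2 ^ d * kap d x)" using C0 by (rule mult_left_mono)
        then show "cmod (partial_deriv i H (x + s *\<^sub>R axis i 1)) \<le> 2 ^ d * C * kap d x"
          using DH[of y] by (simp add: y_def d_def mult_ac)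
      qed simp
      then have "cmod (H (x + (1 / real (Suc m)) *\<^sub>R axis i 1) - H x) * real (Suc m) \<le> (2 ^ d * C * kap d x) * (1 / real (Suc m)) * real (Suc m)"
        by (rule mult_right_mono) simp
      then show "norm (Q m x) \<le> (2 ^ d * C) * kap d x" by (simp add: Q_def norm_mult del: of_nat_Suc)
    qed
    show "Q m \<in> borel_measurable lborel" for m unfolding Q_def by measurable
  qed (use ik in simp)
  then show ?thesis by (simp add: Q0 LIMSEQ_const_iff)
qed

text \<open>Decay in the position variable comes from \<open>kap_triangle\<close>: the product of
  the decay of \<open>g\<close> and that of the shifted \<open>h\<close> decays in the shift. The
  last conclusion provides a majorant integrable in \<open>t\<close> and uniform in
  \<open>w\<close>.\<close>

lemma amb_bound:
  assumes g: "schwartz g" and h: "schwartz h"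
  obtains C where "C > 0" "\<And>w. cmod (amb g h w) \<le> C * kap a (fst w)" "\<And>w t. cmod (g t * atom w h t) \<le> C * kap (DIM(real^'n) + 2) (t::real^'n::finite)"
proof -
  define d where "d = DIM(real^'n) + 2"
  obtain C1 where C1: "C1 > 0" "\<And>x. cmod (g x) \<le> C1 * kap (a + d) x" using schwartz_kap[OF g] by blast
  obtain C2 where C2: "C2 > 0" "\<And>x. cmod (h x) \<le> C2 * kap a x" using schwartz_kap[OF h] by blast
  have ik: "integrable lborel (kap d :: real^'n \<Rightarrow> real)" by (rule integrable_kap) (simp add: d_def)
  define J where "J = (\<integral>x. kap d x \<partial>(lborel :: (real^'n) measure))"
  have J: "J \<ge> 0" unfolding J_def by (rule integral_nonneg_AE) simp
  have pt: "cmod (g t * atom w h t) \<le> (C1 * C2 * kap a (fst w)) * kap d t" for w t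
  proof -
    have "cmod (g t * atom w h t) = cmod (g t) * cmod (h (t - fst w))" by (simp add: atom_def norm_mult)
    also have "\<dots> \<le> (C1 * kap (a + d) t) * (C2 * kap a (t - fst w))" using C1 C2 by (intro mult_mono) auto
    also have "\<dots> = C1 * C2 * (kap a t * kap a (fst w - t)) * kap d t" by (simp add: kap_add kap_minus_commute mult_ac)
    also have "\<dots> \<le> C1 * C2 * kap a (fst w) * kap d t"
      using C1(1) C2(1) kap_triangle[of a t "fst w - t"] by (intro mult_right_mono mult_left_mono) auto
    finally show ?thesis .
  qed
  have amb: "cmod (amb g h w) \<le> C1 * C2 * J * kap a (fst w)" for w
  proof -
    have "cmod (amb g h w) \<le> (\<integral>t. (C1 * C2 * kap a (fst w)) * kap d t \<partial>(lborel :: (real^'n) measure))"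
      unfolding amb_def by (rule order_trans[OF integral_norm_bound integral_mono']) (use ik pt C1(1) C2(1) in auto)
    then show ?thesis by (simp add: J_def mult_ac)
  qed
  show thesis
  proof (rule that[of "C1 * C2 * J + C1 * C2"])
    show "C1 * C2 * J + C1 * C2 > 0" using C1(1) C2(1) J by (intro add_nonneg_pos) auto
    show "cmod (amb g h w) \<le> (C1 * C2 * J + C1 * C2) * kap a (fst w)" for w
      using amb[of w] C1(1) C2(1) by (simp add: distrib_right add_increasing2)
    show "cmod (g t * atom w h t) \<le> (C1 * C2 * J + C1 * C2) * kap (DIM(real^'n) + 2) t" for w t
    proof -
      have "C1 * C2 * kap a (fst w) \<le> C1 * C2 * J + C1 * C2"
        using mult_left_mono[OF kap_le_1[of a "fst w"], of "C1 * C2"] C1(1) C2(1) J by (simp add: add_increasing)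
      then have "(C1 * C2 * kap a (fst w)) * kap d t \<le> (C1 * C2 * J + C1 * C2) * kap d t" by (rule mult_right_mono) simp
      then show ?thesis using pt[of t w] unfolding d_def[symmetric] by linarith
    qed
  qed
qed

lemma integrable_mult_atom:
  fixes g h :: "real^'n::finite \<Rightarrow> complex"
  assumes g: "schwartz g" and h: "schwartz h"
  shows "integrable lborel (\<lambda>t. g t * atom w h t)"
proof -
  obtain C where C: "C > 0" "\<And>w t. cmod (g t * atom w h t) \<le> C * kap (DIM(real^'n) + 2) t"
    using amb_bound[OF g h, where a=0] by metis
  have [measurable]: "g \<in> borel_measurable borel" "atom w h \<in> borel_measurable borel"
    by (intro schwartz_measurable schwartz_atom assms)+
  show ?thesis
  proof (rule Bochner_Integration.integrable_bound)
    show "integrable lborel (\<lambda>t::real^'n. C * kap (DIM(real^'n) + 2) t)"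
      by (intro integrable_mult_right integrable_kap order_refl)
    show "AE t in lborel. norm (g t * atom w h t) \<le> norm (C * kap (DIM(real^'n) + 2) t)"
    proof (rule AE_I2)
      fix t
      show "norm (g t * atom w h t) \<le> norm (C * kap (DIM(real^'n) + 2) t)"
        by (rule order_trans[OF C(2)]) simp
    qed
  qed measurable
qed

text \<open>Integration by parts: the integral of the derivative of \<open>g t * atom w h t\<close>
  vanishes.\<close>

lemma amb_parts:
  fixes g h :: "real^'n::finite \<Rightarrow> complex"
  assumes g: "schwartz g" and h: "schwartz h"
  shows "2 * pi * \<i> * (snd w $ i) * amb g h w = amb (partial_deriv i g) h w + amb g (partial_deriv i h) w"
proof -
  define H where "H = (\<lambda>t. g t * atom w h t)"
  define c where "c = 2 * pi * \<i> * (snd w $ i)"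
  have dg: "\<And>x. g differentiable (at x)" and dh: "\<And>x. h differentiable (at x)"
    using assms by (auto intro: smooth_differentiable schwartz_smooth)
  have dH: "(H has_derivative (\<lambda>v. g x * frechet_derivative (atom w h) (at x) v + frechet_derivative g (at x) v * atom w h x)) (at x)" for x
    unfolding H_def by (intro has_derivative_mult has_derivative_frechet dg atom_differentiable dh)
  have pH: "partial_deriv i H x = partial_deriv i g x * atom w h x + (g x * atom w (partial_deriv i h) x - c * H x)" for x
  proof -
    have "partial_deriv i H x = g x * partial_deriv i (atom w h) x + partial_deriv i g x * atom w h x"
      by (subst partial_deriv_eqI[OF dH]) (simp add: partial_deriv_def)
    then show ?thesis unfolding partial_deriv_atom[OF dh] by (simp add: H_def c_def algebra_simps)
  qed
  then have pHf: "partial_deriv i H = (\<lambda>x. partial_deriv i g x * atom w h x + (g x * atom w (partial_deriv i h) x - c * H x))"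
    by blast
  define d where "d = DIM(real^'n) + 2"
  obtain C1 where C1: "C1 > 0" "\<And>w t. cmod (g t * atom w h t) \<le> C1 * kap d t"
    using amb_bound[OF g h, where a=0] by (metis d_def)
  obtain C2 where C2: "C2 > 0" "\<And>w t. cmod (partial_deriv i g t * atom w h t) \<le> C2 * kap d t"
    using amb_bound[OF schwartz_partial_deriv[OF g] h, where a=0] by (metis d_def)
  obtain C3 where C3: "C3 > 0" "\<And>w t. cmod (g t * atom w (partial_deriv i h) t) \<le> C3 * kap d t"
    using amb_bound[OF g schwartz_partial_deriv[OF h], where a=0] by (metis d_def)
  define C where "C = C1 + (C2 + (C3 + cmod c * C1))"
  have C_ge: "C1 \<le> C" "C2 + (C3 + cmod c * C1) \<le> C" using C1(1) C2(1) C3(1) by (auto simp: C_def add_nonneg_nonneg)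
  have "(\<integral>x. partial_deriv i H x \<partial>lborel) = 0"
  proof (rule integral_partial_deriv_zero)
    show "H differentiable (at x)" for x using dH differentiable_def by blast
    show "cmod (H x) \<le> C * kap (DIM(real^'n) + 2) x" for x
      using order_trans[OF C1(2) mult_right_mono[OF C_ge(1) kap_nonneg[of d x]]] unfolding H_def d_def .
    show "cmod (partial_deriv i H x) \<le> C * kap (DIM(real^'n) + 2) x" for x
    proof -
      have "cmod (partial_deriv i H x) \<le> cmod (partial_deriv i g x * atom w h x) + (cmod (g x * atom w (partial_deriv i h) x) + cmod (c * H x))"
        unfolding pH by (intro order_trans[OF norm_triangle_ineq] add_left_mono norm_triangle_ineq4)
      also have "\<dots> \<le> C2 * kap d x + (C3 * kap d x + cmod c * (C1 * kap d x))"
        unfolding norm_mult[of c] H_def by (intro add_mono mult_left_mono C1 C2 C3) simp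
      also have "\<dots> = (C2 + (C3 + cmod c * C1)) * kap d x" by (simp add: algebra_simps)
      also have "\<dots> \<le> C * kap d x" by (intro mult_right_mono C_ge) simp
      finally show ?thesis by (simp add: d_def)
    qed
  qed
  moreover have "(\<integral>x. partial_deriv i H x \<partial>lborel) = amb (partial_deriv i g) h w + (amb g (partial_deriv i h) w - c * amb g h w)"
    using integrable_mult_atom[OF g h, of w] integrable_mult_atom[OF schwartz_partial_deriv[OF g] h, of i w]
      integrable_mult_atom[OF g schwartz_partial_deriv[OF h], of w i]
    unfolding pHf amb_def unfolding H_def by simp
  ultimately show ?thesis by (simp add: c_def algebra_simps)
qed

text \<open>\<open>amb_parts\<close> trades each power of a frequency component for a derivative on
  \<open>g\<close> or on \<open>h\<close>, which is why the induction generalises over both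
  functions.\<close>

lemma amb_bound_component:
  assumes "schwartz g" "schwartz h"
  shows "\<exists>C. \<forall>w. (1 + norm (fst w)) ^ a * \<bar>snd w $ i\<bar> ^ b * cmod (amb g h w) \<le> C"
  using assms
proof (induction b arbitrary: g h)
  case 0
  obtain C where "\<And>w. cmod (amb g h w) \<le> C * kap a (fst w)" using amb_bound[OF 0] by metis
  then have "(1 + norm (fst w)) ^ a * cmod (amb g h w) \<le> C" for w
    by (simp add: kap_def pos_le_divide_eq mult.commute)
  then show ?case by (intro exI[of _ C] allI) simp
next
  case (Suc b)
  obtain C1 where C1: "\<And>w. (1 + norm (fst w)) ^ a * \<bar>snd w $ i\<bar> ^ b * cmod (amb (partial_deriv i g) h w) \<le> C1"
    using Suc.IH[OF schwartz_partial_deriv[OF Suc.prems(1)] Suc.prems(2)] by blast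
  obtain C2 where C2: "\<And>w. (1 + norm (fst w)) ^ a * \<bar>snd w $ i\<bar> ^ b * cmod (amb g (partial_deriv i h) w) \<le> C2"
    using Suc.IH[OF Suc.prems(1) schwartz_partial_deriv[OF Suc.prems(2)]] by blast
  have "(1 + norm (fst w)) ^ a * \<bar>snd w $ i\<bar> ^ Suc b * cmod (amb g h w) \<le> C1 + C2" for w
  proof -
    have "\<bar>snd w $ i\<bar> * cmod (amb g h w) \<le> 2 * pi * (\<bar>snd w $ i\<bar> * cmod (amb g h w))"
      using pi_gt3 mult_right_mono[of 1 "2 * pi" "\<bar>snd w $ i\<bar> * cmod (amb g h w)"] by simp
    also have "\<dots> = cmod (2 * pi * \<i> * (snd w $ i) * amb g h w)" by (simp add: norm_mult)
    also have "\<dots> \<le> cmod (amb (partial_deriv i g) h w) + cmod (amb g (partial_deriv i h) w)"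
      unfolding amb_parts[OF Suc.prems] by (rule norm_triangle_ineq)
    finally have "(1 + norm (fst w)) ^ a * \<bar>snd w $ i\<bar> ^ b * (\<bar>snd w $ i\<bar> * cmod (amb g h w))
       \<le> (1 + norm (fst w)) ^ a * \<bar>snd w $ i\<bar> ^ b * (cmod (amb (partial_deriv i g) h w) + cmod (amb g (partial_deriv i h) w))"
      by (rule mult_left_mono) simp
    also have "\<dots> \<le> C1 + C2" unfolding distrib_left by (rule add_mono[OF C1 C2])
    finally show ?thesis by (simp add: mult_ac)
  qed
  then show ?case by blast
qed

text \<open>The norm is at most the dimension times the largest component, and the power of that
  component is one of the summands.\<close>

lemma norm1_pow_le_components:
  fixes x :: "real^'n::finite"
  shows "(1 + norm x) ^ j \<le> (1 + real CARD('n)) ^ j * (1 + (\<Sum>i\<in>UNIV. \<bar>x $ i\<bar> ^ j))"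
proof -
  define m where "m = Max (range (\<lambda>i. \<bar>x $ i\<bar>))"
  have m: "\<bar>x $ i\<bar> \<le> m" for i unfolding m_def by (rule Max_ge) auto
  have "m \<in> range (\<lambda>i. \<bar>x $ i\<bar>)" unfolding m_def by (rule Max_in) auto
  then obtain i0 where i0: "m = \<bar>x $ i0\<bar>" by auto
  have "norm x \<le> (\<Sum>i\<in>UNIV. \<bar>x $ i\<bar>)" by (rule norm_le_l1_cart)
  also have "\<dots> \<le> real CARD('n) * m" using sum_bounded_above[of UNIV "\<lambda>i. \<bar>x $ i\<bar>" m] m by simp
  finally have nx: "norm x \<le> real CARD('n) * m" .
  have "1 + norm x \<le> (1 + real CARD('n)) * max 1 m"
  proof -
    have "real CARD('n) * m \<le> real CARD('n) * max 1 m" by (intro mult_left_mono) auto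
    then have "1 + norm x \<le> max 1 m + real CARD('n) * max 1 m" using nx by linarith
    then show ?thesis by (simp add: distrib_right)
  qed
  then have "(1 + norm x) ^ j \<le> ((1 + real CARD('n)) * max 1 m) ^ j" by (intro power_mono) auto
  also have "\<dots> = (1 + real CARD('n)) ^ j * (max 1 m) ^ j" by (simp add: power_mult_distrib)
  also have "(max 1 m) ^ j \<le> 1 + m ^ j" by (cases "m \<le> 1") (auto simp: max_def i0)
  also have "m ^ j \<le> (\<Sum>i\<in>UNIV. \<bar>x $ i\<bar> ^ j)"
    unfolding i0 by (rule member_le_sum) auto
  finally show ?thesis by (simp add: mult_left_mono)
qed

lemma amb_decay:
  fixes g h :: "real^'n::finite \<Rightarrow> complex"
  assumes "schwartz g" "schwartz h"
  obtains C where "C > 0" "\<And>w. cmod (amb g h w) \<le> C * kap j w"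
proof -
  \<comment> \<open>The frequency exponent is 0 here, so any component serves;
    \<open>undefined\<close> names one.\<close>
  obtain C0 where "\<And>w. (1 + norm (fst w)) ^ j * \<bar>snd w $ undefined\<bar> ^ 0 * cmod (amb g h w) \<le> C0"
    using amb_bound_component[OF assms, of j undefined 0] by blast
  then have C0: "\<And>w. (1 + norm (fst w)) ^ j * cmod (amb g h w) \<le> C0" by (simp only: power_0 mult_1_right)
  obtain C1 where C1: "\<And>i w. (1 + norm (fst w)) ^ j * \<bar>snd w $ i\<bar> ^ j * cmod (amb g h w) \<le> C1 i"
    using amb_bound_component[OF assms, of j _ j] by metis
  define C where "C = (1 + real CARD('n)) ^ j * (C0 + (\<Sum>i\<in>UNIV. C1 i))"
  have "(1 + norm w) ^ j * cmod (amb g h w) \<le> C" for w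
  proof -
    have "norm w \<le> norm (fst w) + norm (snd w)"
      using norm_Pair_le[of "fst w" "snd w"] by simp
    then have "1 + norm w \<le> (1 + norm (fst w)) * (1 + norm (snd w))"
      using mult_nonneg_nonneg[OF norm_ge_zero[of "fst w"] norm_ge_zero[of "snd w"]] unfolding distrib_left distrib_right by linarith
    then have "(1 + norm w) ^ j \<le> (1 + norm (fst w)) ^ j * (1 + norm (snd w)) ^ j"
      using power_mono[of "1 + norm w" _ j] by (metis norm1_pos(2) power_mult_distrib)
    also have "\<dots> \<le> (1 + norm (fst w)) ^ j * ((1 + real CARD('n)) ^ j * (1 + (\<Sum>i\<in>UNIV. \<bar>snd w $ i\<bar> ^ j)))"
      by (intro mult_left_mono norm1_pow_le_components) simp
    finally have "(1 + norm w) ^ j * cmod (amb g h w) \<le> (1 + norm (fst w)) ^ j * ((1 + real CARD('n)) ^ j * (1 + (\<Sum>i\<in>UNIV. \<bar>snd w $ i\<bar> ^ j))) * cmod (amb g h w)"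
      by (rule mult_right_mono) simp
    also have "\<dots> = (1 + real CARD('n)) ^ j * ((1 + norm (fst w)) ^ j * cmod (amb g h w) + (\<Sum>i\<in>UNIV. (1 + norm (fst w)) ^ j * \<bar>snd w $ i\<bar> ^ j * cmod (amb g h w)))"
      by (simp add: algebra_simps sum_distrib_left sum_distrib_right)
    also have "\<dots> \<le> C" unfolding C_def by (intro mult_left_mono add_mono sum_mono C0 C1) simp
    finally show ?thesis .
  qed
  then have "cmod (amb g h w) \<le> C * kap j w" for w by (simp add: kap_def pos_le_divide_eq mult.commute)
  then have "cmod (amb g h w) \<le> max C 1 * kap j w" for w
    by (rule order_trans) (auto intro!: mult_right_mono)
  then show thesis by (intro that[of "max C 1"]) auto
qed

subsection \<open>Tempered distributions on time-frequency atoms\<close>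

lemma continuous_on_local_lipschitz:
  fixes f :: "'a::real_normed_vector \<Rightarrow> 'b::real_normed_vector"
  assumes "\<And>w w'. norm (w - w') \<le> 1 \<Longrightarrow> norm (f w - f w') \<le> C w * norm (w - w')"
  shows "continuous_on UNIV f"
proof (intro continuous_at_imp_continuous_on ballI)
  fix w
  have "((\<lambda>w'. f w' - f w) \<longlongrightarrow> 0) (at w)"
  proof (rule Lim_null_comparison)
    show "eventually (\<lambda>w'. norm (f w' - f w) \<le> C w * norm (w' - w)) (at w)"
      unfolding eventually_at
      using assms[of w] by (intro exI[of _ 1]) (auto simp: dist_norm norm_minus_commute)
    have "((\<lambda>w'. C w * norm (w' - w)) \<longlongrightarrow> C w * norm (w - w)) (at w)" by (intro tendsto_intros)
    then show "((\<lambda>w'. C w * norm (w' - w)) \<longlongrightarrow> 0) (at w)" by simp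
  qed
  then show "isCont f w" by (simp add: isCont_def LIM_zero_iff)
qed

lemma atom_continuous:
  assumes "schwartz g"
  shows "continuous_on UNIV (\<lambda>w. iter_partial_deriv is (atom w g) t)"
proof -
  obtain C M where "\<And>w w' t. norm (w - w') \<le> 1 \<Longrightarrow>
    (1 + norm t) ^ 0 * cmod (iter_partial_deriv is (atom w g) t - iter_partial_deriv is (atom w' g) t) \<le> C * (1 + norm w) ^ M * norm (w - w')"
    using atom_lipschitz[OF assms, where k=0] by metis
  then show ?thesis by (intro continuous_on_local_lipschitz[where C="\<lambda>w. C * (1 + norm w) ^ M"]) simp
qed

text \<open>Finitely many bounds are merged by adding all constants and all exponents, which only
  enlarges them as \<open>N p\<close> is at least 1. The predicate \<open>P\<close> and the factor
  \<open>e\<close> let one statement cover both the bounds and the Lipschitz estimates of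
  atoms.\<close>

lemma uniform_poly_bound:
  fixes q :: "'s \<Rightarrow> 'p \<Rightarrow> real"
  assumes "finite S"
    and "\<And>s. s \<in> S \<Longrightarrow> \<exists>C>0. \<exists>M. \<forall>p. P p \<longrightarrow> q s p \<le> C * N p ^ M * e p"
    and N: "\<And>p. 1 \<le> N p" and e: "\<And>p. 0 \<le> e p"
  shows "\<exists>C>0. \<exists>M::nat. \<forall>s\<in>S. \<forall>p. P p \<longrightarrow> q s p \<le> C * N p ^ M * e p"
proof -
  obtain C M where CM: "\<And>s. s \<in> S \<Longrightarrow> C s > 0" "\<And>s p. s \<in> S \<Longrightarrow> P p \<Longrightarrow> q s p \<le> C s * N p ^ M s * e p"
    using assms(2) by metis
  have "q s p \<le> (1 + sum C S) * N p ^ sum M S * e p" if "s \<in> S" "P p" for s p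
  proof -
    have 1: "C s \<le> 1 + sum C S" using member_le_sum[of s S C] that CM(1) assms(1) by (auto simp: less_imp_le add_increasing)
    have 2: "N p ^ M s \<le> N p ^ sum M S" using N member_le_sum[of s S M] that assms(1) by (intro power_increasing) auto
    have "C s * N p ^ M s * e p \<le> (1 + sum C S) * N p ^ sum M S * e p"
      using 1 2 CM(1)[OF that(1)] e N[of p] by (intro mult_right_mono mult_mono) auto
    then show ?thesis using CM(2)[OF that] by linarith
  qed
  moreover have "1 + sum C S > 0" using CM(1) by (intro add_pos_nonneg sum_nonneg) (auto simp: less_imp_le)
  ultimately show ?thesis by blast
qed

lemma finite_lists_le: "finite {is :: 'n::finite list. length is \<le> k}"
  using finite_lists_length_le[of "UNIV :: 'n set" k] by simp

lemma atom_bound_uniform: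
  fixes g :: "real^'n::finite \<Rightarrow> complex"
  assumes "schwartz g"
  obtains C M where "C > 0" "\<And>is w t. length is \<le> k \<Longrightarrow> (1 + norm t) ^ k * cmod (iter_partial_deriv is (atom w g) t) \<le> C * (1 + norm w) ^ M"
proof -
  have "\<exists>C>0. \<exists>M::nat. \<forall>is\<in>{is :: 'n list. length is \<le> k}. \<forall>p. True \<longrightarrow> (1 + norm (snd p)) ^ k * cmod (iter_partial_deriv is (atom (fst p) g) (snd p)) \<le> C * (1 + norm (fst p)) ^ M * 1"
  proof (rule uniform_poly_bound[OF finite_lists_le])
    fix "is" :: "'n list"
    obtain C M where "C > 0" "\<And>w t. (1 + norm t) ^ k * cmod (iter_partial_deriv is (atom w g) t) \<le> C * (1 + norm w) ^ M"
      using atom_bound[OF assms] by metis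
    then show "\<exists>C>0. \<exists>M. \<forall>p. True \<longrightarrow> (1 + norm (snd p)) ^ k * cmod (iter_partial_deriv is (atom (fst p) g) (snd p)) \<le> C * (1 + norm (fst p)) ^ M * 1"
      by (intro exI[of _ C] conjI exI[of _ M]) auto
  qed auto
  then show thesis using that by force
qed

lemma atom_lipschitz_uniform:
  fixes g :: "real^'n::finite \<Rightarrow> complex"
  assumes "schwartz g"
  obtains C M where "C > 0" "\<And>is w w' t. length is \<le> k \<Longrightarrow> norm (w - w') \<le> 1 \<Longrightarrow>
    (1 + norm t) ^ k * cmod (iter_partial_deriv is (atom w g) t - iter_partial_deriv is (atom w' g) t) \<le> C * (1 + norm w) ^ M * norm (w - w')"
proof -
  have "\<exists>C>0. \<exists>M::nat. \<forall>is\<in>{is :: 'n list. length is \<le> k}. \<forall>p. norm (fst p - fst (snd p)) \<le> 1 \<longrightarrow>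
     (1 + norm (snd (snd p))) ^ k * cmod (iter_partial_deriv is (atom (fst p) g) (snd (snd p)) - iter_partial_deriv is (atom (fst (snd p)) g) (snd (snd p)))
      \<le> C * (1 + norm (fst p)) ^ M * norm (fst p - fst (snd p))"
  proof (rule uniform_poly_bound[OF finite_lists_le])
    fix "is" :: "'n list"
    obtain C M where "C > 0" "\<And>w w' t. norm (w - w') \<le> 1 \<Longrightarrow>
    (1 + norm t) ^ k * cmod (iter_partial_deriv is (atom w g) t - iter_partial_deriv is (atom w' g) t) \<le> C * (1 + norm w) ^ M * norm (w - w')"
      using atom_lipschitz[OF assms] by metis
    then show "\<exists>C>0. \<exists>M. \<forall>p. norm (fst p - fst (snd p)) \<le> 1 \<longrightarrow>
     (1 + norm (snd (snd p))) ^ k * cmod (iter_partial_deriv is (atom (fst p) g) (snd (snd p)) - iter_partial_deriv is (atom (fst (snd p)) g) (snd (snd p)))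
      \<le> C * (1 + norm (fst p)) ^ M * norm (fst p - fst (snd p))"
      by (intro exI[of _ C] conjI exI[of _ M]) auto
  qed auto
  then obtain C M where "C > 0" "\<And>is p. length (is :: 'n list) \<le> k \<Longrightarrow> norm (fst p - fst (snd p)) \<le> 1 \<Longrightarrow>
     (1 + norm (snd (snd p))) ^ k * cmod (iter_partial_deriv is (atom (fst p) g) (snd (snd p)) - iter_partial_deriv is (atom (fst (snd p)) g) (snd (snd p)))
      \<le> C * (1 + norm (fst p)) ^ M * norm (fst p - fst (snd p))"
    by blast
  note CM = this
  show thesis
  proof (rule that[OF CM(1)])
    fix "is" :: "'n list" and w w' :: "(real^'n) \<times> (real^'n)" and t
    assume "length is \<le> k" "norm (w - w') \<le> 1"
    then show "(1 + norm t) ^ k * cmod (iter_partial_deriv is (atom w g) t - iter_partial_deriv is (atom w' g) t) \<le> C * (1 + norm w) ^ M * norm (w - w')"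
      using CM(2)[of "is" "(w, w', t)"] by simp
  qed
qed

section \<open>Seminorms and linearity of tempered distributions\<close>

lemma schwartz_seminorm_le:
  fixes g :: "real^'n::finite \<Rightarrow> complex"
  assumes "\<And>is x. length is \<le> k \<Longrightarrow> (1 + norm x) ^ k * cmod (iter_partial_deriv is g x) \<le> e"
  shows "schwartz_seminorm k g \<le> e"
  unfolding schwartz_seminorm_def
proof (rule cSUP_least)
  have "([], 0) \<in> {is :: 'n list. length is \<le> k} \<times> (UNIV :: (real^'n) set)" by simp
  then show "{is :: 'n list. length is \<le> k} \<times> (UNIV :: (real^'n) set) \<noteq> {}" by blast
qed (use assms in auto)

text \<open>Only finitely many derivative lists have length at most \<open>k\<close>, so the
  individual bounds add up to one for the whole supremum.\<close>

lemma schwartz_seminorm_ge: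
  fixes g :: "real^'n::finite \<Rightarrow> complex"
  assumes "schwartz g" "length is \<le> k"
  shows "(1 + norm x) ^ k * cmod (iter_partial_deriv is g x) \<le> schwartz_seminorm k g"
proof -
  have "\<forall>is. \<exists>K. \<forall>x. (1 + norm x) ^ k * cmod (iter_partial_deriv is g x) \<le> K"
    using assms(1) unfolding schwartz_alt by blast
  then obtain K where K: "\<And>is x. (1 + norm x) ^ k * cmod (iter_partial_deriv is g x) \<le> K is"
    by metis
  have K0: "0 \<le> K is" for "is" using K[of 0 "is"] by (rule order_trans[rotated]) simp
  have "bdd_above ((\<lambda>(is, x). (1 + norm x) ^ k * cmod (iter_partial_deriv is g x)) ` ({is. length is \<le> k} \<times> UNIV))"
  proof (rule bdd_aboveI[where M="\<Sum>is\<in>{is. length is \<le> k}. K is"])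
    fix y assume "y \<in> (\<lambda>(is, x). (1 + norm x) ^ k * cmod (iter_partial_deriv is g x)) ` ({is. length is \<le> k} \<times> UNIV)"
    then obtain is' x where "length is' \<le> k" "y = (1 + norm x) ^ k * cmod (iter_partial_deriv is' g x)" by auto
    then have "y \<le> K is'" "is' \<in> {is. length is \<le> k}" using K by auto
    then show "y \<le> (\<Sum>is\<in>{is. length is \<le> k}. K is)"
      using member_le_sum[of is' "{is. length is \<le> k}" K] K0 finite_lists_le[of k] by fastforce
  qed
  then have "(case (is, x) of (is, x) \<Rightarrow> (1 + norm x) ^ k * cmod (iter_partial_deriv is g x)) \<le> schwartz_seminorm k g"
    unfolding schwartz_seminorm_def using assms(2) by (intro cSUP_upper) auto
  then show ?thesis by simp
qed

text \<open>Replaces the supremum in the seminorm by any upper bound \<open>e\<close> and makes the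
  constant nonnegative, so that continuity can be applied without computing seminorms.\<close>

lemma tempered_bound:
  fixes u :: "(real^'n::finite \<Rightarrow> complex) \<Rightarrow> complex"
  assumes "tempered_distribution u"
  obtains K k where "K \<ge> 0" "\<And>g e. schwartz g \<Longrightarrow>
     (\<And>is x. length is \<le> k \<Longrightarrow> (1 + norm x) ^ k * cmod (iter_partial_deriv is g x) \<le> e) \<Longrightarrow> cmod (u g) \<le> K * e"
proof -
  obtain K k where K: "\<And>g. schwartz g \<Longrightarrow> cmod (u g) \<le> K * schwartz_seminorm k g"
    using assms unfolding tempered_distribution_def by blast
  show thesis
  proof (rule that[of "\<bar>K\<bar>" k])
    fix g :: "real^'n \<Rightarrow> complex" and e
    assume g: "schwartz g" and le: "\<And>is x. length is \<le> k \<Longrightarrow> (1 + norm x) ^ k * cmod (iter_partial_deriv is g x) \<le> e"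
    have s0: "0 \<le> schwartz_seminorm k g"
      using schwartz_seminorm_ge[OF g, of "[]" k 0] by (rule order_trans[rotated]) auto
    have "cmod (u g) \<le> \<bar>K\<bar> * schwartz_seminorm k g"
      using K[OF g] mult_right_mono[OF abs_ge_self[of K] s0] by linarith
    also have "\<dots> \<le> \<bar>K\<bar> * e" by (intro mult_left_mono schwartz_seminorm_le le) auto
    finally show "cmod (u g) \<le> \<bar>K\<bar> * e" .
  qed simp
qed

lemma tempered_add_cmult:
  assumes "tempered_distribution u" "schwartz g" "schwartz h"
  shows "u (\<lambda>t. g t + c * h t) = u g + c * u h"
  using assms schwartz_cmult[OF assms(3), of c] unfolding tempered_distribution_def by metis

lemma tempered_cmult:
  assumes "tempered_distribution u" "schwartz g"
  shows "u (\<lambda>t. c * g t) = c * u g"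
  using assms unfolding tempered_distribution_def by metis

lemma schwartz_sum_tempered:
  fixes g :: "real^'n::finite \<Rightarrow> complex" and G :: "'b \<Rightarrow> real^'n \<Rightarrow> complex"
  assumes "finite D" "schwartz g" "\<And>x. x \<in> D \<Longrightarrow> schwartz (G x)" "tempered_distribution u"
  shows "u (\<lambda>t. \<Sum>x\<in>D. c x * G x t) = (\<Sum>x\<in>D. c x * u (G x))"
    and "iter_partial_deriv is (\<lambda>t. \<Sum>x\<in>D. c x * G x t) = (\<lambda>t. \<Sum>x\<in>D. c x * iter_partial_deriv is (G x) t)"
proof -
  have "u (\<lambda>t. \<Sum>x\<in>D. c x * G x t) = (\<Sum>x\<in>D. c x * u (G x)) \<and>
    iter_partial_deriv is (\<lambda>t. \<Sum>x\<in>D. c x * G x t) = (\<lambda>t. \<Sum>x\<in>D. c x * iter_partial_deriv is (G x) t)"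
    using assms(1-3)
  proof (induction D)
    \<comment> \<open>The zero function appears as \<open>0 * g\<close> and as
      \<open>g + (-1) * g\<close>, so linearity covers the empty sum.\<close>
    case empty
    have "u (\<lambda>t. 0 * g t) = 0 * u g" by (rule tempered_cmult[OF assms(4) assms(2)])
    moreover have "iter_partial_deriv is (\<lambda>t. g t + (-1) * g t) = (\<lambda>t. iter_partial_deriv is g t + (-1) * iter_partial_deriv is g t)"
      by (intro iter_add_cmult schwartz_smooth assms(2))
    ultimately show ?case by simp
  next
    case (insert x D)
    have s: "schwartz (\<lambda>t. \<Sum>x\<in>D. c x * G x t)" by (rule schwartz_sum[OF insert(1) assms(2)]) (use insert in auto)
    have gx: "schwartz (G x)" using insert by simp
    have eq: "(\<lambda>t. \<Sum>y\<in>insert x D. c y * G y t) = (\<lambda>t. (\<Sum>x\<in>D. c x * G x t) + c x * G x t)"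
      using insert by (simp add: add.commute)
    show ?case
      unfolding eq tempered_add_cmult[OF assms(4) s gx] iter_add_cmult[OF schwartz_smooth[OF s] schwartz_smooth[OF gx]]
      using insert by (simp add: add.commute)
  qed
  then show "u (\<lambda>t. \<Sum>x\<in>D. c x * G x t) = (\<Sum>x\<in>D. c x * u (G x))"
    and "iter_partial_deriv is (\<lambda>t. \<Sum>x\<in>D. c x * G x t) = (\<lambda>t. \<Sum>x\<in>D. c x * iter_partial_deriv is (G x) t)" by auto
qed

lemma tempered_atom_growth:
  assumes u: "tempered_distribution u" and g: "schwartz g"
  obtains C M where "C > 0" "\<And>w. cmod (u (atom w g)) \<le> C * (1 + norm w) ^ M"
proof -
  obtain K k where K: "K \<ge> 0" "\<And>h e. schwartz h \<Longrightarrow>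
     (\<And>is x. length is \<le> k \<Longrightarrow> (1 + norm x) ^ k * cmod (iter_partial_deriv is h x) \<le> e) \<Longrightarrow> cmod (u h) \<le> K * e"
    using tempered_bound[OF u] by metis
  obtain C M where C: "C > 0" "\<And>is w t. length is \<le> k \<Longrightarrow> (1 + norm t) ^ k * cmod (iter_partial_deriv is (atom w g) t) \<le> C * (1 + norm w) ^ M"
    using atom_bound_uniform[OF g, of k] by metis
  have "cmod (u (atom w g)) \<le> (K * C + C) * (1 + norm w) ^ M" for w
  proof -
    have "cmod (u (atom w g)) \<le> K * (C * (1 + norm w) ^ M)"
      by (rule K(2)[OF schwartz_atom[OF g] C(2)])
    also have "\<dots> \<le> (K * C + C) * (1 + norm w) ^ M" using C(1) by (simp add: distrib_right)
    finally show ?thesis .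
  qed
  moreover have "K * C + C > 0" using K(1) C(1) by (intro add_nonneg_pos) auto
  ultimately show thesis using that by blast
qed

lemma tempered_atom_continuous:
  assumes u: "tempered_distribution u" and g: "schwartz g"
  shows "continuous_on UNIV (\<lambda>w. u (atom w g))"
proof -
  obtain K k where K: "K \<ge> 0" "\<And>h e. schwartz h \<Longrightarrow>
     (\<And>is x. length is \<le> k \<Longrightarrow> (1 + norm x) ^ k * cmod (iter_partial_deriv is h x) \<le> e) \<Longrightarrow> cmod (u h) \<le> K * e"
    using tempered_bound[OF u] by metis
  obtain C M where C: "C > 0" "\<And>is w w' t. length is \<le> k \<Longrightarrow> norm (w - w') \<le> 1 \<Longrightarrow>
    (1 + norm t) ^ k * cmod (iter_partial_deriv is (atom w g) t - iter_partial_deriv is (atom w' g) t) \<le> C * (1 + norm w) ^ M * norm (w - w')"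
    using atom_lipschitz_uniform[OF g, of k] by metis
  show ?thesis
  proof (rule continuous_on_local_lipschitz[where C="\<lambda>w. K * (C * (1 + norm w) ^ M)"])
    fix w w' :: "(real^'a) \<times> (real^'a)" assume ww: "norm (w - w') \<le> 1"
    have eq: "u (atom w g) - u (atom w' g) = u (\<lambda>t. atom w g t + (-1) * atom w' g t)"
      using tempered_add_cmult[OF u schwartz_atom[OF g] schwartz_atom[OF g], of w "-1" w'] by simp
    have "cmod (u (\<lambda>t. atom w g t + (-1) * atom w' g t)) \<le> K * (C * (1 + norm w) ^ M * norm (w - w'))"
    proof (rule K(2))
      show "schwartz (\<lambda>t. atom w g t + (-1) * atom w' g t)" by (intro schwartz_add_cmult schwartz_atom g)
      fix "is" :: "'a list" and x assume "length is \<le> k"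
      then show "(1 + norm x) ^ k * cmod (iter_partial_deriv is (\<lambda>t. atom w g t + (-1) * atom w' g t) x) \<le> C * (1 + norm w) ^ M * norm (w - w')"
        using C(2)[OF _ ww, of "is" x] iter_add_cmult[of "atom w g" "atom w' g" "is" "-1"] g
        by (simp add: smooth_atom schwartz_smooth)
    qed
    then show "cmod (u (atom w g) - u (atom w' g)) \<le> K * (C * (1 + norm w) ^ M) * norm (w - w')"
      unfolding eq by (simp add: mult.assoc)
  qed
qed

section \<open>Schwartz functions as tempered distributions\<close>

lemma dist_of_fun_eq:
  assumes "schwartz g" "schwartz h"
  shows "dist_of_fun g h = (\<integral>t. g t * h t \<partial>lborel)"
proof -
  have [measurable]: "g \<in> borel_measurable borel" "h \<in> borel_measurable borel"
    by (intro schwartz_measurable assms)+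
  show ?thesis unfolding dist_of_fun_def by (rule integral_completion) measurable
qed

lemma integrable_schwartz_mult:
  fixes g h :: "real^'n::finite \<Rightarrow> complex"
  assumes "schwartz g" "schwartz h"
  shows "integrable lborel (\<lambda>t. g t * h t)"
  using integrable_mult_atom[OF assms, of 0] by (simp add: atom_def)

lemma dist_of_fun_tempered:
  fixes g :: "real^'n::finite \<Rightarrow> complex"
  assumes g: "schwartz g"
  shows "tempered_distribution (dist_of_fun g)"
  unfolding tempered_distribution_def
proof (intro conjI allI impI)
  fix h1 h2 :: "real^'n \<Rightarrow> complex" assume h: "schwartz h1" "schwartz h2"
  have "schwartz (\<lambda>t. h1 t + h2 t)" using schwartz_add_cmult[OF h, of 1] by simp
  then show "dist_of_fun g (\<lambda>t. h1 t + h2 t) = dist_of_fun g h1 + dist_of_fun g h2"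
    using integrable_schwartz_mult[OF g h(1)] integrable_schwartz_mult[OF g h(2)] h
    by (simp add: dist_of_fun_eq g distrib_left)
next
  fix c and h :: "real^'n \<Rightarrow> complex" assume "schwartz h"
  then show "dist_of_fun g (\<lambda>t. c * h t) = c * dist_of_fun g h"
    by (simp add: dist_of_fun_eq g schwartz_cmult mult.left_commute)
next
  have "cmod (dist_of_fun g h) \<le> (\<integral>t. cmod (g t) \<partial>lborel) * schwartz_seminorm 0 h" if h: "schwartz h" for h
  proof -
    have hb: "cmod (h t) \<le> schwartz_seminorm 0 h" for t
      using schwartz_seminorm_ge[OF h, of "[]" 0 t] by simp
    obtain C where C: "\<And>x. cmod (g x) \<le> C * kap (DIM(real^'n) + 2) x" using schwartz_kap[OF g] by metis
    have [measurable]: "g \<in> borel_measurable borel" by (rule schwartz_measurable[OF g])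
    have ig: "integrable lborel g"
    proof (rule Bochner_Integration.integrable_bound)
      show "integrable lborel (\<lambda>x::real^'n. C * kap (DIM(real^'n) + 2) x)"
        by (intro integrable_mult_right integrable_kap order_refl)
      show "AE x in lborel. norm (g x) \<le> norm (C * kap (DIM(real^'n) + 2) x)"
        by (rule AE_I2, rule order_trans[OF C]) simp
    qed measurable
    have "cmod (dist_of_fun g h) \<le> (\<integral>t. cmod (g t) * schwartz_seminorm 0 h \<partial>lborel)"
      unfolding dist_of_fun_eq[OF g h]
    proof (rule order_trans[OF integral_norm_bound integral_mono'])
      show "integrable lborel (\<lambda>t. cmod (g t) * schwartz_seminorm 0 h)" using ig by simp
      show "cmod (g t * h t) \<le> cmod (g t) * schwartz_seminorm 0 h" for t
        unfolding norm_mult by (intro mult_left_mono hb) simp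
      show "0 \<le> cmod (g t) * schwartz_seminorm 0 h" for t
        using order_trans[OF norm_ge_zero hb] by simp
    qed
    then show ?thesis by simp
  qed
  then show "\<exists>K k. \<forall>h. schwartz h \<longrightarrow> cmod (dist_of_fun g h) \<le> K * schwartz_seminorm k h" by blast
qed

lemma amb_eq_dist: "schwartz g \<Longrightarrow> schwartz h \<Longrightarrow> amb g h w = dist_of_fun g (atom w h)"
  by (simp add: amb_def dist_of_fun_eq schwartz_atom)

lemma amb_continuous:
  assumes "schwartz g" "schwartz h" shows "continuous_on UNIV (amb g h)"
proof -
  have "amb g h = (\<lambda>w. dist_of_fun g (atom w h))" by (rule ext) (rule amb_eq_dist[OF assms])
  then show ?thesis using tempered_atom_continuous[OF dist_of_fun_tempered[OF assms(1)] assms(2)] by simp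
qed

section \<open>Exchanging a distribution with an integral of atoms\<close>

lemma riemann_sum_error:
  fixes h :: "'a::euclidean_space \<Rightarrow> complex"
  assumes cont: "continuous_on (cbox a b) h" and D: "D tagged_division_of (cbox a b)" and e: "0 \<le> e"
    and osc: "\<And>x K y. (x, K) \<in> D \<Longrightarrow> y \<in> K \<Longrightarrow> cmod (h y - h x) \<le> e"
  shows "cmod (integral (cbox a b) h - (\<Sum>(x, K)\<in>D. of_real (measure lborel K) * h x)) \<le> e * measure lborel (cbox a b)"
proof -
  have int: "h integrable_on cbox a b" by (rule integrable_continuous[OF cont])
  have "integral (cbox a b) h - (\<Sum>(x, K)\<in>D. of_real (measure lborel K) * h x)
     = (\<Sum>(x, K)\<in>D. integral K h - of_real (measure lborel K) * h x)"
    unfolding integral_combine_tagged_division_topdown[OF int D] by (simp add: sum_subtractf split_def)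
  also have "cmod \<dots> \<le> (\<Sum>(x, K)\<in>D. e * measure lborel K)"
  proof (rule order_trans[OF norm_sum sum_mono], clarify)
    fix x K assume xK: "(x, K) \<in> D"
    then obtain l r where K: "K = cbox l r" and sub: "K \<subseteq> cbox a b" using tagged_division_ofD[OF D] by metis
    have "h integrable_on cbox l r" using integrable_on_subcbox[OF int] sub K by simp
    then have "((\<lambda>y. h y - h x) has_integral (integral (cbox l r) h - measure lborel (cbox l r) *\<^sub>R h x)) (cbox l r)"
      by (intro has_integral_diff integrable_integral has_integral_const)
    then have "norm (integral (cbox l r) h - measure lborel (cbox l r) *\<^sub>R h x) \<le> e * measure lborel (cbox l r)"
      using has_integral_bound[OF e, of "\<lambda>y. h y - h x" _ l r] osc[OF xK] K by simp
    then show "cmod (integral K h - of_real (measure lborel K) * h x) \<le> e * measure lborel K"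
      by (simp add: K scaleR_conv_of_real)
  qed
  also have "\<dots> = e * (\<Sum>(x, K)\<in>D. measure lborel K)" by (simp add: sum_distrib_left split_def)
  also have "(\<Sum>(x, K)\<in>D. measure lborel K) = measure lborel (cbox a b)" by (rule additive_content_tagged_division[OF D])
  finally show ?thesis .
qed

text \<open>Rapid decay of \<open>c\<close> beats the polynomial growth of \<open>f\<close> with
  \<open>DIM('a) + 2\<close> powers to spare. The bound for the product is exported together with
  integrability, so that it can serve as a majorant elsewhere.\<close>

lemma rapid_decay_integrable:
  fixes c f :: "'a::euclidean_space \<Rightarrow> complex"
  assumes [measurable]: "c \<in> borel_measurable borel" "f \<in> borel_measurable borel"
    and c: "\<And>j. \<exists>C. \<forall>w. cmod (c w) \<le> C * kap j w"
    and f: "\<And>w. cmod (f w) \<le> K * (1 + norm w) ^ M"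
  obtains C where "C \<ge> 0" "\<And>w. cmod (c w) * (K * (1 + norm w) ^ M) \<le> C * kap (DIM('a) + 2) w" "integrable lborel (\<lambda>w. c w * f w)"
proof -
  define d where "d = DIM('a) + 2"
  obtain C where C: "\<And>w. cmod (c w) \<le> C * kap (M + d) w" using c by blast
  have K0: "K \<ge> 0" using order_trans[OF norm_ge_zero f[of 0]] by simp
  have C0: "C \<ge> 0" using order_trans[OF norm_ge_zero C[of 0]] by (simp add: kap_def)
  have le: "cmod (c w) * (K * (1 + norm w) ^ M) \<le> C * K * kap d w" for w
  proof -
    have "cmod (c w) * (K * (1 + norm w) ^ M) \<le> (C * kap (M + d) w) * (K * (1 + norm w) ^ M)"
      using K0 by (intro mult_right_mono C) auto
    also have "\<dots> = C * K * ((kap M w * (1 + norm w) ^ M) * kap d w)" by (simp only: kap_add mult_ac)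
    finally show ?thesis by simp
  qed
  have int: "integrable lborel (\<lambda>w. c w * f w)"
  proof (rule Bochner_Integration.integrable_bound)
    show "integrable lborel (\<lambda>w::'a. C * K * kap d w)" unfolding d_def by (intro integrable_mult_right integrable_kap order_refl)
    show "AE w in lborel. norm (c w * f w) \<le> norm (C * K * kap d w)"
    proof (rule AE_I2)
      fix w
      have "cmod (c w) * cmod (f w) \<le> cmod (c w) * (K * (1 + norm w) ^ M)" by (intro mult_left_mono f) simp
      then show "norm (c w * f w) \<le> norm (C * K * kap d w)" using le[of w] by (simp add: norm_mult)
    qed
  qed measurable
  show thesis using that[of "C * K"] le int C0 K0 by (simp add: d_def)
qed

lemma atom_measurable: "schwartz g \<Longrightarrow> (\<lambda>w. iter_partial_deriv is (atom w g) t) \<in> borel_measurable borel"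
  by (intro borel_measurable_continuous_onI atom_continuous)

lemma atom_growth:
  assumes "schwartz g"
  obtains K M where "K > 0" "\<And>w t. cmod (iter_partial_deriv is (atom w g) t) \<le> K * (1 + norm w) ^ M"
proof -
  obtain K M where K: "K > 0" "\<And>w t. (1 + norm t) ^ 0 * cmod (iter_partial_deriv is (atom w g) t) \<le> K * (1 + norm w) ^ M"
    using atom_bound[OF assms, where k=0] by metis
  then have "\<And>w t. cmod (iter_partial_deriv is (atom w g) t) \<le> K * (1 + norm w) ^ M" by (simp only: power_0 mult_1_left)
  with K(1) show thesis by (rule that)
qed

text \<open>Both sides are differentiated through difference quotients, so only the existence of the
  derivatives of the limit \<open>I\<close> is needed.\<close>

lemma iter_integral_atom:
  fixes g I :: "real^'n::finite \<Rightarrow> complex" and c :: "(real^'n) \<times> (real^'n) \<Rightarrow> complex"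
  assumes g: "schwartz g" and I: "smooth I" and [measurable]: "c \<in> borel_measurable borel"
    and c: "\<And>j. \<exists>C. \<forall>w. cmod (c w) \<le> C * kap j w"
    and base: "\<And>t. (\<integral>w. c w * atom w g t \<partial>lborel) = I t"
  shows "(\<integral>w. c w * iter_partial_deriv is (atom w g) t \<partial>lborel) = iter_partial_deriv is I t"
proof (induction "is" arbitrary: t)
  case Nil
  then show ?case by (simp add: base)
next
  case (Cons i "is")
  define \<Psi> where "\<Psi> = (\<lambda>w. iter_partial_deriv is (atom w g))"
  have \<Psi>m [measurable]: "(\<lambda>w. \<Psi> w t) \<in> borel_measurable borel" for t unfolding \<Psi>_def by (rule atom_measurable[OF g])
  have D\<Psi>: "\<Psi> w differentiable (at t)" for w t unfolding \<Psi>_def by (intro smooth_iter smooth_atom schwartz_smooth g)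
  have it: "iter_partial_deriv (i # is) (atom w g) = partial_deriv i (\<Psi> w)" for w by (simp add: \<Psi>_def iter_Cons)
  obtain K0 M0 where K0: "K0 > 0" "\<And>w t. cmod (\<Psi> w t) \<le> K0 * (1 + norm w) ^ M0"
    unfolding \<Psi>_def using atom_growth[OF g] by metis
  have int: "integrable lborel (\<lambda>w. c w * \<Psi> w t)" for t
    by (rule rapid_decay_integrable[OF _ _ c K0(2)]) auto
  obtain K M where K: "K > 0" "\<And>w t. cmod (partial_deriv i (\<Psi> w) t) \<le> K * (1 + norm w) ^ M"
    unfolding it[symmetric] using atom_growth[OF g] by metis
  \<comment> \<open>The auxiliary function is the growth bound itself; this instance is taken for
    the majorant of the difference quotients.\<close>
  obtain C where C: "C \<ge> 0" "\<And>w. cmod (c w) * (K * (1 + norm w) ^ M) \<le> C * kap (DIM((real^'n) \<times> (real^'n)) + 2) w"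
  proof (rule rapid_decay_integrable[OF _ _ c])
    show "cmod (complex_of_real (K * (1 + norm w) ^ M)) \<le> K * (1 + norm w) ^ M" for w :: "(real^'n) \<times> (real^'n)"
      using K(1) by (simp only: norm_of_real) simp
  qed auto
  define Q where "Q = (\<lambda>m w. c w * ((\<Psi> w (t + (1 / real (Suc m)) *\<^sub>R axis i 1) - \<Psi> w t) * of_nat (Suc m)))"
  have "(\<lambda>m. \<integral>w. Q m w \<partial>lborel) \<longlonglongrightarrow> (\<integral>w. c w * partial_deriv i (\<Psi> w) t \<partial>lborel)"
  proof (rule integral_dominated_convergence[where w="\<lambda>w. C * kap (DIM((real^'n) \<times> (real^'n)) + 2) w"])
    show "AE w in lborel. (\<lambda>m. Q m w) \<longlonglongrightarrow> c w * partial_deriv i (\<Psi> w) t"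
      unfolding Q_def by (intro AE_I2 tendsto_mult_left difference_quotient_tendsto D\<Psi>)
    show "(\<lambda>w. c w * partial_deriv i (\<Psi> w) t) \<in> borel_measurable lborel"
      unfolding it[symmetric] using atom_measurable[OF g, of "i # is" t] by simp
    show "Q m \<in> borel_measurable lborel" for m unfolding Q_def by measurable
    show "integrable lborel (\<lambda>w. C * kap (DIM((real^'n) \<times> (real^'n)) + 2) (w :: (real^'n) \<times> (real^'n)))"
      by (intro integrable_mult_right integrable_kap order_refl)
    show "AE w in lborel. norm (Q m w) \<le> C * kap (DIM((real^'n) \<times> (real^'n)) + 2) w" for m
    proof (rule AE_I2)
      fix w :: "(real^'n) \<times> (real^'n)"
      have "cmod (\<Psi> w (t + (1 / real (Suc m)) *\<^sub>R axis i 1) - \<Psi> w t) \<le> (K * (1 + norm w) ^ M) * (1 / real (Suc m))"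
        by (rule difference_bound[OF D\<Psi> _ K(2)]) simp
      then have "cmod (\<Psi> w (t + (1 / real (Suc m)) *\<^sub>R axis i 1) - \<Psi> w t) * real (Suc m) \<le> (K * (1 + norm w) ^ M) * (1 / real (Suc m)) * real (Suc m)"
        by (rule mult_right_mono) simp
      also have "\<dots> = K * (1 + norm w) ^ M" by (simp del: of_nat_Suc)
      finally have "cmod (c w) * (cmod (\<Psi> w (t + (1 / real (Suc m)) *\<^sub>R axis i 1) - \<Psi> w t) * real (Suc m)) \<le> cmod (c w) * (K * (1 + norm w) ^ M)"
        by (rule mult_left_mono) simp
      also have "\<dots> \<le> C * kap (DIM((real^'n) \<times> (real^'n)) + 2) w" by (rule C(2))
      finally show "norm (Q m w) \<le> C * kap (DIM((real^'n) \<times> (real^'n)) + 2) w"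
        by (simp add: Q_def norm_mult del: of_nat_Suc)
    qed
  qed
  moreover have "(\<integral>w. Q m w \<partial>lborel) = (iter_partial_deriv is I (t + (1 / real (Suc m)) *\<^sub>R axis i 1) - iter_partial_deriv is I t) * of_nat (Suc m)" for m
  proof -
    have "(\<integral>w. Q m w \<partial>lborel) = (\<integral>w. (c w * \<Psi> w (t + (1 / real (Suc m)) *\<^sub>R axis i 1) - c w * \<Psi> w t) * of_nat (Suc m) \<partial>lborel)"
      by (simp only: Q_def right_diff_distrib left_diff_distrib mult.assoc)
    also have "\<dots> = ((\<integral>w. c w * \<Psi> w (t + (1 / real (Suc m)) *\<^sub>R axis i 1) \<partial>lborel) - (\<integral>w. c w * \<Psi> w t \<partial>lborel)) * of_nat (Suc m)"
      by (simp only: integral_mult_left_zero Bochner_Integration.integral_diff[OF int int])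
    finally show ?thesis by (simp only: \<Psi>_def Cons.IH)
  qed
  moreover have "(\<lambda>m. (iter_partial_deriv is I (t + (1 / real (Suc m)) *\<^sub>R axis i 1) - iter_partial_deriv is I t) * of_nat (Suc m)) \<longlonglongrightarrow> partial_deriv i (iter_partial_deriv is I) t"
    by (intro difference_quotient_tendsto smooth_iter I)
  ultimately have "(\<integral>w. c w * partial_deriv i (\<Psi> w) t \<partial>lborel) = partial_deriv i (iter_partial_deriv is I) t"
    by (simp only: LIMSEQ_unique)
  then show ?case unfolding it unfolding iter_Cons .
qed

text \<open>The Riemann sums over a large box converge in every Schwartz seminorm.\<close>

lemma tempered_integral_atom:
  fixes g I :: "real^'n::finite \<Rightarrow> complex" and c :: "(real^'n) \<times> (real^'n) \<Rightarrow> complex"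
  assumes u: "tempered_distribution u" and g: "schwartz g" and I: "schwartz I"
    and c_cont: "continuous_on UNIV c"
    and c: "\<And>j. \<exists>C. \<forall>w. cmod (c w) \<le> C * kap j w"
    and base: "\<And>t. (\<integral>w. c w * atom w g t \<partial>lborel) = I t"
  shows "(\<integral>w. c w * u (atom w g) \<partial>lborel) = u I"
proof -
  define d where "d = DIM((real^'n) \<times> (real^'n)) + 2"
  have cm [measurable]: "c \<in> borel_measurable borel" using c_cont by (rule borel_measurable_continuous_onI)
  define F where "F = (\<lambda>w. u (atom w g))"
  have F_cont: "continuous_on UNIV F" unfolding F_def by (rule tempered_atom_continuous[OF u g])
  then have [measurable]: "F \<in> borel_measurable borel" by (rule borel_measurable_continuous_onI)
  obtain KF MF where KF: "KF > 0" "\<And>w. cmod (F w) \<le> KF * (1 + norm w) ^ MF"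
    unfolding F_def using tempered_atom_growth[OF u g] by metis
  have icF: "integrable lborel (\<lambda>w. c w * F w)"
    by (rule rapid_decay_integrable[OF _ _ c KF(2)]) auto
  obtain K k where K: "K \<ge> 0" "\<And>h e. schwartz h \<Longrightarrow>
     (\<And>is x. length is \<le> k \<Longrightarrow> (1 + norm x) ^ k * cmod (iter_partial_deriv is h x) \<le> e) \<Longrightarrow> cmod (u h) \<le> K * e"
    using tempered_bound[OF u] by metis
  obtain C1 M1 where C1: "C1 > 0" "\<And>is w t. length is \<le> k \<Longrightarrow> (1 + norm t) ^ k * cmod (iter_partial_deriv is (atom w g) t) \<le> C1 * (1 + norm w) ^ M1"
    using atom_bound_uniform[OF g, of k] by metis
  obtain C2 M2 where C2: "C2 > 0" "\<And>is w w' t. length is \<le> k \<Longrightarrow> norm (w - w') \<le> 1 \<Longrightarrow>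
    (1 + norm t) ^ k * cmod (iter_partial_deriv is (atom w g) t - iter_partial_deriv is (atom w' g) t) \<le> C2 * (1 + norm w) ^ M2 * norm (w - w')"
    using atom_lipschitz_uniform[OF g, of k] by metis
  \<comment> \<open>One integrable majorant for the integrands of all derivatives up to order
    \<open>k\<close> at all points \<open>t\<close>, so that the tails outside large boxes are small
    uniformly in the seminorm.\<close>
  obtain E where E: "E \<ge> 0" "\<And>w. cmod (c w) * (C1 * (1 + norm w) ^ M1) \<le> E * kap d w"
  proof (rule rapid_decay_integrable[OF cm _ c])
    show "cmod (complex_of_real (C1 * (1 + norm w) ^ M1)) \<le> C1 * (1 + norm w) ^ M1" for w :: "(real^'n) \<times> (real^'n)"
      using C1(1) by (simp only: norm_of_real) simp
  qed (auto simp: d_def)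
  have iE: "integrable lborel (\<lambda>w. E * kap d (w :: (real^'n) \<times> (real^'n)))"
    unfolding d_def by (intro integrable_mult_right integrable_kap order_refl)
  define B where "B = (\<lambda>m. cbox (- (real m *\<^sub>R One)) (real m *\<^sub>R One) :: ((real^'n) \<times> (real^'n)) set)"
  have Bm [measurable]: "B m \<in> sets borel" for m by (simp add: B_def)
  define \<tau> where "\<tau> = (\<lambda>m. \<integral>w. E * kap d w * indicator (- B m) w \<partial>lborel)"
  have B_ev: "eventually (\<lambda>m. w \<in> B m) sequentially" for w
  proof (rule eventually_sequentiallyI[of "nat \<lceil>norm w\<rceil>"])
    fix m assume "nat \<lceil>norm w\<rceil> \<le> m"
    then have wm: "norm w \<le> real m" by linarith
    show "w \<in> B m"
      unfolding B_def mem_box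
    proof
      fix b :: "(real^'n) \<times> (real^'n)" assume b: "b \<in> Basis"
      then have "\<bar>w \<bullet> b\<bar> \<le> real m" using Basis_le_norm[OF b, of w] wm by linarith
      then show "- (real m *\<^sub>R One) \<bullet> b \<le> w \<bullet> b \<and> w \<bullet> b \<le> (real m *\<^sub>R One) \<bullet> b"
        using b by (simp add: abs_le_iff)
    qed
  qed
  have \<tau>_lim: "\<tau> \<longlonglongrightarrow> 0"
  proof -
    have "\<tau> \<longlonglongrightarrow> (\<integral>w. 0 \<partial>(lborel :: ((real^'n) \<times> (real^'n)) measure))"
      unfolding \<tau>_def
    proof (rule integral_dominated_convergence[where w="\<lambda>w. E * kap d w"])
      show "AE w in lborel. (\<lambda>m. E * kap d w * indicator (- B m) w) \<longlonglongrightarrow> 0"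
      proof (rule AE_I2, rule tendsto_eventually)
        fix w show "eventually (\<lambda>m. E * kap d w * indicator (- B m) w = 0) sequentially"
          using B_ev[of w] by eventually_elim simp
      qed
      show "AE w in lborel. norm (E * kap d w * indicator (- B m) w) \<le> E * kap d w" for m
        using E(1) by (auto simp: indicator_def)
    qed (use iE in auto)
    then show ?thesis by simp
  qed
  define a where "a = (\<lambda>m. integral (B m) (\<lambda>w. c w * F w))"
  have a_lim: "a \<longlonglongrightarrow> (\<integral>w. c w * F w \<partial>lborel)"
  proof -
    have eq: "a m = (\<integral>w. indicator (B m) w *\<^sub>R (c w * F w) \<partial>lborel)" for m
    proof -
      have "set_integrable lborel (B m) (\<lambda>w. c w * F w)"
        unfolding set_integrable_def by (rule integrable_mult_indicator[OF _ icF]) simp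
      from set_borel_integral_eq_integral(2)[OF this] show ?thesis
        by (simp add: a_def set_lebesgue_integral_def)
    qed
    show ?thesis unfolding eq
    proof (rule integral_dominated_convergence[where w="\<lambda>w. norm (c w * F w)"])
      show "AE w in lborel. (\<lambda>m. indicator (B m) w *\<^sub>R (c w * F w)) \<longlonglongrightarrow> c w * F w"
      proof (rule AE_I2, rule tendsto_eventually)
        fix w show "eventually (\<lambda>m. indicator (B m) w *\<^sub>R (c w * F w) = c w * F w) sequentially"
          using B_ev[of w] by eventually_elim simp
      qed
      show "AE w in lborel. norm (indicator (B m) w *\<^sub>R (c w * F w)) \<le> norm (c w * F w)" for m
        by (auto simp: indicator_def)
    qed (use icF in auto)
  qed
  \<comment> \<open>For a fixed box the integral is approximated by Riemann sums with an arbitrarily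
    small error \<open>e0\<close>, so that only the tail \<tau> remains; the limit over the boxes is
    taken afterwards.\<close>
  have key: "cmod (u I - a m) \<le> K * \<tau> m" for m
  proof (rule field_le_epsilon)
    fix e0 :: real assume e0: "e0 > 0"
    define V where "V = measure lborel (B m)"
    have V: "V \<ge> 0" by (simp add: V_def)
    \<comment> \<open>The error \<open>e\<close> enters twice: times \<open>K * V\<close> through
      the seminorm of the difference, and once more through the Riemann sum of
      \<open>c w * F w\<close>.\<close>
    define e where "e = e0 / (K * V + 1)"
    have KV: "K * V + 1 > 0" using K(1) V by (intro add_nonneg_pos) auto
    have e: "e > 0" using e0 KV by (simp add: e_def)
    have e_sum: "K * (\<tau> m + e * V) + e = K * \<tau> m + e0"
    proof -
      have "e * (K * V + 1) = e0" using KV unfolding e_def by simp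
      then show ?thesis by (simp add: algebra_simps)
    qed
    have comp: "compact (B m)" by (simp add: B_def compact_cbox)
    define h where "h = (\<lambda>is t w. of_real ((1 + norm t) ^ k) * (c w * iter_partial_deriv is (atom w g) t))"
    obtain Rc where Rc: "Rc > 0" "\<And>w. w \<in> B m \<Longrightarrow> cmod (c w) \<le> Rc"
    proof -
      have "bounded (c ` B m)"
        by (intro compact_imp_bounded compact_continuous_image comp continuous_on_subset[OF c_cont]) auto
      then show thesis using that unfolding bounded_pos by auto
    qed
    obtain R where R: "R > 0" "\<And>w. w \<in> B m \<Longrightarrow> 1 + norm w \<le> R"
    proof -
      have "bounded (B m)" using comp by (rule compact_imp_bounded)
      then obtain b where "b > 0" "\<And>w. w \<in> B m \<Longrightarrow> norm w \<le> b" unfolding bounded_pos by auto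
      then show thesis using that[of "1 + b"] by auto
    qed
    have uc: "uniformly_continuous_on (B m) c"
      by (intro compact_uniformly_continuous comp continuous_on_subset[OF c_cont]) auto
    \<comment> \<open>The oscillation of the product splits into that of \<open>c\<close> and that
      of the atom; \<open>e1\<close> and \<open>\<delta>2\<close> allot half of \<open>e\<close> to
      each.\<close>
    define e1 where "e1 = e / (2 * (C1 * R ^ M1))"
    have e1: "e1 > 0" using e C1(1) R(1) by (simp add: e1_def)
    obtain \<delta>1 where \<delta>1: "\<delta>1 > 0" "\<And>w w'. w \<in> B m \<Longrightarrow> w' \<in> B m \<Longrightarrow> dist w' w < \<delta>1 \<Longrightarrow> dist (c w') (c w) < e1"
      using uc e1 unfolding uniformly_continuous_on_def by metis
    define \<delta>2 where "\<delta>2 = e / (2 * (Rc * (C2 * R ^ M2)))"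
    have \<delta>2: "\<delta>2 > 0" using e C2(1) R(1) Rc(1) by (simp add: \<delta>2_def)
    define \<delta> where "\<delta> = min 1 (min \<delta>1 \<delta>2)"
    have \<delta>: "\<delta> > 0" using \<delta>1 \<delta>2 by (simp add: \<delta>_def)
    have osc: "cmod (h is t w' - h is t w) \<le> e" if "length is \<le> k" "w \<in> B m" "w' \<in> B m" "dist w w' < \<delta>" for "is" t w w'
    proof -
      define p p' where "p = iter_partial_deriv is (atom w g) t" and "p' = iter_partial_deriv is (atom w' g) t"
      have dw: "norm (w' - w) \<le> 1" "norm (w' - w) \<le> \<delta>2" "dist w' w < \<delta>1"
        using that(4) by (auto simp: \<delta>_def dist_norm norm_minus_commute)
      have A1: "(1 + norm t) ^ k * cmod p \<le> C1 * R ^ M1"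
      proof -
        have "(1 + norm t) ^ k * cmod p \<le> C1 * (1 + norm w) ^ M1" unfolding p_def by (rule C1(2)[OF that(1)])
        also have "\<dots> \<le> C1 * R ^ M1" using C1(1) R(2)[OF that(2)] by (intro mult_left_mono power_mono) auto
        finally show ?thesis .
      qed
      have A2: "(1 + norm t) ^ k * cmod (p' - p) \<le> C2 * R ^ M2 * \<delta>2"
      proof -
        have "(1 + norm t) ^ k * cmod (p' - p) \<le> C2 * (1 + norm w') ^ M2 * norm (w' - w)"
          unfolding p_def p'_def by (rule C2(2)[OF that(1) dw(1)])
        also have "\<dots> \<le> C2 * R ^ M2 * \<delta>2"
          using C2(1) R(1) R(2)[OF that(3)] dw(2) by (intro mult_mono power_mono) auto
        finally show ?thesis .
      qed
      have "h is t w' - h is t w = of_real ((1 + norm t) ^ k) * (c w' * (p' - p) + (c w' - c w) * p)"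
        by (simp add: h_def p_def p'_def algebra_simps)
      then have "cmod (h is t w' - h is t w) = (1 + norm t) ^ k * cmod (c w' * (p' - p) + (c w' - c w) * p)"
        by (simp only: norm_mult norm_of_real) simp
      also have "\<dots> \<le> (1 + norm t) ^ k * (cmod (c w') * cmod (p' - p) + cmod (c w' - c w) * cmod p)"
        by (intro mult_left_mono order_trans[OF norm_triangle_ineq]) (auto simp: norm_mult)
      also have "\<dots> = cmod (c w') * ((1 + norm t) ^ k * cmod (p' - p)) + cmod (c w' - c w) * ((1 + norm t) ^ k * cmod p)"
        by (simp add: algebra_simps)
      also have "\<dots> \<le> Rc * (C2 * R ^ M2 * \<delta>2) + e1 * (C1 * R ^ M1)"
        using Rc that(3) \<delta>1(2)[OF that(2,3) dw(3)] e1 Rc(1) C1(1) R(1)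
        by (intro add_mono mult_mono A1 A2) (auto simp: dist_norm less_imp_le)
      also have "\<dots> = e / 2 + e / 2"
      proof -
        have "Rc * (C2 * R ^ M2 * \<delta>2) = e / 2" using Rc(1) C2(1) R(1) by (simp add: \<delta>2_def)
        moreover have "e1 * (C1 * R ^ M1) = e / 2" using C1(1) R(1) by (simp add: e1_def)
        ultimately show ?thesis by simp
      qed
      finally show ?thesis by simp
    qed
    have "((\<lambda>w. c w * F w) has_integral a m) (B m)"
      unfolding a_def B_def
      by (intro integrable_integral integrable_continuous continuous_on_mult continuous_on_subset[OF c_cont] continuous_on_subset[OF F_cont]) auto
    then have "\<forall>e>0. \<exists>\<gamma>. gauge \<gamma> \<and> (\<forall>D. D tagged_division_of (B m) \<and> \<gamma> fine D \<longrightarrow>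
       norm ((\<Sum>(x, k)\<in>D. measure lborel k *\<^sub>R (c x * F x)) - a m) < e)"
      unfolding B_def has_integral[of "\<lambda>w. c w * F w"] .
    from this[THEN spec, THEN mp, OF e] obtain \<gamma> where \<gamma>_def: "gauge \<gamma> \<and> (\<forall>D. D tagged_division_of (B m) \<and> \<gamma> fine D \<longrightarrow>
       norm ((\<Sum>(x, k)\<in>D. measure lborel k *\<^sub>R (c x * F x)) - a m) < e)" ..
    note \<gamma> = \<gamma>_def[THEN conjunct1] \<gamma>_def[THEN conjunct2, THEN spec, THEN mp, OF conjI]
    \<comment> \<open>The gauge obtained from the integral of \<open>c w * F w\<close> is
      intersected with balls of radius \<delta>, so that a single tagged division serves this
      integral and all seminorm integrands at once.\<close>
    have "gauge (\<lambda>x. \<gamma> x \<inter> ball x \<delta>)" by (intro gauge_Int \<gamma>(1) gauge_ball \<delta>)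
    then obtain D where D: "D tagged_division_of (B m)" "(\<lambda>x. \<gamma> x \<inter> ball x \<delta>) fine D"
      unfolding B_def using fine_division_exists by blast
    have fineD: "\<gamma> fine D" "(\<lambda>x. ball x \<delta>) fine D" using D(2) by (auto simp: fine_Int)
    have finD: "finite D" using D(1) by (rule tagged_division_of_finite)
    \<comment> \<open>The Riemann sum as a function of \<open>t\<close>: a finite combination of
      atoms, hence a Schwartz function on which \<open>u\<close> is evaluated by linearity.\<close>
    define G where "G = (\<lambda>t. \<Sum>p\<in>D. (of_real (measure lborel (snd p)) * c (fst p)) * atom (fst p) g t)"
    have sG: "schwartz G" unfolding G_def by (rule schwartz_sum[OF finD g schwartz_atom[OF g]])
    have uG: "u G = (\<Sum>p\<in>D. (of_real (measure lborel (snd p)) * c (fst p)) * F (fst p))"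
      unfolding G_def F_def by (rule schwartz_sum_tempered(1)[OF finD g schwartz_atom[OF g] u])
    have itG: "iter_partial_deriv is G = (\<lambda>t. \<Sum>p\<in>D. (of_real (measure lborel (snd p)) * c (fst p)) * iter_partial_deriv is (atom (fst p) g) t)" for "is"
      unfolding G_def by (rule schwartz_sum_tempered(2)[OF finD g schwartz_atom[OF g] u])
    have uG_a: "cmod (u G - a m) \<le> e"
      using \<gamma>(2)[OF D(1) fineD(1)] unfolding uG by (simp add: split_def scaleR_conv_of_real mult.assoc)
    have "cmod (u (\<lambda>t. I t + (-1) * G t)) \<le> K * (\<tau> m + e * V)"
    proof (rule K(2))
      show "schwartz (\<lambda>t. I t + (-1) * G t)" by (intro schwartz_add_cmult I sG)
      fix "is" :: "'n list" and t assume len: "length is \<le> k"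
      have itI: "iter_partial_deriv is I t = (\<integral>w. c w * iter_partial_deriv is (atom w g) t \<partial>lborel)"
        by (rule iter_integral_atom[OF g schwartz_smooth[OF I] cm c base, symmetric])
      have hm [measurable]: "h is t \<in> borel_measurable borel" unfolding h_def using atom_measurable[OF g, of "is" t] by measurable
      have hE: "cmod (h is t w) \<le> E * kap d w" for w
      proof -
        have "cmod (h is t w) = cmod (c w) * ((1 + norm t) ^ k * cmod (iter_partial_deriv is (atom w g) t))"
          unfolding h_def norm_mult norm_of_real by simp
        also have "\<dots> \<le> cmod (c w) * (C1 * (1 + norm w) ^ M1)" by (intro mult_left_mono C1(2) len) simp
        also have "\<dots> \<le> E * kap d w" by (rule E(2))
        finally show ?thesis .
      qed
      have ih: "integrable lborel (h is t)"
        by (rule Bochner_Integration.integrable_bound[OF iE hm[folded measurable_lborel2]]) (use hE E(1) in auto)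
      have Bh: "integral (B m) (h is t) = (\<integral>w. indicator (B m) w *\<^sub>R h is t w \<partial>lborel)"
      proof -
        have "set_integrable lborel (B m) (h is t)"
          unfolding set_integrable_def by (rule integrable_mult_indicator[OF _ ih]) simp
        from set_borel_integral_eq_integral(2)[OF this] show ?thesis by (simp add: set_lebesgue_integral_def)
      qed
      have "integrable lborel (\<lambda>w. indicator (B m) w *\<^sub>R h is t w)" by (rule integrable_mult_indicator[OF _ ih]) simp
      then have "(\<integral>w. h is t w \<partial>lborel) - integral (B m) (h is t) = (\<integral>w. h is t w - indicator (B m) w *\<^sub>R h is t w \<partial>lborel)"
        unfolding Bh using ih by simp
      also have "cmod \<dots> \<le> \<tau> m"
        unfolding \<tau>_def
      proof (rule order_trans[OF integral_norm_bound integral_mono'])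
        show "integrable lborel (\<lambda>w. E * kap d w * indicator (- B m) w)"
          by (rule Bochner_Integration.integrable_bound[OF iE]) (auto simp: indicator_def)
        show "cmod (h is t w - indicator (B m) w *\<^sub>R h is t w) \<le> E * kap d w * indicator (- B m) w" for w
          using hE[of w] by (auto simp: indicator_def)
        show "0 \<le> E * kap d w * indicator (- B m) w" for w using E(1) by simp
      qed
      finally have X1: "cmod ((\<integral>w. h is t w \<partial>lborel) - integral (B m) (h is t)) \<le> \<tau> m" .
      have X2: "cmod (integral (B m) (h is t) - (\<Sum>(x, k)\<in>D. of_real (measure lborel k) * h is t x)) \<le> e * V"
        unfolding V_def B_def
      proof (rule riemann_sum_error)
        show "D tagged_division_of cbox (- (real m *\<^sub>R One)) (real m *\<^sub>R One)" using D(1) by (simp add: B_def)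
        show "continuous_on (cbox (- (real m *\<^sub>R One)) (real m *\<^sub>R One)) (h is t)"
          unfolding h_def
          by (intro continuous_on_mult continuous_on_const continuous_on_subset[OF c_cont] continuous_on_subset[OF atom_continuous[OF g]]) auto
        fix x Kx y assume xK: "(x, Kx) \<in> D" "y \<in> Kx"
        have "x \<in> Kx" "Kx \<subseteq> B m" using tagged_division_ofD(2,3)[OF D(1) xK(1)] by auto
        moreover have "Kx \<subseteq> ball x \<delta>" using fineD(2) xK(1) unfolding fine_def by auto
        ultimately show "cmod (h is t y - h is t x) \<le> e" using xK(2) by (intro osc[OF len]) auto
      qed (use e in simp)
      have I1: "of_real ((1 + norm t) ^ k) * iter_partial_deriv is I t = (\<integral>w. h is t w \<partial>lborel)"
        unfolding itI h_def by (simp only: integral_mult_right_zero)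
      have G1: "of_real ((1 + norm t) ^ k) * iter_partial_deriv is G t = (\<Sum>(x, k)\<in>D. of_real (measure lborel k) * h is t x)"
        unfolding itG h_def by (simp add: sum_distrib_left split_def mult_ac)
      have "(1 + norm t) ^ k * cmod (iter_partial_deriv is I t + (-1) * iter_partial_deriv is G t)
         = cmod (of_real ((1 + norm t) ^ k) * (iter_partial_deriv is I t + (-1) * iter_partial_deriv is G t))"
        by (simp only: norm_mult norm_of_real) simp
      also have "of_real ((1 + norm t) ^ k) * (iter_partial_deriv is I t + (-1) * iter_partial_deriv is G t)
         = ((\<integral>w. h is t w \<partial>lborel) - integral (B m) (h is t)) + (integral (B m) (h is t) - (\<Sum>(x, k)\<in>D. of_real (measure lborel k) * h is t x))"
        unfolding I1[symmetric] G1[symmetric] by (simp add: algebra_simps)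
      also have "cmod \<dots> \<le> \<tau> m + e * V" by (rule order_trans[OF norm_triangle_ineq add_mono[OF X1 X2]])
      finally show "(1 + norm t) ^ k * cmod (iter_partial_deriv is (\<lambda>t. I t + (-1) * G t) t) \<le> \<tau> m + e * V"
        by (simp only: iter_add_cmult[OF schwartz_smooth[OF I] schwartz_smooth[OF sG]])
    qed
    also have "u (\<lambda>t. I t + (-1) * G t) = u I - u G" using tempered_add_cmult[OF u I sG, of "-1"] by simp
    finally have "cmod (u I - u G) \<le> K * (\<tau> m + e * V)" .
    then have "cmod (u I - a m) \<le> K * (\<tau> m + e * V) + e"
      using norm_triangle_ineq[of "u I - u G" "u G - a m"] uG_a by simp
    then show "cmod (u I - a m) \<le> K * \<tau> m + e0" by (simp only: e_sum)
  qed
  have "a \<longlonglongrightarrow> u I"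
  proof (rule Lim_transform2[OF tendsto_const])
    show "(\<lambda>m. u I - a m) \<longlonglongrightarrow> 0"
    proof (rule Lim_null_comparison)
      show "eventually (\<lambda>m. norm (u I - a m) \<le> K * \<tau> m) sequentially" using key by (intro always_eventually allI)
      show "(\<lambda>m. K * \<tau> m) \<longlonglongrightarrow> 0" using tendsto_mult_left[OF \<tau>_lim, of K] by simp
    qed
  qed
  then show ?thesis using LIMSEQ_unique[OF a_lim] by (simp add: F_def)
qed

subsection \<open>The reproducing formula\<close>

lemma tf_shift_eq_cnj_atom: "tf_shift w \<phi> t = cnj (atom w (\<lambda>t. cnj (\<phi> t)) t)"
  by (simp add: cnj_tf_shift[symmetric])

text \<open>For a fixed position x the transform is, in the frequency variable, the Fourier
  transform of y \<mapsto> g y * cnj (\<phi> (y - x)). Inversion at \<open>t\<close> gives g t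
  |\<phi> (t - x)|^2, and integrating in x produces the squared norm of the window.\<close>

lemma stft_inversion:
  fixes g \<phi> :: "real^'n::finite \<Rightarrow> complex"
  assumes g: "schwartz g" and \<phi>: "schwartz \<phi>"
  shows "(\<integral>w. amb g (\<lambda>t. cnj (\<phi> t)) w * tf_shift w \<phi> t \<partial>lborel)
    = g t * complex_of_real (\<integral>x. (cmod (\<phi> x))\<^sup>2 \<partial>lborel)"
proof -
  define \<psi> where "\<psi> = (\<lambda>t. cnj (\<phi> t))"
  have \<psi>: "schwartz \<psi>" unfolding \<psi>_def by (rule schwartz_cnj[OF \<phi>])
  define V where "V = amb g \<psi>"
  have V_cont: "continuous_on UNIV V" unfolding V_def by (rule amb_continuous[OF g \<psi>])
  have Vm [measurable]: "V \<in> borel_measurable borel" using V_cont by (rule borel_measurable_continuous_onI)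
  define d where "d = DIM((real^'n) \<times> (real^'n)) + 2"
  obtain C where C: "C > 0" "\<And>w. cmod (V w) \<le> C * kap d w" unfolding V_def using amb_decay[OF g \<psi>] by metis
  obtain B where B: "B > 0" "\<And>x. cmod (\<phi> x) \<le> B * kap 0 x" using schwartz_kap[OF \<phi>, where k=0] by metis
  obtain B' where B': "B' > 0" "\<And>x. cmod (g x) \<le> B' * kap 0 x" using schwartz_kap[OF g, where k=0] by metis
  have [measurable]: "\<phi> \<in> borel_measurable borel" "g \<in> borel_measurable borel" by (intro schwartz_measurable g \<phi>)+
  have tf_m [measurable]: "(\<lambda>w. tf_shift w \<phi> t) \<in> borel_measurable borel"
    unfolding tf_shift_eq_cnj_atom using atom_measurable[OF \<psi>, of "[]" t] by (simp add: \<psi>_def)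
  have tf_B: "cmod (tf_shift w \<phi> t) \<le> B" for w
    using B(2) by (simp add: tf_shift_eq_cnj_atom atom_def norm_mult kap_def)
  have int: "integrable lborel (\<lambda>w. V w * tf_shift w \<phi> t)"
  proof (rule Bochner_Integration.integrable_bound)
    show "integrable lborel (\<lambda>w::(real^'n) \<times> (real^'n). (C * kap d w) * B)"
      unfolding d_def by (intro integrable_mult_left integrable_mult_right integrable_kap order_refl)
    show "AE w in lborel. norm (V w * tf_shift w \<phi> t) \<le> norm ((C * kap d w) * B)"
    proof (rule AE_I2)
      fix w
      have "cmod (V w) * cmod (tf_shift w \<phi> t) \<le> (C * kap d w) * B" using C(1) by (intro mult_mono C(2) tf_B) auto
      also have "\<dots> \<le> norm ((C * kap d w) * B)" by simp
      finally show "norm (V w * tf_shift w \<phi> t) \<le> norm ((C * kap d w) * B)" by (simp only: norm_mult)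
    qed
  qed measurable
  have inner: "(\<integral>\<omega>. V (x, \<omega>) * tf_shift (x, \<omega>) \<phi> t \<partial>lborel) = g t * complex_of_real ((cmod (\<phi> (t - x)))\<^sup>2)" for x
  proof -
    define h where "h = (\<lambda>y. g y * \<psi> (y - x))"
    have h_atom: "h = (\<lambda>y. g y * atom (x, 0) \<psi> y)" by (simp add: h_def atom_def)
    have FT: "(\<integral>y. h y * cis (- 2 * pi * (\<omega> \<bullet> y)) \<partial>lborel) = V (x, \<omega>)" for \<omega>
      by (simp add: V_def amb_def h_def atom_def mult_ac)
    have "(\<integral>\<omega>. (\<integral>y. h y * cis (- 2 * pi * (\<omega> \<bullet> y)) \<partial>lborel) * cis (2 * pi * (\<omega> \<bullet> t)) \<partial>lborel) = h t"
    proof (rule fourier_inversion)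
      show "continuous_on UNIV h" unfolding h_atom
        by (intro continuous_on_mult smooth_continuous schwartz_smooth schwartz_atom g \<psi>)
      show "cmod (h y) \<le> B' * B" for y
        unfolding h_def norm_mult using B(2)[of "y - x"] B'(2)[of y] B'(1)
        by (intro mult_mono) (auto simp: \<psi>_def kap_def)
      show "integrable lborel h" unfolding h_atom by (rule integrable_mult_atom[OF g \<psi>])
      show "integrable lborel (\<lambda>\<omega>. \<integral>y. h y * cis (- 2 * pi * (\<omega> \<bullet> y)) \<partial>lborel)"
        unfolding FT
      proof (rule Bochner_Integration.integrable_bound)
        show "integrable lborel (\<lambda>\<omega>::real^'n. C * kap d \<omega>)"
          by (intro integrable_mult_right integrable_kap) (simp add: d_def)
        show "AE \<omega> in lborel. norm (V (x, \<omega>)) \<le> norm (C * kap d \<omega>)"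
        proof (rule AE_I2)
          fix \<omega> :: "real^'n"
          have "kap d (x, \<omega>) \<le> kap d \<omega>" by (rule kap_anti) (rule norm_snd_le)
          then have "C * kap d (x, \<omega>) \<le> C * kap d \<omega>" using C(1) by (intro mult_left_mono) auto
          also have "\<dots> \<le> norm (C * kap d \<omega>)" by simp
          finally show "norm (V (x, \<omega>)) \<le> norm (C * kap d \<omega>)" using C(2)[of "(x, \<omega>)"] by linarith
        qed
        show "(\<lambda>\<omega>. V (x, \<omega>)) \<in> borel_measurable lborel"
        proof -
          have "continuous_on UNIV (\<lambda>\<omega>. (x, \<omega>))" by (intro continuous_on_Pair continuous_on_const continuous_on_id)
          from borel_measurable_continuous_onI[OF continuous_on_compose2[OF V_cont this]] show ?thesis by simp
        qed
      qed
    qed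
    then have *: "(\<integral>\<omega>. V (x, \<omega>) * cis (2 * pi * (\<omega> \<bullet> t)) \<partial>lborel) = g t * \<psi> (t - x)" unfolding FT by (simp only: h_def)
    have "(\<integral>\<omega>. V (x, \<omega>) * tf_shift (x, \<omega>) \<phi> t \<partial>lborel) = (\<integral>\<omega>. V (x, \<omega>) * cis (2 * pi * (\<omega> \<bullet> t)) * \<phi> (t - x) \<partial>lborel)"
      by (simp add: tf_shift_def mult.assoc)
    also have "\<dots> = g t * \<psi> (t - x) * \<phi> (t - x)" by (simp only: integral_mult_left_zero *)
    also have "\<dots> = g t * complex_of_real ((cmod (\<phi> (t - x)))\<^sup>2)"
      by (simp add: \<psi>_def complex_norm_square mult_ac del: of_real_power)
    finally show ?thesis .
  qed
  have "(\<integral>w. V w * tf_shift w \<phi> t \<partial>lborel) = (\<integral>w. V w * tf_shift w \<phi> t \<partial>(lborel \<Otimes>\<^sub>M lborel))"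
    by (simp only: lborel_prod)
  also have "\<dots> = (\<integral>x. (\<integral>\<omega>. V (x, \<omega>) * tf_shift (x, \<omega>) \<phi> t \<partial>lborel) \<partial>lborel)"
    by (rule lborel_pair.integral_fst'[symmetric]) (use int in \<open>simp only: lborel_prod\<close>)
  also have "\<dots> = g t * (\<integral>x. complex_of_real ((cmod (\<phi> (t - x)))\<^sup>2) \<partial>lborel)"
    by (simp only: inner integral_mult_right_zero)
  also have "(\<integral>x. complex_of_real ((cmod (\<phi> (t - x)))\<^sup>2) \<partial>lborel) = (\<integral>x. complex_of_real ((cmod (\<phi> x))\<^sup>2) \<partial>lborel)"
    by (rule integral_lborel_minus[of "\<lambda>x. complex_of_real ((cmod (\<phi> x))\<^sup>2)"]) measurable
  also have "\<dots> = complex_of_real (\<integral>x. (cmod (\<phi> x))\<^sup>2 \<partial>lborel)" by (rule integral_complex_of_real)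
  finally show ?thesis by (simp only: V_def \<psi>_def)
qed

text \<open>The Gram kernel of the time-frequency shifts of \<phi>: the inner product of the shift
  by \<open>w\<close> with the shift by \<open>z\<close>.\<close>

definition gab :: "(real^'n::finite \<Rightarrow> complex) \<Rightarrow> (real^'n) \<times> (real^'n) \<Rightarrow> (real^'n) \<times> (real^'n) \<Rightarrow> complex" where
  "gab \<phi> z w = amb (tf_shift w \<phi>) (\<lambda>t. cnj (\<phi> t)) z"

lemma gab_herm: "cnj (gab \<phi> z w) = gab \<phi> w z"
proof -
  have "cnj (gab \<phi> z w) = (\<integral>t. cnj (tf_shift w \<phi> t * atom z (\<lambda>t. cnj (\<phi> t)) t) \<partial>lborel)"
    unfolding gab_def amb_def by (simp del: complex_cnj_mult)
  also have "\<dots> = gab \<phi> w z"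
    unfolding gab_def amb_def by (simp add: tf_shift_eq_cnj_atom mult.commute)
  finally show ?thesis .
qed

text \<open>The substitution by \<open>t - fst w\<close> shows that, up to a phase, the kernel
  depends on the difference of the points only; decay of the ambiguity function thus becomes
  off-diagonal decay.\<close>

lemma gab_covariance:
  fixes \<phi> :: "real^'n::finite \<Rightarrow> complex"
  assumes \<phi>: "schwartz \<phi>"
  shows "gab \<phi> z w = cis (2 * pi * ((snd w - snd z) \<bullet> fst w)) * amb \<phi> (\<lambda>t. cnj (\<phi> t)) (z - w)"
proof -
  define f where "f = (\<lambda>s. cis (2 * pi * ((snd w - snd z) \<bullet> fst w)) * (\<phi> s * atom (z - w) (\<lambda>t. cnj (\<phi> t)) s))"
  have [measurable]: "\<phi> \<in> borel_measurable borel" "atom (z - w) (\<lambda>t. cnj (\<phi> t)) \<in> borel_measurable borel"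
    by (intro schwartz_measurable schwartz_atom schwartz_cnj \<phi>)+
  have fm: "f \<in> borel_measurable borel" unfolding f_def by measurable
  have eq: "tf_shift w \<phi> t * atom z (\<lambda>t. cnj (\<phi> t)) t = f (t - fst w)" for t
  proof -
    define A where "A = 2 * pi * (snd w \<bullet> t)"
    define B where "B = - 2 * pi * (snd z \<bullet> t)"
    define C where "C = 2 * pi * ((snd w - snd z) \<bullet> fst w)"
    define D where "D = - 2 * pi * (snd (z - w) \<bullet> (t - fst w))"
    have "A + B = C + D"
      by (simp add: A_def B_def C_def D_def inner_diff_left inner_diff_right algebra_simps)
    then have AB: "cis A * cis B = cis C * cis D" by (simp add: cis_mult)
    have "tf_shift w \<phi> t * atom z (\<lambda>t. cnj (\<phi> t)) t = (cis A * cis B) * (\<phi> (t - fst w) * cnj (\<phi> (t - fst z)))"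
      by (simp add: tf_shift_def atom_def A_def B_def split_def mult_ac)
    also have "\<dots> = (cis C * cis D) * (\<phi> (t - fst w) * cnj (\<phi> (t - fst z)))" by (simp only: AB)
    also have "\<dots> = f (t - fst w)"
      by (simp add: f_def atom_def C_def D_def mult_ac)
    finally show ?thesis .
  qed
  have "gab \<phi> z w = (\<integral>t. f (t - fst w) \<partial>lborel)" unfolding gab_def amb_def eq ..
  also have "\<dots> = (\<integral>t. f t \<partial>lborel)" by (rule integral_lborel_diff[OF fm])
  finally show ?thesis by (simp add: f_def amb_def)
qed

lemma gab_decay:
  assumes \<phi>: "schwartz \<phi>"
  shows "\<exists>C. \<forall>z w. cmod (gab \<phi> z w) \<le> C * kap j (z - w)"
proof -
  obtain C where "\<And>w. cmod (amb \<phi> (\<lambda>t. cnj (\<phi> t)) w) \<le> C * kap j w"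
    using amb_decay[OF \<phi> schwartz_cnj[OF \<phi>]] by metis
  then show ?thesis by (intro exI[of _ C]) (simp add: gab_covariance[OF \<phi>] norm_mult)
qed

lemma gab_continuous:
  assumes \<phi>: "schwartz \<phi>"
  shows "continuous_on UNIV (\<lambda>p. gab \<phi> (fst p) (snd p))"
  unfolding gab_covariance[OF \<phi>] cis_conv_exp
  by (intro continuous_intros continuous_on_compose2[OF amb_continuous[OF \<phi> schwartz_cnj[OF \<phi>]]]) auto

lemma gab_measurable:
  assumes "schwartz \<phi>"
  shows "case_prod (gab \<phi>) \<in> borel_measurable (borel \<Otimes>\<^sub>M borel)"
  unfolding borel_prod split_def by (rule borel_measurable_continuous_onI[OF gab_continuous[OF assms]])

text \<open>\<open>stft_inversion\<close> for the shift of \<phi> by \<open>z\<close>, after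
  conjugation, writes the squared norm times the atom at \<open>z\<close> as an integral of atoms;
  \<open>tempered_integral_atom\<close> moves \<open>u\<close> inside that integral.\<close>

theorem stft_reproducing:
  assumes u: "tempered_distribution u" and \<phi>: "schwartz \<phi>"
  shows "(\<integral>w. gab \<phi> z w * u (atom w (\<lambda>t. cnj (\<phi> t))) \<partial>lborel)
     = complex_of_real (\<integral>x. (cmod (\<phi> x))\<^sup>2 \<partial>lborel) * u (atom z (\<lambda>t. cnj (\<phi> t)))"
proof -
  define \<psi> where "\<psi> = (\<lambda>t. cnj (\<phi> t))"
  have \<psi>: "schwartz \<psi>" unfolding \<psi>_def by (rule schwartz_cnj[OF \<phi>])
  define nrm where "nrm = complex_of_real (\<integral>x. (cmod (\<phi> x))\<^sup>2 \<partial>lborel)"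
  have "(\<integral>w. gab \<phi> z w * u (atom w \<psi>) \<partial>lborel) = u (\<lambda>t. nrm * atom z \<psi> t)"
  proof (rule tempered_integral_atom[OF u \<psi>])
    show "schwartz (\<lambda>t. nrm * atom z \<psi> t)" by (intro schwartz_cmult schwartz_atom \<psi>)
    show "continuous_on UNIV (gab \<phi> z)"
    proof -
      have "continuous_on UNIV (\<lambda>w. (z, w))" by (intro continuous_on_Pair continuous_on_const continuous_on_id)
      from continuous_on_compose2[OF gab_continuous[OF \<phi>] this] show ?thesis by simp
    qed
    show "\<exists>C. \<forall>w. cmod (gab \<phi> z w) \<le> C * kap j w" for j
    proof -
      obtain C where C: "\<And>z w. cmod (gab \<phi> z w) \<le> C * kap j (z - w)" using gab_decay[OF \<phi>] by metis
      have C0: "C \<ge> 0" using order_trans[OF norm_ge_zero C[of 0 0]] by (simp add: kap_def)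
      \<comment> \<open>Decay about \<open>z\<close> is converted into decay about the origin; the
        constant may depend on the fixed point \<open>z\<close>.\<close>
      have "cmod (gab \<phi> z w) \<le> C * (1 + norm z) ^ j * kap j w" for w
      proof -
        have "kap j (w - z) * kap j z \<le> kap j w" using kap_triangle[of j "w - z" z] by simp
        then have "kap j (w - z) * kap j z * (1 + norm z) ^ j \<le> kap j w * (1 + norm z) ^ j" by (rule mult_right_mono) simp
        then have "kap j (z - w) \<le> (1 + norm z) ^ j * kap j w"
          by (simp only: mult.assoc kap_mult_pow mult_1_right kap_minus_commute[of j w z] mult.commute[of "kap j w"])
        then have "C * kap j (z - w) \<le> C * ((1 + norm z) ^ j * kap j w)" using C0 by (rule mult_left_mono)
        then show ?thesis using C[of z w] by (simp add: mult.assoc)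
      qed
      then show ?thesis by blast
    qed
    fix t
    have "(\<integral>w. gab \<phi> z w * atom w \<psi> t \<partial>lborel) = (\<integral>w. cnj (amb (tf_shift z \<phi>) \<psi> w * tf_shift w \<phi> t) \<partial>lborel)"
    proof (rule Bochner_Integration.integral_cong[OF refl])
      fix w
      have "gab \<phi> z w = cnj (amb (tf_shift z \<phi>) \<psi> w)" using gab_herm[of \<phi> w z] by (simp add: gab_def \<psi>_def)
      then show "gab \<phi> z w * atom w \<psi> t = cnj (amb (tf_shift z \<phi>) \<psi> w * tf_shift w \<phi> t)"
        by (simp add: cnj_tf_shift \<psi>_def)
    qed
    also have "\<dots> = cnj (\<integral>w. amb (tf_shift z \<phi>) \<psi> w * tf_shift w \<phi> t \<partial>lborel)" by (simp del: complex_cnj_mult)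
    also have "\<dots> = cnj (tf_shift z \<phi> t * nrm)"
      unfolding \<psi>_def nrm_def by (subst stft_inversion[OF schwartz_tf_shift[OF \<phi>] \<phi>]) simp
    also have "\<dots> = nrm * atom z \<psi> t"
      by (simp add: cnj_tf_shift \<psi>_def nrm_def)
    finally show "(\<integral>w. gab \<phi> z w * atom w \<psi> t \<partial>lborel) = nrm * atom z \<psi> t" .
  qed
  also have "\<dots> = nrm * u (atom z \<psi>)" by (rule tempered_cmult[OF u schwartz_atom[OF \<psi>]])
  finally show ?thesis by (simp only: nrm_def \<psi>_def)
qed

subsection \<open>Lattices\<close>

lemma phase_point_diff: "phase_point v - phase_point v' = phase_point (v - v')"
  by (simp add: phase_point_def vec_eq_iff)

lemma norm_le_phase_point:
  fixes v :: "real^('n::finite + 'n)"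
  shows "norm v \<le> real CARD('n + 'n) * norm (phase_point v)"
proof -
  have "\<bar>v $ j\<bar> \<le> norm (phase_point v)" for j
  proof (cases j)
    case (Inl i)
    have "\<bar>fst (phase_point v) $ i\<bar> \<le> norm (phase_point v)"
      using component_le_norm_cart[of "fst (phase_point v)" i] norm_fst_le'[of "phase_point v"] by linarith
    then show ?thesis by (simp add: Inl phase_point_def)
  next
    case (Inr i)
    have "\<bar>snd (phase_point v) $ i\<bar> \<le> norm (phase_point v)" by (rule component_snd_le)
    then show ?thesis by (simp add: Inr phase_point_def)
  qed
  then have "(\<Sum>j\<in>UNIV. \<bar>v $ j\<bar>) \<le> real CARD('n + 'n) * norm (phase_point v)"
    using sum_bounded_above[of UNIV "\<lambda>j. \<bar>v $ j\<bar>" "norm (phase_point v)"] by simp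
  then show ?thesis using norm_le_l1_cart[of v] by linarith
qed

text \<open>The difference of two distinct integer vectors has a component of absolute value at
  least 1, and the inverse of the generating matrix bounds that component by a multiple of the
  distance between the lattice points.\<close>

lemma phase_lattice_separated:
  fixes \<Lambda> :: "((real^'n::finite) \<times> (real^'n)) set"
  assumes "phase_lattice \<Lambda>"
  obtains \<delta> where "separated \<delta> \<Lambda>"
proof -
  obtain A :: "real^('n + 'n)^('n + 'n)" where A: "invertible A" and \<Lambda>: "\<Lambda> = {phase_point (A *v k) | k. \<forall>i. k $ i \<in> \<int>}"
    using assms unfolding phase_lattice_def by blast
  obtain B where B: "B ** A = mat 1" using A unfolding invertible_def by blast
  obtain K where K: "K > 0" "\<And>x. norm (B *v x) \<le> norm x * K"
    using bounded_linear.pos_bounded[OF matrix_vector_mul_bounded_linear[of B]] by blast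
  define c where "c = real CARD('n + 'n)"
  have c: "c > 0" unfolding c_def by simp
  have cnt: "countable \<Lambda>"
  proof -
    have "{k :: real^('n + 'n). \<forall>i. k $ i \<in> \<int>} \<subseteq> vec_lambda ` (PiE UNIV (\<lambda>_. \<int>))"
    proof
      fix k :: "real^('n + 'n)" assume "k \<in> {k. \<forall>i. k $ i \<in> \<int>}"
      then have "(\<lambda>i. k $ i) \<in> PiE UNIV (\<lambda>_. \<int>)" by auto
      then have "vec_lambda (\<lambda>i. k $ i) \<in> vec_lambda ` (PiE UNIV (\<lambda>_. \<int>))" by (rule imageI)
      then show "k \<in> vec_lambda ` (PiE UNIV (\<lambda>_. \<int>))" by simp
    qed
    moreover have "countable (PiE UNIV (\<lambda>_ :: 'n + 'n. \<int> :: real set))"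
      by (rule countable_PiE) (auto simp: Ints_def)
    ultimately have "countable {k :: real^('n + 'n). \<forall>i. k $ i \<in> \<int>}"
      by (meson countable_image countable_subset)
    then have "countable ((\<lambda>k. phase_point (A *v k)) ` {k. \<forall>i. k $ i \<in> \<int>})" by (rule countable_image)
    then show ?thesis by (simp add: \<Lambda> setcompr_eq_image)
  qed
  have sep: "1 / (c * K) \<le> dist x y" if xy: "x \<in> \<Lambda>" "y \<in> \<Lambda>" "x \<noteq> y" for x y
  proof -
    obtain k k' where k: "x = phase_point (A *v k)" "y = phase_point (A *v k')" "\<forall>i. k $ i \<in> \<int>" "\<forall>i. k' $ i \<in> \<int>"
      using xy unfolding \<Lambda> by blast
    define m where "m = k - k'"
    have "m \<noteq> 0" using k xy(3) by (auto simp: m_def)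
    then obtain i where i: "m $ i \<noteq> 0" by (auto simp: vec_eq_iff)
    have "m $ i \<in> \<int>" using k by (simp add: m_def)
    then have "1 \<le> \<bar>m $ i\<bar>" using i by (auto elim!: Ints_cases)
    also have "\<dots> \<le> norm m" by (rule component_le_norm_cart)
    also have "m = B *v (A *v m)" by (simp add: matrix_vector_mul_assoc B)
    also have "norm \<dots> \<le> norm (A *v m) * K" by (rule K(2))
    also have "\<dots> \<le> (c * norm (phase_point (A *v m))) * K"
      unfolding c_def by (intro mult_right_mono norm_le_phase_point) (use K in simp)
    also have "phase_point (A *v m) = x - y"
      by (simp add: k phase_point_diff m_def matrix_vector_mult_diff_distrib)
    finally have "1 \<le> dist x y * (c * K)" by (simp add: dist_norm mult_ac)
    then show ?thesis using c K(1) by (simp add: pos_divide_le_eq)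
  qed
  have "separated (1 / (c * K)) \<Lambda>"
    unfolding separated_def using sep cnt c K(1) by simp
  then show thesis by (rule that)
qed

subsection \<open>Localization operators\<close>

lemma measurable_fst_borel [measurable (raw)]:
  fixes f :: "'c \<Rightarrow> 'a::second_countable_topology \<times> 'b::second_countable_topology"
  shows "f \<in> M \<rightarrow>\<^sub>M borel \<Longrightarrow> (\<lambda>x. fst (f x)) \<in> M \<rightarrow>\<^sub>M borel"
  by (rule measurable_compose[OF _ borel_measurable_continuous_onI]) (auto intro: continuous_intros)

lemma measurable_snd_borel [measurable (raw)]:
  fixes f :: "'c \<Rightarrow> 'a::second_countable_topology \<times> 'b::second_countable_topology"
  shows "f \<in> M \<rightarrow>\<^sub>M borel \<Longrightarrow> (\<lambda>x. snd (f x)) \<in> M \<rightarrow>\<^sub>M borel"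
  by (rule measurable_compose[OF _ borel_measurable_continuous_onI]) (auto intro: continuous_intros)

text \<open>If the integral vanished, \<phi> would be zero almost everywhere; but the set where it
  is nonzero is open by continuity and nonempty, hence not negligible.\<close>

lemma integral_cmod_sq_pos:
  fixes \<phi> :: "real^'n::finite \<Rightarrow> complex"
  assumes \<phi>: "schwartz \<phi>" and "\<phi> \<noteq> (\<lambda>_. 0)"
  shows "0 < (\<integral>x. (cmod (\<phi> x))\<^sup>2 \<partial>lborel)" "integrable lborel (\<lambda>x. (cmod (\<phi> x))\<^sup>2)"
proof -
  have "integrable lborel (\<lambda>x. \<phi> x * cnj (\<phi> x))" by (rule integrable_schwartz_mult[OF \<phi> schwartz_cnj[OF \<phi>]])
  then have "integrable lborel (\<lambda>x. complex_of_real ((cmod (\<phi> x))\<^sup>2))" by (simp only: complex_norm_square)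
  from integrable_Re[OF this] show int: "integrable lborel (\<lambda>x. (cmod (\<phi> x))\<^sup>2)" by (simp del: of_real_power)
  show "0 < (\<integral>x. (cmod (\<phi> x))\<^sup>2 \<partial>lborel)"
  proof (rule ccontr)
    assume "\<not> ?thesis"
    moreover have "0 \<le> (\<integral>x. (cmod (\<phi> x))\<^sup>2 \<partial>lborel)" by (rule integral_nonneg_AE) simp
    ultimately have "(\<integral>x. (cmod (\<phi> x))\<^sup>2 \<partial>lborel) = 0" by linarith
    then have "AE x in lborel. (cmod (\<phi> x))\<^sup>2 = 0"
      using integral_nonneg_eq_0_iff_AE[OF int] by simp
    then have "AE x in lebesgue. \<phi> x = 0" by (intro AE_completion) auto
    moreover have m: "{x. \<phi> x \<noteq> 0} = - (\<phi> -` {0})" by auto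
    moreover have op: "open {x. \<phi> x \<noteq> 0}"
      unfolding m using continuous_on_closed_vimage[of UNIV \<phi>] smooth_continuous[OF schwartz_smooth[OF \<phi>], of UNIV]
      by (auto intro!: open_Compl continuous_closed_vimage simp: continuous_on_eq_continuous_at)
    ultimately have "{x. \<phi> x \<noteq> 0} \<in> null_sets lebesgue"
      by (subst AE_iff_null_sets) (auto intro: borel_open)
    then have "negligible {x. \<phi> x \<noteq> 0}" by (simp add: negligible_iff_null_sets)
    moreover have "{x. \<phi> x \<noteq> 0} \<noteq> {}" using assms(2) by auto
    ultimately show False using open_not_negligible[OF op] by blast
  qed
qed

lemma stft_eq_atom: "stft \<phi> f z = f (atom z (\<lambda>t. cnj (\<phi> t)))"
  by (simp add: stft_def bracket_def cnj_tf_shift)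

lemma stft_dist_eq_amb:
  assumes "schwartz h" "schwartz \<phi>"
  shows "stft \<phi> (dist_of_fun h) z = amb h (\<lambda>t. cnj (\<phi> t)) z"
  using assms by (simp add: stft_eq_atom amb_eq_dist schwartz_cnj)

text \<open>\<open>L2_fun\<close> refers to the completed measure while Schwartz functions are
  integrated over \<open>lborel\<close>; the two are matched by
  \<open>nn_integral_completion\<close>.\<close>

lemma cmod_integral_Cauchy_Schwarz:
  assumes "L2_fun g" and h: "schwartz h"
  shows "cmod (dist_of_fun g h) \<le> sqrt (\<integral>t. (cmod (g t))\<^sup>2 \<partial>lebesgue) * sqrt (\<integral>t. (cmod (h t))\<^sup>2 \<partial>lborel)"
proof -
  have gm [measurable]: "g \<in> borel_measurable lebesgue" and gi: "integrable lebesgue (\<lambda>t. (cmod (g t))\<^sup>2)"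
    using assms(1) by (auto simp: L2_fun_def)
  have hb: "h \<in> borel_measurable borel" by (rule schwartz_measurable[OF h])
  then have hm [measurable]: "h \<in> borel_measurable lebesgue" by (simp add: measurable_completion)
  have "integrable lborel (\<lambda>x. h x * cnj (h x))" by (rule integrable_schwartz_mult[OF h schwartz_cnj[OF h]])
  then have "integrable lborel (\<lambda>x. complex_of_real ((cmod (h x))\<^sup>2))" by (simp only: complex_norm_square)
  from integrable_Re[OF this] have hi: "integrable lborel (\<lambda>t. (cmod (h t))\<^sup>2)" by (simp del: of_real_power)
  define a where "a = (\<integral>t. (cmod (g t))\<^sup>2 \<partial>lebesgue)"
  define b where "b = (\<integral>t. (cmod (h t))\<^sup>2 \<partial>lborel)"
  have ab: "a \<ge> 0" "b \<ge> 0" unfolding a_def b_def by (auto intro!: integral_nonneg_AE)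
  have "ennreal (cmod (dist_of_fun g h)) \<le> (\<integral>\<^sup>+t. ennreal (cmod (g t)) * ennreal (cmod (h t)) \<partial>lebesgue)"
    unfolding dist_of_fun_def
    by (rule order_trans[OF norm_integral_le_nn_integral]) (simp add: norm_mult ennreal_mult)
  then have "(ennreal (cmod (dist_of_fun g h)))\<^sup>2 \<le> (\<integral>\<^sup>+t. ennreal (cmod (g t)) * ennreal (cmod (h t)) \<partial>lebesgue)\<^sup>2"
    by (rule power_mono) simp
  also have "\<dots> \<le> (\<integral>\<^sup>+t. ennreal (cmod (g t)) ^ 2 \<partial>lebesgue) * (\<integral>\<^sup>+t. ennreal (cmod (h t)) ^ 2 \<partial>lebesgue)"
    by (rule Cauchy_Schwarz_nn_integral) measurable
  also have "(\<integral>\<^sup>+t. ennreal (cmod (g t)) ^ 2 \<partial>lebesgue) = ennreal a"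
    unfolding a_def using nn_integral_eq_integral[OF gi] by (simp add: ennreal_power)
  also have "(\<integral>\<^sup>+t. ennreal (cmod (h t)) ^ 2 \<partial>lebesgue) = ennreal b"
    unfolding b_def nn_integral_completion using nn_integral_eq_integral[OF hi] by (simp add: ennreal_power)
  finally have "(cmod (dist_of_fun g h))\<^sup>2 \<le> a * b"
    using ab by (simp add: ennreal_power ennreal_mult[symmetric])
  then have "cmod (dist_of_fun g h) \<le> sqrt (a * b)" by (rule real_le_rsqrt)
  then show ?thesis by (simp add: real_sqrt_mult a_def b_def)
qed

text \<open>Cauchy-Schwarz holds for every function competing in the infimum, hence for the infimum.
  Finiteness matters because \<open>enn2real\<close> sends \<infinity> to 0.\<close>

lemma dist_L2_norm_bound:
  assumes h: "schwartz h" and pos: "0 < (\<integral>t. (cmod (h t))\<^sup>2 \<partial>lborel)" and fin: "dist_L2_norm u < \<infinity>"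
  shows "cmod (u h) \<le> sqrt (\<integral>t. (cmod (h t))\<^sup>2 \<partial>lborel) * enn2real (dist_L2_norm u)"
proof -
  define B where "B = sqrt (\<integral>t. (cmod (h t))\<^sup>2 \<partial>lborel)"
  have B: "B > 0" using pos by (simp add: B_def)
  have "ennreal (cmod (u h) / B) \<le> dist_L2_norm u"
    unfolding dist_L2_norm_def
  proof (rule INF_greatest, rule ennreal_leI)
    fix g assume "g \<in> {g. L2_fun g \<and> (\<forall>h. schwartz h \<longrightarrow> u h = dist_of_fun g h)}"
    then have "L2_fun g" "u h = dist_of_fun g h" using h by auto
    then have "cmod (u h) \<le> sqrt (\<integral>t. (cmod (g t))\<^sup>2 \<partial>lebesgue) * B"
      using cmod_integral_Cauchy_Schwarz[OF _ h] by (simp add: B_def)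
    then show "cmod (u h) / B \<le> sqrt (\<integral>t. (cmod (g t))\<^sup>2 \<partial>lebesgue)" using B by (simp add: pos_divide_le_eq)
  qed
  then have "enn2real (ennreal (cmod (u h) / B)) \<le> enn2real (dist_L2_norm u)"
    using fin by (intro enn2real_mono) auto
  then show ?thesis using B by (simp add: B_def[symmetric] pos_divide_le_eq mult.commute)
qed

text \<open>The symbol is exchanged for a Borel function equal to it almost everywhere, which makes
  product measurability and Fubini over \<open>lborel\<close> available. The conjugations in
  \<open>loc_op\<close> cancel, leaving a bilinear expression in \<open>h\<close> and the shifted
  window.\<close>

lemma loc_op_lborel:
  fixes \<phi> :: "real^'n::finite \<Rightarrow> complex"
  assumes \<phi>: "schwartz \<phi>" and f: "tempered_distribution f" and h: "schwartz h"
    and \<tau>0: "\<tau>0 \<in> borel_measurable lebesgue" and \<tau>: "\<tau> \<in> borel_measurable borel" and ae: "AE z in lborel. \<tau>0 z = \<tau> z"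
  shows "loc_op \<phi> \<tau>0 f h = (\<integral>z. complex_of_real (\<tau> z) * stft \<phi> f z * (\<integral>t. h t * tf_shift z \<phi> t \<partial>lborel) \<partial>lborel)"
proof -
  define \<psi> where "\<psi> = (\<lambda>t. cnj (\<phi> t))"
  have \<psi>: "schwartz \<psi>" unfolding \<psi>_def by (rule schwartz_cnj[OF \<phi>])
  define h' where "h' = (\<lambda>t. cnj (h t))"
  have h': "schwartz h'" unfolding h'_def by (rule schwartz_cnj[OF h])
  define F where "F = stft \<phi> f"
  have Fm [measurable]: "F \<in> borel_measurable borel"
    unfolding F_def stft_eq_atom[abs_def]
    by (intro borel_measurable_continuous_onI tempered_atom_continuous f schwartz_cnj \<phi>)
  define A where "A = (\<lambda>z. cnj (amb h' \<psi> z))"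
  have Am [measurable]: "A \<in> borel_measurable borel"
    unfolding A_def using borel_measurable_continuous_onI[OF amb_continuous[OF h' \<psi>]] by simp
  have A_eq: "A z = (\<integral>t. h t * tf_shift z \<phi> t \<partial>lborel)" for z
  proof -
    have "A z = (\<integral>t. cnj (h' t * atom z \<psi> t) \<partial>lborel)" unfolding A_def amb_def by (simp del: complex_cnj_mult)
    then show ?thesis by (simp add: h'_def \<psi>_def tf_shift_eq_cnj_atom)
  qed
  have [measurable]: "F \<in> borel_measurable lebesgue" "A \<in> borel_measurable lebesgue" "\<tau> \<in> borel_measurable lebesgue"
    using Fm Am \<tau> by (simp_all add: measurable_completion)
  note [measurable] = \<tau>0 \<tau>
  have "loc_op \<phi> \<tau>0 f h = (\<integral>z. complex_of_real (\<tau>0 z) * F z * A z \<partial>lebesgue)"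
    using stft_dist_eq_amb[OF h' \<phi>] by (simp add: loc_op_def F_def A_def h'_def \<psi>_def)
  also have "\<dots> = (\<integral>z. complex_of_real (\<tau> z) * F z * A z \<partial>lebesgue)"
  proof (rule integral_cong_AE)
    show "AE z in lebesgue. complex_of_real (\<tau>0 z) * F z * A z = complex_of_real (\<tau> z) * F z * A z"
      using AE_completion[OF ae] by eventually_elim simp
  qed measurable
  also have "\<dots> = (\<integral>z. complex_of_real (\<tau> z) * F z * A z \<partial>lborel)"
    by (rule integral_completion) measurable
  finally show ?thesis by (simp add: A_eq F_def)
qed

text \<open>The operator superposes time-frequency shifts of \<phi> with a density of total mass at
  most \<open>W\<close>, so its value has norm at most a multiple of \<open>W\<close> times the norm
  of \<phi>. The factor 2 comes from using \<open>nn_integral_square_le\<close> in place of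
  Minkowski's inequality.\<close>

lemma loc_op_L2_bound:
  fixes \<phi> :: "real^'n::finite \<Rightarrow> complex"
  assumes \<phi>: "schwartz \<phi>" and f: "tempered_distribution f"
    and \<tau>0: "\<tau>0 \<in> borel_measurable lebesgue" and \<tau> [measurable]: "\<tau> \<in> borel_measurable borel" and ae: "AE z in lborel. \<tau>0 z = \<tau> z"
    and nn: "\<And>z. 0 \<le> \<tau> z"
    and W: "(\<integral>\<^sup>+z. ennreal (\<tau> z * cmod (stft \<phi> f z)) \<partial>lborel) \<le> ennreal W" "W \<ge> 0"
  shows "dist_L2_norm (loc_op \<phi> \<tau>0 f) \<le> ennreal (2 * sqrt (\<integral>x. (cmod (\<phi> x))\<^sup>2 \<partial>lborel) * W)"
proof -
  define N where "N = (\<integral>x. (cmod (\<phi> x))\<^sup>2 \<partial>lborel)"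
  have N0: "N \<ge> 0" unfolding N_def by (rule integral_nonneg_AE) simp
  define F where "F = stft \<phi> f"
  have Fm [measurable]: "F \<in> borel_measurable borel"
    unfolding F_def stft_eq_atom[abs_def]
    by (intro borel_measurable_continuous_onI tempered_atom_continuous f schwartz_cnj \<phi>)
  have \<phi>m [measurable]: "\<phi> \<in> borel_measurable borel" by (rule schwartz_measurable[OF \<phi>])
  obtain B where B: "B > 0" "\<And>x. cmod (\<phi> x) \<le> B" using schwartz_kap[OF \<phi>, where k=0] by (metis kap_def power_0 div_by_1 mult_1_right)
  have tf_norm: "cmod (tf_shift z \<phi> t) = cmod (\<phi> (t - fst z))" for z t
    by (simp add: tf_shift_def split_def norm_mult)
  have tf_m [measurable]: "(\<lambda>p. tf_shift (fst p) \<phi> (snd p)) \<in> borel_measurable (lborel \<Otimes>\<^sub>M lborel)"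
    unfolding tf_shift_def split_def by measurable
  have iF: "integrable lborel (\<lambda>z. \<tau> z * cmod (F z))"
    using W(1)[folded F_def] nn by (intro integrableI_nonneg) (auto intro: le_less_trans)
  \<comment> \<open>The pointwise integral: an L^2 function that represents the weakly defined
    functional.\<close>
  define g where "g = (\<lambda>t. \<integral>z. complex_of_real (\<tau> z) * F z * tf_shift z \<phi> t \<partial>lborel)"
  have gm [measurable]: "g \<in> borel_measurable borel"
  proof -
    have "(\<lambda>(t, z). complex_of_real (\<tau> z) * F z * tf_shift z \<phi> t) \<in> borel_measurable (borel \<Otimes>\<^sub>M lborel)"
      unfolding tf_shift_def split_def by measurable
    then show ?thesis unfolding g_def by (rule lborel.borel_measurable_lebesgue_integral)
  qed
  have \<phi>sq: "(\<integral>\<^sup>+t. ennreal ((cmod (\<phi> (t - x)))\<^sup>2) \<partial>lborel) = ennreal N" for x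
  proof -
    have "integrable lborel (\<lambda>x. \<phi> x * cnj (\<phi> x))" by (rule integrable_schwartz_mult[OF \<phi> schwartz_cnj[OF \<phi>]])
    then have "integrable lborel (\<lambda>x. complex_of_real ((cmod (\<phi> x))\<^sup>2))" by (simp only: complex_norm_square)
    from integrable_Re[OF this] have int: "integrable lborel (\<lambda>x. (cmod (\<phi> x))\<^sup>2)" by (simp del: of_real_power)
    have "(\<integral>\<^sup>+t. ennreal ((cmod (\<phi> (t - x)))\<^sup>2) \<partial>lborel) = (\<integral>\<^sup>+t. ennreal ((cmod (\<phi> t))\<^sup>2) \<partial>lborel)"
      by (rule nn_integral_lborel_diff[of "\<lambda>t. ennreal ((cmod (\<phi> t))\<^sup>2)"]) measurable
    also have "\<dots> = ennreal N" unfolding N_def by (rule nn_integral_eq_integral[OF int]) simp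
    finally show ?thesis .
  qed
  have g_sq: "(\<integral>\<^sup>+t. ennreal ((cmod (g t))\<^sup>2) \<partial>lborel) \<le> ennreal (4 * W * W * N)"
  proof -
    have pt: "ennreal ((cmod (g t))\<^sup>2) \<le> ennreal (4 * W) * (\<integral>\<^sup>+z. ennreal (\<tau> z * cmod (F z)) * ennreal ((cmod (\<phi> (t - fst z)))\<^sup>2) \<partial>lborel)" for t
    proof -
      have "ennreal (cmod (g t)) \<le> (\<integral>\<^sup>+z. ennreal ((\<tau> z * cmod (F z)) * cmod (\<phi> (t - fst z))) \<partial>lborel)"
        unfolding g_def by (rule order_trans[OF norm_integral_le_nn_integral]) (simp add: norm_mult tf_norm nn)
      then have "(ennreal (cmod (g t)))\<^sup>2 \<le> (\<integral>\<^sup>+z. ennreal ((\<tau> z * cmod (F z)) * cmod (\<phi> (t - fst z))) \<partial>lborel)\<^sup>2"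
        by (rule power_mono) simp
      also have "\<dots> \<le> ennreal (4 * W) * (\<integral>\<^sup>+z. ennreal ((\<tau> z * cmod (F z)) * (cmod (\<phi> (t - fst z)))\<^sup>2) \<partial>lborel)"
        using W(1)[folded F_def] W(2) nn by (intro nn_integral_square_le) auto
      finally show ?thesis using nn by (simp add: ennreal_power ennreal_mult)
    qed
    have "(\<integral>\<^sup>+t. ennreal ((cmod (g t))\<^sup>2) \<partial>lborel) \<le> (\<integral>\<^sup>+t. ennreal (4 * W) * (\<integral>\<^sup>+z. ennreal (\<tau> z * cmod (F z)) * ennreal ((cmod (\<phi> (t - fst z)))\<^sup>2) \<partial>lborel) \<partial>lborel)"
      by (intro nn_integral_mono pt)
    also have "\<dots> = ennreal (4 * W) * (\<integral>\<^sup>+t. (\<integral>\<^sup>+z. ennreal (\<tau> z * cmod (F z)) * ennreal ((cmod (\<phi> (t - fst z)))\<^sup>2) \<partial>lborel) \<partial>lborel)"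
      by (rule nn_integral_cmult) measurable
    also have "(\<integral>\<^sup>+t. (\<integral>\<^sup>+z. ennreal (\<tau> z * cmod (F z)) * ennreal ((cmod (\<phi> (t - fst z)))\<^sup>2) \<partial>lborel) \<partial>lborel)
       = (\<integral>\<^sup>+z. (\<integral>\<^sup>+t. ennreal (\<tau> z * cmod (F z)) * ennreal ((cmod (\<phi> (t - fst z)))\<^sup>2) \<partial>lborel) \<partial>lborel)"
      by (rule lborel_pair.Fubini'[symmetric]) measurable
    also have "\<dots> = (\<integral>\<^sup>+z. ennreal (\<tau> z * cmod (F z)) * ennreal N \<partial>lborel)"
      by (rule nn_integral_cong) (subst nn_integral_cmult, measurable, simp add: \<phi>sq)
    also have "\<dots> = (\<integral>\<^sup>+z. ennreal (\<tau> z * cmod (F z)) \<partial>lborel) * ennreal N"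
      by (rule nn_integral_multc) measurable
    also have "ennreal (4 * W) * \<dots> \<le> ennreal (4 * W) * (ennreal W * ennreal N)"
      by (intro mult_left_mono mult_right_mono W(1)[folded F_def]) auto
    also have "\<dots> = ennreal (4 * W * W * N)" using W(2) N0 by (simp add: ennreal_mult mult.assoc)
    finally show ?thesis .
  qed
  have ig: "integrable lborel (\<lambda>t. (cmod (g t))\<^sup>2)"
    using g_sq by (intro integrableI_nonneg) (auto intro: le_less_trans)
  have L2: "L2_fun g"
    unfolding L2_fun_def using gm ig by (simp add: measurable_completion integrable_completion)
  have rep: "loc_op \<phi> \<tau>0 f h = dist_of_fun g h" if h: "schwartz h" for h
  proof -
    have hm [measurable]: "h \<in> borel_measurable borel" by (rule schwartz_measurable[OF h])
    obtain Ch where Ch: "\<And>x. cmod (h x) \<le> Ch * kap (DIM(real^'n) + 2) x" using schwartz_kap[OF h] by metis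
    have ih: "integrable lborel h"
    proof (rule Bochner_Integration.integrable_bound)
      show "integrable lborel (\<lambda>x::real^'n. Ch * kap (DIM(real^'n) + 2) x)"
        by (intro integrable_mult_right integrable_kap order_refl)
      show "AE x in lborel. norm (h x) \<le> norm (Ch * kap (DIM(real^'n) + 2) x)"
        by (rule AE_I2, rule order_trans[OF Ch]) simp
    qed measurable
    have "loc_op \<phi> \<tau>0 f h = (\<integral>z. (\<integral>t. complex_of_real (\<tau> z) * F z * (h t * tf_shift z \<phi> t) \<partial>lborel) \<partial>lborel)"
      by (simp add: loc_op_lborel[OF \<phi> f h \<tau>0 \<tau> ae] F_def)
    also have "\<dots> = (\<integral>t. (\<integral>z. complex_of_real (\<tau> z) * F z * (h t * tf_shift z \<phi> t) \<partial>lborel) \<partial>lborel)"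
    proof (rule lborel_pair.Fubini_integral[symmetric])
      have "integrable (lborel \<Otimes>\<^sub>M lborel) (\<lambda>(z, t). (\<tau> z * cmod (F z)) *\<^sub>R h t)"
        by (rule integrable_product_lborel[OF iF ih])
      then have "integrable (lborel \<Otimes>\<^sub>M lborel) (\<lambda>p. B * norm (case p of (z, t) \<Rightarrow> (\<tau> z * cmod (F z)) *\<^sub>R h t))"
        by (intro integrable_mult_right integrable_norm)
      then show "integrable (lborel \<Otimes>\<^sub>M lborel) (\<lambda>(z, t). complex_of_real (\<tau> z) * F z * (h t * tf_shift z \<phi> t))"
      proof (rule Bochner_Integration.integrable_bound)
        show "(\<lambda>(z, t). complex_of_real (\<tau> z) * F z * (h t * tf_shift z \<phi> t)) \<in> borel_measurable (lborel \<Otimes>\<^sub>M lborel)"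
          unfolding tf_shift_def split_def by measurable
        show "AE p in lborel \<Otimes>\<^sub>M lborel. norm (case p of (z, t) \<Rightarrow> complex_of_real (\<tau> z) * F z * (h t * tf_shift z \<phi> t))
           \<le> norm (B * norm (case p of (z, t) \<Rightarrow> (\<tau> z * cmod (F z)) *\<^sub>R h t))"
        proof (intro AE_I2, clarify)
          fix z t
          have "(\<tau> z * cmod (F z) * cmod (h t)) * cmod (tf_shift z \<phi> t) \<le> (\<tau> z * cmod (F z) * cmod (h t)) * B"
            unfolding tf_norm using nn by (intro mult_left_mono B(2)) auto
          then show "norm (complex_of_real (\<tau> z) * F z * (h t * tf_shift z \<phi> t)) \<le> norm (B * norm ((\<tau> z * cmod (F z)) *\<^sub>R h t))"
            using nn[of z] B(1) by (simp add: norm_mult abs_mult mult_ac)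
        qed
      qed
    qed
    also have "\<dots> = (\<integral>t. g t * h t \<partial>lborel)"
    proof (rule Bochner_Integration.integral_cong[OF refl])
      fix t
      have "(\<integral>z. complex_of_real (\<tau> z) * F z * (h t * tf_shift z \<phi> t) \<partial>lborel) = (\<integral>z. (complex_of_real (\<tau> z) * F z * tf_shift z \<phi> t) * h t \<partial>lborel)"
        by (rule Bochner_Integration.integral_cong) (auto simp: mult_ac)
      then show "(\<integral>z. complex_of_real (\<tau> z) * F z * (h t * tf_shift z \<phi> t) \<partial>lborel) = g t * h t"
        by (simp only: g_def integral_mult_left_zero)
    qed
    also have "\<dots> = dist_of_fun g h"
      unfolding dist_of_fun_def by (rule integral_completion[symmetric]) measurable
    finally show ?thesis .
  qed
  have "dist_L2_norm (loc_op \<phi> \<tau>0 f) \<le> ennreal (sqrt (\<integral>t. (cmod (g t))\<^sup>2 \<partial>lebesgue))"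
    unfolding dist_L2_norm_def by (rule INF_lower) (use L2 rep in blast)
  also have "\<dots> \<le> ennreal (2 * sqrt N * W)"
  proof (rule ennreal_leI)
    have "(\<integral>t. (cmod (g t))\<^sup>2 \<partial>lebesgue) = (\<integral>t. (cmod (g t))\<^sup>2 \<partial>lborel)"
      by (rule integral_completion) measurable
    also have "ennreal \<dots> \<le> ennreal (4 * W * W * N)"
      using g_sq nn_integral_eq_integral[OF ig] by simp
    then have "(\<integral>t. (cmod (g t))\<^sup>2 \<partial>lborel) \<le> (2 * W)\<^sup>2 * N"
      using W(2) N0 by (simp add: ennreal_le_iff power2_eq_square)
    finally have "sqrt (\<integral>t. (cmod (g t))\<^sup>2 \<partial>lebesgue) \<le> sqrt ((2 * W)\<^sup>2 * N)" by simp
    then show "sqrt (\<integral>t. (cmod (g t))\<^sup>2 \<partial>lebesgue) \<le> 2 * sqrt N * W"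
      using W(2) by (simp add: real_sqrt_mult mult_ac)
  qed
  finally show ?thesis by (simp add: N_def)
qed

text \<open>Idempotence is the reproducing formula applied to the distribution given by a single
  shift of \<phi>; off-diagonal decay and symmetry are those of \<open>gab\<close>.\<close>

lemma rep_kernel_gab:
  fixes \<phi> :: "real^'n::finite \<Rightarrow> complex"
  assumes \<phi>: "schwartz \<phi>" and nz: "\<phi> \<noteq> (\<lambda>_. 0)"
  shows "rep_kernel (\<lambda>z w. gab \<phi> z w / complex_of_real (\<integral>x. (cmod (\<phi> x))\<^sup>2 \<partial>lborel))"
proof
  define N where "N = (\<integral>x. (cmod (\<phi> x))\<^sup>2 \<partial>lborel)"
  have N: "N > 0" unfolding N_def by (rule integral_cmod_sq_pos[OF assms])
  have *: "(\<lambda>(z, w). gab \<phi> z w / complex_of_real N) = (\<lambda>p. case_prod (gab \<phi>) p / complex_of_real N)" by auto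
  show "(\<lambda>(z, w). gab \<phi> z w / complex_of_real (\<integral>x. (cmod (\<phi> x))\<^sup>2 \<partial>lborel)) \<in> borel_measurable (borel \<Otimes>\<^sub>M borel)"
    unfolding N_def[symmetric] * using gab_measurable[OF \<phi>] by (intro borel_measurable_divide) auto
  show "\<exists>C. \<forall>z w. cmod (gab \<phi> z w / complex_of_real (\<integral>x. (cmod (\<phi> x))\<^sup>2 \<partial>lborel)) \<le> C * kap j (z - w)" for j
  proof -
    obtain C where "\<And>z w. cmod (gab \<phi> z w) \<le> C * kap j (z - w)" using gab_decay[OF \<phi>] by metis
    then show ?thesis unfolding N_def[symmetric] using N
      by (intro exI[of _ "C / N"]) (simp add: norm_divide divide_right_mono)
  qed
  show "cnj (gab \<phi> z w / complex_of_real (\<integral>x. (cmod (\<phi> x))\<^sup>2 \<partial>lborel)) = gab \<phi> w z / complex_of_real (\<integral>x. (cmod (\<phi> x))\<^sup>2 \<partial>lborel)" for z w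
    by (simp add: gab_herm)
  show "(\<integral>z. gab \<phi> w z / complex_of_real (\<integral>x. (cmod (\<phi> x))\<^sup>2 \<partial>lborel) * (gab \<phi> z v / complex_of_real (\<integral>x. (cmod (\<phi> x))\<^sup>2 \<partial>lborel)) \<partial>lborel)
     = gab \<phi> w v / complex_of_real (\<integral>x. (cmod (\<phi> x))\<^sup>2 \<partial>lborel)" for w v
  proof -
    have "dist_of_fun (tf_shift v \<phi>) (atom z (\<lambda>t. cnj (\<phi> t))) = gab \<phi> z v" for z
      by (simp add: gab_def amb_eq_dist schwartz_tf_shift schwartz_cnj \<phi>)
    then have "(\<integral>z. gab \<phi> w z * gab \<phi> z v \<partial>lborel) = complex_of_real N * gab \<phi> w v"
      using stft_reproducing[OF dist_of_fun_tempered[OF schwartz_tf_shift[OF \<phi>]] \<phi>, of w v] by (simp add: N_def)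
    then have "(\<integral>z. gab \<phi> w z * gab \<phi> z v / complex_of_real (N * N) \<partial>lborel) = complex_of_real N * gab \<phi> w v / complex_of_real (N * N)"
      by (simp only: integral_divide_zero)
    then show ?thesis unfolding N_def[symmetric] using N by (simp add: field_simps)
  qed
qed

section \<open>Borel representatives and powers of extended reals\<close>

lemma AE_lborel_translate:
  fixes a :: "'a::euclidean_space"
  assumes "AE x in lborel. P x" shows "AE x in lborel. P (x - a)"
proof (rule AE_distrD[of "\<lambda>x. x - a" lborel borel P])
  show "(\<lambda>x. x - a) \<in> measurable lborel borel" by simp
  show "AE x in distr lborel borel (\<lambda>x. x - a). P x" unfolding lborel_distr_diff by (rule assms)
qed

lemma lebesgue_measurable_translate:
  fixes a :: "'a::euclidean_space"
  assumes "f \<in> borel_measurable lebesgue" shows "(\<lambda>x. f (x - a)) \<in> borel_measurable lebesgue"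
proof -
  have "(\<lambda>x. - a + (\<Sum>j\<in>Basis. (1 * (x \<bullet> j)) *\<^sub>R j)) \<in> lebesgue \<rightarrow>\<^sub>M lebesgue"
    by (rule lebesgue_affine_measurable[of "\<lambda>_. 1"]) simp
  then have "(\<lambda>x. x - a) \<in> lebesgue \<rightarrow>\<^sub>M (lebesgue :: 'a measure)" by (simp add: euclidean_representation)
  from measurable_compose[OF this assms] show ?thesis .
qed

text \<open>A Borel representative may be negative on a null set; the maximum with 0 repairs this
  without losing agreement almost everywhere.\<close>

lemma borel_representative_nonneg:
  fixes g :: "'a::euclidean_space \<Rightarrow> real"
  assumes "g \<in> borel_measurable lebesgue" "\<And>z. 0 \<le> g z"
  obtains g' where "g' \<in> borel_measurable borel" "\<And>z. 0 \<le> g' z" "AE z in lborel. g z = g' z"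
proof -
  obtain g1 where g1: "g1 \<in> borel_measurable lborel" "AE z in lborel. g z = g1 z"
    using completion_ex_borel_measurable_real[OF assms(1)] by blast
  show thesis
  proof (rule that[of "\<lambda>z. max 0 (g1 z)"])
    show "(\<lambda>z. max 0 (g1 z)) \<in> borel_measurable borel" using g1(1) by simp
    show "AE z in lborel. g z = max 0 (g1 z)"
      using g1(2) by eventually_elim (use assms(2) in \<open>metis max_def max.absorb2\<close>)
  qed simp
qed

lemma ennpowr_less_top: "ennpowr x q < \<infinity> \<longleftrightarrow> x < \<infinity>"
  by (auto simp: ennpowr_def less_top[symmetric])

lemma ennpowr_ennreal: "0 \<le> x \<Longrightarrow> ennpowr (ennreal x) q = ennreal (x powr q)"
  by (simp add: ennpowr_def)

lemma ennpowr_mono: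
  assumes "x \<le> y" "0 \<le> q" shows "ennpowr x q \<le> ennpowr y q"
proof (cases y)
  case (real b)
  then obtain a where a: "x = ennreal a" "a \<ge> 0" using assms(1) by (cases x) (auto simp: top_unique)
  then have "a \<le> b" using assms(1) real by simp
  then show ?thesis using a real assms(2) by (simp add: ennpowr_ennreal ennreal_leI powr_mono2)
qed (simp add: ennpowr_def)

lemma ennpowr_cmult:
  assumes "0 < c" shows "ennpowr (ennreal c * x) q = ennreal (c powr q) * ennpowr x q"
proof (cases x)
  case (real a)
  have eq: "ennreal c * ennreal a = ennreal (c * a)" using assms real by (simp add: ennreal_mult)
  have "ennpowr (ennreal (c * a)) q = ennreal ((c * a) powr q)" using real assms by (intro ennpowr_ennreal) simp
  also have "\<dots> = ennreal (c powr q) * ennpowr x q"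
    using real assms by (simp add: ennpowr_ennreal powr_mult ennreal_mult)
  finally show ?thesis using real eq by simp
next
  case top
  then show ?thesis using assms by (simp add: ennpowr_def ennreal_mult_top)
qed

subsection \<open>Weighted summability\<close>

text \<open>Moving the weight \<open>m\<close> from \<open>z\<close> to \<open>l\<close> costs
  \<open>N'\<close> powers, which the kernel of order \<open>N' + d\<close> provides. What remains
  is a convolution of the weighted sequence with \<open>kap d\<close>; Jensen with the mass
  \<open>Kl\<close>, followed by Tonelli, bounds its p-th power.\<close>

lemma lp_backward:
  fixes F :: "'a::euclidean_space \<Rightarrow> complex" and m b :: "'a \<Rightarrow> real" and L :: "'a set"
  assumes L: "countable L" and p: "1 \<le> p" and d: "d \<ge> DIM('a) + 2"
    and L_sum: "\<And>x. (\<integral>\<^sup>+l. ennreal (kap d (x - l)) \<partial>count_space L) \<le> ennreal Kl" and Kl: "Kl > 0"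
    and F: "\<And>z. ennreal (cmod (F z)) \<le> ennreal K * (\<integral>\<^sup>+l. ennreal (b l * kap (N' + d) (z - l)) \<partial>count_space L)" and K: "K \<ge> 0"
    and m: "\<And>z. 0 < m z" and C: "C > 0" and mod: "\<And>z w. m z \<le> C * (1 + norm (z - w)) ^ N' * m w"
    and b: "\<And>l. 0 \<le> b l"
    and fin: "(\<integral>\<^sup>+l. ennreal ((b l * m l) powr p) \<partial>count_space L) < \<infinity>"
  shows "(\<integral>\<^sup>+z. ennreal (cmod (F z) powr p * m z powr p) \<partial>lborel) < \<infinity>"
proof -
  \<comment> \<open>Enlarged by 1 to be strictly positive, as \<open>ennpowr_cmult\<close>
    requires.\<close>
  define K' where "K' = K * C + 1"
  have K': "K' > 0" "K * C \<le> K'" using K C by (auto simp: K'_def add_nonneg_pos)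
  define q where "q = (\<lambda>l. b l * m l)"
  have q: "0 \<le> q l" for l using b m[of l] by (simp add: q_def)
  define c0 where "c0 = K' powr p * (2 powr p * Kl powr (p - 1))"
  have c0: "c0 \<ge> 0" by (simp add: c0_def)
  have pt: "ennreal (cmod (F z) powr p * m z powr p) \<le> ennreal c0 * (\<integral>\<^sup>+l. ennreal (kap d (z - l) * q l powr p) \<partial>count_space L)" for z
  proof -
    have "ennreal (m z) * ennreal (cmod (F z)) \<le> ennreal (m z) * (ennreal K * (\<integral>\<^sup>+l. ennreal (b l * kap (N' + d) (z - l)) \<partial>count_space L))"
      by (rule mult_left_mono[OF F]) simp
    also have "\<dots> = (\<integral>\<^sup>+l. ennreal (m z) * (ennreal K * ennreal (b l * kap (N' + d) (z - l))) \<partial>count_space L)"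
      by (simp add: nn_integral_cmult)
    also have "\<dots> \<le> (\<integral>\<^sup>+l. ennreal K' * ennreal (kap d (z - l) * q l) \<partial>count_space L)"
    proof (rule nn_integral_mono)
      fix l
      have "m z * (K * (b l * kap (N' + d) (z - l))) \<le> (C * (1 + norm (z - l)) ^ N' * m l) * (K * (b l * kap (N' + d) (z - l)))"
        using K b by (intro mult_right_mono mod) auto
      also have "\<dots> = (K * C) * (((1 + norm (z - l)) ^ N' * kap N' (z - l)) * (kap d (z - l) * q l))"
        by (simp only: kap_add q_def mult_ac)
      also have "\<dots> = (K * C) * (kap d (z - l) * q l)" by simp
      also have "\<dots> \<le> K' * (kap d (z - l) * q l)" using q K' by (intro mult_right_mono) auto
      finally show "ennreal (m z) * (ennreal K * ennreal (b l * kap (N' + d) (z - l))) \<le> ennreal K' * ennreal (kap d (z - l) * q l)"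
        using m[of z] K K' by (simp add: ennreal_mult'[symmetric] ennreal_leI less_imp_le)
    qed
    also have "\<dots> = ennreal K' * (\<integral>\<^sup>+l. ennreal (kap d (z - l) * q l) \<partial>count_space L)" by (rule nn_integral_cmult) simp
    finally have "ennreal (m z * cmod (F z)) \<le> ennreal K' * (\<integral>\<^sup>+l. ennreal (kap d (z - l) * q l) \<partial>count_space L)"
      using m[of z] by (simp add: ennreal_mult' less_imp_le)
    then have "ennpowr (ennreal (m z * cmod (F z))) p \<le> ennpowr (ennreal K' * (\<integral>\<^sup>+l. ennreal (kap d (z - l) * q l) \<partial>count_space L)) p"
      using p by (intro ennpowr_mono) auto
    also have "\<dots> = ennreal (K' powr p) * ennpowr (\<integral>\<^sup>+l. ennreal (kap d (z - l) * q l) \<partial>count_space L) p"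
      by (rule ennpowr_cmult[OF K'(1)])
    also have "\<dots> \<le> ennreal (K' powr p) * (ennreal (2 powr p * Kl powr (p - 1)) * (\<integral>\<^sup>+l. ennreal (kap d (z - l) * q l powr p) \<partial>count_space L))"
      using L_sum[of z] Kl p q by (intro mult_left_mono ennpowr_nn_integral_le) auto
    also have "\<dots> = ennreal c0 * (\<integral>\<^sup>+l. ennreal (kap d (z - l) * q l powr p) \<partial>count_space L)"
      by (simp add: c0_def ennreal_mult mult.assoc)
    also have "ennpowr (ennreal (m z * cmod (F z))) p = ennreal (cmod (F z) powr p * m z powr p)"
      using m[of z] by (simp add: ennpowr_ennreal powr_mult less_imp_le mult.commute)
    finally show ?thesis .
  qed
  define J where "J = (\<integral>\<^sup>+z. ennreal (kap d (z::'a)) \<partial>lborel)"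
  have J: "J < \<infinity>" unfolding J_def by (rule nn_integral_kap_finite[OF d])
  have "(\<integral>\<^sup>+z. ennreal (cmod (F z) powr p * m z powr p) \<partial>lborel) \<le> (\<integral>\<^sup>+z. ennreal c0 * (\<integral>\<^sup>+l. ennreal (kap d (z - l) * q l powr p) \<partial>count_space L) \<partial>lborel)"
    by (rule nn_integral_mono[OF pt])
  also have "\<dots> = ennreal c0 * (\<integral>\<^sup>+z. (\<integral>\<^sup>+l. ennreal (kap d (z - l) * q l powr p) \<partial>count_space L) \<partial>lborel)"
    by (rule nn_integral_cmult, rule nn_integral_count_space_lborel_measurable[OF L]) measurable
  also have "(\<integral>\<^sup>+z. (\<integral>\<^sup>+l. ennreal (kap d (z - l) * q l powr p) \<partial>count_space L) \<partial>lborel)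
     = (\<integral>\<^sup>+l. (\<integral>\<^sup>+z. ennreal (kap d (z - l) * q l powr p) \<partial>lborel) \<partial>count_space L)"
    by (rule nn_integral_count_space_nn_integral[OF L]) measurable
  also have "\<dots> = (\<integral>\<^sup>+l. J * ennreal (q l powr p) \<partial>count_space L)"
  proof (rule nn_integral_cong)
    fix l
    have "(\<integral>\<^sup>+z. ennreal (kap d (z - l) * q l powr p) \<partial>lborel) = (\<integral>\<^sup>+z. ennreal (kap d (z - l)) * ennreal (q l powr p) \<partial>lborel)"
      by (simp add: ennreal_mult)
    also have "\<dots> = (\<integral>\<^sup>+z. ennreal (kap d (z - l)) \<partial>lborel) * ennreal (q l powr p)"
      by (rule nn_integral_multc) measurable
    also have "(\<integral>\<^sup>+z. ennreal (kap d (z - l)) \<partial>lborel) = J"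
      unfolding J_def by (rule nn_integral_lborel_diff[of "\<lambda>z. ennreal (kap d z)"]) measurable
    finally show "(\<integral>\<^sup>+z. ennreal (kap d (z - l) * q l powr p) \<partial>lborel) = J * ennreal (q l powr p)" .
  qed
  also have "\<dots> = J * (\<integral>\<^sup>+l. ennreal (q l powr p) \<partial>count_space L)" by (rule nn_integral_cmult) simp
  also have "ennreal c0 * (J * (\<integral>\<^sup>+l. ennreal (q l powr p) \<partial>count_space L)) < \<infinity>"
    using J fin by (simp add: ennreal_mult_less_top q_def)
  finally show ?thesis .
qed

text \<open>Integrability of \<sigma> against its weight gives no pointwise bound for the lattice
  sums of the weighted symbol. Bounding \<open>F\<close> by a convolution replaces that symbol by
  the smoothed function \<theta>, whose integral and whose lattice sums are both bounded; Jensen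
  uses the former, the summation over \<open>L\<close> the latter.\<close>

lemma lp_forward:
  fixes F :: "'a::euclidean_space \<Rightarrow> complex" and m \<sigma> :: "'a \<Rightarrow> real" and L :: "'a set"
  assumes L: "countable L" and p: "1 \<le> p" and d: "d \<ge> DIM('a) + 2"
    and L_sum: "\<And>x. (\<integral>\<^sup>+l. ennreal (kap d (x - l)) \<partial>count_space L) \<le> ennreal Kl" and Kl: "Kl > 0"
    and Fm [measurable]: "F \<in> borel_measurable borel"
    and F: "\<And>z. ennreal (cmod (F z)) \<le> (\<integral>\<^sup>+w. ennreal (Ck * kap (N' + d) (z - w) * cmod (F w)) \<partial>lborel)" and Ck: "Ck > 0"
    and mm: "m \<in> borel_measurable lebesgue" and m: "\<And>z. 0 < m z" and C: "C > 0"
    and mod: "\<And>z w. m z \<le> C * (1 + norm (z - w)) ^ N' * m w"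
    and mod': "\<And>z w. m z \<le> C * (1 + norm (z - w)) powr s * m w"
    and \<sigma>m [measurable]: "\<sigma> \<in> borel_measurable borel" and \<sigma>: "\<And>z. 0 \<le> \<sigma> z"
    and \<sigma>_int: "(\<integral>\<^sup>+z. ennreal (\<sigma> z * (1 + norm z) powr s) \<partial>lborel) < \<infinity>"
    and fin: "(\<integral>\<^sup>+z. ennreal (cmod (F z) powr p * m z powr p) \<partial>lborel) < \<infinity>"
  shows "(\<integral>\<^sup>+l. ennpowr (\<integral>\<^sup>+z. ennreal (\<sigma> (z - l) * cmod (F z)) \<partial>lborel) p * ennreal (m l powr p) \<partial>count_space L) < \<infinity>"
proof -
  \<comment> \<open>\<open>m\<close> is only Lebesgue measurable. Its Borel representative is used
    under the integrals, while the moderateness inequalities are applied to \<open>m\<close> itself,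
    as they hold at every point.\<close>
  obtain m1 where m1 [measurable]: "m1 \<in> borel_measurable borel" and m10: "\<And>z. 0 \<le> m1 z" and m1_ae: "AE z in lborel. m z = m1 z"
    using borel_representative_nonneg[OF mm less_imp_le[OF m]] by metis
  define q where "q = (\<lambda>w. m1 w * cmod (F w))"
  have [measurable]: "q \<in> borel_measurable borel" unfolding q_def by measurable
  have q0: "0 \<le> q w" for w using m10 by (simp add: q_def)
  define \<sigma>s where "\<sigma>s = (\<lambda>z. \<sigma> z * (1 + norm z) powr s)"
  have [measurable]: "\<sigma>s \<in> borel_measurable borel" unfolding \<sigma>s_def by measurable
  have \<sigma>s0: "0 \<le> \<sigma>s z" for z using \<sigma> by (simp add: \<sigma>s_def)
  define I\<sigma> where "I\<sigma> = (\<integral>z. \<sigma>s z \<partial>lborel)"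
  have i\<sigma>: "integrable lborel \<sigma>s" using \<sigma>_int \<sigma>s0 by (intro integrableI_nonneg) (auto simp: \<sigma>s_def)
  have I\<sigma>: "(\<integral>\<^sup>+z. ennreal (\<sigma>s z) \<partial>lborel) = ennreal I\<sigma>" unfolding I\<sigma>_def
    by (rule nn_integral_eq_integral[OF i\<sigma>]) (use \<sigma>s0 in auto)
  have I\<sigma>0: "I\<sigma> \<ge> 0" unfolding I\<sigma>_def by (rule integral_nonneg_AE) (use \<sigma>s0 in auto)
  define \<theta> where "\<theta> = (\<lambda>w::'a. \<integral>\<^sup>+z. ennreal (\<sigma>s z) * ennreal (kap d (z - w)) \<partial>lborel)"
  have [measurable]: "\<theta> \<in> borel_measurable borel" unfolding \<theta>_def by measurable
  have \<theta>_le: "\<theta> w \<le> ennreal I\<sigma>" for w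
  proof -
    have "\<theta> w \<le> (\<integral>\<^sup>+z. ennreal (\<sigma>s z) * 1 \<partial>lborel)"
      unfolding \<theta>_def by (intro nn_integral_mono mult_left_mono) auto
    then show ?thesis by (simp add: I\<sigma>)
  qed
  define \<theta>r where "\<theta>r = (\<lambda>w. enn2real (\<theta> w))"
  have [measurable]: "\<theta>r \<in> borel_measurable borel" unfolding \<theta>r_def by measurable
  have \<theta>r: "ennreal (\<theta>r w) = \<theta> w" for w
    unfolding \<theta>r_def using \<theta>_le[of w] by (auto simp: ennreal_enn2real_if top_unique)
  have \<theta>r0: "0 \<le> \<theta>r w" for w by (simp add: \<theta>r_def)
  define J where "J = (\<integral>z. kap d (z::'a) \<partial>lborel)"
  have J: "(\<integral>\<^sup>+z. ennreal (kap d (z - w)) \<partial>lborel) = ennreal J" for w :: 'a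
  proof -
    have "(\<integral>\<^sup>+z. ennreal (kap d (z - w)) \<partial>lborel) = (\<integral>\<^sup>+z. ennreal (kap d (z::'a)) \<partial>lborel)"
      by (rule nn_integral_lborel_diff[of "\<lambda>z. ennreal (kap d z)"]) measurable
    also have "\<dots> = ennreal J" unfolding J_def by (rule nn_integral_eq_integral[OF integrable_kap[OF d]]) simp
    finally show ?thesis .
  qed
  have J': "(\<integral>\<^sup>+w. ennreal (kap d (z - w)) \<partial>lborel) = ennreal J" for z :: 'a
    by (subst kap_minus_commute) (rule J)
  have J0: "J \<ge> 0" unfolding J_def by (rule integral_nonneg_AE) simp
  have \<theta>_int: "(\<integral>\<^sup>+w. \<theta> (w - l) \<partial>lborel) \<le> ennreal (I\<sigma> * J + 1)" for l
  proof -
    have "(\<integral>\<^sup>+w. \<theta> (w - l) \<partial>lborel) = (\<integral>\<^sup>+w. \<theta> w \<partial>lborel)" by (rule nn_integral_lborel_diff) measurable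
    also have "\<dots> = (\<integral>\<^sup>+z. (\<integral>\<^sup>+w. ennreal (\<sigma>s z) * ennreal (kap d (z - w)) \<partial>lborel) \<partial>lborel)"
      unfolding \<theta>_def by (rule lborel_pair.Fubini') measurable
    also have "\<dots> = (\<integral>\<^sup>+z. ennreal (\<sigma>s z) * ennreal J \<partial>lborel)"
      by (rule nn_integral_cong) (simp add: nn_integral_cmult J')
    also have "\<dots> = ennreal I\<sigma> * ennreal J" by (simp add: nn_integral_multc I\<sigma>)
    finally show ?thesis using I\<sigma>0 J0 by (simp add: ennreal_mult[symmetric] ennreal_leI)
  qed
  have \<theta>_sum: "(\<integral>\<^sup>+l. \<theta> (w - l) \<partial>count_space L) \<le> ennreal (I\<sigma> * Kl)" for w
  proof -
    have "(\<integral>\<^sup>+l. \<theta> (w - l) \<partial>count_space L) = (\<integral>\<^sup>+z. (\<integral>\<^sup>+l. ennreal (\<sigma>s z) * ennreal (kap d (z - (w - l))) \<partial>count_space L) \<partial>lborel)"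
      unfolding \<theta>_def by (rule nn_integral_count_space_nn_integral[OF L, symmetric]) measurable
    also have "\<dots> \<le> (\<integral>\<^sup>+z. ennreal (\<sigma>s z) * ennreal Kl \<partial>lborel)"
    proof (rule nn_integral_mono)
      fix z
      have "(\<integral>\<^sup>+l. ennreal (\<sigma>s z) * ennreal (kap d (z - (w - l))) \<partial>count_space L) = ennreal (\<sigma>s z) * (\<integral>\<^sup>+l. ennreal (kap d ((w - z) - l)) \<partial>count_space L)"
      proof -
        have "kap d (z - (w - l)) = kap d ((w - z) - l)" for l
          using kap_minus_commute[of d z "w - l"] by (simp add: algebra_simps)
        then show ?thesis by (simp add: nn_integral_cmult)
      qed
      also have "\<dots> \<le> ennreal (\<sigma>s z) * ennreal Kl" by (intro mult_left_mono L_sum) simp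
      finally show "(\<integral>\<^sup>+l. ennreal (\<sigma>s z) * ennreal (kap d (z - (w - l))) \<partial>count_space L) \<le> ennreal (\<sigma>s z) * ennreal Kl" .
    qed
    also have "\<dots> = ennreal (I\<sigma> * Kl)" using I\<sigma>0 Kl by (simp add: nn_integral_multc I\<sigma> ennreal_mult)
    finally show ?thesis .
  qed
  define c1 where "c1 = C * C * Ck"
  have c1: "c1 > 0" using C Ck by (simp add: c1_def)
  define W where "W = I\<sigma> * J + 1"
  have W: "W > 0" unfolding W_def using I\<sigma>0 J0 by (intro add_nonneg_pos) auto
  define c2 where "c2 = c1 powr p * (2 powr p * W powr (p - 1))"
  have pt: "ennpowr (\<integral>\<^sup>+z. ennreal (\<sigma> (z - l) * cmod (F z)) \<partial>lborel) p * ennreal (m l powr p)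
     \<le> ennreal c2 * (\<integral>\<^sup>+w. \<theta> (w - l) * ennreal (q w powr p) \<partial>lborel)" for l
  proof -
    have "ennreal (m l) * (\<integral>\<^sup>+z. ennreal (\<sigma> (z - l) * cmod (F z)) \<partial>lborel)
        = (\<integral>\<^sup>+z. ennreal (m l * \<sigma> (z - l)) * ennreal (cmod (F z)) \<partial>lborel)"
      using m[of l] \<sigma> by (subst nn_integral_cmult[symmetric]) (auto simp: ennreal_mult less_imp_le mult.assoc)
    also have "\<dots> \<le> (\<integral>\<^sup>+z. (\<integral>\<^sup>+w. (ennreal (\<sigma>s (z - l)) * ennreal (kap d (z - w))) * ennreal (c1 * q w) \<partial>lborel) \<partial>lborel)"
    proof (rule nn_integral_mono)
      fix z
      \<comment> \<open>The weight travels from \<open>l\<close> to \<open>z\<close>, paid by the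
        moment of \<sigma> contained in \<open>\<sigma>s\<close>; afterwards it travels from
        \<open>z\<close> to \<open>w\<close>, paid by \<open>N'\<close> powers of the
        kernel.\<close>
      have ms: "m l * \<sigma> (z - l) \<le> C * \<sigma>s (z - l) * m z"
      proof -
        have "m l * \<sigma> (z - l) \<le> (C * (1 + norm (l - z)) powr s * m z) * \<sigma> (z - l)" using \<sigma> by (intro mult_right_mono mod') auto
        also have "\<dots> = C * \<sigma>s (z - l) * m z" by (simp add: \<sigma>s_def norm_minus_commute mult_ac)
        finally show ?thesis .
      qed
      have "ennreal (m l * \<sigma> (z - l)) * ennreal (cmod (F z)) \<le> ennreal (C * \<sigma>s (z - l) * m z) * (\<integral>\<^sup>+w. ennreal (Ck * kap (N' + d) (z - w) * cmod (F w)) \<partial>lborel)"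
        by (intro mult_mono F ennreal_leI ms) auto
      also have "\<dots> = (\<integral>\<^sup>+w. ennreal (C * \<sigma>s (z - l) * m z) * ennreal (Ck * kap (N' + d) (z - w) * cmod (F w)) \<partial>lborel)"
        by (rule nn_integral_cmult[symmetric]) measurable
      also have "\<dots> \<le> (\<integral>\<^sup>+w. (ennreal (\<sigma>s (z - l)) * ennreal (kap d (z - w))) * ennreal (c1 * q w) \<partial>lborel)"
      proof (rule nn_integral_mono_AE, use m1_ae in eventually_elim)
        case (elim w)
        have "(C * \<sigma>s (z - l) * m z) * (Ck * kap (N' + d) (z - w) * cmod (F w))
           \<le> (C * \<sigma>s (z - l) * (C * (1 + norm (z - w)) ^ N' * m w)) * (Ck * kap (N' + d) (z - w) * cmod (F w))"
          using C Ck \<sigma>s0 by (intro mult_right_mono mult_left_mono mod) auto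
        also have "\<dots> = (\<sigma>s (z - l) * (((1 + norm (z - w)) ^ N' * kap N' (z - w)) * kap d (z - w))) * (C * C * Ck * (m w * cmod (F w)))"
          by (simp only: kap_add mult_ac)
        also have "\<dots> = (\<sigma>s (z - l) * kap d (z - w)) * (c1 * q w)"
          by (simp add: c1_def q_def elim)
        finally have le: "(C * \<sigma>s (z - l) * m z) * (Ck * kap (N' + d) (z - w) * cmod (F w)) \<le> (\<sigma>s (z - l) * kap d (z - w)) * (c1 * q w)" .
        have "ennreal (C * \<sigma>s (z - l) * m z) * ennreal (Ck * kap (N' + d) (z - w) * cmod (F w))
            = ennreal ((C * \<sigma>s (z - l) * m z) * (Ck * kap (N' + d) (z - w) * cmod (F w)))"
          by (rule ennreal_mult[symmetric]) (use C Ck \<sigma>s0 m[of z] in auto)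
        also have "\<dots> \<le> ennreal ((\<sigma>s (z - l) * kap d (z - w)) * (c1 * q w))" by (rule ennreal_leI[OF le])
        also have "\<dots> = (ennreal (\<sigma>s (z - l)) * ennreal (kap d (z - w))) * ennreal (c1 * q w)"
          using \<sigma>s0 c1 q0 by (simp add: ennreal_mult)
        finally show ?case .
      qed
      finally show "ennreal (m l * \<sigma> (z - l)) * ennreal (cmod (F z)) \<le> \<dots>" .
    qed
    also have "\<dots> = (\<integral>\<^sup>+w. (\<integral>\<^sup>+z. (ennreal (\<sigma>s (z - l)) * ennreal (kap d (z - w))) * ennreal (c1 * q w) \<partial>lborel) \<partial>lborel)"
      by (rule lborel_pair.Fubini') measurable
    also have "\<dots> = (\<integral>\<^sup>+w. ennreal c1 * ennreal (\<theta>r (w - l) * q w) \<partial>lborel)"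
    proof (rule nn_integral_cong)
      fix w
      have "(\<integral>\<^sup>+z. (ennreal (\<sigma>s (z - l)) * ennreal (kap d (z - w))) * ennreal (c1 * q w) \<partial>lborel)
         = (\<integral>\<^sup>+z. ennreal (\<sigma>s (z - l)) * ennreal (kap d ((z - l) - (w - l))) \<partial>lborel) * ennreal (c1 * q w)"
        by (subst nn_integral_multc[symmetric]) (auto simp: algebra_simps)
      also have "(\<integral>\<^sup>+z. ennreal (\<sigma>s (z - l)) * ennreal (kap d ((z - l) - (w - l))) \<partial>lborel) = \<theta> (w - l)"
        unfolding \<theta>_def by (rule nn_integral_lborel_diff[of "\<lambda>z. ennreal (\<sigma>s z) * ennreal (kap d (z - (w - l)))"]) measurable
      finally show "(\<integral>\<^sup>+z. (ennreal (\<sigma>s (z - l)) * ennreal (kap d (z - w))) * ennreal (c1 * q w) \<partial>lborel) = ennreal c1 * ennreal (\<theta>r (w - l) * q w)"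
        using c1 q0[of w] \<theta>r0[of "w - l"] by (simp add: \<theta>r[symmetric] ennreal_mult mult_ac)
    qed
    also have "\<dots> = ennreal c1 * (\<integral>\<^sup>+w. ennreal (\<theta>r (w - l) * q w) \<partial>lborel)" by (rule nn_integral_cmult) measurable
    finally have le: "ennreal (m l) * (\<integral>\<^sup>+z. ennreal (\<sigma> (z - l) * cmod (F z)) \<partial>lborel) \<le> ennreal c1 * (\<integral>\<^sup>+w. ennreal (\<theta>r (w - l) * q w) \<partial>lborel)" .
    have "ennpowr (\<integral>\<^sup>+z. ennreal (\<sigma> (z - l) * cmod (F z)) \<partial>lborel) p * ennreal (m l powr p)
        = ennpowr (ennreal (m l) * (\<integral>\<^sup>+z. ennreal (\<sigma> (z - l) * cmod (F z)) \<partial>lborel)) p"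
      by (simp add: ennpowr_cmult[OF m] mult.commute)
    also have "\<dots> \<le> ennpowr (ennreal c1 * (\<integral>\<^sup>+w. ennreal (\<theta>r (w - l) * q w) \<partial>lborel)) p"
      using p by (intro ennpowr_mono le) simp
    also have "\<dots> = ennreal (c1 powr p) * ennpowr (\<integral>\<^sup>+w. ennreal (\<theta>r (w - l) * q w) \<partial>lborel) p"
      by (rule ennpowr_cmult[OF c1])
    also have "\<dots> \<le> ennreal (c1 powr p) * (ennreal (2 powr p * W powr (p - 1)) * (\<integral>\<^sup>+w. ennreal (\<theta>r (w - l) * q w powr p) \<partial>lborel))"
      using \<theta>_int[of l] W p q0 \<theta>r0 by (intro mult_left_mono ennpowr_nn_integral_le) (auto simp: \<theta>r W_def)
    also have "\<dots> = ennreal c2 * (\<integral>\<^sup>+w. \<theta> (w - l) * ennreal (q w powr p) \<partial>lborel)"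
      using \<theta>r0 by (simp add: c2_def ennreal_mult mult.assoc \<theta>r)
    finally show ?thesis .
  qed
  have qfin: "(\<integral>\<^sup>+w. ennreal (q w powr p) \<partial>lborel) < \<infinity>"
  proof -
    have "(\<integral>\<^sup>+w. ennreal (q w powr p) \<partial>lborel) = (\<integral>\<^sup>+z. ennreal (cmod (F z) powr p * m z powr p) \<partial>lborel)"
    proof (rule nn_integral_cong_AE, use m1_ae in eventually_elim)
      case (elim z)
      then show ?case using m10[of z] by (simp add: q_def powr_mult mult.commute)
    qed
    then show ?thesis using fin by simp
  qed
  have "(\<integral>\<^sup>+l. ennpowr (\<integral>\<^sup>+z. ennreal (\<sigma> (z - l) * cmod (F z)) \<partial>lborel) p * ennreal (m l powr p) \<partial>count_space L)
     \<le> (\<integral>\<^sup>+l. ennreal c2 * (\<integral>\<^sup>+w. \<theta> (w - l) * ennreal (q w powr p) \<partial>lborel) \<partial>count_space L)"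
    by (rule nn_integral_mono[OF pt])
  also have "\<dots> = ennreal c2 * (\<integral>\<^sup>+l. (\<integral>\<^sup>+w. \<theta> (w - l) * ennreal (q w powr p) \<partial>lborel) \<partial>count_space L)"
    by (rule nn_integral_cmult) simp
  also have "(\<integral>\<^sup>+l. (\<integral>\<^sup>+w. \<theta> (w - l) * ennreal (q w powr p) \<partial>lborel) \<partial>count_space L)
     = (\<integral>\<^sup>+w. (\<integral>\<^sup>+l. \<theta> (w - l) * ennreal (q w powr p) \<partial>count_space L) \<partial>lborel)"
    by (rule nn_integral_count_space_nn_integral[OF L, symmetric]) measurable
  also have "\<dots> \<le> (\<integral>\<^sup>+w. ennreal (I\<sigma> * Kl) * ennreal (q w powr p) \<partial>lborel)"
    using \<theta>_sum by (intro nn_integral_mono) (simp add: nn_integral_multc mult_right_mono)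
  also have "\<dots> = ennreal (I\<sigma> * Kl) * (\<integral>\<^sup>+w. ennreal (q w powr p) \<partial>lborel)" by (rule nn_integral_cmult) measurable
  finally have "(\<integral>\<^sup>+l. ennpowr (\<integral>\<^sup>+z. ennreal (\<sigma> (z - l) * cmod (F z)) \<partial>lborel) p * ennreal (m l powr p) \<partial>count_space L)
     \<le> ennreal c2 * (ennreal (I\<sigma> * Kl) * (\<integral>\<^sup>+w. ennreal (q w powr p) \<partial>lborel))"
    by (simp add: mult_left_mono)
  also have "\<dots> < \<infinity>" using qfin by (simp add: ennreal_mult_less_top)
  finally show ?thesis .
qed

theorem theorem1:
  fixes \<Lambda> :: "((real^'n::finite) \<times> (real^'n)) set"
    and p C N s A B :: real
    and \<phi> :: "real^'n \<Rightarrow> complex"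
    and m \<sigma> :: "(real^'n) \<times> (real^'n) \<Rightarrow> real"
    and f :: "(real^'n \<Rightarrow> complex) \<Rightarrow> complex"
  assumes "phase_lattice \<Lambda>"
    and "1 \<le> p"
    and "schwartz \<phi>" and "\<phi> \<noteq> (\<lambda>_. 0)"
    and "m \<in> borel_measurable lebesgue" and "\<And>z. 0 < m z"
    and "0 \<le> C" and "0 \<le> N"
    and "\<And>z1 z2. m (z1 + z2) \<le> C * (1 + norm z1) powr N * m z2"
    and "N \<le> s"
    and "\<sigma> \<in> borel_measurable lebesgue" and "\<And>z. 0 \<le> \<sigma> z"
    and "(\<integral>\<^sup>+z. ennreal (\<sigma> z * (1 + norm z) powr s) \<partial>lebesgue) < \<infinity>"
    and "0 < A" and "0 < B"
    and "AE z in lebesgue. ennreal A \<le> (\<integral>\<^sup>+l. ennreal (\<sigma> (z - l)) \<partial>count_space \<Lambda>)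
           \<and> (\<integral>\<^sup>+l. ennreal (\<sigma> (z - l)) \<partial>count_space \<Lambda>) \<le> ennreal B"
    and "tempered_distribution f"
    and "bdd_above (range (\<lambda>z. cmod (stft \<phi> f z) * (1 + norm z) powr (- s)))"
  shows "ennpowr (\<integral>\<^sup>+z. ennreal (cmod (stft \<phi> f z) powr p * m z powr p) \<partial>lebesgue) (1 / p) < \<infinity>
     \<longleftrightarrow> ennpowr (\<integral>\<^sup>+l. ennpowr (dist_L2_norm (loc_op \<phi> (translate l \<sigma>) f)) p * ennreal (m l powr p)
           \<partial>count_space \<Lambda>) (1 / p) < \<infinity>"
proof -
  \<comment> \<open>The exponents are rounded up, since \<open>kap\<close> and the growth bounds use
    natural powers.\<close>
  define N' where "N' = nat \<lceil>N\<rceil>"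
  define n where "n = nat \<lceil>s\<rceil>"
  define d where "d = DIM((real^'n) \<times> (real^'n)) + 2"
  \<comment> \<open>\<open>core_estimate\<close> demands \<open>n + d\<close>; the further
    \<open>N'\<close> powers pay for moving \<open>m\<close> in \<open>lp_backward\<close>.\<close>
  define M where "M = n + (N' + d)"
  define \<psi> where "\<psi> = (\<lambda>t. cnj (\<phi> t))"
  define nrm where "nrm = (\<integral>x. (cmod (\<phi> x))\<^sup>2 \<partial>lborel)"
  define F where "F = stft \<phi> f"
  define k where "k = (\<lambda>z w. gab \<phi> z w / complex_of_real nrm)"
  note \<phi> = assms(3) and f = assms(17)
  have \<psi>: "schwartz \<psi>" unfolding \<psi>_def by (rule schwartz_cnj[OF \<phi>])
  have nrm: "nrm > 0" unfolding nrm_def by (rule integral_cmod_sq_pos[OF \<phi> assms(4)])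
  have N': "N \<le> real N'" unfolding N'_def by linarith
  have n: "s \<le> real n" unfolding n_def by linarith
  have powr_le: "(1 + norm x) powr a \<le> (1 + norm x) ^ j" if "a \<le> real j" for a j and x :: "(real^'n) \<times> (real^'n)"
  proof -
    have "(1 + norm x) powr a \<le> (1 + norm x) powr real j" using that by (intro powr_mono) auto
    then show ?thesis by (simp add: powr_realpow)
  qed

  have F_atom: "F z = f (atom z \<psi>)" for z by (simp add: F_def stft_eq_atom \<psi>_def)
  have Fm [measurable]: "F \<in> borel_measurable borel"
    unfolding F_atom[abs_def] by (intro borel_measurable_continuous_onI tempered_atom_continuous f \<psi>)
  obtain C0 where C0: "\<And>z. cmod (F z) \<le> C0 * (1 + norm z) powr s" and C0_nn: "C0 \<ge> 0"
  proof -
    obtain C0 where C0: "\<And>z. cmod (stft \<phi> f z) * (1 + norm z) powr (- s) \<le> C0"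
      using assms(18) unfolding bdd_above_def by auto
    have "cmod (F z) \<le> C0 * (1 + norm z) powr s" for z
    proof -
      have "cmod (F z) = (cmod (stft \<phi> f z) * (1 + norm z) powr (- s)) * (1 + norm z) powr s"
        by (simp add: F_def powr_minus)
      also have "\<dots> \<le> C0 * (1 + norm z) powr s" by (rule mult_right_mono[OF C0]) simp
      finally show ?thesis .
    qed
    moreover have "0 \<le> C0" by (rule order_trans[OF _ C0[of 0]]) simp
    ultimately show thesis using that by blast
  qed
  have F_growth: "cmod (F z) \<le> C0 * (1 + norm z) ^ n" for z
    by (rule order_trans[OF C0 mult_left_mono[OF powr_le[OF n] C0_nn]])

  interpret rk: rep_kernel k
    unfolding k_def nrm_def by (rule rep_kernel_gab[OF \<phi> assms(4)])
  obtain Ck where Ck: "Ck > 0" "\<And>z w. cmod (k z w) \<le> Ck * kap (M + d) (z - w)"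
    using rk.k_decayE by blast
  have F_rep: "(\<integral>w. k z w * F w \<partial>lborel) = F z" for z
  proof -
    have "(\<integral>w. gab \<phi> z w * F w / complex_of_real nrm \<partial>lborel) = complex_of_real nrm * F z / complex_of_real nrm"
      using stft_reproducing[OF f \<phi>, of z] by (simp only: integral_divide_zero F_atom \<psi>_def nrm_def)
    then show ?thesis using nrm by (simp add: k_def)
  qed

  obtain \<delta> where sep: "separated \<delta> \<Lambda>" using phase_lattice_separated[OF assms(1)] by blast
  then have cnt: "countable \<Lambda>" by (simp add: separated_def)
  obtain Kl where Kl: "Kl > 0" "\<And>x. (\<integral>\<^sup>+l. ennreal (kap d (x - l)) \<partial>count_space \<Lambda>) \<le> ennreal Kl"
    using separated_kap_sum[OF sep, of d] by (auto simp: d_def)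

  \<comment> \<open>From here on a Borel representative replaces \<sigma>. As the lattice is
    countable, the exceptional null sets of all translates can be united, and the periodization is
    unchanged almost everywhere.\<close>
  obtain \<sigma>1 where \<sigma>1m [measurable]: "\<sigma>1 \<in> borel_measurable borel" and \<sigma>1: "\<And>z. 0 \<le> \<sigma>1 z"
    and \<sigma>1_ae: "AE z in lborel. \<sigma> z = \<sigma>1 z"
    using borel_representative_nonneg[OF assms(11,12)] by metis
  have \<sigma>1_int: "(\<integral>\<^sup>+z. ennreal (\<sigma>1 z * (1 + norm z) powr s) \<partial>lborel) < \<infinity>"
  proof -
    have "(\<integral>\<^sup>+z. ennreal (\<sigma>1 z * (1 + norm z) powr s) \<partial>lborel) = (\<integral>\<^sup>+z. ennreal (\<sigma> z * (1 + norm z) powr s) \<partial>lborel)"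
      by (rule nn_integral_cong_AE, use \<sigma>1_ae in eventually_elim) simp
    then show ?thesis using assms(13) by (simp add: nn_integral_completion)
  qed
  have s0: "0 \<le> s" using assms(8,10) by simp
  have \<sigma>1_fin: "(\<integral>\<^sup>+z. ennreal (\<sigma>1 z) \<partial>lborel) < \<infinity>"
  proof (rule le_less_trans[OF nn_integral_mono \<sigma>1_int], rule ennreal_leI)
    fix z :: "(real^'n) \<times> (real^'n)"
    show "\<sigma>1 z \<le> \<sigma>1 z * (1 + norm z) powr s"
      using mult_left_mono[OF ge_one_powr_ge_zero[OF _ s0] \<sigma>1[of z], of "1 + norm z"] by simp
  qed
  have tr_ae: "AE z in lborel. translate l \<sigma> z = \<sigma>1 (z - l)" for l
    unfolding translate_def by (rule AE_lborel_translate[OF \<sigma>1_ae])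
  have tr_m: "translate l \<sigma> \<in> borel_measurable lebesgue" for l
    unfolding translate_def[abs_def] by (rule lebesgue_measurable_translate[OF assms(11)])
  have S1: "AE z in lborel. ennreal A \<le> (\<integral>\<^sup>+l. ennreal (\<sigma>1 (z - l)) \<partial>count_space \<Lambda>)
           \<and> (\<integral>\<^sup>+l. ennreal (\<sigma>1 (z - l)) \<partial>count_space \<Lambda>) \<le> ennreal B"
  proof -
    have "AE z in lborel. \<forall>l\<in>\<Lambda>. \<sigma> (z - l) = \<sigma>1 (z - l)"
      by (subst AE_ball_countable[OF cnt]) (use AE_lborel_translate[OF \<sigma>1_ae] in blast)
    moreover have "AE z in lborel. ennreal A \<le> (\<integral>\<^sup>+l. ennreal (\<sigma> (z - l)) \<partial>count_space \<Lambda>)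
           \<and> (\<integral>\<^sup>+l. ennreal (\<sigma> (z - l)) \<partial>count_space \<Lambda>) \<le> ennreal B"
      using assms(16) by (simp only: AE_completion_iff)
    ultimately show ?thesis
    proof eventually_elim
      case (elim z)
      have "(\<integral>\<^sup>+l. ennreal (\<sigma> (z - l)) \<partial>count_space \<Lambda>) = (\<integral>\<^sup>+l. ennreal (\<sigma>1 (z - l)) \<partial>count_space \<Lambda>)"
        by (rule nn_integral_cong) (use elim(1) in auto)
      then show ?case using elim(2) by simp
    qed
  qed
  \<comment> \<open>The whole space is not a null set, so both bounds hold at some point, where the
    periodization lies between \<open>A\<close> and \<open>B\<close>.\<close>
  have AB: "A \<le> B"
  proof (rule ccontr)
    assume "\<not> A \<le> B"
    then have nle: "\<not> ennreal A \<le> ennreal B" using assms(14,15) by (simp add: ennreal_le_iff)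
    have "AE z in (lborel :: ((real^'n) \<times> (real^'n)) measure). False"
    proof (rule eventually_mono[OF S1])
      fix z
      assume "ennreal A \<le> (\<integral>\<^sup>+l. ennreal (\<sigma>1 (z - l)) \<partial>count_space \<Lambda>)
           \<and> (\<integral>\<^sup>+l. ennreal (\<sigma>1 (z - l)) \<partial>count_space \<Lambda>) \<le> ennreal B"
      then have "ennreal A \<le> ennreal B" by (metis order_trans)
      with nle show False by contradiction
    qed
    then have "emeasure (lborel :: ((real^'n) \<times> (real^'n)) measure) (space lborel) = 0"
      by (simp add: AE_iff_measurable[OF _ refl])
    then show False by simp
  qed

  interpret ce: core_estimate k F \<sigma>1 \<Lambda> A B C0 Ck Kl n M d
  proof (rule core_estimate.intro[OF rk.rep_kernel_axioms], rule core_estimate_axioms.intro)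
    show "n + d \<le> M" by (simp add: M_def)
  qed (fact d_def Fm F_growth F_rep \<sigma>1m \<sigma>1 \<sigma>1_fin cnt Kl assms(14) AB S1 Ck)+

  have mod_powr: "m z \<le> C * (1 + norm (z - w)) powr N * m w" for z w
    using assms(9)[of "z - w" w] by simp
  have C_pos: "C > 0"
  proof (rule ccontr)
    assume "\<not> C > 0"
    then have "m 0 \<le> 0" using mod_powr[of 0 0] assms(6)[of 0] assms(7) by simp
    then show False using assms(6)[of 0] by simp
  qed
  have mod1: "m z \<le> C * (1 + norm (z - w)) ^ N' * m w" for z w
  proof -
    have "C * (1 + norm (z - w)) powr N * m w \<le> C * (1 + norm (z - w)) ^ N' * m w"
      using assms(6)[of w] assms(7) by (intro mult_right_mono mult_left_mono powr_le N') auto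
    then show ?thesis using mod_powr[of z w] by linarith
  qed
  have mod2: "m z \<le> C * (1 + norm (z - w)) powr s * m w" for z w
  proof -
    have "C * (1 + norm (z - w)) powr N * m w \<le> C * (1 + norm (z - w)) powr s * m w"
      using assms(6)[of w] assms(7,10) by (intro mult_right_mono mult_left_mono powr_mono) auto
    then show ?thesis using mod_powr[of z w] by linarith
  qed

  define D where "D = (\<lambda>l. dist_L2_norm (loc_op \<phi> (translate l \<sigma>) f))"
  have "(\<integral>\<^sup>+z. ennreal (cmod (F z) powr p * m z powr p) \<partial>lborel) < \<infinity>
     \<longleftrightarrow> (\<integral>\<^sup>+l. ennpowr (D l) p * ennreal (m l powr p) \<partial>count_space \<Lambda>) < \<infinity>" (is "?L \<longleftrightarrow> ?R")
  proof
    assume L: ?L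
    define Y where "Y = (\<lambda>l. \<integral>\<^sup>+z. ennreal (\<sigma>1 (z - l) * cmod (F z)) \<partial>lborel)"
    \<comment> \<open>The growth order of \<open>F\<close> equals the order of the moment of
      \<sigma>, so every local mass is finite and can be used as the real bound in
      \<open>loc_op_L2_bound\<close>.\<close>
    have Y_fin: "Y l < \<infinity>" for l
    proof -
      have le: "\<sigma>1 (z - l) * cmod (F z) \<le> C0 * (1 + norm l) powr s * (\<sigma>1 (z - l) * (1 + norm (z - l)) powr s)" for z
      proof -
        have "(1 + norm z) powr s \<le> ((1 + norm (z - l)) * (1 + norm l)) powr s"
          using norm1_triangle[of "z - l" l] s0 by (intro powr_mono2) auto
        also have "\<dots> = (1 + norm (z - l)) powr s * (1 + norm l) powr s" by (simp add: powr_mult)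
        finally have "C0 * (1 + norm z) powr s \<le> C0 * ((1 + norm (z - l)) powr s * (1 + norm l) powr s)"
          using C0_nn by (rule mult_left_mono)
        then have "cmod (F z) \<le> C0 * ((1 + norm (z - l)) powr s * (1 + norm l) powr s)" using C0[of z] by linarith
        then have "\<sigma>1 (z - l) * cmod (F z) \<le> \<sigma>1 (z - l) * (C0 * ((1 + norm (z - l)) powr s * (1 + norm l) powr s))"
          using \<sigma>1 by (rule mult_left_mono)
        then show ?thesis by (simp add: mult_ac)
      qed
      have "Y l \<le> (\<integral>\<^sup>+z. ennreal (C0 * (1 + norm l) powr s) * ennreal (\<sigma>1 (z - l) * (1 + norm (z - l)) powr s) \<partial>lborel)"
        unfolding Y_def
      proof (rule nn_integral_mono)
        fix z
        show "ennreal (\<sigma>1 (z - l) * cmod (F z)) \<le> ennreal (C0 * (1 + norm l) powr s) * ennreal (\<sigma>1 (z - l) * (1 + norm (z - l)) powr s)"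
          using ennreal_leI[OF le[of z]] C0_nn \<sigma>1 by (simp add: ennreal_mult)
      qed
      also have "\<dots> = ennreal (C0 * (1 + norm l) powr s) * (\<integral>\<^sup>+z. ennreal (\<sigma>1 (z - l) * (1 + norm (z - l)) powr s) \<partial>lborel)"
        by (rule nn_integral_cmult) measurable
      also have "(\<integral>\<^sup>+z. ennreal (\<sigma>1 (z - l) * (1 + norm (z - l)) powr s) \<partial>lborel) = (\<integral>\<^sup>+z. ennreal (\<sigma>1 z * (1 + norm z) powr s) \<partial>lborel)"
        by (rule nn_integral_lborel_diff[of "\<lambda>z. ennreal (\<sigma>1 z * (1 + norm z) powr s)"]) measurable
      also have "ennreal (C0 * (1 + norm l) powr s) * \<dots> < \<infinity>" using \<sigma>1_int by (simp add: ennreal_mult_less_top)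
      finally show ?thesis .
    qed
    have F_conv: "ennreal (cmod (F z)) \<le> (\<integral>\<^sup>+w. ennreal (Ck * kap (N' + d) (z - w) * cmod (F w)) \<partial>lborel)" for z
    proof -
      have "ennreal (cmod (F z)) \<le> (\<integral>\<^sup>+w. ennreal (cmod (k z w * F w)) \<partial>lborel)"
        by (subst F_rep[symmetric]) (rule norm_integral_le_nn_integral)
      also have "\<dots> \<le> (\<integral>\<^sup>+w. ennreal (Ck * kap (N' + d) (z - w) * cmod (F w)) \<partial>lborel)"
      proof (intro nn_integral_mono ennreal_leI)
        fix w
        have "Ck * kap (M + d) (z - w) \<le> Ck * kap (N' + d) (z - w)"
          using Ck(1) by (intro mult_left_mono kap_mono) (auto simp: M_def)
        then have "cmod (k z w) \<le> Ck * kap (N' + d) (z - w)" using Ck(2)[of z w] by linarith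
        then show "cmod (k z w * F w) \<le> Ck * kap (N' + d) (z - w) * cmod (F w)"
          unfolding norm_mult by (rule mult_right_mono) simp
      qed
      finally show ?thesis .
    qed
    have fin: "(\<integral>\<^sup>+l. ennpowr (Y l) p * ennreal (m l powr p) \<partial>count_space \<Lambda>) < \<infinity>"
      unfolding Y_def
      by (rule lp_forward[OF cnt assms(2) _ Kl(2,1) Fm F_conv Ck(1) assms(5,6) C_pos mod1 mod2 \<sigma>1m \<sigma>1 \<sigma>1_int L]) (simp add: d_def)
    define c3 where "c3 = 2 * sqrt nrm"
    have c3: "c3 > 0" using nrm by (simp add: c3_def)
    have D_le: "D l \<le> ennreal c3 * Y l" for l
    proof -
      obtain y where y: "Y l = ennreal y" "y \<ge> 0" using Y_fin[of l] by (cases "Y l") auto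
      have "D l \<le> ennreal (2 * sqrt nrm * y)"
        unfolding D_def nrm_def
        by (rule loc_op_L2_bound[OF \<phi> f tr_m _ tr_ae]) (use \<sigma>1 y in \<open>auto simp: Y_def F_def\<close>)
      then show ?thesis using y c3 by (simp add: c3_def ennreal_mult)
    qed
    have "(\<integral>\<^sup>+l. ennpowr (D l) p * ennreal (m l powr p) \<partial>count_space \<Lambda>)
       \<le> (\<integral>\<^sup>+l. ennreal (c3 powr p) * (ennpowr (Y l) p * ennreal (m l powr p)) \<partial>count_space \<Lambda>)"
    proof (rule nn_integral_mono)
      fix l
      have "ennpowr (D l) p \<le> ennpowr (ennreal c3 * Y l) p" using assms(2) by (intro ennpowr_mono D_le) simp
      also have "\<dots> = ennreal (c3 powr p) * ennpowr (Y l) p" by (rule ennpowr_cmult[OF c3])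
      finally have "ennpowr (D l) p * ennreal (m l powr p) \<le> (ennreal (c3 powr p) * ennpowr (Y l) p) * ennreal (m l powr p)"
        by (rule mult_right_mono) simp
      then show "ennpowr (D l) p * ennreal (m l powr p) \<le> ennreal (c3 powr p) * (ennpowr (Y l) p * ennreal (m l powr p))"
        by (simp add: mult.assoc)
    qed
    also have "\<dots> = ennreal (c3 powr p) * (\<integral>\<^sup>+l. ennpowr (Y l) p * ennreal (m l powr p) \<partial>count_space \<Lambda>)"
      by (rule nn_integral_cmult) simp
    also have "\<dots> < \<infinity>" using fin by (simp add: ennreal_mult_less_top)
    finally show ?R .
  next
    assume R: ?R
    \<comment> \<open>A finite sum forces each term to be finite, and the factor from
      \<open>m l\<close> is positive.\<close>
    have D_fin: "D l < \<infinity>" if "l \<in> \<Lambda>" for l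
    proof -
      have "ennpowr (D l) p * ennreal (m l powr p) \<le> (\<integral>\<^sup>+l. ennpowr (D l) p * ennreal (m l powr p) \<partial>count_space \<Lambda>)"
        using that by (intro nn_integral_ge_point) auto
      then have "ennpowr (D l) p * ennreal (m l powr p) < \<infinity>" using R by (rule le_less_trans)
      moreover have "0 < m l powr p" using assms(6)[of l] by simp
      ultimately have "ennpowr (D l) p < \<infinity>"
        by (auto simp: ennreal_mult_less_top)
      then show ?thesis by (simp only: ennpowr_less_top)
    qed
    \<comment> \<open>Testing against an atom of norm \<open>sqrt nrm\<close> and dividing by the
      factor \<open>nrm\<close> of the kernel leaves \<open>1 / sqrt nrm\<close>.\<close>
    define b where "b = (\<lambda>l. enn2real (D l) / sqrt nrm)"
    have b0: "0 \<le> b l" for l using nrm by (simp add: b_def)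
    have g_le: "cmod (ce.g l w) \<le> b l" if l: "l \<in> \<Lambda>" for l w
    proof -
      \<comment> \<open>Testing the localization operator against this atom recovers, up to the
        factor \<open>nrm\<close>, the projected piece \<open>ce.g l\<close> at
        \<open>w\<close>.\<close>
      define h where "h = atom w \<psi>"
      have h: "schwartz h" unfolding h_def by (rule schwartz_atom[OF \<psi>])
      have hn: "(\<integral>t. (cmod (h t))\<^sup>2 \<partial>lborel) = nrm"
      proof -
        have [measurable]: "\<phi> \<in> borel_measurable borel" by (rule schwartz_measurable[OF \<phi>])
        have "(\<integral>t. (cmod (h t))\<^sup>2 \<partial>lborel) = (\<integral>t. (cmod (\<phi> (t - fst w)))\<^sup>2 \<partial>lborel)"
          by (simp add: h_def atom_def \<psi>_def norm_mult)
        also have "\<dots> = nrm" unfolding nrm_def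
          by (rule integral_lborel_diff[of "\<lambda>t. (cmod (\<phi> t))\<^sup>2"]) measurable
        finally show ?thesis .
      qed
      have in_t: "(\<integral>t. h t * tf_shift z \<phi> t \<partial>lborel) = gab \<phi> w z" for z
        unfolding gab_def amb_def h_def \<psi>_def by (simp add: mult.commute)
      have "loc_op \<phi> (translate l \<sigma>) f h = (\<integral>z. complex_of_real (\<sigma>1 (z - l)) * F z * gab \<phi> w z \<partial>lborel)"
        unfolding F_def in_t[symmetric] by (rule loc_op_lborel[OF \<phi> f h tr_m _ tr_ae]) measurable
      also have "\<dots> = complex_of_real nrm * ce.g l w"
      proof -
        have "ce.g l w = (\<integral>z. complex_of_real (\<sigma>1 (z - l)) * F z * k w z \<partial>lborel)" by (rule ce.g_def)
        also have "\<dots> = (\<integral>z. complex_of_real (\<sigma>1 (z - l)) * F z * gab \<phi> w z / complex_of_real nrm \<partial>lborel)"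
          by (simp add: k_def)
        finally show ?thesis using nrm by (simp only: integral_divide_zero) simp
      qed
      finally have eq: "loc_op \<phi> (translate l \<sigma>) f h = complex_of_real nrm * ce.g l w" .
      have "cmod (loc_op \<phi> (translate l \<sigma>) f h) \<le> sqrt nrm * enn2real (D l)"
        using dist_L2_norm_bound[OF h, of "loc_op \<phi> (translate l \<sigma>) f"] nrm D_fin[OF l] by (simp add: hn D_def)
      then have "nrm * cmod (ce.g l w) \<le> sqrt nrm * enn2real (D l)" using nrm by (simp add: eq norm_mult)
      then have "cmod (ce.g l w) \<le> sqrt nrm * enn2real (D l) / nrm" using nrm by (simp add: pos_le_divide_eq mult.commute)
      also have "\<dots> = b l" using nrm real_sqrt_mult_self[of nrm] by (simp add: b_def field_simps)
      finally show ?thesis .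
    qed
    obtain K where K: "K \<ge> 0" "\<And>a. ennreal (cmod (F a)) \<le> ennreal K * (\<integral>\<^sup>+l. ennreal (b l * kap M (a - l)) \<partial>count_space \<Lambda>)"
    proof (rule ce.core_bound)
      fix K
      assume K: "0 \<le> K" and bd: "\<And>b a. (\<And>l. 0 \<le> b l) \<Longrightarrow> (\<And>l w. l \<in> \<Lambda> \<Longrightarrow> cmod (ce.g l w) \<le> b l) \<Longrightarrow>
        ennreal (cmod (F a)) \<le> ennreal K * (\<integral>\<^sup>+l. ennreal (b l * kap M (a - l)) \<partial>count_space \<Lambda>)"
      show thesis by (rule that[OF K bd[OF b0 g_le]])
    qed
    have FK: "ennreal (cmod (F a)) \<le> ennreal K * (\<integral>\<^sup>+l. ennreal (b l * kap (N' + d) (a - l)) \<partial>count_space \<Lambda>)" for a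
    proof -
      have "(\<integral>\<^sup>+l. ennreal (b l * kap M (a - l)) \<partial>count_space \<Lambda>) \<le> (\<integral>\<^sup>+l. ennreal (b l * kap (N' + d) (a - l)) \<partial>count_space \<Lambda>)"
        using b0 by (intro nn_integral_mono ennreal_leI mult_left_mono kap_mono) (auto simp: M_def)
      then show ?thesis by (rule order_trans[OF K(2) mult_left_mono]) simp
    qed
    have "(\<integral>\<^sup>+l. ennreal ((b l * m l) powr p) \<partial>count_space \<Lambda>)
       = (\<integral>\<^sup>+l. ennreal ((1 / sqrt nrm) powr p) * (ennpowr (D l) p * ennreal (m l powr p)) \<partial>count_space \<Lambda>)"
    proof (rule nn_integral_cong)
      fix l assume "l \<in> space (count_space \<Lambda>)"
      then obtain x where x: "D l = ennreal x" "x \<ge> 0" using D_fin[of l] by (cases "D l") auto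
      have "(b l * m l) powr p = ((1 / sqrt nrm) * (x * m l)) powr p" using x by (simp add: b_def)
      also have "\<dots> = (1 / sqrt nrm) powr p * (x powr p * m l powr p)"
      proof -
        have powr3: "(r * (x * m l)) powr p = r powr p * (x powr p * m l powr p)" if "0 \<le> r" for r
          using that x assms(6)[of l] by (simp add: powr_mult less_imp_le)
        show ?thesis by (rule powr3) (use nrm in simp)
      qed
      finally show "ennreal ((b l * m l) powr p) = ennreal ((1 / sqrt nrm) powr p) * (ennpowr (D l) p * ennreal (m l powr p))"
        using x by (simp add: ennpowr_ennreal ennreal_mult)
    qed
    also have "\<dots> = ennreal ((1 / sqrt nrm) powr p) * (\<integral>\<^sup>+l. ennpowr (D l) p * ennreal (m l powr p) \<partial>count_space \<Lambda>)"
      by (rule nn_integral_cmult) simp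
    also have "\<dots> < \<infinity>" using R by (simp add: ennreal_mult_less_top)
    finally have fin: "(\<integral>\<^sup>+l. ennreal ((b l * m l) powr p) \<partial>count_space \<Lambda>) < \<infinity>" .
    show ?L
      by (rule lp_backward[OF cnt assms(2) _ Kl(2,1) FK K(1) assms(6) C_pos mod1 b0 fin]) (simp add: d_def)
  qed
  \<comment> \<open>\<open>ennpowr\<close> is finite exactly when its base is, so the outer
    exponents 1 / p disappear.\<close>
  then show ?thesis by (simp only: ennpowr_less_top nn_integral_completion F_def D_def)
qed

end
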